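(* For every integer $n\geq 3$ there exists a constant $\Theta=\Theta(n)$, depending only on $n$, such that for every regular hyperbolic $n$-gon $P$ with interior angle $\theta$ the following hold. (1) If $\theta\geq\Theta$, then for any configuration of $n$-gons $P_1,\dots,P_k$ in $\mathbb{H}^2$ with total area equal to $\mathrm{area}(P)$, we have $$\mathrm{perim}(P)\leq\sum_{i=1}^k\mathrm{perim}(P_i).$$ Furthermore, if $\theta>\Theta$, then equality occurs only if $k=1$. (2) If $\theta<\Theta$, then there exists a configuration $Q_1,\dots,Q_l$ (for some $l\geq 1$) of $n$-gons in $\mathbb{H}^2$, with total area equal to $\mathrm{area}(P)$, satisfying $$\sum_{i=1}^l\mathrm{perim}(Q_i)<\mathrm{perim}(P).$$
   Context: $\mathbb{H}^2$ is the hyperbolic plane of constant curvature $-1$. Polygons are geodesic polygons and are non-degenerate (non-zero area); $\mathrm{perim}$ denotes the perimeter. A regular $n$-gon has all sides equal and all interior angles equal; a regular hyperbolic $n$-gon with interior angle $\theta\in\left(0,\frac{(n-2)\pi}{n}\right)$ has area $(n-2)\pi-n\theta$. A configuration of polygons is a finite set of disjoint polygons $P_1,\dots,P_k$ in $\mathbb{H}^2$; its total area is $\sum_{i=1}^k\mathrm{area}(P_i)$. *)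

theory Defs
  imports "HOL-Analysis.Analysis"
begin

text \<open>
  The hyperbolic plane of curvature $-1$ is represented by the Poincare disc: the open unit disc
  of the complex plane with the metric $4|dz|^2/(1-|z|^2)^2$. The distance and the area density
  below are those of this metric.
\<close>

definition hyp_plane :: "complex set" where
  "hyp_plane = ball 0 1"

definition hyp_dist :: "complex \<Rightarrow> complex \<Rightarrow> real" where
  "hyp_dist z w =
     arcosh (1 + 2 * (cmod (z - w))\<^sup>2 / ((1 - (cmod z)\<^sup>2) * (1 - (cmod w)\<^sup>2)))"

text \<open>
  The hyperbolic plane is uniquely geodesic, so the geodesic segment joining two points consists of
  the points lying metrically between them.
\<close>

definition hyp_segment :: "complex \<Rightarrow> complex \<Rightarrow> complex set" where
  "hyp_segment a b = {z \<in> hyp_plane. hyp_dist a z + hyp_dist z b = hyp_dist a b}"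

text \<open>
  A polygon is given by the list of its vertices in cyclic order; side \<open>i\<close> joins vertex \<open>i\<close> to
  the cyclically next vertex.
\<close>

definition next_vertex :: "complex list \<Rightarrow> nat \<Rightarrow> complex" where
  "next_vertex P i = P ! (Suc i mod length P)"

definition side :: "complex list \<Rightarrow> nat \<Rightarrow> complex set" where
  "side P i = hyp_segment (P ! i) (next_vertex P i)"

definition side_length :: "complex list \<Rightarrow> nat \<Rightarrow> real" where
  "side_length P i = hyp_dist (P ! i) (next_vertex P i)"

definition boundary :: "complex list \<Rightarrow> complex set" where
  "boundary P = (\<Union>i<length P. side P i)"

text \<open>
  \<^const>\<open>inside\<close> refers to the complement of the boundary in the whole complex plane. For a closed
  curve in the open disc its bounded complementary components lie in the disc, so they are
  the hyperbolically bounded ones.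
\<close>

definition region :: "complex list \<Rightarrow> complex set" where
  "region P = boundary P \<union> inside (boundary P)"

definition hyp_area :: "complex list \<Rightarrow> real" where
  "hyp_area P = (LINT z:region P|lborel. 4 / (1 - (cmod z)\<^sup>2)\<^sup>2)"

definition perim :: "complex list \<Rightarrow> real" where
  "perim P = (\<Sum>i<length P. side_length P i)"

text \<open>
  Simple closed geodesic polygons, not necessarily convex; distinct sides meet exactly in their
  common endpoints. Straight angles at vertices are allowed. The last conjunct (non-degeneracy)
  is implied by the others and kept for explicitness.
\<close>

definition hyp_ngon :: "nat \<Rightarrow> complex list \<Rightarrow> bool" where
  "hyp_ngon n P \<longleftrightarrow>
     length P = n \<and> 3 \<le> n \<and> set P \<subseteq> hyp_plane \<and> distinct P \<and>
     (\<forall>i<n. \<forall>j<n. i \<noteq> j \<longrightarrow>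
        side P i \<inter> side P j = {P ! i, next_vertex P i} \<inter> {P ! j, next_vertex P j}) \<and>
     0 < hyp_area P"

text \<open>
  The interior angle at a vertex is the angular measure of the set of directions pointing from the
  vertex into the polygon; in particular it exceeds $\pi$ at a reflex vertex. The disc model is
  conformal, so angles may be measured in the Euclidean sense, and replacing geodesic rays
  by Euclidean ones can only affect the directions of the two adjacent sides.
\<close>

definition interior_angle :: "complex list \<Rightarrow> nat \<Rightarrow> real" where
  "interior_angle P i =
     measure lborel {t \<in> {0..<2 * pi}.
       \<exists>\<epsilon>>0. \<forall>s\<in>{0<..<\<epsilon>}. P ! i + of_real s * cis t \<in> region P}"

definition regular_ngon :: "nat \<Rightarrow> real \<Rightarrow> complex list \<Rightarrow> bool" where
  "regular_ngon n \<theta> P \<longleftrightarrow>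
     hyp_ngon n P \<and>
     (\<forall>i<n. \<forall>j<n. side_length P i = side_length P j) \<and>
     (\<forall>i<n. interior_angle P i = \<theta>)"

text \<open>
  Distinct vertex lists of one and the same polygon have equal regions, so disjointness prevents
  a polygon from being counted more than once.
\<close>

definition ngon_configuration :: "nat \<Rightarrow> complex list set \<Rightarrow> bool" where
  "ngon_configuration n C \<longleftrightarrow>
     finite C \<and> (\<forall>P\<in>C. hyp_ngon n P) \<and> disjoint_family_on region C"

definition total_area :: "complex list set \<Rightarrow> real" where
  "total_area C = (\<Sum>P\<in>C. hyp_area P)"

definition total_perim :: "complex list set \<Rightarrow> real" where
  "total_perim C = (\<Sum>P\<in>C. perim P)"

end

theory Submission
  imports Defs "HOL-Complex_Analysis.Complex_Analysis"
begin

text \<open>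
  The signed area of a closed polygon with vertices \<open>z\<^sub>i\<close> in the disc is the sum of the terms
  \<open>2 Arg (1 - z\<^sub>i cnj z\<^sub>i\<^sub>+\<^sub>1)\<close>. Among the closed \<open>n\<close>-gons of bounded length an area maximiser exists, and it
  can be chosen equilateral and equiangular; hence an \<open>n\<close>-gon of area \<open>A\<close> has at least the perimeter
  \<open>f A\<close> of the regular one, where \<open>cosh (f A / 2n) cos (A / 2n + \<pi> / n) = cos (\<pi> / n)\<close>. In the Klein chart
  geodesics are straight, so winding numbers identify the area of a simple polygon with its signed
  area up to sign.

  What remains concerns the function \<open>f\<close> alone. For fixed \<open>y\<close> the difference \<open>f (t + y) - f t\<close> first
  decreases and then increases in \<open>t\<close>; since \<open>f 0 = 0\<close>, an inequality \<open>f x + f y \<le> f (x + y)\<close> therefore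
  becomes strict and persists when \<open>x\<close> grows. So the areas at which splitting is profitable form an
  up-set, whose infimum corresponds to the angle \<open>\<Theta>\<close>.
\<close>

section \<open>Isometries of the disc and the Klein chart\<close>

text \<open>Simplicity is not preserved by the moves that improve a polygon. The maximisation
  therefore runs over all closed n-tuples of points, with signed area in place of area, and
  star-shaped maximisers occur as candidates. They do no harm, because the bound holds for the orbit
  of every n-th root of unity. For a given regular polygon, on the other hand, star shapes have to
  be ruled out, and this is where simplicity enters. Rotational symmetry is obtained from the
  centroid on the hyperboloid, which an isometry permuting the vertices has to fix. The interior
  angle is a measure of directions. It is tied to the orientation by following the winding number
  across the sides and around a vertex. The monotonicity of differences of \<open>f\<close> rests on
  a sign condition for \<open>f'\<close>: a product of two sines, increasing in the area, is
  compared with sin (\<pi> / n). A profitable split is realised by two regular n-gons translated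
  into opposite half-planes. As \<open>f\<close> is continuous, no split is strictly profitable at
  the infimum itself, so the boundary angle belongs to the first alternative. If no split ever pays,
  the threshold is the area of the ideal polygon and \<Theta> = 0.\<close>

definition mob :: "complex \<Rightarrow> complex \<Rightarrow> complex" where
  "mob b z = (z - b) / (1 - cnj b * z)"

text \<open>Passage from the Poincare disc to the Klein disc: a point at hyperbolic distance d from
  0 moves along its ray from Euclidean radius tanh (d/2) to tanh d.\<close>

definition klein :: "complex \<Rightarrow> complex" where
  "klein z = 2 * z / of_real (1 + (cmod z)\<^sup>2)"

lemma one_minus_mult_Re_pos:
  assumes "cmod a < 1" "cmod b < 1"
  shows "0 < Re (1 - a * b)"
proof -
  have "cmod (a * b) < 1"
    using assms by (metis mult_strict_mono' mult_1 norm_ge_zero norm_mult)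
  then show ?thesis
    using complex_Re_le_cmod[of "a * b"] by simp
qed

lemma one_minus_mult_nz:
  assumes "cmod a < 1" "cmod b < 1"
  shows "1 - a * b \<noteq> 0"
  using one_minus_mult_Re_pos[OF assms] by (metis less_irrefl zero_complex.sel(1))

lemma one_minus_norm_pos: "cmod z < 1 \<Longrightarrow> 0 < 1 - (cmod z)\<^sup>2"
  by (simp add: power_less_one_iff abs_square_less_1)

lemma cmod_one_minus_sq:
  "(cmod (1 - z * cnj w))\<^sup>2 = (cmod (z - w))\<^sup>2 + (1 - (cmod z)\<^sup>2) * (1 - (cmod w)\<^sup>2)"
  unfolding cmod_power2 by (simp add: algebra_simps power2_eq_square)

text \<open>Multiplied out, so that no quotient occurs. The case \<open>x = z\<close> yields the
  norm identity \<open>one_minus_mob_norm\<close>; its argument yields the change of the area term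
  under an isometry in \<open>tri_term_mob\<close>.\<close>

lemma mob_one_minus:
  assumes "cmod b < 1" "cmod x < 1" "cmod z < 1"
  shows "(1 - mob b x * cnj (mob b z)) * ((1 - cnj b * x) * cnj (1 - cnj b * z))
       = of_real (1 - (cmod b)\<^sup>2) * (1 - x * cnj z)"
proof -
  have nz: "1 - cnj b * x \<noteq> 0" "1 - cnj b * z \<noteq> 0"
    using assms one_minus_mult_nz[of "cnj b"] by auto
  have "(1 - p / X * cnj (q / Z)) * (X * cnj Z) = X * cnj Z - p * cnj q"
    if "X \<noteq> 0" "Z \<noteq> 0" for p q X Z
    using that by (simp add: field_simps)
  note frac = this[OF nz]
  have "(1 - mob b x * cnj (mob b z)) * ((1 - cnj b * x) * cnj (1 - cnj b * z))
     = (1 - cnj b * x) * cnj (1 - cnj b * z) - (x - b) * cnj (z - b)"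
    unfolding mob_def by (rule frac)
  also have "\<dots> = (1 - b * cnj b) * (1 - x * cnj z)"
    by (simp add: algebra_simps)
  finally show ?thesis
    by (simp add: complex_mult_cnj cmod_power2 flip: of_real_power)
qed

lemma mob_diff:
  assumes "cmod b < 1" "cmod x < 1" "cmod z < 1"
  shows "(mob b x - mob b z) * ((1 - cnj b * x) * (1 - cnj b * z))
       = of_real (1 - (cmod b)\<^sup>2) * (x - z)"
proof -
  have nz: "1 - cnj b * x \<noteq> 0" "1 - cnj b * z \<noteq> 0"
    using assms one_minus_mult_nz[of "cnj b"] by auto
  have "(p / X - q / Z) * (X * Z) = p * Z - q * X"
    if "X \<noteq> 0" "Z \<noteq> 0" for p q X Z :: complex
    using that by (simp add: field_simps)
  note frac = this[OF nz]
  have "(mob b x - mob b z) * ((1 - cnj b * x) * (1 - cnj b * z))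
     = (x - b) * (1 - cnj b * z) - (z - b) * (1 - cnj b * x)"
    unfolding mob_def by (rule frac)
  also have "\<dots> = (1 - b * cnj b) * (x - z)"
    by (simp add: algebra_simps)
  finally show ?thesis
    by (simp add: complex_mult_cnj cmod_power2 flip: of_real_power)
qed

lemma one_minus_mob_norm:
  assumes "cmod b < 1" "cmod z < 1"
  shows "(1 - (cmod (mob b z))\<^sup>2) * (cmod (1 - cnj b * z))\<^sup>2
       = (1 - (cmod b)\<^sup>2) * (1 - (cmod z)\<^sup>2)"
proof -
  have "complex_of_real ((1 - (cmod (mob b z))\<^sup>2) * (cmod (1 - cnj b * z))\<^sup>2)
      = complex_of_real ((1 - (cmod b)\<^sup>2) * (1 - (cmod z)\<^sup>2))"
    using mob_one_minus[OF assms assms(2)]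
    by (simp only: of_real_mult of_real_diff of_real_1 complex_norm_square)
  then show ?thesis
    using of_real_eq_iff by blast
qed

lemma mob_in_disc [simp]:
  assumes "cmod b < 1" "cmod z < 1"
  shows "cmod (mob b z) < 1"
proof -
  have "0 < (1 - (cmod (mob b z))\<^sup>2) * (cmod (1 - cnj b * z))\<^sup>2"
    unfolding one_minus_mob_norm[OF assms]
    using assms one_minus_norm_pos by simp
  then have "0 < 1 - (cmod (mob b z))\<^sup>2"
    by (simp add: zero_less_mult_iff)
  then show ?thesis
    by (simp add: abs_square_less_1)
qed

lemma mob_neg_mob:
  assumes "cmod b < 1" "cmod z < 1"
  shows "mob (- b) (mob b z) = z"
proof -
  have nz: "1 - cnj b * z \<noteq> 0" "1 - cnj b * b \<noteq> 0"
    using assms one_minus_mult_nz[of "cnj b"] by auto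
  have "mob b z + b = z * (1 - cnj b * b) / (1 - cnj b * z)"
    "1 + cnj b * mob b z = (1 - cnj b * b) / (1 - cnj b * z)"
    unfolding mob_def using nz by (simp_all add: field_simps)
  then show ?thesis
    unfolding mob_def[of "- b"] using nz by simp
qed

lemma mob_mob_neg:
  assumes "cmod b < 1" "cmod z < 1"
  shows "mob b (mob (- b) z) = z"
  using mob_neg_mob[of "- b" z] assms by simp

lemma mob_self [simp]: "mob b b = 0"
  by (simp add: mob_def)

lemma mob_zero [simp]: "mob 0 z = z" "mob b 0 = - b"
  by (simp_all add: mob_def)

lemma mob_eq_iff:
  assumes "cmod b < 1" "cmod z < 1" "cmod w < 1"
  shows "mob b z = mob b w \<longleftrightarrow> z = w"
  by (metis assms mob_neg_mob)

lemma mob_eq_0_iff: "cmod b < 1 \<Longrightarrow> cmod z < 1 \<Longrightarrow> mob b z = 0 \<longleftrightarrow> z = b"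
  using one_minus_mult_nz[of "cnj b" z] by (auto simp: mob_def)

section \<open>Hyperbolic distance in the disc\<close>

lemma cosh_hyp_dist:
  assumes "cmod z < 1" "cmod w < 1"
  shows "cosh (hyp_dist z w)
    = 1 + 2 * (cmod (z - w))\<^sup>2 / ((1 - (cmod z)\<^sup>2) * (1 - (cmod w)\<^sup>2))"
  unfolding hyp_dist_def
  using one_minus_norm_pos[OF assms(1)] one_minus_norm_pos[OF assms(2)]
  by (intro cosh_arcosh_real) simp

lemma hyp_dist_nonneg:
  assumes "cmod z < 1" "cmod w < 1"
  shows "0 \<le> hyp_dist z w"
  unfolding hyp_dist_def
  using one_minus_norm_pos[OF assms(1)] one_minus_norm_pos[OF assms(2)]
  by (intro arcosh_nonneg_real) simp

lemma cosh_half_sq: "(cosh (x/2))\<^sup>2 = (cosh x + 1) / 2" for x :: real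
  using cosh_double_cosh[of "x/2"] by simp

lemma sinh_half_sq: "(sinh (x/2))\<^sup>2 = (cosh x - 1) / 2" for x :: real
  using cosh_half_sq[of x] by (simp add: sinh_square_eq)

lemma sinh_half_hyp_dist:
  assumes "cmod z < 1" "cmod w < 1"
  shows "(sinh (hyp_dist z w / 2))\<^sup>2
    = (cmod (z - w))\<^sup>2 / ((1 - (cmod z)\<^sup>2) * (1 - (cmod w)\<^sup>2))"
  unfolding sinh_half_sq cosh_hyp_dist[OF assms] by simp

lemma cosh_half_hyp_dist:
  assumes "cmod z < 1" "cmod w < 1"
  shows "(cosh (hyp_dist z w / 2))\<^sup>2
    = (cmod (1 - z * cnj w))\<^sup>2 / ((1 - (cmod z)\<^sup>2) * (1 - (cmod w)\<^sup>2))"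
proof -
  have "(1 + 2 * d / E + 1) / 2 = (d + E) / E" if "E \<noteq> 0" for d E :: real
    using that by (simp add: field_simps)
  then show ?thesis
    using one_minus_norm_pos[OF assms(1)] one_minus_norm_pos[OF assms(2)]
    unfolding cosh_half_sq cosh_hyp_dist[OF assms] cmod_one_minus_sq
    by (metis less_irrefl mult_pos_pos)
qed

text \<open>\<open>mob z w\<close> is the position of \<open>w\<close> after \<open>z\<close> has
  been moved to the origin: its argument is the initial direction of the geodesic from
  \<open>z\<close> to \<open>w\<close>, its modulus encodes the length. Side lengths and directions
  are carried in this form throughout.\<close>

lemma norm_mob_eq_tanh:
  assumes "cmod z < 1" "cmod w < 1"
  shows "cmod (mob z w) = tanh (hyp_dist z w / 2)"
proof -
  have "(cmod (mob z w))\<^sup>2 = (tanh (hyp_dist z w / 2))\<^sup>2"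
    unfolding tanh_def power_divide sinh_half_hyp_dist[OF assms] cosh_half_hyp_dist[OF assms]
    unfolding mob_def norm_divide power_divide
    using one_minus_norm_pos[OF assms(1)] one_minus_norm_pos[OF assms(2)]
    by (simp add: norm_minus_commute mult.commute[of _ "cnj _"]
        flip: complex_mod_cnj[of "1 - cnj z * w"])
  moreover have "0 \<le> tanh (hyp_dist z w / 2)"
    using hyp_dist_nonneg[OF assms] by simp
  ultimately show ?thesis
    by (simp add: power2_eq_iff_nonneg)
qed

lemma hyp_dist_commute: "hyp_dist z w = hyp_dist w z"
  unfolding hyp_dist_def by (simp add: norm_minus_commute mult.commute)

lemma hyp_dist_eq_0_iff:
  assumes "cmod z < 1" "cmod w < 1"
  shows "hyp_dist z w = 0 \<longleftrightarrow> z = w"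
  using norm_mob_eq_tanh[OF assms] mob_eq_0_iff[OF assms] by auto

lemma hyp_dist_mob:
  assumes "cmod b < 1" "cmod z < 1" "cmod w < 1"
  shows "hyp_dist (mob b z) (mob b w) = hyp_dist z w"
proof -
  define B where "B = 1 - (cmod b)\<^sup>2"
  define X where "X = cmod (1 - cnj b * z)"
  define Y where "Y = cmod (1 - cnj b * w)"
  have nz: "X > 0" "Y > 0" "B > 0"
    using assms one_minus_mult_nz[of "cnj b"] one_minus_norm_pos[of b]
    by (auto simp: X_def Y_def B_def)
  have "cmod (mob b z - mob b w) * (X * Y) = B * cmod (z - w)"
  proof -
    have "cmod (complex_of_real B) = B" using nz by simp
    then show ?thesis
      using arg_cong[OF mob_diff[OF assms], of cmod] by (simp only: norm_mult B_def X_def Y_def)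
  qed
  then have 1: "cmod (mob b z - mob b w) = B * cmod (z - w) / (X * Y)"
    using nz by (simp add: field_simps)
  have 2: "1 - (cmod (mob b z))\<^sup>2 = B * (1 - (cmod z)\<^sup>2) / X\<^sup>2"
    "1 - (cmod (mob b w))\<^sup>2 = B * (1 - (cmod w)\<^sup>2) / Y\<^sup>2"
    using one_minus_mob_norm[OF assms(1,2)] one_minus_mob_norm[OF assms(1,3)] nz
    by (simp_all add: field_simps B_def X_def Y_def)
  show ?thesis
  proof -
    have "2 * (B * d / (X * Y))\<^sup>2 / ((B * p / X\<^sup>2) * (B * q / Y\<^sup>2)) = 2 * d\<^sup>2 / (p * q)"
      if "p > 0" "q > 0" for d p q
      using that nz by (simp add: field_simps power2_eq_square)
    then show ?thesis
      unfolding hyp_dist_def 1 2 using one_minus_norm_pos assms by simp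
  qed
qed

lemma hyp_dist_rot: "cmod u = 1 \<Longrightarrow> hyp_dist (u * z) (u * w) = hyp_dist z w"
  unfolding hyp_dist_def by (simp add: norm_mult flip: right_diff_distrib)

text \<open>Moving the middle point to the origin turns additivity of distances into a collinearity.\<close>

lemma hyp_dist_through_0:
  assumes "cmod a < 1" "cmod b < 1"
  shows "hyp_dist a b \<le> hyp_dist a 0 + hyp_dist 0 b"
    and "hyp_dist a 0 + hyp_dist 0 b = hyp_dist a b \<longleftrightarrow> Re (a * cnj b) = - (cmod a * cmod b)"
proof -
  define x y where "x = cmod a" and "y = cmod b"
  have xy: "0 \<le> x" "0 \<le> y" "x\<^sup>2 < 1" "y\<^sup>2 < 1"
    using assms by (auto simp: x_def y_def abs_square_less_1)
  have sx: "sinh (hyp_dist a 0) = 2 * x / (1 - x\<^sup>2)" and sy: "sinh (hyp_dist 0 b) = 2 * y / (1 - y\<^sup>2)"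
  proof -
    have *: "sinh (hyp_dist c 0) = 2 * cmod c / (1 - (cmod c)\<^sup>2)" if c: "cmod c < 1" for c
    proof -
      have p: "0 < 1 - (cmod c)\<^sup>2" using one_minus_norm_pos[OF c] .
      have "(sinh (hyp_dist c 0))\<^sup>2 = (2 * cmod c / (1 - (cmod c)\<^sup>2))\<^sup>2"
      proof -
        have "(1 + 2 * k / p)\<^sup>2 - 1 = 4 * k * (k + p) / p\<^sup>2" if "p \<noteq> 0" for k p :: real
          using that by (simp add: field_simps power2_eq_square)
        from this[of "1 - (cmod c)\<^sup>2" "(cmod c)\<^sup>2"]
        have "(1 + 2 * (cmod c)\<^sup>2 / (1 - (cmod c)\<^sup>2))\<^sup>2 - 1 = 4 * (cmod c)\<^sup>2 / (1 - (cmod c)\<^sup>2)\<^sup>2"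
          using p by simp
        then show ?thesis
          using cosh_hyp_dist[OF c, of 0] p unfolding sinh_square_eq
          by (simp add: power_divide power_mult_distrib)
      qed
      moreover have "0 \<le> sinh (hyp_dist c 0)" "0 \<le> 2 * cmod c / (1 - (cmod c)\<^sup>2)"
        using hyp_dist_nonneg[OF c, of 0] p by auto
      ultimately show ?thesis by (simp add: power2_eq_iff_nonneg)
    qed
    show "sinh (hyp_dist a 0) = 2 * x / (1 - x\<^sup>2)" "sinh (hyp_dist 0 b) = 2 * y / (1 - y\<^sup>2)"
      using *[OF assms(1)] *[OF assms(2)] hyp_dist_commute[of 0 b] by (simp_all add: x_def y_def)
  qed
  have cx: "cosh (hyp_dist a 0) = (1 + x\<^sup>2) / (1 - x\<^sup>2)" "cosh (hyp_dist 0 b) = (1 + y\<^sup>2) / (1 - y\<^sup>2)"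
    using cosh_hyp_dist[of a 0] cosh_hyp_dist[of 0 b] assms xy
    by (simp_all add: x_def y_def field_simps)
  have d: "(cmod (a - b))\<^sup>2 = x\<^sup>2 + y\<^sup>2 - 2 * Re (a * cnj b)"
    unfolding x_def y_def cmod_power2 by (simp add: power2_eq_square algebra_simps)
  have "cosh (hyp_dist a 0 + hyp_dist 0 b) = ((1 + x\<^sup>2) * (1 + y\<^sup>2) + 4 * (x * y)) / ((1 - x\<^sup>2) * (1 - y\<^sup>2))"
    unfolding cosh_add sx sy cx times_divide_times_eq add_divide_distrib[symmetric] by (simp add: mult_ac)
  moreover have "cosh (hyp_dist a b) = ((1 + x\<^sup>2) * (1 + y\<^sup>2) - 4 * Re (a * cnj b)) / ((1 - x\<^sup>2) * (1 - y\<^sup>2))"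
  proof -
    have "1 + 2 * t / E = (E + 2 * t) / E" if "E \<noteq> 0" for t E :: real
      using that by (simp add: field_simps)
    from this[of "(1 - x\<^sup>2) * (1 - y\<^sup>2)" "x\<^sup>2 + y\<^sup>2 - 2 * Re (a * cnj b)"]
    have "cosh (hyp_dist a b) = ((1 - x\<^sup>2) * (1 - y\<^sup>2) + 2 * (x\<^sup>2 + y\<^sup>2 - 2 * Re (a * cnj b)))
      / ((1 - x\<^sup>2) * (1 - y\<^sup>2))"
      unfolding cosh_hyp_dist[OF assms] d using xy by (simp flip: x_def y_def)
    also have "(1 - x\<^sup>2) * (1 - y\<^sup>2) + 2 * (x\<^sup>2 + y\<^sup>2 - 2 * Re (a * cnj b))
       = (1 + x\<^sup>2) * (1 + y\<^sup>2) - 4 * Re (a * cnj b)"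
      by (simp add: algebra_simps)
    finally show ?thesis .
  qed
  \<comment> \<open>The gap between the two values of cosh is a positive multiple of |a| |b| + Re (a
    cnj b). It is nonnegative, and it vanishes exactly when \<open>a\<close> and \<open>b\<close>
    are opposite or one of them is 0.\<close>
  ultimately have e: "cosh (hyp_dist a 0 + hyp_dist 0 b) = cosh (hyp_dist a b) +
     4 * (x * y + Re (a * cnj b)) / ((1 - x\<^sup>2) * (1 - y\<^sup>2))"
    by (simp add: field_simps diff_divide_distrib add_divide_distrib)
  have p: "0 < (1 - x\<^sup>2) * (1 - y\<^sup>2)" using xy by simp
  have nn: "0 \<le> hyp_dist a 0 + hyp_dist 0 b" "0 \<le> hyp_dist a b"
    using hyp_dist_nonneg assms by (simp_all add: add_nonneg_nonneg)
  have "- Re (a * cnj b) \<le> x * y"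
    using complex_Re_le_cmod[of "- (a * cnj b)"] by (simp add: norm_mult x_def y_def)
  then have "cosh (hyp_dist a b) \<le> cosh (hyp_dist a 0 + hyp_dist 0 b)"
    using e p by simp
  then show "hyp_dist a b \<le> hyp_dist a 0 + hyp_dist 0 b"
    using nn cosh_real_nonneg_le_iff by blast
  have "hyp_dist a 0 + hyp_dist 0 b = hyp_dist a b \<longleftrightarrow> cosh (hyp_dist a 0 + hyp_dist 0 b) = cosh (hyp_dist a b)"
    using nn by (metis cosh_real_nonneg_le_iff order_antisym order_refl)
  also have "\<dots> \<longleftrightarrow> Re (a * cnj b) = - (cmod a * cmod b)"
    using e p unfolding x_def y_def by auto
  finally show "hyp_dist a 0 + hyp_dist 0 b = hyp_dist a b \<longleftrightarrow> Re (a * cnj b) = - (cmod a * cmod b)" .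
qed

lemma hyp_dist_triangle:
  assumes "cmod a < 1" "cmod b < 1" "cmod z < 1"
  shows "hyp_dist a b \<le> hyp_dist a z + hyp_dist z b"
  using hyp_dist_through_0(1)[of "mob z a" "mob z b"] hyp_dist_mob[of z] assms
  by (metis mob_in_disc mob_self)

section \<open>The Klein chart and its straight geodesics\<close>

lemma klein_0 [simp]: "klein 0 = 0" by (simp add: klein_def)

lemma norm_klein: "cmod (klein z) = 2 * cmod z / (1 + (cmod z)\<^sup>2)"
  unfolding klein_def by (simp add: norm_divide norm_mult del: of_real_add of_real_power)

lemma one_minus_klein: "1 - (cmod (klein z))\<^sup>2 = ((1 - (cmod z)\<^sup>2) / (1 + (cmod z)\<^sup>2))\<^sup>2"
proof -
  define t where "t = 1 + (cmod z)\<^sup>2"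
  have "t \<noteq> 0" unfolding t_def by (metis add_pos_nonneg less_irrefl zero_le_power2 zero_less_one)
  then have "1 - (2 * cmod z / t)\<^sup>2 = (t\<^sup>2 - 4 * (cmod z)\<^sup>2) / t\<^sup>2"
    by (simp add: diff_divide_distrib power_divide power_mult_distrib)
  also have "t\<^sup>2 - 4 * (cmod z)\<^sup>2 = (1 - (cmod z)\<^sup>2)\<^sup>2"
    unfolding t_def by (simp add: power2_eq_square algebra_simps)
  finally show ?thesis unfolding norm_klein t_def by (simp add: power_divide)
qed

lemma klein_in_disc: "cmod z < 1 \<Longrightarrow> cmod (klein z) < 1"
proof -
  assume "cmod z < 1"
  then have "0 < 1 - (cmod (klein z))\<^sup>2"
    unfolding one_minus_klein using one_minus_norm_pos[of z]
    by (simp add: add_nonneg_eq_0_iff)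
  then show ?thesis by (simp add: abs_square_less_1)
qed

text \<open>The differential of the Klein chart is a positive multiple of \<open>x \<mapsto> x - v\<^sup>2 x\<^sup>*\<close>; projectivity
  makes the formula exact for finite displacements.\<close>

definition kdir :: "complex \<Rightarrow> complex \<Rightarrow> complex" where
  "kdir v x = x - v\<^sup>2 * cnj x"

lemma klein_mob_diff:
  assumes "cmod v < 1" "cmod x < 1"
  obtains c where "0 < c" "klein (mob (- v) x) - klein v = of_real c * kdir v x"
proof -
  \<comment> \<open>\<open>D\<close> equals |1 + cnj v x|^2 + |x + v|^2, the denominator that arises
    when \<open>klein\<close> is applied to the quotient \<open>mob (- v) x\<close>.\<close>
  define D where "D = (1 + (cmod x)\<^sup>2) * (1 + (cmod v)\<^sup>2) + 4 * Re (cnj v * x)"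
  have "- Re (cnj v * x) \<le> cmod v * cmod x"
    using complex_Re_le_cmod[of "- (cnj v * x)"] by (simp add: norm_mult)
  moreover have "0 \<le> (cmod v - cmod x)\<^sup>2" "cmod v * cmod x < 1"
    using assms by (auto intro: order_le_less_trans[OF mult_right_mono[of _ 1]] simp: mult_le_one)
  ultimately have Dp: "0 < D"
    using mult_nonneg_nonneg[of "cmod v" "cmod x"]
  proof -
    assume a: "- Re (cnj v * x) \<le> cmod v * cmod x" "cmod v * cmod x < 1" "0 \<le> (cmod v - cmod x)\<^sup>2"
    have "0 < (1 - cmod v * cmod x)\<^sup>2" using a by simp
    moreover have "D \<ge> (1 - cmod v * cmod x)\<^sup>2 + (cmod v - cmod x)\<^sup>2"
      using a unfolding D_def by (simp add: power2_eq_square algebra_simps)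
    ultimately show ?thesis using a by linarith
  qed
  have nz: "1 + cnj v * x \<noteq> 0"
    using one_minus_mult_nz[of "- cnj v" x] assms by simp
  have m: "mob (- v) x = (x + v) / (1 + cnj v * x)" by (simp add: mob_def)
  have DD: "complex_of_real D = (1 + x * cnj x) * (1 + v * cnj v) + 2 * (cnj v * x + v * cnj x)"
  proof -
    have "complex_of_real (4 * Re (cnj v * x)) = 2 * (cnj v * x + v * cnj x)"
      by (simp add: complex_eq_iff)
    then show ?thesis
      by (simp only: D_def of_real_add of_real_mult of_real_1 complex_norm_square)
  qed
  have cn: "complex_of_real (1 + (cmod v)\<^sup>2) = 1 + v * cnj v"
    by (simp only: of_real_add of_real_1 complex_norm_square)
  have vnz: "1 + v * cnj v \<noteq> 0"
    by (metis cn of_real_eq_0_iff add_pos_nonneg less_irrefl zero_le_power2 zero_less_one)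
  have "klein (mob (- v) x) = 2 * ((x + v) * (1 + v * cnj x)) / of_real D"
  proof -
    have nz': "1 + v * cnj x \<noteq> 0" using nz by (metis complex_cnj_add complex_cnj_cnj complex_cnj_mult complex_cnj_one complex_cnj_zero_iff)
    have "complex_of_real (1 + (cmod (mob (- v) x))\<^sup>2) = of_real D / ((1 + cnj v * x) * (1 + v * cnj x))"
    proof -
      have "1 + (x + v) / P * cnj ((x + v) / P) = (P * cnj P + (x + v) * cnj (x + v)) / (P * cnj P)"
        if "P \<noteq> 0" for P
        using that by (simp add: field_simps)
      from this[OF nz] show ?thesis
        unfolding of_real_add of_real_1 m complex_norm_square DD
        by (simp add: algebra_simps)
    qed
    moreover have "2 * (y / P) / (E / (P * Q)) = 2 * (y * Q) / E"
      if "P \<noteq> 0" "Q \<noteq> 0" "E \<noteq> 0" for y P Q E :: complex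
      using that by (simp add: field_simps)
    from this[OF nz nz', of "of_real D" "x + v"]
    have "2 * ((x + v) / (1 + cnj v * x)) / (of_real D / ((1 + cnj v * x) * (1 + v * cnj x)))
      = 2 * ((x + v) * (1 + v * cnj x)) / of_real D" using Dp by simp
    ultimately show ?thesis unfolding klein_def by (simp only: m)
  qed
  moreover have "klein v = 2 * v / (1 + v * cnj v)" by (simp only: klein_def cn)
  ultimately have "klein (mob (- v) x) - klein v
     = 2 * ((x + v) * (1 + v * cnj x)) / of_real D - 2 * v / (1 + v * cnj v)" by simp
  also have "\<dots> = (2 * ((x + v) * (1 + v * cnj x)) * (1 + v * cnj v) - 2 * v * of_real D) / (of_real D * (1 + v * cnj v))"
    using Dp vnz by (simp add: field_simps)
  also have "2 * ((x + v) * (1 + v * cnj x)) * (1 + v * cnj v) - 2 * v * of_real D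
      = 2 * (1 - v * cnj v) * kdir v x"
    unfolding DD kdir_def by (simp add: algebra_simps power2_eq_square)
  also have "2 * (1 - v * cnj v) * kdir v x / (of_real D * (1 + v * cnj v))
     = of_real (2 * (1 - (cmod v)\<^sup>2) / (D * (1 + (cmod v)\<^sup>2))) * kdir v x"
  proof -
    have "complex_of_real (2 * (1 - (cmod v)\<^sup>2) / (D * (1 + (cmod v)\<^sup>2)))
      = 2 * (1 - v * cnj v) / (of_real D * (1 + v * cnj v))"
      by (simp only: of_real_divide of_real_mult of_real_diff of_real_add of_real_1 of_real_numeral
          complex_norm_square)
    then show ?thesis by simp
  qed
  finally show ?thesis
    using that[of "2 * (1 - (cmod v)\<^sup>2) / (D * (1 + (cmod v)\<^sup>2))"] Dp one_minus_norm_pos[OF assms(1)]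
    by (simp add: add_pos_nonneg)
qed

lemma klein_diff:
  assumes "cmod v < 1" "cmod z < 1"
  obtains c where "0 < c" "klein z - klein v = of_real c * kdir v (mob v z)"
  using klein_mob_diff[OF assms(1), of "mob v z"] mob_neg_mob[OF assms] assms by auto

lemma kdir_scale: "kdir v (of_real c * x) = of_real c * kdir v x"
  by (simp add: kdir_def algebra_simps)

lemma kdir_add: "kdir v (x + y) = kdir v x + kdir v y"
  by (simp add: kdir_def algebra_simps)

lemma kdir_eq_0_iff:
  assumes "cmod v < 1"
  shows "kdir v x = 0 \<longleftrightarrow> x = 0"
proof
  assume "kdir v x = 0"
  then have "x = v\<^sup>2 * cnj x" by (simp add: kdir_def)
  then have "cmod x = cmod (v\<^sup>2 * cnj x)" by (rule arg_cong)
  then have "cmod x = cmod v ^ 2 * cmod x" by (simp add: norm_mult norm_power)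
  moreover have "cmod v ^ 2 < 1" using assms by (simp add: abs_square_less_1)
  ultimately show "x = 0" by auto
qed (simp add: kdir_def)

lemma klein_eq_iff:
  assumes "cmod v < 1" "cmod z < 1"
  shows "klein z = klein v \<longleftrightarrow> z = v"
proof -
  obtain c where c: "0 < c" "klein z - klein v = of_real c * kdir v (mob v z)"
    using klein_diff[OF assms] by blast
  then have "klein z = klein v \<longleftrightarrow> kdir v (mob v z) = 0"
    by (metis eq_iff_diff_eq_0 less_irrefl mult_eq_0_iff of_real_eq_0_iff)
  then show ?thesis
    using kdir_eq_0_iff mob_eq_0_iff assms by simp
qed

text \<open>The equality case of the Cauchy-Schwarz inequality. It translates the metric condition
  of \<open>hyp_dist_through_0\<close> into an affine incidence.\<close>

lemma opposite_iff_between: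
  fixes x y :: complex
  shows "Re (x * cnj y) = - (cmod x * cmod y) \<longleftrightarrow> 0 \<in> closed_segment x y"
proof
  assume "Re (x * cnj y) = - (cmod x * cmod y)"
  then have "x \<bullet> (- y) = norm x * norm (- y)"
    by (simp add: inner_complex_def)
  then have e: "norm x *\<^sub>R (- y) = norm (- y) *\<^sub>R x"
    using norm_cauchy_schwarz_eq by blast
  show "0 \<in> closed_segment x y"
  proof (cases "x = 0 \<and> y = 0")
    case False
    then have p: "norm x + norm y > 0" by (meson add_nonneg_pos add_pos_nonneg norm_ge_zero zero_less_norm_iff)
    have "norm y *\<^sub>R x + norm x *\<^sub>R y = 0"
    proof -
      have "norm y *\<^sub>R x = - (norm x *\<^sub>R y)" using e by simp
      then show ?thesis by simp
    qed
    moreover have "1 - norm x / (norm x + norm y) = inverse (norm x + norm y) * norm y"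
      "norm x / (norm x + norm y) = inverse (norm x + norm y) * norm x"
      using p by (simp_all add: field_simps)
    ultimately have "(1 - norm x / (norm x + norm y)) *\<^sub>R x + (norm x / (norm x + norm y)) *\<^sub>R y = 0"
      by (metis (no_types) scaleR_scaleR scaleR_add_right scaleR_zero_right)
    then show ?thesis
      unfolding closed_segment_def using p by (auto intro!: exI[of _ "norm x / (norm x + norm y)"])
  qed auto
next
  assume "0 \<in> closed_segment x y"
  then obtain u where u: "0 \<le> u" "u \<le> 1" "(1 - u) *\<^sub>R x + u *\<^sub>R y = 0"
    unfolding closed_segment_def by auto
  show "Re (x * cnj y) = - (cmod x * cmod y)"
  proof (cases "u = 1")
    case True
    then show ?thesis using u by simp
  next
    case False
    define k where "k = u / (1 - u)"
    have "(1 - u) *\<^sub>R x = - (u *\<^sub>R y)" using u(3) by (simp add: eq_neg_iff_add_eq_0)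
    moreover have "x = inverse (1 - u) *\<^sub>R ((1 - u) *\<^sub>R x)" using False by simp
    ultimately have x: "x = - (of_real k * y)"
      by (simp add: k_def divide_inverse scaleR_conv_of_real)
    have "0 \<le> k" using u by (simp add: k_def)
    have "x * cnj y = - of_real (k * (cmod y)\<^sup>2)"
      using x complex_norm_square[of y] by simp
    then have "Re (x * cnj y) = - (k * (cmod y)\<^sup>2)"
      by (metis Re_complex_of_real uminus_complex.sel(1))
    moreover have "cmod x = k * cmod y"
      using x \<open>0 \<le> k\<close> by (simp add: norm_mult)
    ultimately show ?thesis by (simp add: power2_eq_square)
  qed
qed

lemma zero_in_segment_scale:
  fixes x y :: complex
  assumes "0 < c" "0 < d"
  shows "0 \<in> closed_segment (of_real c * x) (of_real d * y) \<longleftrightarrow> 0 \<in> closed_segment x y"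
proof -
  have "Re (of_real c * x * cnj (of_real d * y)) = - (cmod (of_real c * x) * cmod (of_real d * y))
    \<longleftrightarrow> c * d * Re (x * cnj y) = c * d * (- (cmod x * cmod y))"
    using assms by (simp add: norm_mult algebra_simps)
  also have "\<dots> \<longleftrightarrow> Re (x * cnj y) = - (cmod x * cmod y)"
    using assms by (simp only: mult_cancel_left) auto
  finally show ?thesis
    by (simp only: opposite_iff_between)
qed

lemma zero_in_segment_kdir:
  assumes "cmod v < 1"
  shows "0 \<in> closed_segment (kdir v x) (kdir v y) \<longleftrightarrow> 0 \<in> closed_segment x y"
proof -
  have e: "(1 - u) *\<^sub>R kdir v x + u *\<^sub>R kdir v y = kdir v ((1 - u) *\<^sub>R x + u *\<^sub>R y)" for u
    using kdir_scale[of v "1 - u" x] kdir_scale[of v u y]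
    by (simp only: scaleR_conv_of_real kdir_add)
  show ?thesis
    unfolding closed_segment_def mem_Collect_eq e
    by (metis (no_types) kdir_eq_0_iff[OF assms])
qed

text \<open>With \<open>z\<close> moved to the origin, lying between \<open>a\<close> and
  \<open>b\<close> means that 0 is on the segment from \<open>mob z a\<close> to
  \<open>mob z b\<close>. Positive factors and the injective real-linear map \<open>kdir z\<close>
  preserve this, and together they turn \<open>mob z a\<close> and \<open>mob z b\<close> into the
  displacements in the Klein chart.\<close>

lemma mem_hyp_segment_iff:
  assumes "cmod a < 1" "cmod b < 1"
  shows "z \<in> hyp_segment a b \<longleftrightarrow> cmod z < 1 \<and> klein z \<in> closed_segment (klein a) (klein b)"
proof (cases "cmod z < 1")
  case z: True
  obtain c where c: "0 < c" "klein a - klein z = of_real c * kdir z (mob z a)"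
    using klein_diff[OF z assms(1)] .
  obtain d where d: "0 < d" "klein b - klein z = of_real d * kdir z (mob z b)"
    using klein_diff[OF z assms(2)] .
  have "z \<in> hyp_segment a b \<longleftrightarrow> hyp_dist (mob z a) 0 + hyp_dist 0 (mob z b) = hyp_dist (mob z a) (mob z b)"
    using z assms hyp_dist_mob[OF z] unfolding hyp_segment_def hyp_plane_def
    by (metis (mono_tags, lifting) dist_0_norm mem_Collect_eq mem_ball mob_self)
  also have "\<dots> \<longleftrightarrow> 0 \<in> closed_segment (mob z a) (mob z b)"
    using hyp_dist_through_0(2) opposite_iff_between z assms by simp
  also have "\<dots> \<longleftrightarrow> 0 \<in> closed_segment (klein a - klein z) (klein b - klein z)"
    unfolding c d zero_in_segment_scale[OF c(1) d(1)] zero_in_segment_kdir[OF z] ..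
  also have "\<dots> \<longleftrightarrow> klein z \<in> closed_segment (klein a) (klein b)"
    using closed_segment_translation_eq[of "- klein z" "klein z" "klein a" "klein b"] by simp
  finally show ?thesis using z by simp
qed (simp add: hyp_segment_def hyp_plane_def)

definition unklein :: "complex \<Rightarrow> complex" where
  "unklein w = w / of_real (1 + sqrt (1 - (cmod w)\<^sup>2))"

lemma klein_unklein:
  assumes "cmod w < 1"
  shows "klein (unklein w) = w" "cmod (unklein w) < 1"
proof -
  define q where "q = sqrt (1 - (cmod w)\<^sup>2)"
  have q: "0 < q" "q\<^sup>2 = 1 - (cmod w)\<^sup>2"
    using one_minus_norm_pos[OF assms] by (auto simp: q_def)
  have "cmod (unklein w) = cmod w / (1 + q)"
    using q unfolding unklein_def norm_divide by (simp flip: q_def add: norm_of_real abs_of_pos del: of_real_add)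
  then have n: "(cmod (unklein w))\<^sup>2 = (1 - q\<^sup>2) / (1 + q)\<^sup>2" "cmod (unklein w) < 1"
    using q assms by (simp_all add: power_divide)
  have "(1 - q\<^sup>2) / (1 + q)\<^sup>2 = (1 - q) / (1 + q)"
  proof -
    have "1 - q\<^sup>2 = (1 - q) * (1 + q)" by (simp add: power2_eq_square algebra_simps)
    then show ?thesis using q(1) by (simp add: power2_eq_square[of "1 + q"])
  qed
  then have "1 + (cmod (unklein w))\<^sup>2 = 2 / (1 + q)"
    unfolding n using q(1) by (simp add: field_simps)
  then have "klein (unklein w) = 2 * (w / of_real (1 + q)) / of_real (2 / (1 + q))"
    unfolding klein_def by (simp add: unklein_def q_def)
  also have "\<dots> = w" 
  proof -
    have "2 * (w / Q) / (2 / Q) = w" if "Q \<noteq> 0" for Q :: complex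
      using that by simp
    from this[of "complex_of_real (1 + q)"] show ?thesis
      using q(1) by (simp only: of_real_divide of_real_numeral of_real_eq_0_iff)
  qed
  finally show "klein (unklein w) = w" .
  show "cmod (unklein w) < 1" by (rule n)
qed

lemma klein_image_hyp_segment:
  assumes "cmod a < 1" "cmod b < 1"
  shows "klein ` hyp_segment a b = closed_segment (klein a) (klein b)"
proof
  show "klein ` hyp_segment a b \<subseteq> closed_segment (klein a) (klein b)"
    using mem_hyp_segment_iff[OF assms] by auto
  show "closed_segment (klein a) (klein b) \<subseteq> klein ` hyp_segment a b"
  proof
    fix w assume w: "w \<in> closed_segment (klein a) (klein b)"
    have "closed_segment (klein a) (klein b) \<subseteq> ball 0 1"
      by (rule closed_segment_subset) (auto simp: assms klein_in_disc)
    then have "cmod w < 1" using w by auto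
    then show "w \<in> klein ` hyp_segment a b"
      using klein_unklein[of w] mem_hyp_segment_iff[OF assms, of "unklein w"] w
      by (metis image_eqI)
  qed
qed

lemma mob_image_hyp_segment:
  assumes "cmod v < 1" "cmod a < 1" "cmod b < 1"
  shows "hyp_segment (mob v a) (mob v b) = mob v ` hyp_segment a b"
proof
  show "mob v ` hyp_segment a b \<subseteq> hyp_segment (mob v a) (mob v b)"
    using assms by (auto simp: hyp_segment_def hyp_plane_def hyp_dist_mob)
  show "hyp_segment (mob v a) (mob v b) \<subseteq> mob v ` hyp_segment a b"
  proof
    fix z assume z: "z \<in> hyp_segment (mob v a) (mob v b)"
    then have "cmod z < 1" by (simp add: hyp_segment_def hyp_plane_def)
    then have "mob (- v) z \<in> hyp_segment a b"
      using z assms hyp_dist_mob[of v a "mob (- v) z"] hyp_dist_mob[of v "mob (- v) z" b] hyp_dist_mob[of v a b]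
      by (simp add: hyp_segment_def hyp_plane_def mob_mob_neg)
    then show "z \<in> mob v ` hyp_segment a b"
      by (metis image_eqI mob_mob_neg assms(1) \<open>cmod z < 1\<close>)
  qed
qed

text \<open>The signed hyperbolic area of the triangle with vertices \<open>0\<close>, \<open>a\<close>, \<open>b\<close>.\<close>

definition tri_term :: "complex \<Rightarrow> complex \<Rightarrow> real" where
  "tri_term a b = 2 * Arg (1 - a * cnj b)"

lemma Arg_cnj': "0 < Re z \<Longrightarrow> Arg (cnj z) = - Arg z"
  using Arg_cnj[of z] Arg_eq_0_iff[of z] by auto

lemma tri_term_swap:
  assumes "cmod a < 1" "cmod b < 1"
  shows "tri_term b a = - tri_term a b"
  using Arg_cnj'[OF one_minus_mult_Re_pos[of a "cnj b"]] assms
  by (simp add: tri_term_def mult.commute)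

lemma tri_term_rot: "cmod u = 1 \<Longrightarrow> tri_term (u * a) (u * b) = tri_term a b"
proof -
  assume "cmod u = 1"
  then have "u * cnj u = 1" using complex_norm_square[of u] by simp
  then have "u * a * cnj (u * b) = a * cnj b"
    by (metis (no_types, lifting) complex_cnj_mult mult.assoc mult.left_commute mult_1)
  then show ?thesis by (simp only: tri_term_def)
qed

lemma cis_eq_1_imp_0:
  assumes "cis t = 1" "\<bar>t\<bar> < 2 * pi"
  shows "t = 0"
proof -
  have "cos t = 1" using assms(1) by (metis cis.sel(1) one_complex.sel(1))
  then obtain k :: int where k: "t = of_int k * 2 * pi" using cos_one_2pi_int by blast
  then have "\<bar>real_of_int k\<bar> < 1"
    using assms(2) by (simp add: abs_mult)
  then have "k = 0" by linarith
  then show ?thesis using k by simp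
qed

lemma cis_Arg_of_real_mult: "z \<noteq> 0 \<Longrightarrow> z = of_real (cmod z) * cis (Arg z)"
  by (metis rcis_cmod_Arg rcis_def)

text \<open>\<open>mob_one_minus\<close> gives the identity modulo 2 \<pi>. All four numbers have
  positive real part, so each argument is below \<pi>/2 in modulus and the congruence is an
  equality. The correction is a difference of terms depending on one vertex each and cancels around
  a closed polygon.\<close>

lemma tri_term_mob:
  assumes "cmod b < 1" "cmod x < 1" "cmod z < 1"
  shows "tri_term (mob b x) (mob b z)
       = tri_term x z - 2 * Arg (1 - cnj b * x) + 2 * Arg (1 - cnj b * z)"
proof -
  define P X Z G where "P = 1 - x * cnj z" and "X = 1 - cnj b * x" and "Z = 1 - cnj b * z"
    and "G = 1 - mob b x * cnj (mob b z)"
  have re: "0 < Re P" "0 < Re X" "0 < Re Z" "0 < Re G"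
    unfolding P_def X_def Z_def G_def
    by (rule one_minus_mult_Re_pos; simp add: assms)+
  then have nz: "P \<noteq> 0" "X \<noteq> 0" "Z \<noteq> 0" "G \<noteq> 0" by auto
  have e: "G * (X * cnj Z) = of_real (1 - (cmod b)\<^sup>2) * P"
    using mob_one_minus[OF assms] by (simp add: P_def X_def Z_def G_def)
  have bp: "0 < 1 - (cmod b)\<^sup>2" using one_minus_norm_pos assms by blast
  have "cis (Arg G) * (cis (Arg X) * cnj (cis (Arg Z))) = cis (Arg P)"
  proof -
    have "cis (Arg (G * (X * cnj Z))) = cis (Arg P)"
      by (simp only: e Arg_times_of_real[OF bp])
    then show ?thesis
      using nz by (simp add: cis_Arg sgn_mult) (metis sgn_eq complex_cnj_divide complex_cnj_complex_of_real complex_mod_cnj)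
  qed
  then have "cis (Arg G + Arg X - Arg Z) = cis (Arg P)"
    by (simp add: cis_mult cis_cnj algebra_simps)
  then have "cis (Arg G + Arg X - Arg Z - Arg P) = 1"
    by (metis cis_divide cis_neq_zero divide_self)
  moreover have "\<bar>Arg G\<bar> < pi/2" "\<bar>Arg X\<bar> < pi/2" "\<bar>Arg Z\<bar> < pi/2" "\<bar>Arg P\<bar> < pi/2"
    using re Arg_Re_pos by blast+
  ultimately have "Arg G + Arg X - Arg Z - Arg P = 0"
    by (intro cis_eq_1_imp_0) auto
  then show ?thesis
    unfolding tri_term_def P_def X_def Z_def G_def by simp
qed

section \<open>The isoperimetric inequality for closed polygons\<close>

lemma cosh_sum_diff:
  fixes s d :: real
  shows "cosh (s + d) + cosh (s - d) = 2 * (cosh s * cosh d)"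
    and "cosh (s + d) - cosh (s - d) = 2 * (sinh s * sinh d)"
  by (simp_all add: cosh_add cosh_diff)

text \<open>Hyperboloid coordinates: the apex is (B, X, Y), \<open>P\<close> is cosh of half the
  base, \<open>h\<close> and \<open>g\<close> are the squared cosh of half the sum and half the
  difference of the legs. Primes denote the isosceles apex with the same \<open>h\<close>, where
  \<open>g = 1\<close> and \<open>X = 0\<close>. Passing to it does not raise the denominator, and
  it does not lower the numerator because P^2 (P^2 - 1) (Y'^2 - Y^2) = (g - 1) (h - P^2).\<close>

lemma isosceles_ratio:
  fixes P B B' X Y Y' h g :: real
  assumes P: "1 < P" and h: "P\<^sup>2 \<le> h" and g: "1 \<le> g" and B: "0 \<le> B" and B': "0 \<le> B'"
    and hg: "h * g = B\<^sup>2 * P\<^sup>2" and X: "(h - 1) * (g - 1) = X\<^sup>2 * (P\<^sup>2 - 1)"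
    and Y: "B\<^sup>2 = 1 + X\<^sup>2 + Y\<^sup>2" and h': "B'\<^sup>2 * P\<^sup>2 = h" and Y': "0 \<le> Y'" "Y'\<^sup>2 = B'\<^sup>2 - 1"
  shows "\<bar>Y\<bar> / (P + B) \<le> Y' / (P + B')"
proof -
  have PP: "0 < P\<^sup>2 * (P\<^sup>2 - 1)" using P by (simp add: one_less_power)
  have "B'\<^sup>2 * P\<^sup>2 \<le> B\<^sup>2 * P\<^sup>2"
  proof -
    have "0 \<le> h" using h zero_le_power2[of P] by linarith
    then have "h * 1 \<le> h * g" using g by (intro mult_left_mono) auto
    then show ?thesis using h' hg by linarith
  qed
  then have "(B' * P)\<^sup>2 \<le> (B * P)\<^sup>2" by (simp only: power_mult_distrib)
  then have "B' * P \<le> B * P" using P B by (intro power2_le_imp_le[of "B' * P"]) auto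
  then have BB: "B' \<le> B" using P by simp
  have "P\<^sup>2 * (P\<^sup>2 - 1) * (Y'\<^sup>2 - Y\<^sup>2)
     = (P\<^sup>2 - 1) * (B'\<^sup>2 * P\<^sup>2 - P\<^sup>2) - (P\<^sup>2 - 1) * (B\<^sup>2 * P\<^sup>2 - P\<^sup>2) + P\<^sup>2 * (X\<^sup>2 * (P\<^sup>2 - 1))"
  proof -
    have "Y\<^sup>2 = B\<^sup>2 - 1 - X\<^sup>2" using Y by simp
    then show ?thesis by (simp only: Y'(2)) (simp add: algebra_simps)
  qed
  also have "\<dots> = (P\<^sup>2 - 1) * (h - P\<^sup>2) - (P\<^sup>2 - 1) * (h * g - P\<^sup>2) + P\<^sup>2 * ((h - 1) * (g - 1))"
    by (simp only: X h' hg)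
  also have "\<dots> = (g - 1) * (h - P\<^sup>2)" by (simp add: algebra_simps)
  also have "\<dots> \<ge> 0" using g h by simp
  finally have "0 \<le> Y'\<^sup>2 - Y\<^sup>2" using PP by (simp add: zero_le_mult_iff)
  then have "\<bar>Y\<bar>\<^sup>2 \<le> Y'\<^sup>2" by simp
  then have "\<bar>Y\<bar> \<le> Y'" using Y'(1) by (rule power2_le_imp_le)
  then show ?thesis
    using BB P B B' by (intro frac_le) auto
qed

text \<open>A property of the base alone, so that isometries can move the base into symmetric
  position. The term of the side from \<open>c\<close> back to \<open>a\<close> does not depend on
  the apex and is left out.\<close>

definition isosceles_max :: "complex \<Rightarrow> complex \<Rightarrow> bool" where
  "isosceles_max a c \<longleftrightarrow> (\<forall>b. cmod b < 1 \<longrightarrow> (\<exists>b'. cmod b' < 1 \<and>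
     hyp_dist a b' = (hyp_dist a b + hyp_dist b c) / 2 \<and>
     hyp_dist b' c = (hyp_dist a b + hyp_dist b c) / 2 \<and>
     tri_term a b + tri_term b c \<le> tri_term a b' + tri_term b' c))"

lemma isosceles_max_mob:
  assumes "isosceles_max (mob v a) (mob v c)" "cmod v < 1" "cmod a < 1" "cmod c < 1"
  shows "isosceles_max a c"
  unfolding isosceles_max_def
proof (intro allI impI)
  fix b assume b: "cmod b < 1"
  obtain b' where b': "cmod b' < 1" 
     "hyp_dist (mob v a) b' = (hyp_dist (mob v a) (mob v b) + hyp_dist (mob v b) (mob v c)) / 2"
     "hyp_dist b' (mob v c) = (hyp_dist (mob v a) (mob v b) + hyp_dist (mob v b) (mob v c)) / 2"
     "tri_term (mob v a) (mob v b) + tri_term (mob v b) (mob v c) \<le> tri_term (mob v a) b' + tri_term b' (mob v c)"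
    using assms b unfolding isosceles_max_def by (meson mob_in_disc)
  define d where "d = mob (- v) b'"
  have d: "cmod d < 1" "b' = mob v d"
    using b'(1) assms by (simp_all add: d_def mob_mob_neg)
  show "\<exists>b'. cmod b' < 1 \<and>
     hyp_dist a b' = (hyp_dist a b + hyp_dist b c) / 2 \<and>
     hyp_dist b' c = (hyp_dist a b + hyp_dist b c) / 2 \<and>
     tri_term a b + tri_term b c \<le> tri_term a b' + tri_term b' c"
    using b'(2-4) d(1) assms(2-4) b unfolding d(2)
    by (intro exI[of _ d]) (simp add: hyp_dist_mob tri_term_mob)
qed

lemma isosceles_max_rot:
  assumes "isosceles_max (u * a) (u * c)" "cmod u = 1"
  shows "isosceles_max a c"
  unfolding isosceles_max_def
proof (intro allI impI)
  fix b assume b: "cmod b < 1"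
  then have "cmod (u * b) < 1" using assms(2) by (simp add: norm_mult)
  then obtain b' where b': "cmod b' < 1" 
     "hyp_dist (u * a) b' = (hyp_dist (u * a) (u * b) + hyp_dist (u * b) (u * c)) / 2"
     "hyp_dist b' (u * c) = (hyp_dist (u * a) (u * b) + hyp_dist (u * b) (u * c)) / 2"
     "tri_term (u * a) (u * b) + tri_term (u * b) (u * c) \<le> tri_term (u * a) b' + tri_term b' (u * c)"
    using assms(1) unfolding isosceles_max_def by blast
  define d where "d = b' / u"
  have "u \<noteq> 0" using assms(2) by auto
  then have d: "b' = u * d" "cmod d < 1"
    using b'(1) assms(2) by (simp_all add: d_def norm_divide)
  show "\<exists>b'. cmod b' < 1 \<and>
     hyp_dist a b' = (hyp_dist a b + hyp_dist b c) / 2 \<and>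
     hyp_dist b' c = (hyp_dist a b + hyp_dist b c) / 2 \<and>
     tri_term a b + tri_term b c \<le> tri_term a b' + tri_term b' c"
    using b'(2-4) d(2) unfolding d(1) hyp_dist_rot[OF assms(2)] tri_term_rot[OF assms(2)]
    by (intro exI[of _ d]) simp
qed

text \<open>Both factors have positive real part, so their arguments add up to the argument of the
  product. Its tangent is then rewritten in the coordinates of \<open>isosceles_ratio\<close>, where
  the apex enters only through Y / (P + B).\<close>

lemma tri_term_symmetric_base:
  fixes p :: real
  assumes p: "0 \<le> p" "p < 1" and b: "cmod b < 1"
  defines "k \<equiv> (cmod b)\<^sup>2"
  shows "tri_term (- of_real p) b + tri_term b (of_real p)
     = - 2 * arctan ((2 * p / (1 - p\<^sup>2)) * ((2 * Im b / (1 - k)) / ((1 + p\<^sup>2) / (1 - p\<^sup>2) + (1 + k) / (1 - k))))"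
proof -
  define U V where "U = 1 + of_real p * cnj b" and "V = 1 - b * of_real p"
  have re: "0 < Re U" "0 < Re V"
    using one_minus_mult_Re_pos[of "- of_real p" "cnj b"] one_minus_mult_Re_pos[of b "of_real p"] p b
    by (simp_all add: U_def V_def)
  then have nz: "U \<noteq> 0" "V \<noteq> 0" by auto
  have "\<bar>Arg U\<bar> < pi/2" "\<bar>Arg V\<bar> < pi/2" using re Arg_Re_pos by blast+
  then have A: "Arg (U * V) = Arg U + Arg V"
    using nz by (subst Arg_times') (auto simp: abs_less_iff)
  have Re: "Re (U * V) = 1 - p\<^sup>2 * k" and Im: "Im (U * V) = - 2 * p * Im b"
    unfolding U_def V_def k_def cmod_power2 by (simp_all add: algebra_simps power2_eq_square)
  have kp: "0 \<le> k" "k < 1" "p\<^sup>2 < 1"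
    using p b by (auto simp: k_def abs_square_less_1)
  have pos: "0 < 1 - p\<^sup>2 * k"
    using kp by (metis diff_gt_0_iff_gt mult_le_one mult_less_cancel_right2 order_less_le zero_le_power2 mult_strict_mono' mult_1)
  have "tri_term (- of_real p) b + tri_term b (of_real p) = 2 * Arg (U * V)"
    unfolding tri_term_def A by (simp add: U_def V_def)
  also have "Arg (U * V) = arctan (- (2 * p * Im b) / (1 - p\<^sup>2 * k))"
    using arg_conv_arctan[of "U * V"] Re Im pos by simp
  also have "- (2 * p * Im b) / (1 - p\<^sup>2 * k)
    = - ((2 * p / (1 - p\<^sup>2)) * ((2 * Im b / (1 - k)) / ((1 + p\<^sup>2) / (1 - p\<^sup>2) + (1 + k) / (1 - k))))"
  proof -
    have "(1 + q) / (1 - q) + (1 + k) / (1 - k) = 2 * (1 - q * k) / ((1 - q) * (1 - k))"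
      if "q < 1" "k < 1" for q k :: real
    proof -
      have "(1 + q) / (1 - q) + (1 + k) / (1 - k) = ((1 + q) * (1 - k) + (1 + k) * (1 - q)) / ((1 - q) * (1 - k))"
        using that by (simp add: add_frac_eq)
      also have "(1 + q) * (1 - k) + (1 + k) * (1 - q) = 2 * (1 - q * k)" by (simp add: algebra_simps)
      finally show ?thesis .
    qed
    note * = this[OF kp(3,2)]
    have "- (c / E) = - ((d / F) * ((e / G) / (2 * E / (F * G))))"
      if "c = d * e / 2" "F > 0" "G > 0" "E > 0" for c d e E F G :: real
      using that by (simp add: field_simps)
    from this[of "2 * p * Im b" "2 * p" "2 * Im b" "1 - p\<^sup>2" "1 - k" "1 - p\<^sup>2 * k"]
    show ?thesis unfolding * using kp pos by simp
  qed
  finally show ?thesis by (simp add: arctan_minus)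
qed

lemma isosceles_max_symmetric:
  fixes p :: real
  assumes p: "0 \<le> p" "p < 1"
  shows "isosceles_max (- of_real p) (of_real p)"
  unfolding isosceles_max_def
proof (intro allI impI)
  fix b assume b: "cmod b < 1"
  define d1 d2 s d where "d1 = hyp_dist (- of_real p) b" and "d2 = hyp_dist b (of_real p)"
    and "s = (d1 + d2) / 2" and "d = (d1 - d2) / 2"
  define k P B where "k = (cmod b)\<^sup>2" and "P = (1 + p\<^sup>2) / (1 - p\<^sup>2)" and "B = (1 + k) / (1 - k)"
  define X Y where "X = 2 * Re b / (1 - k)" and "Y = 2 * Im b / (1 - k)"
  have kp: "0 \<le> k" "k < 1" "p\<^sup>2 < 1" "k = (Re b)\<^sup>2 + (Im b)\<^sup>2"
    using p b by (auto simp: k_def abs_square_less_1) (simp add: cmod_power2)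
  have pd: "cmod (of_real p) < 1" "cmod (- of_real p) < 1" using p by simp_all
  have cp: "(cmod (of_real p))\<^sup>2 = p\<^sup>2" "(cmod (- of_real p))\<^sup>2 = p\<^sup>2" by simp_all
  have n: "(cmod (- of_real p - b))\<^sup>2 = k + p\<^sup>2 + 2 * (p * Re b)" "(cmod (b - of_real p))\<^sup>2 = k + p\<^sup>2 - 2 * (p * Re b)"
    unfolding cmod_power2 kp(4) by (simp_all add: power2_eq_square algebra_simps)
  have gen: "1 + 2 * (k + q + e) / ((1 - q) * (1 - k)) = (1 + q) / (1 - q) * ((1 + k) / (1 - k)) + 2 * e / ((1 - q) * (1 - k))"
    if "q < 1" "k < 1" for q k e :: real
  proof -
    have "1 + 2 * (k + q + e) / E = (E + 2 * (k + q)) / E + 2 * e / E" if "E > 0" for E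
      using that by (simp add: field_simps)
    from this[of "(1 - q) * (1 - k)"] have "1 + 2 * (k + q + e) / ((1 - q) * (1 - k))
      = ((1 - q) * (1 - k) + 2 * (k + q)) / ((1 - q) * (1 - k)) + 2 * e / ((1 - q) * (1 - k))"
      using that by simp
    also have "(1 - q) * (1 - k) + 2 * (k + q) = (1 + q) * (1 + k)" by (simp add: algebra_simps)
    finally show ?thesis by simp
  qed
  define w where "w = 2 * (2 * (p * Re b)) / ((1 - p\<^sup>2) * (1 - k))"
  have c1: "cosh d1 = P * B + w"
    unfolding d1_def cosh_hyp_dist[OF pd(2) b] n cp
    using gen[OF kp(3,2), of "2 * (p * Re b)"] by (simp add: P_def B_def w_def k_def)
  have c2: "cosh d2 = P * B - w"
    unfolding d2_def cosh_hyp_dist[OF b pd(1)] n cp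
    using gen[OF kp(3,2), of "- (2 * (p * Re b))"] by (simp add: P_def B_def w_def k_def mult.commute)
  have sd: "d1 = s + d" "d2 = s - d" by (simp_all add: s_def d_def field_simps)
  have cc: "cosh s * cosh d = P * B" "sinh s * sinh d = w"
    using c1 c2 cosh_sum_diff[of s d] unfolding sd by linarith+
  have s0: "0 \<le> s" using hyp_dist_nonneg pd b by (simp add: s_def d1_def d2_def)
  have "hyp_dist (- of_real p) (of_real p) / 2 \<le> s"
    using hyp_dist_triangle[OF pd(2) pd(1) b] by (simp add: s_def d1_def d2_def)
  moreover have Pc: "cosh (hyp_dist (- of_real p) (of_real p) / 2) = P"
  proof -
    have "1 - (- complex_of_real p) * cnj (of_real p) = of_real (1 + p\<^sup>2)" by (simp add: power2_eq_square)
    moreover have "0 < 1 + p\<^sup>2" by (simp add: add_pos_nonneg)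
    ultimately have "cmod (1 - (- complex_of_real p) * cnj (of_real p)) = 1 + p\<^sup>2"
      by (simp only: norm_of_real)
    then have "(cosh (hyp_dist (- of_real p) (of_real p) / 2))\<^sup>2 = P\<^sup>2"
      unfolding cosh_half_hyp_dist[OF pd(2,1)] P_def cp by (simp only: power_divide power2_eq_square[of "1 - p\<^sup>2"])
    moreover have "0 \<le> P" using kp by (simp add: P_def)
    ultimately show ?thesis by (simp add: power2_eq_iff_nonneg cosh_real_nonneg)
  qed
  moreover have "0 \<le> hyp_dist (- of_real p) (of_real p) / 2" using hyp_dist_nonneg[OF pd(2,1)] by simp
  ultimately have sP: "P \<le> cosh s" using cosh_real_nonneg_le_iff s0 by metis
  have P1: "1 \<le> P" and B1: "1 \<le> B" using kp by (simp_all add: P_def B_def field_simps)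
  \<comment> \<open>By the hyperbolic Pythagorean theorem an apex on the imaginary axis at distance
    r from 0 has legs l with cosh l = P cosh r. \<open>B'\<close> is the value of cosh r for which
    both legs equal the mean \<open>s\<close>.\<close>
  define B' where "B' = cosh s / P"
  have B'1: "1 \<le> B'" using sP P1 by (simp add: B'_def field_simps)
  define y' where "y' = sqrt ((B' - 1) / (B' + 1))"
  have y'2: "y'\<^sup>2 = (B' - 1) / (B' + 1)" using B'1 by (simp add: y'_def)
  have y'0: "0 \<le> y'" "y'\<^sup>2 < 1" using B'1 by (simp_all add: y'_def y'2)
  have "(1 + (B' - 1) / (B' + 1)) / (1 - (B' - 1) / (B' + 1)) = B'"
  proof -
    have "1 + (B' - 1) / (B' + 1) = 2 * B' / (B' + 1)" "1 - (B' - 1) / (B' + 1) = 2 / (B' + 1)"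
      using B'1 by (simp_all add: field_simps)
    then show ?thesis using B'1 by simp
  qed
  then have B'y: "(1 + y'\<^sup>2) / (1 - y'\<^sup>2) = B'" by (simp add: y'2)
  \<comment> \<open>Below the real axis: the path from \<open>- p\<close> over the apex to
    \<open>p\<close> has positive signed area when the apex has negative imaginary part.\<close>
  define b' where "b' = - \<i> * of_real y'"
  have b': "cmod b' = y'" "cmod b' < 1" "(cmod b')\<^sup>2 = y'\<^sup>2" "Re b' = 0" "Im b' = - y'"
    using y'0 by (simp_all add: b'_def norm_mult abs_square_less_1)
  have n': "(cmod (- of_real p - b'))\<^sup>2 = y'\<^sup>2 + p\<^sup>2 + 0" "(cmod (b' - of_real p))\<^sup>2 = y'\<^sup>2 + p\<^sup>2 + 0"
    unfolding cmod_power2 by (simp_all add: b' power2_eq_square)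
  have "cosh (hyp_dist (- of_real p) b') = cosh s" "cosh (hyp_dist b' (of_real p)) = cosh s"
    unfolding cosh_hyp_dist[OF pd(2) b'(2)] cosh_hyp_dist[OF b'(2) pd(1)] n' cp b'(3)
    using gen[OF kp(3) y'0(2), of 0] P1 B'y by (simp_all add: P_def[symmetric] B'_def mult.commute)
  then have dd: "hyp_dist (- of_real p) b' = s" "hyp_dist b' (of_real p) = s"
    using s0 hyp_dist_nonneg[OF pd(2) b'(2)] hyp_dist_nonneg[OF b'(2) pd(1)]
    by (metis cosh_real_nonneg_le_iff order_antisym order_refl)+
  have area: "tri_term (- of_real p) b + tri_term b (of_real p) \<le> tri_term (- of_real p) b' + tri_term b' (of_real p)"
  proof (cases "p = 0")
    case True
    then show ?thesis by (simp add: tri_term_def)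
  next
    case False
    then have P2: "1 < P" using p kp by (simp add: P_def field_simps)
    define Y' where "Y' = 2 * y' / (1 - y'\<^sup>2)"
    have sq: "((1 + q) / (1 - q))\<^sup>2 = 1 + 4 * q / (1 - q)\<^sup>2" if "q < 1" for q :: real
    proof -
      have "((1 + q) / (1 - q))\<^sup>2 = ((1 - q)\<^sup>2 + 4 * q) / (1 - q)\<^sup>2"
        by (simp add: power_divide power2_eq_square algebra_simps)
      then show ?thesis using that by (simp add: add_divide_distrib)
    qed
    have "\<bar>Y\<bar> / (P + B) \<le> Y' / (P + B')"
    proof (rule isosceles_ratio[where h = "(cosh s)\<^sup>2" and g = "(cosh d)\<^sup>2" and X = X])
      show "P\<^sup>2 \<le> (cosh s)\<^sup>2" using sP P1 by (simp add: power_mono)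
      show "(cosh s)\<^sup>2 * (cosh d)\<^sup>2 = B\<^sup>2 * P\<^sup>2" using cc(1) by (metis mult.commute power_mult_distrib)
      have "((cosh s)\<^sup>2 - 1) * ((cosh d)\<^sup>2 - 1) = w\<^sup>2"
        unfolding sinh_square_eq[symmetric] cc(2)[symmetric] by (simp only: power_mult_distrib)
      also have "w\<^sup>2 = X\<^sup>2 * (4 * p\<^sup>2 / (1 - p\<^sup>2)\<^sup>2)"
        by (simp add: w_def X_def power_mult_distrib power_divide mult_ac)
      also have "4 * p\<^sup>2 / (1 - p\<^sup>2)\<^sup>2 = P\<^sup>2 - 1" using sq[OF kp(3)] by (simp add: P_def)
      finally show "((cosh s)\<^sup>2 - 1) * ((cosh d)\<^sup>2 - 1) = X\<^sup>2 * (P\<^sup>2 - 1)" .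
      show "B\<^sup>2 = 1 + X\<^sup>2 + Y\<^sup>2"
        using sq[OF kp(2)] kp(4) by (simp add: B_def X_def Y_def power_divide power_mult_distrib add_divide_distrib)
      show "B'\<^sup>2 * P\<^sup>2 = (cosh s)\<^sup>2" using P1 by (simp add: B'_def power_divide)
      show "0 \<le> Y'" "Y'\<^sup>2 = B'\<^sup>2 - 1"
        using y'0 sq[OF y'0(2)] B'y by (simp_all add: Y'_def power_divide power_mult_distrib)
    qed (use P2 B1 B'1 cosh_real_ge_1[of d] in \<open>auto intro: one_le_power\<close>)
    then have "- Y / (P + B) \<le> Y' / (P + B')"
      using P1 B1 by (smt (verit, best) divide_right_mono)
    then have "(2 * p / (1 - p\<^sup>2)) * (- Y / (P + B)) \<le> (2 * p / (1 - p\<^sup>2)) * (Y' / (P + B'))"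
      using p kp by (intro mult_left_mono) auto
    then have "- ((2 * p / (1 - p\<^sup>2)) * (Y / (P + B))) \<le> - ((2 * p / (1 - p\<^sup>2)) * ((2 * Im b' / (1 - y'\<^sup>2)) / (P + B')))"
      by (simp add: Y'_def b')
    then have "- arctan ((2 * p / (1 - p\<^sup>2)) * (Y / (P + B))) \<le> - arctan ((2 * p / (1 - p\<^sup>2)) * ((2 * Im b' / (1 - y'\<^sup>2)) / (P + B')))"
      by (simp only: arctan_minus[symmetric] arctan_le_iff)
    then show ?thesis
      unfolding tri_term_symmetric_base[OF p b] tri_term_symmetric_base[OF p b'(2)] b'(3) B'y
      by (simp only: P_def[symmetric] B_def[symmetric] Y_def[symmetric] k_def[symmetric])
  qed
  show "\<exists>b'. cmod b' < 1 \<and>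
     hyp_dist (- of_real p) b' = (hyp_dist (- of_real p) b + hyp_dist b (of_real p)) / 2 \<and>
     hyp_dist b' (of_real p) = (hyp_dist (- of_real p) b + hyp_dist b (of_real p)) / 2 \<and>
     tri_term (- of_real p) b + tri_term b (of_real p) \<le> tri_term (- of_real p) b' + tri_term b' (of_real p)"
    using dd b'(2) area by (intro exI[of _ b']) (simp add: s_def d1_def d2_def)
qed

text \<open>Isometries reduce every base to a symmetric one: \<open>a\<close> goes to 0, a rotation
  puts \<open>c\<close> on the real axis, and the midpoint is moved to the origin.\<close>

lemma isosceles_max:
  assumes "cmod a < 1" "cmod c < 1"
  shows "isosceles_max a c"
proof -
  define c' where "c' = mob a c"
  define q where "q = cmod c'"
  have q: "0 \<le> q" "q < 1" using assms by (simp_all add: q_def c'_def)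
  define u where "u = (if c' = 0 then 1 else cnj c' / of_real q)"
  have u: "cmod u = 1" "u * c' = of_real q"
    using complex_norm_square[of c'] by (auto simp: u_def q_def norm_divide power2_eq_square field_simps)
  \<comment> \<open>\<open>p\<close> is the hyperbolic midpoint of 0 and \<open>q\<close>. Read as a
    map of the Poincare disc, \<open>klein\<close> doubles the distance from 0, so the midpoint is
    the \<open>unklein\<close> image of \<open>q\<close>; hence \<open>mob p\<close> takes 0 and
    \<open>q\<close> to \<open>- p\<close> and \<open>p\<close>.\<close>
  define p where "p = q / (1 + sqrt (1 - q\<^sup>2))"
  have up: "unklein (of_real q) = of_real p" using q by (simp add: unklein_def p_def)
  have p: "0 \<le> p" "p < 1"
  proof -
    have "0 \<le> 1 - q\<^sup>2" using q by (simp add: abs_square_le_1)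
    then show "0 \<le> p" using q by (simp add: p_def)
    have "cmod (complex_of_real p) < 1" using klein_unklein(2)[of "of_real q"] q unfolding up by simp
    then show "p < 1" by simp
  qed
  have "klein (of_real p) = of_real q"
    using klein_unklein(1)[of "of_real q"] q up by simp
  then have qp: "q = 2 * p / (1 + p\<^sup>2)"
    unfolding klein_def using p of_real_eq_iff[of q "2 * p / (1 + p\<^sup>2)", where ?'a = complex] by simp
  have "(q - p) / (1 - p * q) = p"
  proof -
    have "q - p = p * (1 - p\<^sup>2) / (1 + p\<^sup>2)" "1 - p * q = (1 - p\<^sup>2) / (1 + p\<^sup>2)"
      unfolding qp by (simp_all add: field_simps power2_eq_square add_nonneg_eq_0_iff)
    moreover have "1 - p\<^sup>2 > 0" "1 + p\<^sup>2 > 0" using p by (auto simp: abs_square_less_1 add_pos_nonneg)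
    ultimately show ?thesis by simp
  qed
  moreover have "mob (of_real p) (of_real q) = of_real ((q - p) / (1 - p * q))" by (simp add: mob_def)
  ultimately have "mob (of_real p) (of_real q) = of_real p" by simp
  then have "isosceles_max (mob (of_real p) 0) (mob (of_real p) (of_real q))"
    using isosceles_max_symmetric[OF p] by simp
  then have "isosceles_max 0 (of_real q)"
    by (rule isosceles_max_mob) (use p q in auto)
  then have "isosceles_max 0 c'"
    using isosceles_max_rot[OF _ u(1), of 0 c'] u(2) by simp
  then have "isosceles_max (mob a a) (mob a c)" by (simp add: c'_def)
  then show ?thesis by (rule isosceles_max_mob) (use assms in auto)
qed

text \<open>An isometry rotates all directions at \<open>x\<close> by one common factor, which does
  not depend on the target point. Quotients of directions at a vertex, hence turning angles, are
  therefore invariant.\<close>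

lemma mob_mob_factor:
  assumes "cmod b < 1" "cmod x < 1"
  obtains w where "cmod w = 1" "\<And>y. cmod y < 1 \<Longrightarrow> mob (mob b x) (mob b y) = w * mob x y"
proof
  define X where "X = 1 - cnj b * x"
  have Xnz: "X \<noteq> 0" using one_minus_mult_nz[of "cnj b" x] assms by (simp add: X_def)
  define w where "w = cnj X / X"
  show "cmod w = 1" using Xnz by (simp add: w_def norm_divide)
  fix y assume y: "cmod y < 1"
  define Y where "Y = 1 - cnj b * y"
  have Ynz: "Y \<noteq> 0" using one_minus_mult_nz[of "cnj b" y] assms y by (simp add: Y_def)
  have B: "complex_of_real (1 - (cmod b)\<^sup>2) \<noteq> 0"
    using one_minus_norm_pos[OF assms(1)] by (metis less_irrefl of_real_eq_0_iff)
  have D: "1 - y * cnj x \<noteq> 0" using one_minus_mult_nz[of y "cnj x"] assms y by simp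
  have 1: "(mob b y - mob b x) * (Y * X) = of_real (1 - (cmod b)\<^sup>2) * (y - x)"
    using mob_diff[OF assms(1) y assms(2)] by (simp add: X_def Y_def)
  have 2: "(1 - mob b y * cnj (mob b x)) * (Y * cnj X) = of_real (1 - (cmod b)\<^sup>2) * (1 - y * cnj x)"
    using mob_one_minus[OF assms(1) y assms(2)] by (simp only: X_def Y_def)
  have aux: "p / q = (cX / X) * (d / e)"
    if "p * (Y * X) = B * d" "q * (Y * cX) = B * e" "X \<noteq> 0" "Y \<noteq> 0" "B \<noteq> 0" "e \<noteq> 0" "cX \<noteq> 0"
    for p q X Y B d e cX :: complex
  proof -
    have p: "p = B * d / (Y * X)" and q: "q = B * e / (Y * cX)" using that by (simp_all add: field_simps)
    show ?thesis unfolding p q using that by (simp add: field_simps)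
  qed
  show "mob (mob b x) (mob b y) = w * mob x y"
    using aux[OF 1 2 Xnz Ynz B D] Xnz unfolding mob_def[of "mob b x"] mob_def[of x] w_def
    by (simp add: mult.commute)
qed

section \<open>The hyperbolic centroid and orbits of rotations\<close>

lemma mob_rot: "cmod u = 1 \<Longrightarrow> mob (u * x) (u * y) = u * mob x y"
proof -
  assume "cmod u = 1"
  then have "u * cnj u = 1" using complex_norm_square[of u] by simp
  then have "cnj (u * x) * (u * y) = cnj x * y"
    by (metis (no_types, lifting) complex_cnj_mult mult.assoc mult.left_commute mult.commute mult_1)
  then show ?thesis unfolding mob_def by (simp add: right_diff_distrib)
qed

text \<open>On the hyperboloid a point has the space coordinate 2 z / (1 - |z|^2) and the time
  coordinate (1 + |z|^2) / (1 - |z|^2), so \<open>2 * Z\<close> and \<open>N\<close> belong to the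
  sum of the points. \<open>mob b\<close> acts as a linear boost, and this is the space part of the
  boosted sum.\<close>

lemma centroid_mob:
  fixes z :: "nat \<Rightarrow> complex"
  assumes b: "cmod b < 1" and z: "\<And>i. i < n \<Longrightarrow> cmod (z i) < 1"
  defines "Z \<equiv> (\<Sum>i<n. z i / of_real (1 - (cmod (z i))\<^sup>2))"
    and "N \<equiv> (\<Sum>i<n. (1 + (cmod (z i))\<^sup>2) / (1 - (cmod (z i))\<^sup>2))"
  shows "(\<Sum>i<n. mob b (z i) / of_real (1 - (cmod (mob b (z i)))\<^sup>2)) * of_real (1 - (cmod b)\<^sup>2)
     = Z + b\<^sup>2 * cnj Z - b * of_real N"
proof -
  have "mob b x / of_real (1 - (cmod (mob b x))\<^sup>2) * of_real (1 - (cmod b)\<^sup>2)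
     = x / of_real (1 - (cmod x)\<^sup>2) + b\<^sup>2 * cnj (x / of_real (1 - (cmod x)\<^sup>2))
        - b * of_real ((1 + (cmod x)\<^sup>2) / (1 - (cmod x)\<^sup>2))" if x: "cmod x < 1" for x
  proof -
    define X where "X = 1 - cnj b * x"
    define E where "E = complex_of_real (1 - (cmod x)\<^sup>2)"
    define F where "F = complex_of_real (1 - (cmod b)\<^sup>2)"
    define G where "G = complex_of_real (1 - (cmod (mob b x))\<^sup>2)"
    have nz: "X \<noteq> 0" "E \<noteq> 0" "F \<noteq> 0" "G \<noteq> 0"
      using one_minus_mult_nz[of "cnj b" x] one_minus_norm_pos[OF x] one_minus_norm_pos[OF b]
        one_minus_norm_pos[of "mob b x"] b x by (simp_all add: X_def E_def F_def G_def del: of_real_diff)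
    have "G * (X * cnj X) = F * E"
      using arg_cong[OF one_minus_mob_norm[OF b x], of complex_of_real]
      by (simp only: of_real_mult complex_norm_square[of "1 - cnj b * x"] G_def F_def E_def X_def)
    then have G: "G = F * E / (X * cnj X)" using nz by (simp add: field_simps)
    have "mob b x / G * F = (x - b) * cnj X / E"
      unfolding G mob_def X_def[symmetric] using nz by simp
    also have "(x - b) * cnj X = x + b\<^sup>2 * cnj x - b * (1 + x * cnj x)"
      by (simp add: X_def algebra_simps power2_eq_square)
    also have "\<dots> / E = x / E + b\<^sup>2 * cnj (x / E) - b * ((1 + x * cnj x) / E)"
    proof -
      have "cnj (x / E) = cnj x / E" by (simp add: E_def)
      moreover have "(y + m - b * k) / E = y / E + m / E - b * (k / E)" for y m k
        by (simp add: diff_divide_distrib add_divide_distrib)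
      ultimately show ?thesis by (simp only: times_divide_eq_right)
    qed
    also have "(1 + x * cnj x) / E = of_real ((1 + (cmod x)\<^sup>2) / (1 - (cmod x)\<^sup>2))"
      by (simp only: E_def of_real_divide of_real_add of_real_1 complex_norm_square)
    finally show ?thesis unfolding E_def F_def G_def .
  qed
  then have "(\<Sum>i<n. mob b (z i) / of_real (1 - (cmod (mob b (z i)))\<^sup>2)) * of_real (1 - (cmod b)\<^sup>2)
    = (\<Sum>i<n. z i / of_real (1 - (cmod (z i))\<^sup>2) + b\<^sup>2 * cnj (z i / of_real (1 - (cmod (z i))\<^sup>2))
        - b * of_real ((1 + (cmod (z i))\<^sup>2) / (1 - (cmod (z i))\<^sup>2)))"
    unfolding sum_distrib_right using z by (intro sum.cong) auto
  also have "\<dots> = Z + b\<^sup>2 * cnj Z - b * of_real N"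
    unfolding Z_def N_def by (simp only: sum.distrib sum_subtractf sum_distrib_left cnj_sum of_real_sum)
  finally show ?thesis .
qed

text \<open>The sum of the points on the hyperboloid is timelike, that is |2 Z| < N, so a boost
  makes its space part vanish. The centre \<open>b\<close> has Klein coordinate 2 Z / N, space over
  time.\<close>

lemma exists_center:
  fixes z :: "nat \<Rightarrow> complex"
  assumes z: "\<And>i. i < n \<Longrightarrow> cmod (z i) < 1" and n: "0 < n"
  obtains b where "cmod b < 1" "(\<Sum>i<n. mob b (z i) / of_real (1 - (cmod (mob b (z i)))\<^sup>2)) = 0"
proof -
  define Z where "Z = (\<Sum>i<n. z i / of_real (1 - (cmod (z i))\<^sup>2))"
  define N where "N = (\<Sum>i<n. (1 + (cmod (z i))\<^sup>2) / (1 - (cmod (z i))\<^sup>2))"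
  have "cmod (2 * Z) \<le> (\<Sum>i<n. cmod (2 * (z i / of_real (1 - (cmod (z i))\<^sup>2))))"
    unfolding Z_def sum_distrib_left by (rule norm_sum)
  also have "\<dots> < N"
    unfolding N_def
  proof (rule sum_strict_mono)
    fix i assume "i \<in> {..<n}"
    then have i: "cmod (z i) < 1" using z by auto
    have "0 < (1 - cmod (z i))\<^sup>2" using i by simp
    then have "2 * cmod (z i) < 1 + (cmod (z i))\<^sup>2" by (simp add: power2_eq_square algebra_simps)
    moreover have "cmod (2 * (z i / of_real (1 - (cmod (z i))\<^sup>2))) = 2 * cmod (z i) / (1 - (cmod (z i))\<^sup>2)"
      using one_minus_norm_pos[OF i] by (simp add: norm_mult norm_divide del: of_real_diff)
    ultimately show "cmod (2 * (z i / of_real (1 - (cmod (z i))\<^sup>2))) < (1 + (cmod (z i))\<^sup>2) / (1 - (cmod (z i))\<^sup>2)"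
      using one_minus_norm_pos[OF i] by (simp add: divide_strict_right_mono)
  qed (use n in auto)
  finally have ZN: "cmod (2 * Z) < N" .
  then have Np: "0 < N" using norm_ge_zero[of "2 * Z"] by linarith
  define b where "b = unklein (2 * Z / of_real N)"
  have "cmod (2 * Z / of_real N) < 1" using ZN Np by (simp add: norm_divide norm_mult)
  then have b: "cmod b < 1" "klein b = 2 * Z / of_real N" using klein_unklein by (auto simp: b_def)
  define t where "t = 1 + (cmod b)\<^sup>2"
  have t: "0 < t" by (simp add: t_def add_pos_nonneg)
  have Z: "Z = b * of_real N / of_real t"
    using b(2) Np t unfolding klein_def t_def[symmetric] by (simp add: field_simps)
  have "Z + b\<^sup>2 * cnj Z = b * of_real N / of_real t * (1 + b * cnj b)"
    unfolding Z by (simp add: algebra_simps power2_eq_square add_divide_distrib)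
  also have "1 + b * cnj b = of_real t" by (simp only: t_def of_real_add of_real_1 complex_norm_square)
  finally have "Z + b\<^sup>2 * cnj Z - b * of_real N = 0" using t by simp
  then have "(\<Sum>i<n. mob b (z i) / of_real (1 - (cmod (mob b (z i)))\<^sup>2)) * of_real (1 - (cmod b)\<^sup>2) = 0"
    using centroid_mob[of b n z] b(1) z unfolding Z_def N_def by simp
  then show ?thesis
    using that[OF b(1)] one_minus_norm_pos[OF b(1)] by (simp del: of_real_diff)
qed

text \<open>Equal sides and equal (signed) turning make the cyclic shift the restriction of an isometry,
  which fixes the centroid.\<close>

lemma equilateral_equiangular_orbit:
  fixes Z :: "nat \<Rightarrow> complex"
  assumes disc: "\<And>i. cmod (Z i) < 1" and n: "0 < n" and per: "\<And>i. Z (i + n) = Z i"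
    and side: "\<And>i. cmod (mob (Z i) (Z (Suc i))) = t" and t: "0 < t"
    and turn: "\<And>i. mob (Z (Suc i)) (Z (Suc (Suc i))) = \<kappa> * mob (Z (Suc i)) (Z i)"
    and centre: "(\<Sum>i<n. Z i / of_real (1 - (cmod (Z i))\<^sup>2)) = 0"
  obtains u where "u ^ n = 1" "\<And>i. Z i = u ^ i * Z 0" "Z 0 \<noteq> 0"
proof -
  define \<rho> where "\<rho> = mob (Z 1) (Z 2) / mob (Z 0) (Z 1)"
  have nz0: "mob (Z 0) (Z 1) \<noteq> 0" using side[of 0] t by auto
  have \<rho>: "cmod \<rho> = 1" "\<rho> * mob (Z 0) (Z 1) = mob (Z 1) (Z 2)"
    using side[of 0] side[of 1] t nz0 by (simp_all add: \<rho>_def norm_divide numeral_2_eq_2)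
  define b where "b = mob (- Z 0) (- cnj \<rho> * Z 1)"
  have b: "cmod b < 1" using disc \<rho>(1) by (simp add: b_def norm_mult)
  have \<rho>c: "\<rho> * cnj \<rho> = 1" using \<rho>(1) complex_norm_square[of \<rho>] by simp
  \<comment> \<open>The orientation-preserving isometry that takes \<open>Z 0\<close> to
    \<open>Z 1\<close> and \<open>Z 1\<close> to \<open>Z 2\<close>. The point \<open>b\<close> is
    the one it sends to 0, so \<open>g\<close> is \<open>mob b\<close> followed by a
    rotation.\<close>
  define g where "g x = mob (- Z 1) (\<rho> * mob (Z 0) x)" for x
  have gd: "cmod (g x) < 1" if "cmod x < 1" for x
    using that disc \<rho>(1) by (simp add: g_def norm_mult)
  have equi: "\<exists>w. cmod w = 1 \<and> (\<forall>y. cmod y < 1 \<longrightarrow> mob (g x) (g y) = w * mob x y)" if x: "cmod x < 1" for x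
  proof -
    obtain w1 where w1: "cmod w1 = 1" "\<And>y. cmod y < 1 \<Longrightarrow> mob (mob (Z 0) x) (mob (Z 0) y) = w1 * mob x y"
      using mob_mob_factor[OF disc x] by metis
    have "cmod (\<rho> * mob (Z 0) x) < 1" using x disc \<rho>(1) by (simp add: norm_mult)
    then obtain w2 where w2: "cmod w2 = 1"
      "\<And>y. cmod y < 1 \<Longrightarrow> mob (g x) (mob (- Z 1) y) = w2 * mob (\<rho> * mob (Z 0) x) y"
      unfolding g_def using mob_mob_factor[of "- Z 1"] disc by (metis norm_minus_cancel)
    show ?thesis
    proof (intro exI[of _ "w2 * (\<rho> * w1)"] conjI allI impI)
      show "cmod (w2 * (\<rho> * w1)) = 1" using w1 w2 \<rho> by (simp add: norm_mult)
      fix y assume y: "cmod y < 1"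
      have "mob (g x) (g y) = w2 * mob (\<rho> * mob (Z 0) x) (\<rho> * mob (Z 0) y)"
        unfolding g_def[of y] using y disc \<rho>(1) by (intro w2) (simp add: norm_mult)
      then show "mob (g x) (g y) = w2 * (\<rho> * w1) * mob x y"
        using mob_rot[OF \<rho>(1)] w1(2)[OF y] by simp
    qed
  qed
  have "g b = 0"
  proof -
    have "mob (Z 0) b = - cnj \<rho> * Z 1"
      unfolding b_def by (rule mob_mob_neg) (use disc \<rho>(1) in \<open>simp_all add: norm_mult\<close>)
    then have "\<rho> * mob (Z 0) b = - (\<rho> * cnj \<rho>) * Z 1" by simp
    then show ?thesis unfolding g_def \<rho>c by simp
  qed
  then obtain w where w: "cmod w = 1" "\<And>y. cmod y < 1 \<Longrightarrow> g y = w * mob b y"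
    using equi[OF b] by auto
  have g0: "g (Z 0) = Z 1" by (simp add: g_def)
  have g1: "g (Z 1) = Z 2" unfolding g_def \<rho>(2) using disc mob_neg_mob by blast
  \<comment> \<open>\<open>g\<close> shifts all vertices: it keeps the quotient of two directions at
    a vertex, and \<kappa> is the same at every vertex, so the images of two consecutive vertices
    determine the image of the next.\<close>
  have gZ: "g (Z i) = Z (Suc i) \<and> g (Z (Suc i)) = Z (Suc (Suc i))" for i
  proof (induction i)
    case 0
    then show ?case using g0 g1 by (simp add: numeral_2_eq_2)
  next
    case (Suc i)
    obtain w' where w': "\<And>y. cmod y < 1 \<Longrightarrow> mob (g (Z (Suc i))) (g y) = w' * mob (Z (Suc i)) y"
      using equi[OF disc] by blast
    have "mob (Z (Suc (Suc i))) (g (Z (Suc (Suc i)))) = w' * mob (Z (Suc i)) (Z (Suc (Suc i)))"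
      using w'[OF disc, of "Suc (Suc i)"] Suc by simp
    also have "\<dots> = \<kappa> * (w' * mob (Z (Suc i)) (Z i))" unfolding turn by simp
    also have "w' * mob (Z (Suc i)) (Z i) = mob (Z (Suc (Suc i))) (Z (Suc i))"
      using w'[OF disc, of i] Suc by simp
    also have "\<kappa> * mob (Z (Suc (Suc i))) (Z (Suc i)) = mob (Z (Suc (Suc i))) (Z (Suc (Suc (Suc i))))"
      unfolding turn[of "Suc i"] ..
    finally have "g (Z (Suc (Suc i))) = Z (Suc (Suc (Suc i)))"
      using mob_eq_iff[OF disc gd[OF disc] disc] by blast
    then show ?case using Suc by simp
  qed
  have "(\<Sum>i<n. Z (Suc i) / of_real (1 - (cmod (Z (Suc i)))\<^sup>2)) = 0"
  proof -
    have "(\<Sum>i<Suc n. Z i / of_real (1 - (cmod (Z i))\<^sup>2)) = Z n / of_real (1 - (cmod (Z n))\<^sup>2)"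
      using centre by simp
    then show ?thesis unfolding sum.lessThan_Suc_shift using per[of 0] by simp
  qed
  then have "(\<Sum>i<n. w * mob b (Z i) / of_real (1 - (cmod (w * mob b (Z i)))\<^sup>2)) = 0"
    using gZ w(2)[OF disc] by simp
  then have "w * (\<Sum>i<n. mob b (Z i) / of_real (1 - (cmod (mob b (Z i)))\<^sup>2)) = 0"
    using w(1) by (simp add: sum_distrib_left norm_mult)
  then have "(\<Sum>i<n. mob b (Z i) / of_real (1 - (cmod (mob b (Z i)))\<^sup>2)) = 0"
    using w(1) by auto
  define N where "N = (\<Sum>i<n. (1 + (cmod (Z i))\<^sup>2) / (1 - (cmod (Z i))\<^sup>2))"
  \<comment> \<open>The shifted vertices are the same points, so the centroid is still 0 after
    \<open>g\<close>, hence after \<open>mob b\<close>. In \<open>centroid_mob\<close> only the term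
    with \<open>N\<close> survives, and as \<open>N\<close> is positive, \<open>g\<close> is a
    rotation about 0.\<close>
  have "b * of_real N = 0"
    using centroid_mob[of b n Z, OF b disc] unfolding centre N_def[symmetric]
    using \<open>(\<Sum>i<n. mob b (Z i) / of_real (1 - (cmod (mob b (Z i)))\<^sup>2)) = 0\<close> by simp
  moreover have "0 < N"
    unfolding N_def
    using n one_minus_norm_pos[OF disc] by (intro sum_pos) (auto intro!: divide_pos_pos add_pos_nonneg)
  ultimately have "b = 0" by simp
  then have step: "Z (Suc i) = w * Z i" for i using gZ w(2)[OF disc] by simp
  have pw: "Z i = w ^ i * Z 0" for i by (induction i) (simp_all add: step)
  have "Z 0 \<noteq> 0" using side[of 0] t step[of 0] by auto
  moreover have "w ^ n = 1" using pw[of n] per[of 0] calculation by simp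
  ultimately show ?thesis using that pw by blast
qed

section \<open>Closed polygons as vertex sequences, and the existence of an area maximiser\<close>

definition cyc_sum :: "nat \<Rightarrow> (complex \<Rightarrow> complex \<Rightarrow> real) \<Rightarrow> (nat \<Rightarrow> complex) \<Rightarrow> real" where
  "cyc_sum n F z = (\<Sum>i<n. F (z i) (z (Suc i mod n)))"

abbreviation cyc_area :: "nat \<Rightarrow> (nat \<Rightarrow> complex) \<Rightarrow> real" where
  "cyc_area n \<equiv> cyc_sum n tri_term"

abbreviation cyc_len :: "nat \<Rightarrow> (nat \<Rightarrow> complex) \<Rightarrow> real" where
  "cyc_len n \<equiv> cyc_sum n hyp_dist"

lemma sum_shift_mod:
  fixes g :: "nat \<Rightarrow> 'a::comm_monoid_add"
  shows "(\<Sum>i<n. g (Suc i mod n)) = (\<Sum>i<n. g i)"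
proof (cases n)
  case (Suc m)
  have "(\<Sum>i<m. g (Suc i mod Suc m)) = (\<Sum>i<m. g (Suc i))"
    by (intro sum.cong) auto
  then have "(\<Sum>i<Suc m. g (Suc i mod Suc m)) = (\<Sum>i<m. g (Suc i)) + g 0" by simp
  also have "\<dots> = (\<Sum>i<Suc m. g i)" by (simp only: sum.lessThan_Suc_shift add.commute)
  finally show ?thesis by (simp only: Suc)
qed simp

lemma Suc_mod_inj: "m < n \<Longrightarrow> i < n \<Longrightarrow> Suc m mod n = Suc i mod n \<Longrightarrow> m = i"
  by (auto simp: mod_Suc split: if_splits)

lemma Suc_mod_neq: "2 \<le> n \<Longrightarrow> i < n \<Longrightarrow> Suc i mod n \<noteq> i"
  by (auto simp: mod_Suc split: if_splits)

lemma pred_Suc_mod: "i < n \<Longrightarrow> (Suc i mod n + n - 1) mod n = i"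
  by (auto simp: mod_Suc split: if_splits)

lemma cyc_area_mob:
  assumes "cmod b < 1" "\<And>i. cmod (z i) < 1"
  shows "cyc_area n (\<lambda>i. mob b (z i)) = cyc_area n z"
  using sum_shift_mod[of "\<lambda>j. 2 * Arg (1 - cnj b * z j)" n]
  unfolding cyc_sum_def tri_term_mob[OF assms(1) assms(2) assms(2)] sum.distrib sum_subtractf by simp

lemma cyc_sum_update:
  assumes n: "2 \<le> n" and i: "i < n"
  defines "j \<equiv> Suc i mod n"
  defines "k \<equiv> Suc j mod n"
  shows "cyc_sum n F (z(j := b))
    = cyc_sum n F z - F (z i) (z j) - F (z j) (z k) + F (z i) b + F b (z k)"
proof -
  have ij: "i \<noteq> j" "j \<noteq> k" "j < n" using Suc_mod_neq[OF n i] Suc_mod_neq[OF n, of j] n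
    by (auto simp: j_def k_def)
  define R where "R = {..<n} - {i, j}"
  have e: "{..<n} = insert i (insert j R)" "finite R" "i \<notin> R" "j \<notin> R" using i ij by (auto simp: R_def)
  have "(\<Sum>m\<in>R. F ((z(j := b)) m) ((z(j := b)) (Suc m mod n))) = (\<Sum>m\<in>R. F (z m) (z (Suc m mod n)))"
  proof (rule sum.cong)
    fix m assume "m \<in> R"
    then have "m \<noteq> j" "Suc m mod n \<noteq> j" using Suc_mod_inj[of m n i] i by (auto simp: R_def j_def)
    then show "F ((z(j := b)) m) ((z(j := b)) (Suc m mod n)) = F (z m) (z (Suc m mod n))" by simp
  qed simp
  note eq = this
  have S: "sum G {..<n} = G i + (G j + sum G R)" for G :: "nat \<Rightarrow> real"
    unfolding e(1) using e(2-4) ij by simp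
  have new: "cyc_sum n F (z(j := b)) = F (z i) b + (F b (z k) + (\<Sum>m\<in>R. F (z m) (z (Suc m mod n))))"
    unfolding cyc_sum_def S eq j_def[symmetric] k_def[symmetric] using ij(1,2) by simp
  have old: "cyc_sum n F z = F (z i) (z j) + (F (z j) (z k) + (\<Sum>m\<in>R. F (z m) (z (Suc m mod n))))"
    unfolding cyc_sum_def S j_def[symmetric] k_def[symmetric] ..
  show ?thesis unfolding new old by simp
qed

lemma Re_pos_not_nonpos_Reals: "0 < Re z \<Longrightarrow> z \<notin> \<real>\<^sub>\<le>\<^sub>0"
  by (auto simp: complex_nonpos_Reals_iff)

lemma Re_pos_nonzero: "0 < Re z \<Longrightarrow> z \<noteq> 0"
  by auto

lemma continuous_on_coordinate: "continuous_on S (\<lambda>z :: nat \<Rightarrow> complex. z i)"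
  by (rule continuous_on_subset[OF continuous_on_product_coordinates subset_UNIV])

lemma continuous_on_tri_term:
  assumes "\<And>z i. z \<in> S \<Longrightarrow> cmod (z i) < 1"
  shows "continuous_on S (\<lambda>z :: nat \<Rightarrow> complex. tri_term (z i) (z j))"
proof -
  have re: "0 < Re (1 - z i * cnj (z j))" if "z \<in> S" for z
    using one_minus_mult_Re_pos[of "z i" "cnj (z j)"] assms[OF that] by simp
  have "continuous_on S (\<lambda>z. 2 * Im (Ln (1 - z i * cnj (z j))))"
    by (intro continuous_intros continuous_on_coordinate Re_pos_not_nonpos_Reals re)
  moreover have "2 * Im (Ln (1 - z i * cnj (z j))) = tri_term (z i) (z j)" if "z \<in> S" for z
    unfolding tri_term_def Arg_eq_Im_Ln[OF Re_pos_nonzero[OF re[OF that]]] ..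
  ultimately show ?thesis by (simp cong: continuous_on_cong)
qed

lemma continuous_on_hyp_dist:
  assumes "\<And>z i. z \<in> S \<Longrightarrow> cmod (z i) < 1"
  shows "continuous_on S (\<lambda>z :: nat \<Rightarrow> complex. hyp_dist (z i) (z j))"
proof -
  have p: "0 < (1 - (cmod (z i))\<^sup>2) * (1 - (cmod (z j))\<^sup>2)" if "z \<in> S" for z
    using one_minus_norm_pos assms[OF that] by simp
  have "continuous_on S (\<lambda>z. 1 + 2 * (cmod (z i - z j))\<^sup>2 / ((1 - (cmod (z i))\<^sup>2) * (1 - (cmod (z j))\<^sup>2)))"
    using p by (intro continuous_intros continuous_on_coordinate) force
  moreover have "(\<lambda>z. 1 + 2 * (cmod (z i - z j))\<^sup>2 / ((1 - (cmod (z i))\<^sup>2) * (1 - (cmod (z j))\<^sup>2))) ` S \<subseteq> {1..}"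
    using p by (auto simp: less_imp_le)
  ultimately show ?thesis
    unfolding hyp_dist_def by (rule continuous_on_compose2[OF continuous_on_arcosh, rotated 1]) simp
qed

lemma dist_le_cyc_len:
  assumes z: "\<And>i. cmod (z i) < 1" and "i < n"
  shows "hyp_dist (z 0) (z i) \<le> cyc_len n z"
proof -
  have "hyp_dist (z 0) (z m) \<le> (\<Sum>j<m. hyp_dist (z j) (z (Suc j)))" for m
  proof (induction m)
    case 0
    then show ?case using hyp_dist_eq_0_iff[OF z[of 0] z[of 0]] by simp
  next
    case (Suc m)
    then show ?case using hyp_dist_triangle[OF z[of 0] z[of "Suc m"] z[of m]] by simp
  qed
  from this[of i] have "hyp_dist (z 0) (z i) \<le> (\<Sum>j<i. hyp_dist (z j) (z (Suc j mod n)))"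
  proof -
    have "(\<Sum>j<i. hyp_dist (z j) (z (Suc j))) = (\<Sum>j<i. hyp_dist (z j) (z (Suc j mod n)))"
      using \<open>i < n\<close> by (intro sum.cong) auto
    then show ?thesis using \<open>hyp_dist (z 0) (z i) \<le> (\<Sum>j<i. hyp_dist (z j) (z (Suc j)))\<close> by simp
  qed
  also have "\<dots> \<le> cyc_len n z"
    unfolding cyc_sum_def using assms hyp_dist_nonneg by (intro sum_mono2) auto
  finally show ?thesis .
qed

text \<open>Among the area maximisers of bounded length, one that minimises the sum of the squared
  sides is selected: the isosceles move then forces its sides to be equal.\<close>

lemma exists_maximiser:
  assumes n: "0 < n" and L: "0 \<le> L"
  obtains z where "\<And>i. cmod (z i) < 1" "cyc_len n z \<le> L"
    "\<And>z'. (\<And>i. cmod (z' i) < 1) \<Longrightarrow> cyc_len n z' \<le> L \<Longrightarrow> cyc_area n z' \<le> cyc_area n z"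
    "\<And>z'. (\<And>i. cmod (z' i) < 1) \<Longrightarrow> cyc_len n z' \<le> L \<Longrightarrow> cyc_area n z' = cyc_area n z \<Longrightarrow>
       cyc_sum n (\<lambda>a b. (hyp_dist a b)\<^sup>2) z \<le> cyc_sum n (\<lambda>a b. (hyp_dist a b)\<^sup>2) z'"
proof -
  define \<rho> where "\<rho> = tanh (L / 2)"
  have \<rho>: "0 \<le> \<rho>" "\<rho> < 1" using L tanh_real_bounds[of "L/2"] by (auto simp: \<rho>_def)
  define B where "B = {z :: nat \<Rightarrow> complex. \<forall>i. z i \<in> cball 0 \<rho>}"
  have Bd: "cmod (z i) < 1" if "z \<in> B" for z i
  proof -
    have "cmod (z i) \<le> \<rho>" using that by (simp add: B_def)
    then show ?thesis using \<rho> by linarith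
  qed
  \<comment> \<open>A product of closed discs is compact in the product topology, for which area and
    length are continuous, each depending on finitely many coordinates.\<close>
  have "B = PiE UNIV (\<lambda>_. cball 0 \<rho>)" by (auto simp: B_def PiE_def)
  then have "compact B"
    using compactin_PiE[of "\<lambda>_::nat. euclidean :: complex topology" UNIV "\<lambda>_. cball 0 \<rho>"]
    unfolding euclidean_product_topology by (simp add: compactin_euclidean_iff)
  define Q where "Q = cyc_sum n (\<lambda>a b. (hyp_dist a b)\<^sup>2)"
  have cA: "continuous_on B (cyc_area n)" and cL: "continuous_on B (cyc_len n)" and cQ: "continuous_on B Q"
    unfolding Q_def cyc_sum_def
    by (intro continuous_intros continuous_on_tri_term continuous_on_hyp_dist Bd; assumption)+
  define K where "K = B \<inter> cyc_len n -` {..L}"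
  have cK: "compact K"
    unfolding K_def using continuous_closedin_preimage[OF cL, of "{..L}"] \<open>compact B\<close>
    by (auto intro: closedin_compact)
  have "(\<lambda>_. 0) \<in> K"
    using \<rho> L by (simp add: K_def B_def cyc_sum_def hyp_dist_def)
  then have "K \<noteq> {}" by auto
  then obtain z0 where z0: "z0 \<in> K" "\<And>z. z \<in> K \<Longrightarrow> cyc_area n z \<le> cyc_area n z0"
    using continuous_attains_sup[OF cK _ continuous_on_subset[OF cA]] unfolding K_def by blast
  define M where "M = K \<inter> cyc_area n -` {cyc_area n z0}"
  have "compact M"
    unfolding M_def using continuous_closedin_preimage[OF continuous_on_subset[OF cA], of K "{cyc_area n z0}"] cK
    by (auto intro: closedin_compact simp: K_def)
  moreover have "M \<noteq> {}" using z0 by (auto simp: M_def)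
  ultimately obtain z where z: "z \<in> M" "\<And>y. y \<in> M \<Longrightarrow> Q z \<le> Q y"
    using continuous_attains_inf[OF _ _ continuous_on_subset[OF cQ], of M] unfolding M_def K_def by blast
  \<comment> \<open>Every admissible polygon has an isometric copy in \<open>K\<close>: vertex 0
    goes to the origin, and by \<open>dist_le_cyc_len\<close> the others stay within distance
    \<open>L\<close> of it, that is within Euclidean radius tanh (L/2). Coordinates from
    \<open>n\<close> on are set to 0.\<close>
  have norm: "\<exists>y\<in>K. cyc_area n y = cyc_area n x \<and> Q y = Q x"
    if x: "\<And>i. cmod (x i) < 1" "cyc_len n x \<le> L" for x
  proof -
    define y where "y i = (if i < n then mob (x 0) (x i) else 0)" for i
    have e: "cyc_sum n F y = cyc_sum n F (\<lambda>i. mob (x 0) (x i))" for F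
      unfolding cyc_sum_def y_def using n by (intro sum.cong) auto
    have "cmod (y i) \<le> \<rho>" for i
    proof (cases "i < n")
      case True
      then have "hyp_dist (x 0) (x i) / 2 \<le> L / 2" using dist_le_cyc_len[of x i n, OF x(1)] x(2) by simp
      then show ?thesis using True unfolding y_def \<rho>_def by (simp add: norm_mob_eq_tanh x(1))
    qed (simp add: y_def \<rho>)
    moreover have len: "cyc_len n y = cyc_len n x" "Q y = Q x"
      unfolding Q_def e unfolding cyc_sum_def using x(1) by (simp_all add: hyp_dist_mob)
    moreover have "cyc_area n y = cyc_area n x"
      unfolding e by (rule cyc_area_mob) (use x in auto)
    ultimately show ?thesis using x(2) by (intro bexI[of _ y]) (auto simp: K_def B_def)
  qed
  show ?thesis
  proof (rule that[of z])
    have zK: "z \<in> K" "cyc_area n z = cyc_area n z0" using z by (auto simp: M_def)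
    then show "cmod (z i) < 1" for i using Bd by (auto simp: K_def)
    show "cyc_len n z \<le> L" using zK by (auto simp: K_def)
    fix z' assume z': "\<And>i. cmod (z' i) < 1" "cyc_len n z' \<le> L"
    obtain y where y: "y \<in> K" "cyc_area n y = cyc_area n z'" "Q y = Q z'" using norm[OF z'] by auto
    show "cyc_area n z' \<le> cyc_area n z" using z0(2)[OF y(1)] y zK by simp
    assume "cyc_area n z' = cyc_area n z"
    then have "y \<in> M" using y zK by (auto simp: M_def)
    then show "cyc_sum n (\<lambda>a b. (hyp_dist a b)\<^sup>2) z \<le> cyc_sum n (\<lambda>a b. (hyp_dist a b)\<^sup>2) z'"
      using z(2)[of y] y(3) by (simp add: Q_def)
  qed
qed

lemma maximiser_equilateral:
  assumes n: "2 \<le> n" and z: "\<And>i. cmod (z i) < 1" "cyc_len n z \<le> L"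
    and max: "\<And>z'. (\<And>i. cmod (z' i) < 1) \<Longrightarrow> cyc_len n z' \<le> L \<Longrightarrow> cyc_area n z' \<le> cyc_area n z"
    and sq: "\<And>z'. (\<And>i. cmod (z' i) < 1) \<Longrightarrow> cyc_len n z' \<le> L \<Longrightarrow> cyc_area n z' = cyc_area n z \<Longrightarrow>
       cyc_sum n (\<lambda>a b. (hyp_dist a b)\<^sup>2) z \<le> cyc_sum n (\<lambda>a b. (hyp_dist a b)\<^sup>2) z'"
    and i: "i < n"
  shows "hyp_dist (z i) (z (Suc i mod n)) = hyp_dist (z 0) (z (Suc 0 mod n))"
proof -
  have step: "hyp_dist (z i) (z (Suc i mod n)) = hyp_dist (z (Suc i mod n)) (z (Suc (Suc i mod n) mod n))"
    if i: "i < n" for i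
  proof -
    define j where "j = Suc i mod n"
    define k where "k = Suc j mod n"
    obtain b where b: "cmod b < 1" 
     "hyp_dist (z i) b = (hyp_dist (z i) (z j) + hyp_dist (z j) (z k)) / 2"
     "hyp_dist b (z k) = (hyp_dist (z i) (z j) + hyp_dist (z j) (z k)) / 2"
     "tri_term (z i) (z j) + tri_term (z j) (z k) \<le> tri_term (z i) b + tri_term b (z k)"
      using isosceles_max[of "z i" "z k"] z(1) unfolding isosceles_max_def by blast
    note u = cyc_sum_update[OF n i, of _ z b, folded j_def, folded k_def]
    have d: "cmod ((z(j := b)) m) < 1" for m using z b by simp
    have l: "cyc_len n (z(j := b)) \<le> L" using z(2) b(2,3) by (simp add: u)
    have a: "cyc_area n (z(j := b)) = cyc_area n z"
      using max[OF d l] b(4) by (simp add: u)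
    define p q where "p = hyp_dist (z i) (z j)" and "q = hyp_dist (z j) (z k)"
    \<comment> \<open>The isosceles move keeps the length and does not lower the area, so its result
      is again a maximiser. Replacing \<open>p\<close> and \<open>q\<close> by their mean lowers the
      sum of squares unless they agree.\<close>
    have "p\<^sup>2 + q\<^sup>2 \<le> ((p + q) / 2)\<^sup>2 + ((p + q) / 2)\<^sup>2"
      using sq[OF d l a] unfolding u b(2,3) p_def[symmetric] q_def[symmetric] by simp
    then have "(p - q)\<^sup>2 \<le> 0" by (simp add: power2_eq_square field_simps)
    then show ?thesis by (simp add: p_def q_def j_def k_def)
  qed
  show ?thesis using i
  proof (induction i)
    case (Suc i)
    then show ?case using step[of i] by simp
  qed simp
qed

text \<open>At each end the derivative splits into a part containing the direction to the other end
  and a part containing that end alone. Around a closed polygon the latter cancel, which leaves an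
  expression in the side directions.\<close>

lemma tri_term_deriv:
  assumes a: "cmod a < 1" and b: "cmod b < 1"
  shows "((\<lambda>\<tau>. tri_term (a + of_real \<tau> * p) (b + of_real \<tau> * q)) has_real_derivative
     2 * (Im (q * cnj (mob b a)) / (1 - (cmod b)\<^sup>2) + Im (q * cnj b) / (1 - (cmod b)\<^sup>2)
       - Im (p * cnj (mob a b)) / (1 - (cmod a)\<^sup>2) - Im (p * cnj a) / (1 - (cmod a)\<^sup>2))) (at 0)"
proof -
  have re: "0 < Re (1 - a * cnj b)" using one_minus_mult_Re_pos[of a "cnj b"] a b by simp
  have D: "1 - a * cnj b \<noteq> 0" using Re_pos_nonzero[OF re] .
  have "((\<lambda>w. Ln (1 - (a + w * p) * (cnj b + w * cnj q))) has_field_derivative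
     - ((p * cnj b + a * cnj q) / (1 - a * cnj b))) (at (of_real 0))"
    using Re_pos_not_nonpos_Reals[OF re] D
    by (auto intro!: derivative_eq_intros simp: divide_inverse algebra_simps)
  then have "((\<lambda>\<tau>. Ln (1 - (a + of_real \<tau> * p) * (cnj b + of_real \<tau> * cnj q))) has_vector_derivative
     - ((p * cnj b + a * cnj q) / (1 - a * cnj b))) (at 0)"
    by (rule has_vector_derivative_real_field)
  from bounded_linear.has_vector_derivative[OF bounded_linear_Im this]
  have "((\<lambda>\<tau>. Im (Ln (1 - (a + of_real \<tau> * p) * (cnj b + of_real \<tau> * cnj q)))) has_real_derivative
     Im (- ((p * cnj b + a * cnj q) / (1 - a * cnj b)))) (at 0)"
    by (simp add: has_real_derivative_iff_has_vector_derivative)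
  from DERIV_cmult[OF this, of 2]
  have *: "((\<lambda>\<tau>. tri_term (a + of_real \<tau> * p) (b + of_real \<tau> * q)) has_real_derivative
     2 * Im (- ((p * cnj b + a * cnj q) / (1 - a * cnj b)))) (at 0)"
  proof (rule has_field_derivative_transform_within_open)
    let ?S = "{\<tau> :: real. 0 < Re (1 - (a + of_real \<tau> * p) * cnj (b + of_real \<tau> * q))}"
    show "open ?S" by (intro open_Collect_less continuous_intros)
    show "0 \<in> ?S" using re by simp
    fix \<tau> assume "\<tau> \<in> ?S"
    then have "1 - (a + of_real \<tau> * p) * cnj (b + of_real \<tau> * q) \<noteq> 0" by (intro Re_pos_nonzero) simp
    then show "2 * Im (Ln (1 - (a + of_real \<tau> * p) * (cnj b + of_real \<tau> * cnj q)))
      = tri_term (a + of_real \<tau> * p) (b + of_real \<tau> * q)"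
      unfolding tri_term_def by (simp add: Arg_eq_Im_Ln)
  qed
  have id: "cnj d / (1 - c * cnj d) = (cnj (mob c d) + cnj c) / of_real (1 - (cmod c)\<^sup>2)"
    if "cmod c < 1" "cmod d < 1" for c d
  proof -
    have nz: "1 - c * cnj d \<noteq> 0" using one_minus_mult_nz[of c "cnj d"] that by simp
    have E: "complex_of_real (1 - (cmod c)\<^sup>2) = 1 - c * cnj c"
      by (simp only: of_real_diff of_real_1 complex_norm_square)
    have Enz: "1 - c * cnj c \<noteq> 0" using one_minus_mult_nz[of c "cnj c"] that by simp
    have "cnj (mob c d) + cnj c = (cnj d - cnj c) / (1 - c * cnj d) + cnj c" by (simp add: mob_def)
    also have "\<dots> = (cnj d - cnj c + cnj c * (1 - c * cnj d)) / (1 - c * cnj d)"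
    proof -
      have "x / X + y = (x + y * X) / X" if "X \<noteq> 0" for x y X :: complex
        using that by (simp add: field_simps)
      then show ?thesis using nz by blast
    qed
    also have "cnj d - cnj c + cnj c * (1 - c * cnj d) = cnj d * (1 - c * cnj c)" by (simp add: algebra_simps)
    finally show ?thesis unfolding E using Enz by simp
  qed
  have Imd: "Im (x / of_real r) = Im x / r" for x r by simp
  have "Im (p * cnj b / (1 - a * cnj b)) = Im (p * (cnj (mob a b) + cnj a)) / (1 - (cmod a)\<^sup>2)"
    using arg_cong[OF id[OF a b], of "\<lambda>x. Im (p * x)"] by (simp only: times_divide_eq_right Imd)
  moreover have "Im (a * cnj q / (1 - a * cnj b)) = - Im (cnj (a * cnj q / (1 - a * cnj b)))"
    by (simp only: cnj.sel minus_minus)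
  moreover have "cnj (a * cnj q / (1 - a * cnj b)) = q * (cnj a / (1 - b * cnj a))" by (simp add: mult.commute)
  moreover have "Im (q * (cnj a / (1 - b * cnj a))) = Im (q * (cnj (mob b a) + cnj b)) / (1 - (cmod b)\<^sup>2)"
    unfolding id[OF b a] times_divide_eq_right Imd ..
  ultimately have "2 * Im (- ((p * cnj b + a * cnj q) / (1 - a * cnj b)))
    = 2 * (Im (q * (cnj (mob b a) + cnj b)) / (1 - (cmod b)\<^sup>2) - Im (p * (cnj (mob a b) + cnj a)) / (1 - (cmod a)\<^sup>2))"
    by (simp only: add_divide_distrib uminus_complex.sel plus_complex.sel minus_add_distrib minus_minus) simp
  then show ?thesis using *
    by (simp only: distrib_left[of q] distrib_left[of p] plus_complex.sel add_divide_distrib diff_diff_add add_diff_eq diff_add_eq)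
qed

lemma cmod_sq_affine:
  "(cmod (x + of_real \<tau> * y))\<^sup>2 = (cmod x)\<^sup>2 + 2 * \<tau> * Re (y * cnj x) + \<tau>\<^sup>2 * (cmod y)\<^sup>2"
  unfolding cmod_power2 by (simp add: algebra_simps power2_eq_square)

text \<open>First variation of length: an endpoint contributes minus the component of its velocity
  towards the other endpoint. The unit direction is \<open>mob a b\<close> divided by its modulus,
  and 2 / (1 - |a|^2) is the conformal factor of the metric.\<close>

lemma hyp_dist_deriv:
  assumes a: "cmod a < 1" and b: "cmod b < 1" and ab: "a \<noteq> b"
  shows "((\<lambda>\<tau>. hyp_dist (a + of_real \<tau> * p) (b + of_real \<tau> * q)) has_real_derivative
     - (2 / cmod (mob a b)) * (Re (p * cnj (mob a b)) / (1 - (cmod a)\<^sup>2)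
       + Re (q * cnj (mob b a)) / (1 - (cmod b)\<^sup>2))) (at 0)"
proof -
  define A0 B0 N0 where "A0 = 1 - (cmod a)\<^sup>2" and "B0 = 1 - (cmod b)\<^sup>2" and "N0 = (cmod (a - b))\<^sup>2"
  define A1 B1 N1 where "A1 = Re (p * cnj a)" and "B1 = Re (q * cnj b)" and "N1 = Re ((p - q) * cnj (a - b))"
  define A where "A \<tau> = A0 - 2 * \<tau> * A1 - \<tau>\<^sup>2 * (cmod p)\<^sup>2" for \<tau> :: real
  define B where "B \<tau> = B0 - 2 * \<tau> * B1 - \<tau>\<^sup>2 * (cmod q)\<^sup>2" for \<tau> :: real
  define N where "N \<tau> = N0 + 2 * \<tau> * N1 + \<tau>\<^sup>2 * (cmod (p - q))\<^sup>2" for \<tau> :: real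
  have pos: "0 < A0" "0 < B0" "0 < N0" using one_minus_norm_pos a b ab by (auto simp: A0_def B0_def N0_def)
  have eq: "hyp_dist (a + of_real \<tau> * p) (b + of_real \<tau> * q) = arcosh (1 + 2 * N \<tau> / (A \<tau> * B \<tau>))" for \<tau>
  proof -
    have "a + of_real \<tau> * p - (b + of_real \<tau> * q) = (a - b) + of_real \<tau> * (p - q)" by (simp add: algebra_simps)
    then show ?thesis
      unfolding hyp_dist_def cmod_sq_affine by (simp only: cmod_sq_affine)
        (simp only: A_def B_def N_def A0_def B0_def N0_def A1_def B1_def N1_def diff_diff_add)
  qed
  define s where "s = hyp_dist a b"
  define sh ch where "sh = sinh (s / 2)" and "ch = cosh (s / 2)"
  have cs: "cosh s = 1 + 2 * N0 / (A0 * B0)" using cosh_hyp_dist[OF a b] by (simp add: s_def A0_def B0_def N0_def)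
  have s0: "0 < s" using hyp_dist_nonneg[OF a b] hyp_dist_eq_0_iff[OF a b] ab by (simp add: s_def)
  have shch: "0 < sh" "0 < ch" using s0 by (simp_all add: sh_def ch_def)
  have "sqrt ((1 + 2 * N0 / (A0 * B0))\<^sup>2 - 1) = sinh s"
    using s0 by (simp flip: cs sinh_square_eq)
  also have "sinh s = 2 * sh * ch" using sinh_double[of "s/2"] by (simp add: sh_def ch_def)
  finally have sq: "sqrt ((1 + 2 * N0 / (A0 * B0))\<^sup>2 - 1) = 2 * sh * ch" .
  have g: "((\<lambda>\<tau>. 1 + 2 * N \<tau> / (A \<tau> * B \<tau>)) has_real_derivative
     4 * (N1 * (A0 * B0) + N0 * (A1 * B0 + A0 * B1)) / (A0 * B0)\<^sup>2) (at 0)"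
  proof -
    have "(A has_real_derivative - 2 * A1) (at 0)" "(B has_real_derivative - 2 * B1) (at 0)"
      "(N has_real_derivative 2 * N1) (at 0)"
      unfolding A_def B_def N_def by (auto intro!: derivative_eq_intros)
    moreover have "A 0 = A0" "B 0 = B0" "N 0 = N0" by (simp_all add: A_def B_def N_def)
    ultimately show ?thesis
      using pos by (auto intro!: derivative_eq_intros simp: power2_eq_square algebra_simps)
  qed
  have "((\<lambda>\<tau>. arcosh (1 + 2 * N \<tau> / (A \<tau> * B \<tau>))) has_real_derivative
     1 / sqrt ((1 + 2 * N 0 / (A 0 * B 0))\<^sup>2 - 1) * (4 * (N1 * (A0 * B0) + N0 * (A1 * B0 + A0 * B1)) / (A0 * B0)\<^sup>2)) (at 0)"
    by (rule DERIV_chain'[OF g, of arcosh]) (rule arcosh_real_has_field_derivative, use pos in \<open>simp add: A_def B_def N_def\<close>)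
  then have d: "((\<lambda>\<tau>. hyp_dist (a + of_real \<tau> * p) (b + of_real \<tau> * q)) has_real_derivative
     1 / (2 * sh * ch) * (4 * (N1 * (A0 * B0) + N0 * (A1 * B0 + A0 * B1)) / (A0 * B0)\<^sup>2)) (at 0)"
    unfolding eq by (simp add: A_def B_def N_def sq)
  \<comment> \<open>The contribution of one endpoint: the derivatives of |c - d|^2 and of 1 - |c|^2
    combine into the direction \<open>mob c d\<close>.\<close>
  have part: "(1 - (cmod c)\<^sup>2) * Re (r * cnj (c - d)) + (cmod (c - d))\<^sup>2 * Re (r * cnj c)
      = - ((cmod (1 - c * cnj d))\<^sup>2 * Re (r * cnj (mob c d)))" if "cmod c < 1" "cmod d < 1" for c d r
  proof -
    have nz: "1 - c * cnj d \<noteq> 0" using one_minus_mult_nz[of c "cnj d"] that by simp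
    have "(1 - (cmod c)\<^sup>2) * Re (r * cnj (c - d)) + (cmod (c - d))\<^sup>2 * Re (r * cnj c)
      = Re (r * (of_real (1 - (cmod c)\<^sup>2) * cnj (c - d) + of_real ((cmod (c - d))\<^sup>2) * cnj c))"
      by (simp add: algebra_simps del: of_real_diff of_real_power)
    also have "of_real (1 - (cmod c)\<^sup>2) * cnj (c - d) + of_real ((cmod (c - d))\<^sup>2) * cnj c
      = cnj (c - d) * (1 - cnj c * d)"
      unfolding of_real_diff of_real_1 complex_norm_square by (simp add: algebra_simps)
    also have "\<dots> = - (of_real ((cmod (1 - c * cnj d))\<^sup>2) * cnj (mob c d))"
      unfolding complex_norm_square using nz by (simp add: mob_def) (simp add: algebra_simps)
    also have "Re (r * (- (of_real ((cmod (1 - c * cnj d))\<^sup>2) * cnj (mob c d))))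
       = - ((cmod (1 - c * cnj d))\<^sup>2 * Re (r * cnj (mob c d)))"
      by (simp add: algebra_simps del: of_real_power)
    finally show ?thesis .
  qed
  have W: "(cmod (1 - a * cnj b))\<^sup>2 = ch\<^sup>2 * (A0 * B0)"
    using cosh_half_hyp_dist[OF a b] pos by (simp add: ch_def s_def A0_def B0_def)
  have W': "(cmod (1 - b * cnj a))\<^sup>2 = ch\<^sup>2 * (A0 * B0)"
  proof -
    have "1 - b * cnj a = cnj (1 - a * cnj b)" by (simp add: mult.commute)
    then show ?thesis using W by (simp only: complex_mod_cnj)
  qed
  have P: "A0 * Re (p * cnj (a - b)) + N0 * A1 = - (ch\<^sup>2 * (A0 * B0) * Re (p * cnj (mob a b)))"
    using part[OF a b, of p] unfolding W A0_def[symmetric] N0_def[symmetric] A1_def[symmetric] .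
  have Q: "B0 * Re (q * cnj (b - a)) + N0 * B1 = - (ch\<^sup>2 * (A0 * B0) * Re (q * cnj (mob b a)))"
    using part[OF b a, of q] unfolding W' B0_def[symmetric] B1_def[symmetric]
    by (simp only: N0_def norm_minus_commute[of b a])
  have "N1 = Re (p * cnj (a - b)) + Re (q * cnj (b - a))" by (simp add: N1_def algebra_simps)
  then have "N1 * (A0 * B0) + N0 * (A1 * B0 + A0 * B1)
    = B0 * (A0 * Re (p * cnj (a - b)) + N0 * A1) + A0 * (B0 * Re (q * cnj (b - a)) + N0 * B1)"
    by (simp only: distrib_left distrib_right mult_ac add_ac)
  also note P
  also note Q
  also have "B0 * - (ch\<^sup>2 * (A0 * B0) * Re (p * cnj (mob a b))) + A0 * - (ch\<^sup>2 * (A0 * B0) * Re (q * cnj (mob b a))) = - (ch\<^sup>2 * (A0 * B0) * (B0 * Re (p * cnj (mob a b)) + A0 * Re (q * cnj (mob b a))))"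
  proof -
    have "B0 * - (k * x) + A0 * - (k * y) = - (k * (B0 * x + A0 * y))" for k x y :: real
      by (simp add: algebra_simps)
    then show ?thesis .
  qed
  finally have num: "N1 * (A0 * B0) + N0 * (A1 * B0 + A0 * B1)
    = - (ch\<^sup>2 * (A0 * B0) * (B0 * Re (p * cnj (mob a b)) + A0 * Re (q * cnj (mob b a))))" .
  have t: "cmod (mob a b) = sh / ch" using norm_mob_eq_tanh[OF a b] by (simp add: tanh_def sh_def ch_def s_def)
  have "1 / (2 * sh * ch) * (4 * - (ch\<^sup>2 * (A0 * B0) * (B0 * x + A0 * y)) / (A0 * B0)\<^sup>2)
     = - (2 / (sh / ch)) * (x / A0 + y / B0)" for x y
    using pos shch by (simp add: field_simps power2_eq_square)
  then show ?thesis using d unfolding num t A0_def[symmetric] B0_def[symmetric] by simp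
qed

text \<open>Velocities are scaled by 1 - |z|^2 to remove the conformal factor. With \<open>a\<close>
  and \<open>c\<close> the directions to the two neighbours, area responds to the component of \<xi>
  across \<open>a - c\<close> and length to the component along \<open>a + c\<close>.\<close>

lemma cyc_variation:
  fixes \<xi> :: "nat \<Rightarrow> complex"
  assumes z: "\<And>i. cmod (z i) < 1" and n: "0 < n" and t: "0 < t"
    and side: "\<And>i. i < n \<Longrightarrow> cmod (mob (z i) (z (Suc i mod n))) = t"
  defines "v \<equiv> \<lambda>i. of_real (1 - (cmod (z i))\<^sup>2) * \<xi> i"
    and "a \<equiv> \<lambda>j. mob (z j) (z ((j + n - 1) mod n))" and "c \<equiv> \<lambda>j. mob (z j) (z (Suc j mod n))"
  shows "((\<lambda>\<tau>. cyc_area n (\<lambda>i. z i + of_real \<tau> * v i)) has_real_derivative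
      (\<Sum>j<n. 2 * Im (\<xi> j * cnj (a j - c j)))) (at 0)"
    and "((\<lambda>\<tau>. cyc_len n (\<lambda>i. z i + of_real \<tau> * v i)) has_real_derivative
      (\<Sum>j<n. - (2 / t) * Re (\<xi> j * cnj (a j + c j)))) (at 0)"
proof -
  have A: "1 - (cmod (z i))\<^sup>2 \<noteq> 0" for i using one_minus_norm_pos[OF z[of i]] by simp
  have IR: "Im (v i * x) / (1 - (cmod (z i))\<^sup>2) = Im (\<xi> i * x)"
    "Re (v i * x) / (1 - (cmod (z i))\<^sup>2) = Re (\<xi> i * x)" for i x
  proof -
    have gen: "Im (of_real r * y) = r * Im y" "Re (of_real r * y) = r * Re y" for r y by simp_all
    have "v i * x = of_real (1 - (cmod (z i))\<^sup>2) * (\<xi> i * x)" by (simp only: v_def mult.assoc)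
    then have "Im (v i * x) = (1 - (cmod (z i))\<^sup>2) * Im (\<xi> i * x)" "Re (v i * x) = (1 - (cmod (z i))\<^sup>2) * Re (\<xi> i * x)"
      by (simp_all only: gen)
    then show "Im (v i * x) / (1 - (cmod (z i))\<^sup>2) = Im (\<xi> i * x)"
       "Re (v i * x) / (1 - (cmod (z i))\<^sup>2) = Re (\<xi> i * x)" using A[of i] by simp_all
  qed
  have c_fold: "mob (z i) (z (Suc i mod n)) = c i" for i by (simp add: c_def)
  have pr: "mob (z (Suc i mod n)) (z i) = a (Suc i mod n)" if "i < n" for i
    unfolding a_def pred_Suc_mod[OF that] ..
  have "((\<lambda>\<tau>. cyc_area n (\<lambda>i. z i + of_real \<tau> * v i)) has_real_derivative
    (\<Sum>i<n. 2 * (Im (\<xi> (Suc i mod n) * cnj (a (Suc i mod n))) + Im (\<xi> (Suc i mod n) * cnj (z (Suc i mod n)))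
        - Im (\<xi> i * cnj (c i)) - Im (\<xi> i * cnj (z i))))) (at 0)"
    unfolding cyc_sum_def
  proof (rule DERIV_sum)
    fix i assume "i \<in> {..<n}"
    then have i: "i < n" by simp
    show "((\<lambda>\<tau>. tri_term (z i + of_real \<tau> * v i) (z (Suc i mod n) + of_real \<tau> * v (Suc i mod n))) has_real_derivative
      2 * (Im (\<xi> (Suc i mod n) * cnj (a (Suc i mod n))) + Im (\<xi> (Suc i mod n) * cnj (z (Suc i mod n)))
        - Im (\<xi> i * cnj (c i)) - Im (\<xi> i * cnj (z i)))) (at 0)"
      using tri_term_deriv[OF z[of i] z[of "Suc i mod n"], of "v i" "v (Suc i mod n)"]
      unfolding IR pr[OF i] c_fold .
  qed
  moreover have "(\<Sum>i<n. 2 * (Im (\<xi> (Suc i mod n) * cnj (a (Suc i mod n))) + Im (\<xi> (Suc i mod n) * cnj (z (Suc i mod n)))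
        - Im (\<xi> i * cnj (c i)) - Im (\<xi> i * cnj (z i)))) = (\<Sum>j<n. 2 * Im (\<xi> j * cnj (a j - c j)))"
  proof -
    have "(\<Sum>i<n. 2 * (f (Suc i mod n) + g (Suc i mod n) - h i - g i)) = (\<Sum>i<n. 2 * (f i - h i))" for f g h :: "nat \<Rightarrow> real"
      using sum_shift_mod[of f n] sum_shift_mod[of g n]
      by (simp add: sum.distrib sum_subtractf flip: sum_distrib_left)
    from this[of "\<lambda>i. Im (\<xi> i * cnj (a i))" "\<lambda>i. Im (\<xi> i * cnj (z i))" "\<lambda>i. Im (\<xi> i * cnj (c i))"]
    show ?thesis by (simp only: complex_cnj_diff right_diff_distrib[of "\<xi> _"] minus_complex.sel)
  qed
  ultimately show "((\<lambda>\<tau>. cyc_area n (\<lambda>i. z i + of_real \<tau> * v i)) has_real_derivative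
      (\<Sum>j<n. 2 * Im (\<xi> j * cnj (a j - c j)))) (at 0)" by simp
  have "((\<lambda>\<tau>. cyc_len n (\<lambda>i. z i + of_real \<tau> * v i)) has_real_derivative
    (\<Sum>i<n. - (2 / t) * (Re (\<xi> i * cnj (c i)) + Re (\<xi> (Suc i mod n) * cnj (a (Suc i mod n)))))) (at 0)"
    unfolding cyc_sum_def
  proof (rule DERIV_sum)
    fix i assume "i \<in> {..<n}"
    then have i: "i < n" by simp
    have "z i \<noteq> z (Suc i mod n)" using side[OF i] t by force
    from hyp_dist_deriv[OF z z this, of "v i" "v (Suc i mod n)"]
    show "((\<lambda>\<tau>. hyp_dist (z i + of_real \<tau> * v i) (z (Suc i mod n) + of_real \<tau> * v (Suc i mod n))) has_real_derivative
      - (2 / t) * (Re (\<xi> i * cnj (c i)) + Re (\<xi> (Suc i mod n) * cnj (a (Suc i mod n))))) (at 0)"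
      unfolding IR pr[OF i] side[OF i] unfolding c_fold .
  qed
  moreover have "(\<Sum>i<n. - (2 / t) * (Re (\<xi> i * cnj (c i)) + Re (\<xi> (Suc i mod n) * cnj (a (Suc i mod n)))))
     = (\<Sum>j<n. - (2 / t) * Re (\<xi> j * cnj (a j + c j)))"
  proof -
    have "(\<Sum>i<n. k * (h i + f (Suc i mod n))) = (\<Sum>i<n. k * (f i + h i))" for f h :: "nat \<Rightarrow> real" and k
      using sum_shift_mod[of f n] by (simp add: sum.distrib flip: sum_distrib_left)
    from this[of "- (2 / t)" "\<lambda>i. Re (\<xi> i * cnj (c i))" "\<lambda>i. Re (\<xi> i * cnj (a i))"]
    show ?thesis by (simp only: complex_cnj_add distrib_left[of "\<xi> _"] plus_complex.sel)
  qed
  ultimately show "((\<lambda>\<tau>. cyc_len n (\<lambda>i. z i + of_real \<tau> * v i)) has_real_derivative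
      (\<Sum>j<n. - (2 / t) * Re (\<xi> j * cnj (a j + c j)))) (at 0)" by simp
qed

lemma Suc_pred_mod: "j < n \<Longrightarrow> Suc ((j + n - 1) mod n) mod n = j"
  by (simp add: mod_Suc_eq)

lemma norm_mob_commute: "cmod a < 1 \<Longrightarrow> cmod b < 1 \<Longrightarrow> cmod (mob a b) = cmod (mob b a)"
  by (simp add: norm_mob_eq_tanh hyp_dist_commute)

lemma disc_line_stays:
  assumes "cmod w < 1" "0 < \<tau>" "\<tau> < (1 - cmod w) / (1 + cmod v)"
  shows "cmod (w + of_real \<tau> * v) < 1"
proof -
  have "0 < 1 + cmod v" by (simp add: add_pos_nonneg)
  then have "\<tau> * (1 + cmod v) < 1 - cmod w" using assms(3) by (simp add: pos_less_divide_eq)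
  moreover have "cmod (w + of_real \<tau> * v) \<le> cmod w + \<tau> * cmod v"
    using norm_triangle_ineq[of w "of_real \<tau> * v"] assms(2) by (simp add: norm_mult)
  ultimately show ?thesis using assms(2) by (simp add: algebra_simps)
qed

text \<open>\<open>e\<close> is the direction of an angle bisector at the vertex and
  \<open>h\<close> the half angle as a unit complex number, determined only up to a common sign of
  both.\<close>

lemma half_angle_frame:
  fixes a c :: complex
  assumes "cmod a = t" "cmod c = t" "0 < t"
  obtains h e where "h\<^sup>2 = a / c" "cmod h = 1" "cmod e = 1"
    "a = of_real t * e * h" "c = of_real t * e * cnj h"
proof -
  define h where "h = csqrt (a / c)"
  define e where "e = a / (of_real t * h)"
  have nz: "a \<noteq> 0" "c \<noteq> 0" using assms by auto
  have h2: "h\<^sup>2 = a / c" by (simp add: h_def)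
  then have "(cmod h)\<^sup>2 = 1" using assms nz by (metis norm_divide norm_power divide_self less_irrefl)
  then have h: "cmod h = 1" using abs_square_eq_1[of "cmod h"] by simp
  then have hnz: "h \<noteq> 0" by auto
  have e: "cmod e = 1" using assms h by (simp add: e_def norm_divide norm_mult)
  have a: "a = of_real t * e * h" using assms hnz by (simp add: e_def)
  have "h * cnj h = 1" using h complex_norm_square[of h] by simp
  moreover have "c = a / h\<^sup>2" using h2 nz by simp
  ultimately have "c = of_real t * e * cnj h"
  proof -
    assume "h * cnj h = 1" "c = a / h\<^sup>2"
    then have "cnj h = inverse h" by (metis inverse_unique)
    then show ?thesis using a hnz \<open>c = a / h\<^sup>2\<close>
      by (simp only: \<open>cnj h = inverse h\<close>) (simp add: power2_eq_square field_simps)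
  qed
  then show ?thesis using that h2 h e a by blast
qed

text \<open>At a maximiser no first-order variation can shorten the polygon and enlarge its area at the
  same time; testing this on two vertices, each moved along the bisector of its angle, shows
  that all turning angles agree.\<close>

lemma maximiser_equiangular:
  assumes n: "2 \<le> n" and z: "\<And>i. cmod (z i) < 1" "cyc_len n z \<le> L" and t: "0 < t"
    and side: "\<And>i. i < n \<Longrightarrow> cmod (mob (z i) (z (Suc i mod n))) = t"
    and max: "\<And>z'. (\<And>i. cmod (z' i) < 1) \<Longrightarrow> cyc_len n z' \<le> L \<Longrightarrow> cyc_area n z' \<le> cyc_area n z"
  obtains \<kappa> where "\<And>j. j < n \<Longrightarrow> mob (z j) (z (Suc j mod n)) = \<kappa> * mob (z j) (z ((j + n - 1) mod n))"
proof -
  define a c where "a = (\<lambda>j. mob (z j) (z ((j + n - 1) mod n)))" and "c = (\<lambda>j. mob (z j) (z (Suc j mod n)))"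
  have n0: "0 < n" using n by simp
  have ct: "cmod (c j) = t" if "j < n" for j using side[OF that] by (simp add: c_def)
  have at: "cmod (a j) = t" if "j < n" for j
    using side[of "(j + n - 1) mod n"] n0 norm_mob_commute[OF z(1) z(1)] Suc_pred_mod[OF that]
    unfolding a_def by (metis mod_less_divisor)
  have "\<forall>j. \<exists>h e. j < n \<longrightarrow> h\<^sup>2 = a j / c j \<and> cmod h = 1 \<and> cmod e = 1 \<and>
     a j = of_real t * e * h \<and> c j = of_real t * e * cnj h"
    using half_angle_frame at ct t by metis
  then obtain h e where he: "\<And>j. j < n \<Longrightarrow> (h j)\<^sup>2 = a j / c j" "\<And>j. j < n \<Longrightarrow> cmod (h j) = 1"
    "\<And>j. j < n \<Longrightarrow> cmod (e j) = 1" "\<And>j. j < n \<Longrightarrow> a j = of_real t * e j * h j"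
    "\<And>j. j < n \<Longrightarrow> c j = of_real t * e j * cnj (h j)"
    by metis
  have par: "Re (h i) * Im (h j) - Re (h j) * Im (h i) = 0" if ij: "i < n" "j < n" for i j
  proof (rule ccontr)
    define D where "D = Re (h i) * Im (h j) - Re (h j) * Im (h i)"
    assume "Re (h i) * Im (h j) - Re (h j) * Im (h i) \<noteq> 0"
    then have D: "D \<noteq> 0" by (simp add: D_def)
    then have neq: "i \<noteq> j" by (auto simp: D_def)
    \<comment> \<open>Cramer's rule for two equations. The displacements along the bisectors at
      \<open>i\<close> and \<open>j\<close> are chosen so that the length has derivative -4 and the
      area has derivative 4 t; this works as soon as \<open>h i\<close> and \<open>h j\<close> are
      not parallel.\<close>
    define x where "x = (\<lambda>m. if m = i then (Im (h j) + Re (h j)) / D else if m = j then - (Re (h i) + Im (h i)) / D else 0)"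
    have x: "x i * Re (h i) + x j * Re (h j) = 1" "x i * Im (h i) + x j * Im (h j) = - 1"
    proof -
      have "(p + q) / D * r + - (r + s) / D * q = (p * r - s * q) / D" for p q r s
        by (simp add: field_simps diff_divide_distrib add_divide_distrib)
      moreover have "(p + q) / D * s + - (r + s) / D * p = - ((p * r - s * q) / D)" for p q r s
        by (simp add: field_simps diff_divide_distrib add_divide_distrib)
      moreover have "Im (h j) * Re (h i) - Im (h i) * Re (h j) = D" by (simp add: D_def algebra_simps)
      ultimately show "x i * Re (h i) + x j * Re (h j) = 1" "x i * Im (h i) + x j * Im (h j) = - 1"
        using D neq by (simp_all add: x_def)
    qed
    define \<xi> where "\<xi> m = of_real (x m) * e m" for m
    define v where "v = (\<lambda>m. of_real (1 - (cmod (z m))\<^sup>2) * \<xi> m)"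
    define w where "w = (\<lambda>\<tau> m. z m + of_real \<tau> * v m)"
    have only: "(\<Sum>m<n. G m) = G i + G j" if "\<And>m. m \<noteq> i \<Longrightarrow> m \<noteq> j \<Longrightarrow> G m = 0" for G :: "nat \<Rightarrow> real"
    proof -
      have "(\<Sum>m<n. G m) = (\<Sum>m\<in>{i, j}. G m)" using ij that by (intro sum.mono_neutral_right) auto
      then show ?thesis using neq by simp
    qed
    have vals: "2 * Im (\<xi> m * cnj (a m - c m)) = - 4 * t * (x m * Im (h m))"
      "- (2 / t) * Re (\<xi> m * cnj (a m + c m)) = - 4 * (x m * Re (h m))" if m: "m < n" for m
    proof -
      have ee: "e m * cnj (e m) = 1" using he(3)[OF m] complex_norm_square[of "e m"] by simp
      have "a m - c m = e m * (\<i> * of_real (2 * t * Im (h m)))" "a m + c m = e m * of_real (2 * t * Re (h m))"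
        unfolding he(4,5)[OF m] by (simp_all add: complex_eq_iff algebra_simps)
      then have "\<xi> m * cnj (a m - c m) = (e m * cnj (e m)) * (- \<i> * of_real (2 * t * x m * Im (h m)))"
         "\<xi> m * cnj (a m + c m) = (e m * cnj (e m)) * of_real (2 * t * x m * Re (h m))"
        by (simp_all add: \<xi>_def algebra_simps)
      then show "2 * Im (\<xi> m * cnj (a m - c m)) = - 4 * t * (x m * Im (h m))"
        "- (2 / t) * Re (\<xi> m * cnj (a m + c m)) = - 4 * (x m * Re (h m))"
        unfolding ee using t by simp_all
    qed
    have x0: "x m = 0" if "m \<noteq> i" "m \<noteq> j" for m using that by (simp add: x_def)
    have "(\<Sum>m<n. 2 * Im (\<xi> m * cnj (a m - c m))) = (\<Sum>m<n. - 4 * t * (x m * Im (h m)))"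
      using vals by (intro sum.cong) auto
    also have "\<dots> = - 4 * t * (x i * Im (h i) + x j * Im (h j))"
      by (subst only) (simp_all add: x0 algebra_simps)
    finally have dS: "(\<Sum>m<n. 2 * Im (\<xi> m * cnj (a m - c m))) = 4 * t" unfolding x by simp
    have "(\<Sum>m<n. - (2 / t) * Re (\<xi> m * cnj (a m + c m))) = (\<Sum>m<n. - 4 * (x m * Re (h m)))"
      using vals by (intro sum.cong) auto
    also have "\<dots> = - 4 * (x i * Re (h i) + x j * Re (h j))"
      by (subst only) (simp_all add: x0 algebra_simps)
    finally have dL: "(\<Sum>m<n. - (2 / t) * Re (\<xi> m * cnj (a m + c m))) = - 4" unfolding x by simp
    note var = cyc_variation[where z = z and n = n and t = t and \<xi> = \<xi>, OF z(1) n0 t side]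
    have "((\<lambda>\<tau>. cyc_area n (w \<tau>)) has_real_derivative 4 * t) (at 0)"
      using var(1) dS by (simp only: a_def c_def w_def v_def)
    then obtain d1 where d1: "0 < d1" "\<And>\<tau>. 0 < \<tau> \<Longrightarrow> \<tau> < d1 \<Longrightarrow> cyc_area n (w 0) < cyc_area n (w \<tau>)"
      using DERIV_pos_inc_right[of "\<lambda>\<tau>. cyc_area n (w \<tau>)" "4 * t" 0] t by auto
    have "((\<lambda>\<tau>. cyc_len n (w \<tau>)) has_real_derivative - 4) (at 0)"
      using var(2) dL by (simp only: a_def c_def w_def v_def)
    then obtain d2 where d2: "0 < d2" "\<And>\<tau>. 0 < \<tau> \<Longrightarrow> \<tau> < d2 \<Longrightarrow> cyc_len n (w \<tau>) < cyc_len n (w 0)"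
      using DERIV_neg_dec_right[of "\<lambda>\<tau>. cyc_len n (w \<tau>)" "- 4" 0] by auto
    define r where "r m = (1 - cmod (z m)) / (1 + cmod (v m))" for m
    have r: "0 < r m" for m using z(1)[of m] by (simp add: r_def add_pos_nonneg)
    define \<tau> where "\<tau> = min (min d1 d2) (min (r i) (r j)) / 2"
    have \<tau>: "0 < \<tau>" "\<tau> < d1" "\<tau> < d2" "\<tau> < r i" "\<tau> < r j"
      using d1(1) d2(1) r[of i] r[of j] by (auto simp: \<tau>_def min_def)
    have w0: "w 0 = z" by (simp add: w_def fun_eq_iff)
    have "cmod (w \<tau> m) < 1" for m
    proof (cases "m = i \<or> m = j")
      case True
      then show ?thesis using disc_line_stays[OF z(1) \<tau>(1), of m "v m"] \<tau>(4,5) by (auto simp: w_def r_def)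
    next
      case False
      then show ?thesis using z(1) by (simp add: w_def v_def \<xi>_def x0)
    qed
    moreover have "cyc_len n (w \<tau>) \<le> L" using d2(2)[OF \<tau>(1,3)] z(2) by (simp add: w0)
    ultimately have "cyc_area n (w \<tau>) \<le> cyc_area n z" by (rule max)
    then show False using d1(2)[OF \<tau>(1,2)] by (simp add: w0)
  qed
  \<comment> \<open>Parallel unit vectors agree up to sign. The sign ambiguity of the half angle
    disappears in the square, which is the quotient of the two directions.\<close>
  have hh: "(h i)\<^sup>2 = (h j)\<^sup>2" if ij: "i < n" "j < n" for i j
  proof -
    have "h j = of_real (Re (cnj (h i) * h j)) * h i"
    proof -
      have "cnj (h i) * h j = of_real (Re (cnj (h i) * h j))"
        using par[OF ij] by (simp add: complex_eq_iff algebra_simps)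
      moreover have "h i * cnj (h i) = 1" using he(2)[OF ij(1)] complex_norm_square[of "h i"] by simp
      ultimately show ?thesis by (metis mult.assoc mult.commute mult.right_neutral)
    qed
    then obtain \<rho> where \<rho>: "h j = of_real \<rho> * h i" by blast
    then have "\<bar>\<rho>\<bar> = 1" using he(2)[OF ij(1)] he(2)[OF ij(2)] by (simp add: norm_mult)
    then have "\<rho>\<^sup>2 = 1" by (simp add: abs_square_eq_1)
    then show ?thesis unfolding \<rho> by (simp add: power_mult_distrib flip: of_real_power)
  qed
  show ?thesis
  proof (rule that)
    fix j assume j: "j < n"
    have "a j \<noteq> 0" "c j \<noteq> 0" using at[OF j] ct[OF j] t by auto
    moreover have "a j / c j = (h 0)\<^sup>2" using he(1)[OF j] hh[OF j n0] by simp
    ultimately have "c j = inverse ((h 0)\<^sup>2) * a j" by (metis divide_inverse inverse_divide mult.commute nonzero_divide_eq_eq)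
    then show "mob (z j) (z (Suc j mod n)) = inverse ((h 0)\<^sup>2) * mob (z j) (z ((j + n - 1) mod n))"
      by (simp add: a_def c_def)
  qed
qed

section \<open>Chords of a circle about the centre, and the isoperimetric inequality\<close>

lemma cos_le_cos_between:
  fixes x y :: real
  assumes "0 \<le> y" "y \<le> x" "x \<le> 2 * pi - y"
  shows "cos x \<le> cos y"
proof (cases "x \<le> pi")
  case True
  then show ?thesis using assms by (simp add: cos_mono_le_eq)
next
  case False
  then have "cos (2 * pi - x) \<le> cos y" using assms by (intro cos_monotone_0_pi_le) auto
  then show ?thesis by (simp add: cos_diff)
qed

lemma roots_unity_cis:
  assumes "u ^ n = 1" "0 < n"
  obtains k where "k < n" "u = cis (2 * pi * real k / real n)"
proof -
  have "u \<in> (\<lambda>k. cis (2 * pi * real k / real n)) ` {..<n}"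
    using Complex.bij_betw_roots_unity[OF assms(2)] assms(1) unfolding bij_betw_def by auto
  then show ?thesis using that by auto
qed

text \<open>Polar form of the number behind \<open>tri_term\<close>: the argument is half the signed
  area of the triangle over the chord, and the modulus is cosh of half the chord times 1 - |x|^2.
  Both quantities of the isoperimetric relation thus come from one complex number.\<close>

lemma circle_chord:
  fixes \<phi> :: real
  assumes r: "cmod x < 1"
  defines "\<alpha> \<equiv> Arg (1 - of_real ((cmod x)\<^sup>2) * cis (- \<phi>))"
  shows "tri_term x (cis \<phi> * x) = 2 * \<alpha>"
    and "\<bar>\<alpha>\<bar> < pi / 2"
    and "of_real (cosh (hyp_dist x (cis \<phi> * x) / 2) * (1 - (cmod x)\<^sup>2)) * cis \<alpha>
      = 1 - of_real ((cmod x)\<^sup>2) * cis (- \<phi>)"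
proof -
  have e: "x * cnj (cis \<phi> * x) = of_real ((cmod x)\<^sup>2) * cis (- \<phi>)"
    unfolding complex_norm_square by (simp add: cis_cnj mult_ac)
  show "tri_term x (cis \<phi> * x) = 2 * \<alpha>" unfolding tri_term_def e \<alpha>_def ..
  have d: "cmod (cis \<phi> * x) < 1" using r by (simp add: norm_mult)
  have re: "0 < Re (1 - of_real ((cmod x)\<^sup>2) * cis (- \<phi>))"
  proof -
    have "cmod (cnj (cis \<phi> * x)) < 1" using d by (simp only: complex_mod_cnj)
    from one_minus_mult_Re_pos[OF r this] show ?thesis unfolding e .
  qed
  then show "\<bar>\<alpha>\<bar> < pi / 2" unfolding \<alpha>_def using Arg_Re_pos by blast
  have p: "0 < 1 - (cmod x)\<^sup>2" using one_minus_norm_pos[OF r] .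
  have n: "(cmod (cis \<phi> * x)) = cmod x" by (simp add: norm_mult)
  have "(cosh (hyp_dist x (cis \<phi> * x) / 2) * (1 - (cmod x)\<^sup>2))\<^sup>2 = (cmod (1 - of_real ((cmod x)\<^sup>2) * cis (- \<phi>)))\<^sup>2"
    using p unfolding power_mult_distrib cosh_half_hyp_dist[OF r d] e n by (simp add: power2_eq_square)
  then have "cosh (hyp_dist x (cis \<phi> * x) / 2) * (1 - (cmod x)\<^sup>2) = cmod (1 - of_real ((cmod x)\<^sup>2) * cis (- \<phi>))"
    using p by (simp add: power2_eq_iff_nonneg cosh_real_nonneg)
  then show "of_real (cosh (hyp_dist x (cis \<phi> * x) / 2) * (1 - (cmod x)\<^sup>2)) * cis \<alpha>
      = 1 - of_real ((cmod x)\<^sup>2) * cis (- \<phi>)"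
    using cis_Arg_of_real_mult[OF Re_pos_nonzero[OF re]] unfolding \<alpha>_def by simp
qed

text \<open>The real part of the polar form after a rotation by \<beta>. For \<phi> = 2 \<pi> / n
  and \<beta> = \<pi> / n the factor 1 - |x|^2 cancels, and the relation between side and area of
  the regular polygon remains.\<close>

lemma circle_chord_cos:
  fixes \<phi> :: real
  assumes r: "cmod x < 1"
  defines "\<alpha> \<equiv> Arg (1 - of_real ((cmod x)\<^sup>2) * cis (- \<phi>))"
  shows "cosh (hyp_dist x (cis \<phi> * x) / 2) * (1 - (cmod x)\<^sup>2) * cos (\<alpha> + \<beta>)
    = cos \<beta> - (cmod x)\<^sup>2 * cos (\<phi> - \<beta>)"
proof -
  define K where "K = cosh (hyp_dist x (cis \<phi> * x) / 2) * (1 - (cmod x)\<^sup>2)"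
  have "of_real K * cis \<alpha> * cis \<beta> = (1 - of_real ((cmod x)\<^sup>2) * cis (- \<phi>)) * cis \<beta>"
    using circle_chord(3)[OF r, of \<phi>] by (simp only: K_def \<alpha>_def)
  also have "\<dots> = cis \<beta> - of_real ((cmod x)\<^sup>2) * cis (\<beta> - \<phi>)"
    by (simp add: left_diff_distrib mult.assoc cis_mult add.commute del: of_real_power)
  finally have "of_real K * cis (\<alpha> + \<beta>) = cis \<beta> - of_real ((cmod x)\<^sup>2) * cis (\<beta> - \<phi>)"
    by (simp add: mult.assoc cis_mult)
  from arg_cong[OF this, of Re]
  have "K * cos (\<alpha> + \<beta>) = cos \<beta> - (cmod x)\<^sup>2 * cos (\<beta> - \<phi>)" by simp
  then show ?thesis using cos_minus[of "\<beta> - \<phi>"] by (simp add: K_def)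
qed

lemma abs_less_cos_pos:
  fixes x :: real
  assumes "0 < cos x" "- (pi/2) \<le> x" "x < 3 * pi / 2"
  shows "x < pi / 2"
proof (rule ccontr)
  assume "\<not> x < pi / 2"
  then have "0 \<le> cos (x - pi)" using assms by (intro cos_ge_zero) auto
  then show False using assms(1) by (simp add: cos_diff)
qed

text \<open>Centred, the maximiser is an orbit of an n-th root of unity with exponent
  \<open>k\<close>. In \<open>circle_chord_cos\<close> the angle \<phi> - \<pi> / n is then an odd
  multiple of \<pi> / n, so its cosine is at most cos (\<pi> / n). This is the desired direction for
  every \<open>k\<close>, including the star-shaped orbits.\<close>

theorem polygon_isoperimetric:
  fixes z :: "nat \<Rightarrow> complex"
  assumes n: "3 \<le> n" and z: "\<And>i. cmod (z i) < 1" and S: "0 \<le> cyc_area n z"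
  shows "cyc_area n z / (2 * real n) + pi / real n < pi / 2"
    and "cos (pi / real n) \<le> cosh (cyc_len n z / (2 * real n)) * cos (cyc_area n z / (2 * real n) + pi / real n)"
proof -
  define L where "L = cyc_len n z"
  have n0: "0 < n" "2 \<le> n" using n by auto
  have L0: "0 \<le> L" unfolding L_def cyc_sum_def using hyp_dist_nonneg z by (intro sum_nonneg) auto
  have pn: "0 < pi / real n" "pi / real n < pi / 2" using n by (simp_all add: field_simps)
  have cp: "0 < cos (pi / real n)" using pn by (intro cos_gt_zero) auto
  obtain w where w: "\<And>i. cmod (w i) < 1" "cyc_len n w \<le> L"
    "\<And>z'. (\<And>i. cmod (z' i) < 1) \<Longrightarrow> cyc_len n z' \<le> L \<Longrightarrow> cyc_area n z' \<le> cyc_area n w"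
    "\<And>z'. (\<And>i. cmod (z' i) < 1) \<Longrightarrow> cyc_len n z' \<le> L \<Longrightarrow> cyc_area n z' = cyc_area n w \<Longrightarrow>
       cyc_sum n (\<lambda>a b. (hyp_dist a b)\<^sup>2) w \<le> cyc_sum n (\<lambda>a b. (hyp_dist a b)\<^sup>2) z'"
    using exists_maximiser[OF n0(1) L0] by blast
  have Sw: "cyc_area n z \<le> cyc_area n w" by (rule w(3)) (use z in \<open>auto simp: L_def\<close>)
  define s where "s = hyp_dist (w 0) (w (Suc 0 mod n))"
  have ws: "hyp_dist (w i) (w (Suc i mod n)) = s" if "i < n" for i
    unfolding s_def by (rule maximiser_equilateral[OF n0(2) w(1,2,3,4) that])
  define t where "t = tanh (s / 2)"
  have wt: "cmod (mob (w i) (w (Suc i mod n))) = t" if "i < n" for i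
    using norm_mob_eq_tanh[OF w(1) w(1)] ws[OF that] by (simp add: t_def)
  have sn: "real n * s \<le> L" using w(2) ws by (simp add: cyc_sum_def)
  have s0: "0 \<le> s" unfolding s_def using hyp_dist_nonneg w(1) by blast
  have key: "cyc_area n w / (2 * real n) + pi / real n < pi / 2 \<and>
    cos (pi / real n) \<le> cosh (s / 2) * cos (cyc_area n w / (2 * real n) + pi / real n)"
  proof (cases "s = 0")
    \<comment> \<open>All vertices coincide; the signed area is 0 and the relation is
      trivial.\<close>
    case True
    have "tri_term (w i) (w (Suc i mod n)) = 0" if "i < n" for i
    proof -
      have "w (Suc i mod n) = w i" using ws[OF that] True hyp_dist_eq_0_iff w(1) by metis
      moreover have "tri_term x x = - tri_term x x" if "cmod x < 1" for x using tri_term_swap[of x x] that by simp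
      ultimately show ?thesis using w(1)[of i] by simp
    qed
    then have "cyc_area n w = 0" by (simp add: cyc_sum_def)
    then show ?thesis using True pn by simp
  next
    case False
    then have t: "0 < t" using s0 by (simp add: t_def)
    obtain \<kappa> where \<kappa>: "\<And>j. j < n \<Longrightarrow> mob (w j) (w (Suc j mod n)) = \<kappa> * mob (w j) (w ((j + n - 1) mod n))"
      using maximiser_equiangular[OF n0(2) w(1,2) t wt w(3)] by blast
    obtain b where b: "cmod b < 1" "(\<Sum>i<n. mob b (w i) / of_real (1 - (cmod (mob b (w i)))\<^sup>2)) = 0"
      using exists_center[of n w] w(1) n0 by blast
    define Z where "Z i = mob b (w (i mod n))" for i
    have Zd: "cmod (Z i) < 1" for i using b(1) w(1) by (simp add: Z_def)
    have sm: "w (Suc i mod n) = w (Suc (i mod n) mod n)" for i by (simp add: mod_Suc_eq)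
    have dZ: "hyp_dist (Z i) (Z (Suc i)) = s" for i
      unfolding Z_def hyp_dist_mob[OF b(1) w(1) w(1)] sm[of i] using ws n0 by simp
    have side: "cmod (mob (Z i) (Z (Suc i))) = t" for i
      using norm_mob_eq_tanh[OF Zd Zd] dZ by (simp add: t_def)
    have turn: "mob (Z (Suc i)) (Z (Suc (Suc i))) = \<kappa> * mob (Z (Suc i)) (Z i)" for i
    proof -
      define j where "j = Suc i mod n"
      have j: "j < n" using n0 by (simp add: j_def)
      obtain v where v: "\<And>y. cmod y < 1 \<Longrightarrow> mob (mob b (w j)) (mob b y) = v * mob (w j) y"
        using mob_mob_factor[OF b(1) w(1)] by metis
      have "(j + n - 1) mod n = i mod n"
        using pred_Suc_mod[of "i mod n" n] n0 by (simp add: j_def mod_Suc_eq)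
      moreover have "Suc (Suc i) mod n = Suc j mod n" by (simp add: j_def mod_Suc_eq)
      ultimately show ?thesis
        unfolding Z_def j_def[symmetric] using v[OF w(1)] \<kappa>[OF j] by simp
    qed
    have per: "Z (i + n) = Z i" for i by (simp add: Z_def)
    have cent: "(\<Sum>i<n. Z i / of_real (1 - (cmod (Z i))\<^sup>2)) = 0"
    proof -
      have "(\<Sum>i<n. Z i / of_real (1 - (cmod (Z i))\<^sup>2)) = (\<Sum>i<n. mob b (w i) / of_real (1 - (cmod (mob b (w i)))\<^sup>2))"
        by (intro sum.cong) (auto simp: Z_def)
      then show ?thesis using b(2) by simp
    qed
    obtain u where u: "u ^ n = 1" "\<And>i. Z i = u ^ i * Z 0" "Z 0 \<noteq> 0"
      using equilateral_equiangular_orbit[where Z = Z, OF Zd n0(1) per side t turn cent] by metis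
    obtain k where k: "k < n" "u = cis (2 * pi * real k / real n)" using roots_unity_cis[OF u(1) n0(1)] .
    define \<phi> where "\<phi> = 2 * pi * real k / real n"
    define \<alpha> where "\<alpha> = Arg (1 - of_real ((cmod (Z 0))\<^sup>2) * cis (- \<phi>))"
    have Zs: "Z (Suc i) = cis \<phi> * Z i" for i using u(2)[of "Suc i"] u(2)[of i] k(2) by (simp add: \<phi>_def mult.assoc)
    have nZ: "cmod (Z i) = cmod (Z 0)" for i
      using Zs by (induction i) (simp_all add: norm_mult)
    have tt: "tri_term (Z i) (Z (Suc i)) = 2 * \<alpha>" for i
      unfolding Zs[of i] using circle_chord(1)[OF Zd[of i], of \<phi>] by (simp add: nZ[of i] \<alpha>_def)
    have "cyc_area n w = cyc_area n (\<lambda>i. mob b (w i))" using cyc_area_mob[OF b(1) w(1)] by simp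
    also have "\<dots> = (\<Sum>i<n. tri_term (Z i) (Z (Suc i)))"
      unfolding cyc_sum_def by (intro sum.cong) (auto simp: Z_def)
    finally have A: "cyc_area n w / (2 * real n) = \<alpha>" using n0 by (simp add: tt)
    have "cosh (s / 2) * (1 - (cmod (Z 0))\<^sup>2) * cos (\<alpha> + pi / real n)
       = cos (pi / real n) - (cmod (Z 0))\<^sup>2 * cos (\<phi> - pi / real n)"
      using circle_chord_cos[OF Zd[of 0], of \<phi> "pi / real n"] dZ[of 0] Zs[of 0] by (simp add: \<alpha>_def)
    moreover have "cos (\<phi> - pi / real n) \<le> cos (pi / real n)"
    proof (cases "k = 0")
      case False
      have "\<phi> - pi / real n = (2 * real k - 1) * (pi / real n)"
      proof -
        have "2 * pi * real k - pi = (2 * real k - 1) * pi" by (simp add: algebra_simps)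
        then show ?thesis by (simp only: \<phi>_def diff_divide_distrib[symmetric] times_divide_eq_right)
      qed
      moreover have "1 * (pi / real n) \<le> (2 * real k - 1) * (pi / real n)"
        using False pn by (intro mult_right_mono) auto
      moreover have "(2 * real k - 1) * (pi / real n) \<le> (2 * real n - 1) * (pi / real n)"
        using k(1) pn by (intro mult_right_mono) auto
      moreover have "(2 * real n - 1) * (pi / real n) = 2 * pi - pi / real n" using n0 by (simp add: field_simps)
      ultimately show ?thesis using pn by (intro cos_le_cos_between) auto
    qed (simp add: \<phi>_def)
    then have "(cmod (Z 0))\<^sup>2 * cos (\<phi> - pi / real n) \<le> (cmod (Z 0))\<^sup>2 * cos (pi / real n)"
      by (intro mult_left_mono) auto
    ultimately have "(1 - (cmod (Z 0))\<^sup>2) * cos (pi / real n)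
       \<le> (1 - (cmod (Z 0))\<^sup>2) * (cosh (s / 2) * cos (\<alpha> + pi / real n))"
      by (simp add: algebra_simps)
    then have ge: "cos (pi / real n) \<le> cosh (s / 2) * cos (\<alpha> + pi / real n)"
      using one_minus_norm_pos[OF Zd[of 0]] by simp
    then have "0 < cos (\<alpha> + pi / real n)"
      using cp cosh_real_pos[of "s/2"] by (meson less_le_trans zero_less_mult_pos)
    moreover have "\<bar>\<alpha>\<bar> < pi / 2" unfolding \<alpha>_def by (rule circle_chord(2)[OF Zd])
    ultimately have "\<alpha> + pi / real n < pi / 2"
      using pn by (intro abs_less_cos_pos) auto
    then show ?thesis using ge unfolding A by simp
  qed
  have mono: "cyc_area n z / (2 * real n) + pi / real n \<le> cyc_area n w / (2 * real n) + pi / real n"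
    using Sw n0 by (simp add: divide_right_mono)
  show "cyc_area n z / (2 * real n) + pi / real n < pi / 2" using mono key by linarith
  have lo: "0 \<le> cyc_area n z / (2 * real n) + pi / real n" using S pn by simp
  \<comment> \<open>From the maximiser back to \<open>z\<close>: the area of \<open>z\<close> is not
    larger, which can only raise the cosine, and the length bound \<open>L\<close> can only raise
    the cosh. The arguments stay between 0 and \<pi>/2, where the cosine decreases.\<close>
  have "cos (cyc_area n w / (2 * real n) + pi / real n) \<le> cos (cyc_area n z / (2 * real n) + pi / real n)"
    using mono lo key by (intro cos_monotone_0_pi_le) auto
  moreover have "0 \<le> cos (cyc_area n w / (2 * real n) + pi / real n)"
    using mono lo key by (intro cos_ge_zero) auto
  moreover have "cosh (s / 2) \<le> cosh (L / (2 * real n))"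
  proof -
    have "s / 2 \<le> L / (2 * real n)" using sn n0 by (simp add: field_simps)
    then show ?thesis using s0 by (simp add: cosh_real_nonneg_le_iff)
  qed
  ultimately have "cosh (s / 2) * cos (cyc_area n w / (2 * real n) + pi / real n)
    \<le> cosh (L / (2 * real n)) * cos (cyc_area n z / (2 * real n) + pi / real n)"
    by (intro mult_mono) (auto simp: cosh_real_nonneg)
  then show "cos (pi / real n) \<le> cosh (cyc_len n z / (2 * real n)) * cos (cyc_area n z / (2 * real n) + pi / real n)"
    using key unfolding L_def by linarith
qed

section \<open>Area in the Klein chart\<close>

text \<open>Carries integrals between \<open>complex\<close>, \<open>real ^ 2\<close> and
  \<open>real \<times> real\<close> along coordinate maps that send boxes to boxes of the same
  content. The change of variables is carried out on \<open>real ^ 2\<close>, Fubini on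
  pairs.\<close>

lemma has_integral_box_iso:
  fixes g :: "'a::euclidean_space \<Rightarrow> 'b::euclidean_space" and f :: "'b \<Rightarrow> real"
  assumes hg: "\<And>x. h (g x) = x" and gh: "\<And>x. g (h x) = x" and contg: "\<And>x. continuous (at x) g"
    and g: "\<And>u v. \<exists>w z. g ` cbox u v = cbox w z" and h: "\<And>u v. \<exists>w z. h ` cbox u v = cbox w z"
    and c: "\<And>u v. measure lborel (g ` cbox u v) = measure lborel (cbox u v)"
    and S: "bounded S" and f: "(f has_integral i) S"
  shows "((\<lambda>x. f (g x)) has_integral i) (h ` S)"
proof -
  obtain a b where ab: "S \<subseteq> cbox a b" using bounded_subset_cbox_symmetric[OF S] by blast
  have "((\<lambda>x. if x \<in> S then f x else 0) has_integral i) (cbox a b)"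
    using f by (simp only: has_integral_restrict[OF ab])
  note F = this
  have "((\<lambda>x. (\<lambda>x. if x \<in> S then f x else 0) (g x)) has_integral (1 / 1) *\<^sub>R i) (h ` cbox a b)"
  proof (rule has_integral_twiddle)
    show "0 < (1::real)" by (rule zero_less_one)
    show "measure lborel (g ` cbox u v) = 1 * measure lborel (cbox u v)" for u v
      unfolding c mult_1 ..
  qed (rule hg gh contg g h F)+
  then have "((\<lambda>x. if g x \<in> S then f (g x) else 0) has_integral i) (h ` cbox a b)"
    by (simp only: div_by_1 scaleR_one)
  moreover have "g x \<in> S \<longleftrightarrow> x \<in> h ` S" for x by (metis gh hg image_iff)
  ultimately have "((\<lambda>x. if x \<in> h ` S then f (g x) else 0) has_integral i) (h ` cbox a b)" by simp
  then show ?thesis by (simp only: has_integral_restrict[OF image_mono[OF ab]])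
qed

lemma content_cbox_complex:
  "measure lborel (cbox u v) = (if Re u \<le> Re v \<and> Im u \<le> Im v then (Re v - Re u) * (Im v - Im u) else 0)"
proof -
  have "cbox u v = {} \<longleftrightarrow> \<not> (Re u \<le> Re v \<and> Im u \<le> Im v)"
    unfolding box_eq_empty Basis_complex_def by auto
  moreover have "(\<Prod>i\<in>Basis. v \<bullet> i - u \<bullet> i) = (Re v - Re u) * (Im v - Im u)"
    unfolding Basis_complex_def by simp
  ultimately show ?thesis unfolding content_cbox_if by simp
qed

definition cvec :: "real ^ 2 \<Rightarrow> complex" where "cvec v = Complex (v $ 1) (v $ 2)"
definition vecc :: "complex \<Rightarrow> real ^ 2" where "vecc z = vector [Re z, Im z]"

lemma cvec_vecc [simp]: "cvec (vecc z) = z" "vecc (cvec v) = v"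
  by (simp_all add: cvec_def vecc_def vec_eq_iff forall_2)

lemma vecc_nth [simp]: "vecc z $ 1 = Re z" "vecc z $ 2 = Im z"
  by (simp_all add: vecc_def)

lemma cvec_sel [simp]: "Re (cvec v) = v $ 1" "Im (cvec v) = v $ 2"
  by (simp_all add: cvec_def)

lemma linear_cvec: "linear cvec" and linear_vecc: "linear vecc"
  by (rule linearI; simp add: complex_eq_iff vec_eq_iff forall_2)+

lemma cvec_cbox: "cvec ` cbox u v = cbox (cvec u) (cvec v)"
proof -
  have "z \<in> cvec ` cbox u v \<longleftrightarrow> vecc z \<in> cbox u v" for z by (metis cvec_vecc image_iff)
  then show ?thesis by (auto simp: mem_box_cart forall_2 in_cbox_complex_iff)
qed

lemma vecc_cbox: "vecc ` cbox u v = cbox (vecc u) (vecc v)"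
proof -
  have "z \<in> vecc ` cbox u v \<longleftrightarrow> cvec z \<in> cbox u v" for z by (metis cvec_vecc image_iff)
  then show ?thesis by (auto simp: mem_box_cart forall_2 in_cbox_complex_iff)
qed

lemma content_cvec: "measure lborel (cvec ` cbox u v) = measure lborel (cbox u v)"
proof -
  have "(\<exists>i::2. Q i) \<longleftrightarrow> Q 1 \<or> Q 2" for Q by (metis exhaust_2)
  then have "cbox u v = {} \<longleftrightarrow> \<not> (u $ 1 \<le> v $ 1 \<and> u $ 2 \<le> v $ 2)"
    unfolding interval_eq_empty_cart by (simp add: not_le)
  then show ?thesis
    unfolding cvec_cbox content_cbox_complex content_cbox_if_cart by (simp add: UNIV_2)
qed

lemma content_vecc: "measure lborel (vecc ` cbox u v) = measure lborel (cbox u v)"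
  using content_cvec[of "vecc u" "vecc v"] unfolding vecc_cbox cvec_cbox by simp

lemma has_integral_cvec:
  fixes f :: "complex \<Rightarrow> real"
  assumes "bounded S" "(f has_integral i) S"
  shows "((\<lambda>x. f (cvec x)) has_integral i) (vecc ` S)"
  by (rule has_integral_box_iso[OF _ _ _ _ _ content_cvec assms])
     (use cvec_cbox vecc_cbox in \<open>auto simp: linear_continuous_at linear_conv_bounded_linear[symmetric] linear_cvec\<close>)

lemma has_integral_vecc:
  fixes f :: "real ^ 2 \<Rightarrow> real"
  assumes "bounded S" "(f has_integral i) S"
  shows "((\<lambda>x. f (vecc x)) has_integral i) (cvec ` S)"
  by (rule has_integral_box_iso[OF _ _ _ _ _ content_vecc assms])
     (use cvec_cbox vecc_cbox in \<open>auto simp: linear_continuous_at linear_conv_bounded_linear[symmetric] linear_vecc\<close>)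

lemma bounded_vecc: "bounded S \<Longrightarrow> bounded (vecc ` S)"
  by (rule bounded_linear_image) (simp_all add: linear_conv_bounded_linear[symmetric] linear_vecc)

lemma integral_cvec:
  fixes f :: "complex \<Rightarrow> real"
  assumes S: "bounded S"
  shows "f integrable_on S \<longleftrightarrow> (\<lambda>x. f (cvec x)) integrable_on (vecc ` S)"
    and "integral S f = integral (vecc ` S) (\<lambda>x. f (cvec x))"
proof -
  have e: "cvec ` vecc ` S = S" by (simp add: image_image)
  have 1: "(f has_integral i) S \<longleftrightarrow> ((\<lambda>x. f (cvec x)) has_integral i) (vecc ` S)" for i
    using has_integral_cvec[OF S, of f i] has_integral_vecc[OF bounded_vecc[OF S], of "\<lambda>x. f (cvec x)" i]
    unfolding e by auto
  then show 2: "f integrable_on S \<longleftrightarrow> (\<lambda>x. f (cvec x)) integrable_on (vecc ` S)"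
    by (simp add: integrable_on_def)
  show "integral S f = integral (vecc ` S) (\<lambda>x. f (cvec x))"
    using 1 2 by (metis integrable_integral integral_unique not_integrable_integral)
qed

lemma absolutely_integrable_cvec:
  fixes f :: "complex \<Rightarrow> real"
  assumes "bounded S"
  shows "f absolutely_integrable_on S \<longleftrightarrow> (\<lambda>x. f (cvec x)) absolutely_integrable_on (vecc ` S)"
  using integral_cvec(1)[OF assms, of f] integral_cvec(1)[OF assms, of "\<lambda>x. norm (f x)"]
  by (simp add: absolutely_integrable_on_def)

text \<open>Every real-linear map of the plane has the form h -> A h + B cnj h. With
  \<open>A\<close> and \<open>B\<close> the two Wirtinger derivatives this is the Jacobian
  determinant.\<close>

lemma det_complex_linear:
  "det (matrix (\<lambda>v. vecc (A * cvec v + B * cnj (cvec v)))) = (cmod A)\<^sup>2 - (cmod B)\<^sup>2"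
  unfolding cmod_power2 by (simp add: det_2 matrix_def axis_def algebra_simps power2_eq_square)

lemma integral_complex_change_of_variables:
  fixes f :: "complex \<Rightarrow> real" and g :: "complex \<Rightarrow> complex"
  assumes S: "S \<in> sets borel" "bounded S" "bounded (g ` S)"
    and der: "\<And>x. x \<in> S \<Longrightarrow> (g has_derivative (\<lambda>h. A x * h + B x * cnj h)) (at x within S)"
    and inj: "inj_on g S" and f: "f absolutely_integrable_on (g ` S)"
  shows "integral (g ` S) f = integral S (\<lambda>x. \<bar>(cmod (A x))\<^sup>2 - (cmod (B x))\<^sup>2\<bar> * f (g x))"
proof -
  define S' where "S' = vecc ` S"
  define G where "G v = vecc (g (cvec v))" for v
  define G' where "G' v h = vecc (A (cvec v) * cvec h + B (cvec v) * cnj (cvec h))" for v h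
  have S'e: "S' = cvec -` S" unfolding S'_def by (auto simp: image_iff) (metis cvec_vecc(2))
  have "cvec \<in> borel_measurable borel"
    by (intro borel_measurable_continuous_onI linear_continuous_on) (simp add: linear_conv_bounded_linear[symmetric] linear_cvec)
  then have "S' \<in> sets borel" unfolding S'e using measurable_sets[of cvec borel borel S] S(1) by simp
  then have S'l: "S' \<in> sets lebesgue" by (simp add: sets_completionI_sets)
  have GS: "G ` S' = vecc ` g ` S" unfolding G_def S'_def by (simp add: image_image)
  have der': "(G has_derivative G' v) (at v within S')" if "v \<in> S'" for v
  proof -
    have v: "cvec v \<in> S" using that S'e by simp
    have bl: "bounded_linear cvec" "bounded_linear vecc"
      by (simp_all add: linear_conv_bounded_linear[symmetric] linear_cvec linear_vecc)
    have "((\<lambda>v. g (cvec v)) has_derivative (\<lambda>h. A (cvec v) * cvec h + B (cvec v) * cnj (cvec h))) (at v within S')"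
      by (rule has_derivative_in_compose[OF bounded_linear_imp_has_derivative[OF bl(1)], of g _ , simplified])
        (rule has_derivative_subset[OF der[OF v]], use S'e in auto)
    from bounded_linear.has_derivative[OF bl(2) this] show ?thesis unfolding G_def G'_def .
  qed
  have inj': "inj_on G S'"
  proof (rule inj_onI)
    fix x y assume "x \<in> S'" "y \<in> S'" "G x = G y"
    then have "cvec x = cvec y" using inj S'e unfolding G_def by (metis cvec_vecc(1) inj_onD vimageE)
    then show "x = y" by (metis cvec_vecc(2))
  qed
  \<comment> \<open>The change of variables formula is applied to vector-valued integrands, so the
    real integrand is wrapped as a vector of length 1.\<close>
  define F :: "real ^ 2 \<Rightarrow> real ^ 1" where "F v = vec (f (cvec v))" for v
  have "(\<lambda>v. f (cvec v)) absolutely_integrable_on (G ` S')"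
    using f absolutely_integrable_cvec[OF S(3), of f] by (simp add: GS)
  then have "F absolutely_integrable_on (G ` S')"
    unfolding absolutely_integrable_on_1_iff F_def by simp
  then have "integral (G ` S') F = integral S' (\<lambda>x. \<bar>det (matrix (G' x))\<bar> *\<^sub>R F (G x))"
    using integral_change_of_variables[OF S'l der' inj', of F] by blast
  then have "integral (G ` S') (\<lambda>v. f (cvec v)) = integral S' (\<lambda>v. \<bar>det (matrix (G' v))\<bar> * f (cvec (G v)))"
    unfolding integral_on_1_eq F_def by (simp add: vec_eq_iff)
  moreover have "det (matrix (G' v)) = (cmod (A (cvec v)))\<^sup>2 - (cmod (B (cvec v)))\<^sup>2" for v
    unfolding G'_def by (rule det_complex_linear)
  ultimately have "integral (vecc ` g ` S) (\<lambda>v. f (cvec v))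
    = integral (vecc ` S) (\<lambda>v. \<bar>(cmod (A (cvec v)))\<^sup>2 - (cmod (B (cvec v)))\<^sup>2\<bar> * f (g (cvec v)))"
    unfolding GS by (simp add: G_def S'_def)
  then show ?thesis
    using integral_cvec(2)[OF S(3), of f]
      integral_cvec(2)[OF S(2), of "\<lambda>x. \<bar>(cmod (A x))\<^sup>2 - (cmod (B x))\<^sup>2\<bar> * f (g x)"] by simp
qed

text \<open>The hyperbolic area density in the Klein chart.\<close>

definition klein_density :: "complex \<Rightarrow> real" where
  "klein_density w = 1 / (sqrt (1 - (cmod w)\<^sup>2)) ^ 3"

lemma continuous_on_klein_density:
  assumes "\<And>x. x \<in> S \<Longrightarrow> continuous (at x within S) g" "\<And>x. x \<in> S \<Longrightarrow> cmod (g x) < 1"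
  shows "continuous_on S (\<lambda>x. klein_density (g x))"
proof -
  have "continuous_on S g" using assms(1) by (simp add: continuous_on_eq_continuous_within)
  moreover have "sqrt (1 - (cmod (g x))\<^sup>2) ^ 3 \<noteq> 0" if "x \<in> S" for x
    using one_minus_norm_pos[OF assms(2)[OF that]] by simp
  ultimately show ?thesis unfolding klein_density_def by (intro continuous_intros) auto
qed

lemma klein_has_derivative:
  "(klein has_derivative (\<lambda>h. 2 / (1 + z * cnj z)\<^sup>2 * h + (- 2 * z\<^sup>2 / (1 + z * cnj z)\<^sup>2) * cnj h)) (at z within S)"
proof -
  have nz: "1 + z * cnj z \<noteq> 0" for z
  proof -
    have "1 + z * cnj z = of_real (1 + (cmod z)\<^sup>2)" by (simp only: of_real_add of_real_1 complex_norm_square)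
    then show ?thesis by (metis of_real_eq_0_iff add_pos_nonneg less_irrefl zero_le_power2 zero_less_one)
  qed
  have k: "klein = (\<lambda>z. 2 * z / (1 + z * cnj z))"
    unfolding klein_def of_real_add of_real_1 complex_norm_square ..
  have "((\<lambda>z. 2 * z / (1 + z * cnj z)) has_derivative
     (\<lambda>h. (2 * h * (1 + z * cnj z) - 2 * z * (z * cnj h + h * cnj z)) / ((1 + z * cnj z) * (1 + z * cnj z)))) (at z within S)"
    using nz by (auto intro!: derivative_eq_intros bounded_linear.has_derivative[OF bounded_linear_cnj])
  moreover have "(2 * h * (1 + z * cnj z) - 2 * z * (z * cnj h + h * cnj z)) / ((1 + z * cnj z) * (1 + z * cnj z))
     = 2 / (1 + z * cnj z)\<^sup>2 * h + (- 2 * z\<^sup>2 / (1 + z * cnj z)\<^sup>2) * cnj h" for h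
  proof -
    have "2 * h * (1 + z * cnj z) - 2 * z * (z * cnj h + h * cnj z) = 2 * h + (- 2 * z\<^sup>2) * cnj h"
      by (simp add: algebra_simps power2_eq_square)
    then show ?thesis unfolding power2_eq_square[of "1 + z * cnj z", symmetric]
      by (simp add: diff_divide_distrib)
  qed
  ultimately show ?thesis unfolding k by simp
qed

lemma klein_jacobian:
  assumes "cmod z < 1"
  shows "\<bar>(cmod (2 / (1 + z * cnj z)\<^sup>2))\<^sup>2 - (cmod (- 2 * z\<^sup>2 / (1 + z * cnj z)\<^sup>2))\<^sup>2\<bar> * klein_density (klein z)
    = 4 / (1 - (cmod z)\<^sup>2)\<^sup>2"
proof -
  define r where "r = (cmod z)\<^sup>2"
  have r: "0 \<le> r" "r < 1" using assms by (simp_all add: r_def abs_square_less_1)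
  have "1 + z * cnj z = of_real (1 + r)" by (simp only: of_real_add of_real_1 complex_norm_square r_def)
  then have n: "cmod (1 + z * cnj z) = 1 + r" using r by (simp del: of_real_add)
  have "(cmod (2 / (1 + z * cnj z)\<^sup>2))\<^sup>2 - (cmod (- 2 * z\<^sup>2 / (1 + z * cnj z)\<^sup>2))\<^sup>2
     = 4 / ((1 + r)\<^sup>2)\<^sup>2 - 4 * r\<^sup>2 / ((1 + r)\<^sup>2)\<^sup>2"
    by (simp only: norm_divide norm_power n) (simp add: norm_mult norm_power power_divide power_mult_distrib r_def)
  also have "\<dots> = 4 * ((1 - r) * (1 + r)) / ((1 + r)\<^sup>2)\<^sup>2"
    by (simp add: diff_divide_distrib[symmetric] power2_eq_square algebra_simps)
  also have "\<dots> = 4 * (1 - r) / (1 + r) ^ 3"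
    using r by (simp add: power2_eq_square power3_eq_cube)
  finally have J: "(cmod (2 / (1 + z * cnj z)\<^sup>2))\<^sup>2 - (cmod (- 2 * z\<^sup>2 / (1 + z * cnj z)\<^sup>2))\<^sup>2 = 4 * (1 - r) / (1 + r) ^ 3" .
  have "sqrt (1 - (cmod (klein z))\<^sup>2) = (1 - r) / (1 + r)"
    unfolding one_minus_klein using r by (simp add: r_def)
  then have D: "klein_density (klein z) = (1 + r) ^ 3 / (1 - r) ^ 3"
    by (simp add: klein_density_def power_divide)
  have "4 * (1 - r) / (1 + r) ^ 3 * ((1 + r) ^ 3 / (1 - r) ^ 3) = 4 * (1 - r) / (1 - r) ^ 3"
    using r by simp
  also have "\<dots> = 4 / (1 - r)\<^sup>2"
  proof -
    have "4 * x / x ^ 3 = 4 / x\<^sup>2" if "x \<noteq> 0" for x :: real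
      using that by (simp add: power2_eq_square power3_eq_cube)
    moreover have "1 - r \<noteq> 0" using r by simp
    ultimately show ?thesis .
  qed
  finally show ?thesis unfolding J D using r by (simp add: r_def[symmetric])
qed

lemma klein_inj: "inj_on klein (ball 0 1)"
  by (auto simp: inj_on_def klein_eq_iff)

text \<open>Compactness keeps \<open>R\<close> and its image away from the unit circle, so both
  densities are continuous on compact sets and absolutely integrable. The Jacobian then converts one
  density into the other.\<close>

lemma integral_klein_compact:
  assumes R: "compact R" "R \<subseteq> ball 0 1"
  shows "(LINT z:R|lborel. 4 / (1 - (cmod z)\<^sup>2)\<^sup>2) = integral (klein ` R) klein_density"
proof -
  have cz: "1 - (cmod z)\<^sup>2 \<noteq> 0" if "z \<in> R" for z
    using one_minus_norm_pos[of z] R(2) that by auto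
  have "continuous_on R (\<lambda>z. 4 / (1 - (cmod z)\<^sup>2)\<^sup>2)"
    using cz by (intro continuous_intros) auto
  then have "set_integrable lborel R (\<lambda>z. 4 / (1 - (cmod z)\<^sup>2)\<^sup>2)"
    unfolding set_integrable_def by (rule borel_integrable_compact[OF R(1)])
  then have 1: "(LINT z:R|lborel. 4 / (1 - (cmod z)\<^sup>2)\<^sup>2) = integral R (\<lambda>z. 4 / (1 - (cmod z)\<^sup>2)\<^sup>2)"
    by (rule set_borel_integral_eq_integral(2))
  have "continuous_on R klein"
    unfolding continuous_on_eq_continuous_within using klein_has_derivative has_derivative_continuous by blast
  then have K: "compact (klein ` R)" using R(1) by (rule compact_continuous_image)
  have Kd: "cmod w < 1" if "w \<in> klein ` R" for w using that R(2) klein_in_disc by auto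
  have "continuous_on (klein ` R) klein_density"
    by (rule continuous_on_klein_density[of "klein ` R" "\<lambda>x. x"]) (use Kd in auto)
  then have "set_integrable lborel (klein ` R) klein_density"
    unfolding set_integrable_def by (rule borel_integrable_compact[OF K])
  then have "klein_density integrable_on (klein ` R)"
    by (rule set_borel_integral_eq_integral(1))
  then have ai: "klein_density absolutely_integrable_on (klein ` R)"
    by (rule nonnegative_absolutely_integrable_1)
      (use Kd one_minus_norm_pos in \<open>auto simp: klein_density_def less_imp_le\<close>)
  have "integral (klein ` R) klein_density
     = integral R (\<lambda>z. \<bar>(cmod (2 / (1 + z * cnj z)\<^sup>2))\<^sup>2 - (cmod (- 2 * z\<^sup>2 / (1 + z * cnj z)\<^sup>2))\<^sup>2\<bar> * klein_density (klein z))"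
    by (rule integral_complex_change_of_variables)
      (use R K ai klein_has_derivative klein_inj in \<open>auto simp: compact_imp_bounded borel_compact intro: inj_on_subset\<close>)
  also have "\<dots> = integral R (\<lambda>z. 4 / (1 - (cmod z)\<^sup>2)\<^sup>2)"
    by (rule integral_cong) (use R(2) klein_jacobian in auto)
  finally show ?thesis using 1 by simp
qed

section \<open>Areas of triangles with one vertex at the centre\<close>

definition cross :: "complex \<Rightarrow> complex \<Rightarrow> real" where
  "cross a b = Re a * Im b - Im a * Re b"

text \<open>In the Klein chart \<open>tval a b\<close> is the signed hyperbolic area of the triangle with vertices \<open>0\<close>, \<open>a\<close>, \<open>b\<close>.\<close>

definition kq :: "complex \<Rightarrow> real" where "kq w = sqrt (1 - (cmod w)\<^sup>2)"

definition tval :: "complex \<Rightarrow> complex \<Rightarrow> real" where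
  "tval a b = 2 * arctan (cross a b / ((1 + kq a) * (1 + kq b) - Re (b * cnj a)))"

lemma kq_pos: "cmod w < 1 \<Longrightarrow> 0 < kq w"
  using one_minus_norm_pos[of w] by (simp add: kq_def)

lemma kq_sq: "cmod w < 1 \<Longrightarrow> (kq w)\<^sup>2 = 1 - (cmod w)\<^sup>2"
  using one_minus_norm_pos[of w] by (simp add: kq_def)

lemma Re_mult_cnj_less_1: "cmod a < 1 \<Longrightarrow> cmod b < 1 \<Longrightarrow> Re (b * cnj a) < 1"
  using one_minus_mult_Re_pos[of b "cnj a"] by simp

lemma tri_term_klein:
  assumes z: "cmod z < 1" "cmod z' < 1"
  shows "tri_term z z' = tval (klein z) (klein z')"
proof -
  define a b where "a = klein z" and "b = klein z'"
  have ab: "cmod a < 1" "cmod b < 1" using z klein_in_disc by (auto simp: a_def b_def)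
  have "unklein a = z" "unklein b = z'"
    using klein_unklein[OF ab(1)] klein_unklein[OF ab(2)] klein_eq_iff z unfolding a_def b_def by metis+
  then have zz: "z = a / of_real (1 + kq a)" "z' = b / of_real (1 + kq b)"
    by (simp_all add: unklein_def kq_def)
  define K where "K = (1 + kq a) * (1 + kq b)"
  have q: "0 < kq a" "0 < kq b" using kq_pos ab by auto
  then have K: "1 < K" unfolding K_def by (simp add: algebra_simps add_pos_pos)
  have "1 - z * cnj z' = of_real (1 / K) * (of_real K - a * cnj b)"
  proof -
    have "z * cnj z' = a * cnj b / of_real K" unfolding zz K_def by simp
    then show ?thesis using K by (simp add: field_simps)
  qed
  then have "Arg (1 - z * cnj z') = Arg (of_real K - a * cnj b)"
    using K by (simp only: Arg_times_of_real[of "1 / K"] zero_less_divide_1_iff)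
  also have "\<dots> = arctan (Im (of_real K - a * cnj b) / Re (of_real K - a * cnj b))"
    using Re_mult_cnj_less_1[OF ab] K by (intro arg_conv_arctan) (simp add: mult.commute)
  also have "Im (of_real K - a * cnj b) / Re (of_real K - a * cnj b) = cross a b / (K - Re (b * cnj a))"
    by (simp add: cross_def algebra_simps)
  finally show ?thesis unfolding tri_term_def tval_def a_def[symmetric] b_def[symmetric] K_def by simp
qed

lemma cross_self [simp]: "cross a a = 0" by (simp add: cross_def)

lemma cross_Lagrange: "(cross a e)\<^sup>2 = (cmod a)\<^sup>2 * (cmod e)\<^sup>2 - (Re (e * cnj a))\<^sup>2"
  unfolding cmod_power2 cross_def by (simp add: power2_eq_square algebra_simps)

text \<open>As the end \<open>w u\<close> slides along a line, the triangle over 0 gains a thin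
  sector. The right-hand side is \<open>cross a e\<close> times the radial integral of the density
  computed in \<open>radial_integral\<close>, so integrating it in \<open>u\<close> gives the
  area.\<close>

lemma tval_deriv:
  fixes a e :: complex and u :: real
  defines "w \<equiv> \<lambda>u. a + of_real u * e"
  assumes a: "cmod a < 1" and w: "cmod (w u) < 1"
  shows "((\<lambda>u. tval a (w u)) has_real_derivative cross a e / (kq (w u) * (1 + kq (w u)))) (at u)"
proof -
  define n0 n1 n2 c p q where "n0 = (cmod a)\<^sup>2" and "n1 = Re (e * cnj a)" and "n2 = (cmod e)\<^sup>2"
    and "c = cross a e" and "p = kq a" and "q = kq (w u)"
  define m where "m = u * n1"
  have Nw: "(cmod (w u))\<^sup>2 = n0 + 2 * u * n1 + u\<^sup>2 * n2" for u
    unfolding w_def cmod_sq_affine n0_def n1_def n2_def by simp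
  have q: "0 < q" "q\<^sup>2 = 1 - (n0 + 2 * u * n1 + u\<^sup>2 * n2)"
    using kq_pos[OF w] kq_sq[OF w] by (simp_all add: q_def Nw)
  have p: "0 < p" "p\<^sup>2 = 1 - n0" using kq_pos[OF a] kq_sq[OF a] by (simp_all add: p_def n0_def)
  have dot: "Re (w u * cnj a) = n0 + u * n1" for u
    unfolding w_def n0_def n1_def cmod_power2 by (simp add: algebra_simps power2_eq_square)
  have cr: "cross a (w u) = u * c" for u by (simp add: w_def c_def cross_def algebra_simps)
  define D where "D u = (1 + p) * (1 + sqrt (1 - (n0 + 2 * u * n1 + u\<^sup>2 * n2))) - (n0 + u * n1)" for u
  have tv: "tval a (w u) = 2 * arctan (u * c / D u)" for u
    unfolding tval_def cr dot D_def kq_def[of "w u"] Nw p_def ..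
  have qs: "sqrt (1 - (n0 + 2 * u * n1 + u\<^sup>2 * n2)) = q" unfolding q_def kq_def Nw ..
  have Du: "D u = (1 + p) * (1 + q) - (1 - p\<^sup>2) - m" unfolding D_def qs m_def p(2) by simp
  have dotl: "n0 + m < 1" using Re_mult_cnj_less_1[OF a w] unfolding dot m_def by simp
  \<comment> \<open>The common factor that makes the quotient collapse: the Lagrange identity turns
    D^2 + u^2 c^2 into 2 (1 + p) (1 + q) M, and D - u D' equals (1 + p) M / q.\<close>
  define M where "M = p * q + p\<^sup>2 - m"
  have Mpos: "0 < M" 
  proof -
    have "0 < p * q" using p q by simp
    then show ?thesis using dotl unfolding M_def p(2) by linarith
  qed
  have Dpos: "0 < D u"
  proof -
    have "D u = M + p + q" unfolding Du M_def by (simp add: algebra_simps power2_eq_square)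
    then show ?thesis using Mpos p q by linarith
  qed
  define D' where "D' = (1 + p) * (- (n1 + u * n2) / q) - n1"
  have "(D has_real_derivative D') (at u)"
  proof -
    have "1 - (n0 + 2 * u * n1 + u\<^sup>2 * n2) > 0" using q by (metis zero_less_power)
    then have "((\<lambda>u. sqrt (1 - (n0 + 2 * u * n1 + u\<^sup>2 * n2))) has_real_derivative
       (- (2 * n1 + 2 * u * n2)) * (inverse (sqrt (1 - (n0 + 2 * u * n1 + u\<^sup>2 * n2))) / 2)) (at u)"
      by (auto intro!: derivative_eq_intros)
    then have "((\<lambda>u. sqrt (1 - (n0 + 2 * u * n1 + u\<^sup>2 * n2))) has_real_derivative - (n1 + u * n2) / q) (at u)"
    proof (rule DERIV_cong)
      have "- (2 * x) * (inverse q / 2) = - x / q" for x using q(1) by (simp add: field_simps)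
      from this[of "n1 + u * n2"]
      show "(- (2 * n1 + 2 * u * n2)) * (inverse (sqrt (1 - (n0 + 2 * u * n1 + u\<^sup>2 * n2))) / 2) = - (n1 + u * n2) / q"
        unfolding qs by (simp only: distrib_left mult.assoc)
    qed
    moreover have "((\<lambda>u. (1 + p) * (1 + s u) - (n0 + u * n1)) has_real_derivative (1 + p) * s' - n1) (at u)"
      if "(s has_real_derivative s') (at u)" for s s'
      using that by (auto intro!: derivative_eq_intros)
    ultimately show ?thesis unfolding D_def D'_def by blast
  qed
  then have "((\<lambda>u. 2 * arctan (u * c / D u)) has_real_derivative
     2 * (inverse (1 + (u * c / D u)\<^sup>2) * ((c * D u - u * c * D') / (D u * D u)))) (at u)"
    using Dpos by (auto intro!: derivative_eq_intros)
  moreover have "2 * (inverse (1 + (u * c / D u)\<^sup>2) * ((c * D u - u * c * D') / (D u * D u)))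
      = 2 * c * (D u - u * D') / ((D u)\<^sup>2 + u\<^sup>2 * c\<^sup>2)"
  proof -
    have "1 + (u * c / D u)\<^sup>2 = ((D u)\<^sup>2 + u\<^sup>2 * c\<^sup>2) / (D u)\<^sup>2"
      using Dpos by (simp add: power_divide power_mult_distrib add_divide_distrib)
    moreover have "2 * (inverse (E / X\<^sup>2) * (Y / (X * X))) = 2 * Y / E" if "X \<noteq> 0" for E X Y :: real
      using that by (simp add: power2_eq_square)
    moreover have "c * D u - u * c * D' = c * (D u - u * D')" by (simp add: algebra_simps)
    ultimately show ?thesis using Dpos by simp
  qed
  moreover have "(D u)\<^sup>2 + u\<^sup>2 * c\<^sup>2 = 2 * ((1 + p) * (1 + q)) * M"
  proof -
    have k: "u\<^sup>2 * n2 = p\<^sup>2 - 2 * m - q\<^sup>2" using q(2) p(2) by (simp add: m_def)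
    have "u\<^sup>2 * c\<^sup>2 = n0 * (u\<^sup>2 * n2) - m\<^sup>2"
    proof -
      have "c\<^sup>2 = n0 * n2 - n1\<^sup>2" unfolding c_def n0_def n1_def n2_def by (rule cross_Lagrange)
      then show ?thesis unfolding m_def by (simp only: power_mult_distrib) (simp add: algebra_simps)
    qed
    also have "\<dots> = (1 - p\<^sup>2) * (p\<^sup>2 - 2 * m - q\<^sup>2) - m\<^sup>2" unfolding k using p(2) by simp
    finally show ?thesis unfolding Du M_def by (simp add: power2_eq_square algebra_simps)
  qed
  moreover have "D u - u * D' = (1 + p) * M / q"
  proof -
    have k: "u * (u * n2) = p\<^sup>2 - 2 * m - q\<^sup>2" using q(2) p(2) by (simp add: m_def power2_eq_square)
    have "q * (D u - u * D') = q * D u + (1 + p) * (u * n1 + u * (u * n2)) + q * (u * n1)"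
      unfolding D'_def using q(1) by (simp add: field_simps)
    also have "\<dots> = (1 + p) * M" unfolding k Du M_def m_def[symmetric] by (simp add: power2_eq_square algebra_simps)
    finally show ?thesis using q(1) by (simp add: field_simps)
  qed
  moreover have "2 * c * ((1 + p) * M / q) / (2 * ((1 + p) * (1 + q)) * M) = c / (q * (1 + q))"
  proof -
    have "2 * c * (P * M / q) / (2 * (P * Q) * M) = c / (q * Q)" if "P > 0" "M > 0" "q > 0" "Q > 0" for c P M q Q :: real
      using that by (simp add: field_simps)
    from this[of "1 + p" M q "1 + q"] show ?thesis using p q Mpos by simp
  qed
  ultimately show ?thesis unfolding tv c_def[symmetric] q_def[symmetric] by (simp only:)
qed

text \<open>The antiderivative is 1 / (N sqrt (1 - l^2 N)) with N = |w|^2, which is where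
  \<open>w \<noteq> 0\<close> enters. Writing N as (1 - q) (1 + q) brings the result into a form
  without this singularity.\<close>

lemma radial_integral:
  assumes w: "cmod w < 1" "w \<noteq> 0"
  shows "((\<lambda>l. l * klein_density (of_real l * w)) has_integral 1 / (kq w * (1 + kq w))) {0..1}"
proof -
  define N q where "N = (cmod w)\<^sup>2" and "q = kq w"
  have N: "0 < N" "N < 1" using w by (simp_all add: N_def abs_square_less_1)
  have q: "0 < q" "q\<^sup>2 = 1 - N" using kq_pos[OF w(1)] kq_sq[OF w(1)] by (simp_all add: q_def N_def)
  have "((\<lambda>l. l * klein_density (of_real l * w)) has_integral 1 / (N * sqrt (1 - 1\<^sup>2 * N)) - 1 / (N * sqrt (1 - 0\<^sup>2 * N))) {0..1}"
  proof (rule fundamental_theorem_of_calculus)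
    fix l :: real assume l: "l \<in> {0..1}"
    have "l\<^sup>2 * N < 1"
      using l N by (metis abs_square_le_1 abs_of_nonneg atLeastAtMost_iff less_eq_real_def mult_left_le_one_le order_le_less_trans zero_le_power2)
    then have s: "0 < 1 - l\<^sup>2 * N" by simp
    define t where "t = sqrt (1 - l\<^sup>2 * N)"
    have t: "0 < t" using s by (simp add: t_def)
    have "((\<lambda>l. sqrt (1 - l\<^sup>2 * N)) has_real_derivative - l * N / t) (at l within {0..1})"
      using s t unfolding t_def by (auto intro!: derivative_eq_intros simp: field_simps)
    note d = this
    have "N * sqrt (1 - l\<^sup>2 * N) \<noteq> 0" using t N by (simp add: t_def)
    from DERIV_divide[OF DERIV_const[of 1] DERIV_cmult[OF d, of N] this]
    have "((\<lambda>l. 1 / (N * sqrt (1 - l\<^sup>2 * N))) has_real_derivative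
       - (N * (- l * N / t)) / (N * t * (N * t))) (at l within {0..1})"
      unfolding t_def[symmetric] by (rule DERIV_cong) simp
    moreover have "- (N * (- l * N / t)) / (N * t * (N * t)) = l / t ^ 3"
      using t N by (simp add: field_simps power3_eq_cube)
    moreover have "l * klein_density (of_real l * w) = l / t ^ 3"
      using l by (simp add: klein_density_def norm_mult power_mult_distrib t_def N_def)
    ultimately show "((\<lambda>l. 1 / (N * sqrt (1 - l\<^sup>2 * N))) has_vector_derivative l * klein_density (of_real l * w)) (at l within {0..1})"
      by (simp add: has_real_derivative_iff_has_vector_derivative)
  qed simp
  moreover have "1 / (N * sqrt (1 - 1\<^sup>2 * N)) - 1 / (N * sqrt (1 - 0\<^sup>2 * N)) = 1 / (q * (1 + q))"
  proof -
    have sq: "sqrt (1 - N) = q" using q by (metis real_sqrt_unique less_imp_le)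
    have "q < 1" using q N by (metis abs_square_less_1 abs_of_pos diff_less_eq less_add_same_cancel1)
    moreover have "N = (1 - q) * (1 + q)" using q by (simp add: power2_eq_square algebra_simps)
    moreover have "1 / ((1 - q) * P * q) - 1 / ((1 - q) * P) = 1 / (q * P)" if "q < 1" "0 < q" "0 < P" for q P :: real
    proof -
      have "1 / (r * P * q) - 1 / (r * P) = (1 - q) / (r * P * q)" if "r \<noteq> 0" "P \<noteq> 0" "q \<noteq> 0" for r
        using that by (simp add: field_simps)
      from this[of "1 - q"] show ?thesis using that by simp
    qed
    from this[of q "1 + q"] have "1 / ((1 - q) * (1 + q) * q) - 1 / ((1 - q) * (1 + q)) = 1 / (q * (1 + q))"
      using \<open>q < 1\<close> q by simp
    ultimately show ?thesis using sq by simp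
  qed
  ultimately show ?thesis by (simp add: q_def)
qed

lemma convex_comb_in_disc:
  assumes "cmod a < 1" "cmod b < 1" "0 \<le> u" "u \<le> 1"
  shows "cmod (a + of_real u * (b - a)) < 1"
proof -
  have "a + of_real u * (b - a) = (1 - u) *\<^sub>R a + u *\<^sub>R b"
    by (simp add: scaleR_conv_of_real algebra_simps)
  moreover have "(1 - u) *\<^sub>R a + u *\<^sub>R b \<in> ball 0 1"
    using assms by (intro convexD_alt[OF convex_ball]) auto
  ultimately show ?thesis by simp
qed

text \<open>The coordinates are swapped so that the outer integral runs over the position
  \<open>u\<close> along the side and the inner one over the radial parameter
  \<open>l\<close>.\<close>

definition pairc :: "real \<times> real \<Rightarrow> complex" where "pairc = (\<lambda>(u, l). Complex l u)"
definition cpair :: "complex \<Rightarrow> real \<times> real" where "cpair z = (Im z, Re z)"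

lemma pairc_cpair [simp]: "pairc (cpair z) = z" "cpair (pairc p) = p"
  by (simp_all add: pairc_def cpair_def split: prod.splits)

lemma pairc_cbox: "pairc ` cbox u v = cbox (pairc u) (pairc v)"
proof -
  have "z \<in> pairc ` cbox u v \<longleftrightarrow> cpair z \<in> cbox u v" for z by (metis pairc_cpair image_iff)
  then show ?thesis
    by (auto simp: in_cbox_complex_iff cpair_def pairc_def split: prod.splits)
qed

lemma cpair_cbox: "cpair ` cbox u v = cbox (cpair u) (cpair v)"
proof -
  have "z \<in> cpair ` cbox u v \<longleftrightarrow> pairc z \<in> cbox u v" for z by (metis pairc_cpair image_iff)
  then show ?thesis
    by (auto simp: in_cbox_complex_iff cpair_def pairc_def split: prod.splits)
qed

lemma integral_unit_square:
  fixes F :: "complex \<Rightarrow> real"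
  assumes F: "continuous_on (cbox 0 (Complex 1 1)) F"
  shows "integral (cbox 0 (Complex 1 1)) F = integral {0..1} (\<lambda>u. integral {0..1} (\<lambda>l. F (Complex l u)))"
proof -
  have lin: "linear pairc" by (rule linearI) (auto simp: pairc_def complex_eq_iff split: prod.splits)
  have cont: "continuous (at x) pairc" for x
    by (simp add: linear_continuous_at linear_conv_bounded_linear[symmetric] lin)
  have "(F has_integral integral (cbox 0 (Complex 1 1)) F) (cbox 0 (Complex 1 1))"
    using F by (simp add: integrable_continuous integrable_integral)
  then have "((\<lambda>x. F (pairc x)) has_integral integral (cbox 0 (Complex 1 1)) F) (cpair ` cbox 0 (Complex 1 1))"
  proof (rule has_integral_box_iso[rotated -1])
    show "measure lborel (pairc ` cbox u v) = measure lborel (cbox u v)" for u v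
      unfolding pairc_cbox content_cbox_complex
      by (cases u; cases v) (auto simp: pairc_def content_Pair content_real_if)
    show "\<exists>w z. pairc ` cbox u v = cbox w z" for u v using pairc_cbox by blast
    show "\<exists>w z. cpair ` cbox u v = cbox w z" for u v using cpair_cbox by blast
  qed (use cont in auto)
  then have I: "((\<lambda>x. F (pairc x)) has_integral integral (cbox 0 (Complex 1 1)) F) (cbox (0, 0) (1, 1))"
    unfolding cpair_cbox by (simp add: cpair_def)
  have "continuous_on (cbox (0, 0) (1, 1)) (\<lambda>x. F (pairc x))"
  proof (rule continuous_on_compose2[OF F])
    show "continuous_on (cbox (0, 0) (1, 1)) pairc" using cont by (simp add: continuous_at_imp_continuous_on)
    show "pairc ` cbox (0, 0) (1, 1) \<subseteq> cbox 0 (Complex 1 1)" unfolding pairc_cbox by (auto simp: pairc_def in_cbox_complex_iff)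
  qed
  from integral_prod_continuous[OF this] show ?thesis
    using integral_unique[OF I] by (simp add: pairc_def cbox_interval)
qed

lemma cross_eq_0_collinear:
  assumes "cross a b \<noteq> 0"
  shows "\<not> collinear {0, a, b}"
  using assms by (auto simp: collinear_lemma cross_def)

lemma interior_hull_triangle:
  assumes "cross a b \<noteq> 0"
  shows "interior (convex hull {0, a, b}) = {v. \<exists>y z. 0 < y \<and> 0 < z \<and> y + z < 1 \<and> of_real y * a + of_real z * b = v}"
proof -
  have "(\<exists>x y z. 0 < x \<and> 0 < y \<and> 0 < z \<and> x + y + z = 1 \<and> x *\<^sub>R 0 + y *\<^sub>R a + z *\<^sub>R b = v)
     \<longleftrightarrow> (\<exists>y z. 0 < y \<and> 0 < z \<and> y + z < 1 \<and> of_real y * a + of_real z * b = v)" for v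
  proof (intro iffI; elim exE conjE)
    fix x y z :: real
    assume "0 < x" "0 < y" "0 < z" "x + y + z = 1" "x *\<^sub>R 0 + y *\<^sub>R a + z *\<^sub>R b = v"
    then show "\<exists>y z. 0 < y \<and> 0 < z \<and> y + z < 1 \<and> of_real y * a + of_real z * b = v"
      by (intro exI[of _ y] exI[of _ z]) (simp add: scaleR_conv_of_real)
  next
    fix y z :: real
    assume "0 < y" "0 < z" "y + z < 1" "of_real y * a + of_real z * b = v"
    then show "\<exists>x y z. 0 < x \<and> 0 < y \<and> 0 < z \<and> x + y + z = 1 \<and> x *\<^sub>R 0 + y *\<^sub>R a + z *\<^sub>R b = v"
      by (intro exI[of _ "1 - y - z"] exI[of _ y] exI[of _ z]) (simp add: scaleR_conv_of_real)
  qed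
  then show ?thesis
    unfolding interior_convex_hull_3_minimal[OF cross_eq_0_collinear[OF assms] DIM_complex] by simp
qed

lemma interior_hull_degenerate:
  assumes "cross a b = 0"
  shows "interior (convex hull {0, a, b}) = {}"
proof -
  define n where "n = (if a = 0 then if b = 0 then 1 else \<i> * b else \<i> * a)"
  have n: "n \<noteq> 0" by (simp add: n_def)
  have "{0, a, b} \<subseteq> {x. n \<bullet> x = 0}"
    using assms by (auto simp: n_def cross_def inner_complex_def)
  then have "convex hull {0, a, b} \<subseteq> {x. n \<bullet> x = 0}"
    by (rule hull_minimal) (rule convex_hyperplane)
  then have "interior (convex hull {0, a, b}) \<subseteq> interior {x. n \<bullet> x = 0}" by (rule interior_mono)
  then show ?thesis using interior_hyperplane[OF n] by simp
qed

lemma hull_triangle_in_disc: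
  assumes "cmod a < 1" "cmod b < 1"
  shows "convex hull {0, a, b} \<subseteq> ball 0 1"
  by (rule hull_minimal) (use assms in auto)

text \<open>The open unit square is mapped onto the open triangle by (l, u) -> l (a + u (b - a)),
  with Jacobian l times \<open>cross a b\<close>. The inner integral is
  \<open>radial_integral\<close>, and \<open>tval a\<close> is an antiderivative for the outer one.
  In the degenerate case both sides are 0.\<close>

lemma triangle_has_integral:
  assumes a: "cmod a < 1" and b: "cmod b < 1"
  shows "(klein_density has_integral sgn (cross a b) * tval a b) (interior (convex hull {0, a, b}))"
proof (cases "cross a b = 0")
  case True
  then show ?thesis by (simp add: interior_hull_degenerate)
next
  case False
  define T where "T = interior (convex hull {0, a, b})"
  define c where "c = cross a b"
  define e where "e = b - a"
  have c: "c \<noteq> 0" using False by (simp add: c_def)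
  have ce: "cross a e = c" by (simp add: c_def e_def cross_def algebra_simps)
  have hull: "compact (convex hull {0, a, b})" by (simp add: compact_convex_hull)
  have hd: "cmod x < 1" if "x \<in> convex hull {0, a, b}" for x
    using hull_triangle_in_disc[OF a b] that by auto
  have "continuous_on (convex hull {0, a, b}) klein_density"
    by (rule continuous_on_klein_density[of _ "\<lambda>x. x"]) (use hd in auto)
  then have "set_integrable lborel (convex hull {0, a, b}) klein_density"
    unfolding set_integrable_def by (rule borel_integrable_compact[OF hull])
  then have "set_integrable lborel T klein_density"
    by (rule set_integrable_subset) (auto simp: T_def interior_subset)
  then have int: "klein_density integrable_on T" by (rule set_borel_integral_eq_integral(1))
  have pos: "0 \<le> klein_density x" if "x \<in> T" for x
  proof -
    have "cmod x < 1" using that hd interior_subset[THEN subsetD] unfolding T_def by blast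
    then show ?thesis using one_minus_norm_pos[of x] by (simp add: klein_density_def)
  qed
  have ai: "klein_density absolutely_integrable_on T"
    using int pos by (rule nonnegative_absolutely_integrable_1)
  define S where "S = box 0 (Complex 1 1)"
  have S: "z \<in> S \<longleftrightarrow> 0 < Re z \<and> Re z < 1 \<and> 0 < Im z \<and> Im z < 1" for z
    by (auto simp: S_def in_box_complex_iff)
  define w where "w u = a + of_real u * e" for u
  define g where "g z = of_real (Re z) * w (Im z)" for z
  have gab: "g z = of_real (Re z * (1 - Im z)) * a + of_real (Re z * Im z) * b" for z
    by (simp add: g_def w_def e_def algebra_simps)
  have gS: "g ` S = T"
  proof
    show "g ` S \<subseteq> T"
    proof
      fix v assume "v \<in> g ` S"
      then obtain z where z: "z \<in> S" "v = g z" by auto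
      have "0 < Re z * (1 - Im z)" "0 < Re z * Im z" "Re z * (1 - Im z) + Re z * Im z < 1"
        using z S by (simp_all add: algebra_simps)
      then show "v \<in> T" unfolding T_def interior_hull_triangle[OF False] z(2) gab by blast
    qed
    show "T \<subseteq> g ` S"
    proof
      fix v assume "v \<in> T"
      then obtain y z where yz: "0 < y" "0 < z" "y + z < 1" "v = of_real y * a + of_real z * b"
        unfolding T_def interior_hull_triangle[OF False] by auto
      define x where "x = Complex (y + z) (z / (y + z))"
      have "x \<in> S" using yz by (simp add: x_def S)
      moreover have "Re x * (1 - Im x) = y" "Re x * Im x = z" using yz by (simp_all add: x_def field_simps)
      ultimately show "v \<in> g ` S" using yz(4) gab by (metis image_eqI)
    qed
  qed
  \<comment> \<open>The parameters are recovered from the two cross products with \<open>a\<close>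
    and with \<open>b\<close>, which are nonzero multiples of the barycentric coordinates.\<close>
  have inj: "inj_on g S"
  proof (rule inj_onI)
    fix x y assume xy: "x \<in> S" "y \<in> S" "g x = g y"
    have ca: "cross a (g z) = Re z * Im z * c" for z
      unfolding gab c_def by (simp add: cross_def algebra_simps)
    have cb: "cross (g z) b = Re z * (1 - Im z) * c" for z
      unfolding gab c_def by (simp add: cross_def algebra_simps)
    have 1: "Re x * Im x = Re y * Im y" using ca[of x] ca[of y] c xy by simp
    have "Re x * (1 - Im x) = Re y * (1 - Im y)" using cb[of x] cb[of y] c xy by simp
    then have "Re x = Re y" using 1 by (simp add: algebra_simps)
    then show "x = y" using 1 xy S by (simp add: complex_eq_iff)
  qed
  define A where "A z = (w (Im z) - \<i> * of_real (Re z) * e) / 2" for z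
  define B where "B z = (w (Im z) + \<i> * of_real (Re z) * e) / 2" for z
  have der: "(g has_derivative (\<lambda>h. A z * h + B z * cnj h)) (at z within S)" for z
  proof -
    have "(g has_derivative (\<lambda>h. of_real (Re h) * w (Im z) + of_real (Re z) * (of_real (Im h) * e))) (at z within S)"
      unfolding g_def w_def
      by (auto intro!: derivative_eq_intros bounded_linear.has_derivative[OF bounded_linear_Re]
          bounded_linear.has_derivative[OF bounded_linear_Im] bounded_linear.has_derivative[OF bounded_linear_of_real])
    moreover have "of_real (Re h) * w (Im z) + of_real (Re z) * (of_real (Im h) * e) = A z * h + B z * cnj h" for h
      unfolding A_def B_def by (simp add: complex_eq_iff field_simps)
    ultimately show ?thesis by simp
  qed
  have jac: "(cmod (A z))\<^sup>2 - (cmod (B z))\<^sup>2 = Re z * c" for z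
  proof -
    have "cross (w (Im z)) e = c" unfolding ce[symmetric] w_def by (simp add: cross_def algebra_simps)
    moreover have "(cmod (A z))\<^sup>2 - (cmod (B z))\<^sup>2 = Re z * cross (w (Im z)) e"
      unfolding A_def B_def cmod_power2 cross_def by (simp add: power2_eq_square field_simps)
    ultimately show ?thesis by simp
  qed
  define F where "F z = \<bar>c\<bar> * (Re z * klein_density (of_real (Re z) * w (Im z)))" for z
  have "integral (g ` S) klein_density = integral S (\<lambda>z. \<bar>(cmod (A z))\<^sup>2 - (cmod (B z))\<^sup>2\<bar> * klein_density (g z))"
  proof (rule integral_complex_change_of_variables)
    show "S \<in> sets borel" "bounded S" by (simp_all add: S_def bounded_box)
    show "bounded (g ` S)" unfolding gS T_def
      by (rule bounded_subset[OF compact_imp_bounded[OF hull] interior_subset])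
  qed (use der inj ai gS in auto)
  also have "\<dots> = integral S F"
    by (rule integral_cong) (use S in \<open>simp add: jac F_def g_def abs_mult mult_ac\<close>)
  also have "\<dots> = integral (cbox 0 (Complex 1 1)) F"
    unfolding S_def by (rule integral_open_interval)
  also have "\<dots> = integral {0..1} (\<lambda>u. integral {0..1} (\<lambda>l. F (Complex l u)))"
  proof (rule integral_unit_square)
    have "continuous_on (cbox 0 (Complex 1 1)) (\<lambda>z. klein_density (of_real (Re z) * w (Im z)))"
    proof (rule continuous_on_klein_density)
      fix z assume "z \<in> cbox 0 (Complex 1 1)"
      then have z: "0 \<le> Re z" "Re z \<le> 1" "0 \<le> Im z" "Im z \<le> 1" by (auto simp: in_cbox_complex_iff)
      show "continuous (at z within cbox 0 (Complex 1 1)) (\<lambda>z. of_real (Re z) * w (Im z))"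
        unfolding w_def
        by (intro continuous_intros linear_continuous_within bounded_linear_Re bounded_linear_Im)
      have "cmod (w (Im z)) < 1" unfolding w_def e_def using convex_comb_in_disc[OF a b z(3,4)] .
      then show "cmod (of_real (Re z) * w (Im z)) < 1"
        using z by (simp add: norm_mult) (meson le_less_trans mult_left_le_one_le norm_ge_zero)
    qed
    then show "continuous_on (cbox 0 (Complex 1 1)) F" unfolding F_def by (intro continuous_intros)
  qed
  also have "\<dots> = integral {0..1} (\<lambda>u. \<bar>c\<bar> * (1 / (kq (w u) * (1 + kq (w u)))))"
  proof (rule integral_cong)
    fix u :: real assume u: "u \<in> {0..1}"
    have "cmod (w u) < 1" unfolding w_def e_def using convex_comb_in_disc[OF a b] u by simp
    moreover have "w u \<noteq> 0"
    proof
      assume "w u = 0"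
      then have "a = - (of_real u * e)" by (simp add: w_def add_eq_0_iff2)
      then have "cross a e = 0" by (simp add: cross_def)
      then show False using c ce by simp
    qed
    ultimately have "((\<lambda>l. l * klein_density (of_real l * w u)) has_integral 1 / (kq (w u) * (1 + kq (w u)))) {0..1}"
      by (rule radial_integral)
    from integral_unique[OF this]
    show "integral {0..1} (\<lambda>l. F (Complex l u)) = \<bar>c\<bar> * (1 / (kq (w u) * (1 + kq (w u))))"
      by (simp add: F_def)
  qed
  also have "\<dots> = sgn c * tval a b"
  proof -
    have "((\<lambda>u. c / (kq (w u) * (1 + kq (w u)))) has_integral tval a (w 1) - tval a (w 0)) {0..1}"
    proof (rule fundamental_theorem_of_calculus)
      fix u :: real assume u: "u \<in> {0..1}"
      have "cmod (w u) < 1" unfolding w_def e_def using convex_comb_in_disc[OF a b] u by simp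
      then have "((\<lambda>u. tval a (w u)) has_real_derivative c / (kq (w u) * (1 + kq (w u)))) (at u)"
        using tval_deriv[OF a, of u e] unfolding ce w_def by simp
      then show "((\<lambda>u. tval a (w u)) has_vector_derivative c / (kq (w u) * (1 + kq (w u)))) (at u within {0..1})"
        by (simp add: has_real_derivative_iff_has_vector_derivative has_vector_derivative_at_within)
    qed simp
    moreover have "tval a (w 1) = tval a b" "tval a (w 0) = 0" by (simp_all add: w_def e_def tval_def)
    ultimately have "((\<lambda>u. c / (kq (w u) * (1 + kq (w u)))) has_integral tval a b) {0..1}" by simp
    from has_integral_mult_right[OF this, of "sgn c"]
    moreover have "sgn c * (c / y) = \<bar>c\<bar> * (1 / y)" for y by (simp add: sgn_if abs_if)
    ultimately show ?thesis by (simp only: integral_unique)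
  qed
  finally have "integral T klein_density = sgn c * tval a b" unfolding gS .
  then show ?thesis using int unfolding T_def c_def by (metis integrable_integral)
qed

section \<open>Simple polygons and winding numbers\<close>

text \<open>An n-periodic sequence of vertices, so that \<open>Suc i\<close> needs no reduction
  modulo \<open>n\<close>; \<open>cyc_sum\<close> by contrast reduces the index.\<close>

definition simple_polygon :: "nat \<Rightarrow> (nat \<Rightarrow> complex) \<Rightarrow> bool" where
  "simple_polygon n w \<longleftrightarrow> 3 \<le> n \<and> (\<forall>i. w (i + n) = w i) \<and> inj_on w {..<n} \<and>
     (\<forall>i<n. \<forall>j<n. i \<noteq> j \<longrightarrow> closed_segment (w i) (w (Suc i)) \<inter> closed_segment (w j) (w (Suc j))
        = {w i, w (Suc i)} \<inter> {w j, w (Suc j)})"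

definition polygon_boundary :: "nat \<Rightarrow> (nat \<Rightarrow> complex) \<Rightarrow> complex set" where
  "polygon_boundary n w = (\<Union>i<n. closed_segment (w i) (w (Suc i)))"

text \<open>Traverses the sides 0 to \<open>k\<close>, that is \<open>k + 1\<close> of them; the
  closed polygon is the path for \<open>n - 1\<close>.\<close>

primrec polygon_path :: "(nat \<Rightarrow> complex) \<Rightarrow> nat \<Rightarrow> real \<Rightarrow> complex" where
  "polygon_path w 0 = linepath (w 0) (w 1)"
| "polygon_path w (Suc k) = polygon_path w k +++ linepath (w (Suc k)) (w (Suc (Suc k)))"

lemma polygon_path_start [simp]: "pathstart (polygon_path w k) = w 0"
  by (induction k) simp_all

lemma polygon_path_finish [simp]: "pathfinish (polygon_path w k) = w (Suc k)"
  by (cases k) simp_all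

lemma path_polygon_path [simp]: "path (polygon_path w k)"
  by (induction k) auto

lemma path_image_polygon_path:
  "path_image (polygon_path w k) = (\<Union>i\<le>k. closed_segment (w i) (w (Suc i)))"
  by (induction k) (auto simp: path_image_join atMost_Suc)

lemma winding_polygon_path:
  assumes "z \<notin> path_image (polygon_path w k)"
  shows "winding_number (polygon_path w k) z = (\<Sum>i\<le>k. winding_number (linepath (w i) (w (Suc i))) z)"
  using assms
proof (induction k)
  case (Suc k)
  have "z \<notin> (\<Union>i\<le>Suc k. closed_segment (w i) (w (Suc i)))"
    using Suc.prems unfolding path_image_polygon_path .
  then have "z \<notin> path_image (polygon_path w k)" "z \<notin> closed_segment (w (Suc k)) (w (Suc (Suc k)))"
    unfolding path_image_polygon_path by (auto simp: atMost_Suc)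
  then show ?case using Suc.IH by (simp add: winding_number_join)
qed simp

lemma simple_polygonD:
  assumes "simple_polygon n w"
  shows "3 \<le> n" "\<And>i. w (i + n) = w i" "w n = w 0"
    "\<And>i j. i < n \<Longrightarrow> j < n \<Longrightarrow> w i = w j \<longleftrightarrow> i = j"
    "\<And>i j x. i < n \<Longrightarrow> j < n \<Longrightarrow> i \<noteq> j \<Longrightarrow> x \<in> closed_segment (w i) (w (Suc i)) \<Longrightarrow>
       x \<in> closed_segment (w j) (w (Suc j)) \<Longrightarrow> x \<in> {w i, w (Suc i)} \<and> x \<in> {w j, w (Suc j)}"
proof -
  show "3 \<le> n" and per: "\<And>i. w (i + n) = w i" using assms by (auto simp: simple_polygon_def)
  show "w n = w 0" using per[of 0] by simp
  show "\<And>i j. i < n \<Longrightarrow> j < n \<Longrightarrow> w i = w j \<longleftrightarrow> i = j"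
    using assms by (auto simp: simple_polygon_def inj_on_def)
  show "\<And>i j x. i < n \<Longrightarrow> j < n \<Longrightarrow> i \<noteq> j \<Longrightarrow> x \<in> closed_segment (w i) (w (Suc i)) \<Longrightarrow>
       x \<in> closed_segment (w j) (w (Suc j)) \<Longrightarrow> x \<in> {w i, w (Suc i)} \<and> x \<in> {w j, w (Suc j)}"
    using assms unfolding simple_polygon_def by blast
qed

lemma simple_polygon_consecutive:
  assumes "simple_polygon n w" "i < n"
  shows "w i \<noteq> w (Suc i)"
proof (cases "Suc i < n")
  case True
  then show ?thesis using simple_polygonD(4)[OF assms(1), of i "Suc i"] assms(2) by simp
next
  case False
  then have "Suc i = n" using assms(2) by simp
  then show ?thesis using simple_polygonD(1,3)[OF assms(1)] simple_polygonD(4)[OF assms(1), of i 0] assms(2) by auto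
qed

text \<open>All sides but the last form an arc, since each new side meets the earlier ones only in
  its initial vertex. The last side closes the arc and meets it only in its two ends.\<close>

lemma simple_polygon_path:
  assumes P: "simple_polygon n w"
  shows "simple_path (polygon_path w (n - 1))" "pathfinish (polygon_path w (n - 1)) = pathstart (polygon_path w (n - 1))"
    "path_image (polygon_path w (n - 1)) = polygon_boundary n w"
proof -
  note D = simple_polygonD[OF P]
  obtain m where m: "n = Suc (Suc m)" "0 < m" using D(1) by (cases n; cases "n - 1") auto
  have arc: "arc (polygon_path w k)" if "k \<le> m" for k
    using that
  proof (induction k)
    case 0
    then show ?case using simple_polygon_consecutive[OF P, of 0] m by simp
  next
    case (Suc k)
    have "x = w (Suc k)" if "x \<in> path_image (polygon_path w k)" "x \<in> closed_segment (w (Suc k)) (w (Suc (Suc k)))" for x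
    proof -
      have x: "x \<in> path_image (polygon_path w k)" by (rule that(1))
      obtain i where i: "i \<le> k" "x \<in> closed_segment (w i) (w (Suc i))"
      proof -
        have "x \<in> (\<Union>i\<le>k. closed_segment (w i) (w (Suc i)))"
          using x by (simp only: path_image_polygon_path)
        then show thesis by (elim UN_E) (rule that, simp_all)
      qed
      have "i < n" "Suc k < n" "i \<noteq> Suc k" using i(1) Suc.prems m(1) by linarith+
      from D(5)[OF this i(2) that(2)]
      have "x \<in> {w i, w (Suc i)} \<and> x \<in> {w (Suc k), w (Suc (Suc k))}" .
      moreover have "w i \<noteq> w (Suc k)" "w i \<noteq> w (Suc (Suc k))" "w (Suc i) \<noteq> w (Suc (Suc k))"
        using D(4)[of i "Suc k"] D(4)[of i "Suc (Suc k)"] D(4)[of "Suc i" "Suc (Suc k)"] i(1) Suc.prems m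
        by auto
      ultimately show ?thesis by auto
    qed
    then show ?case
      using Suc simple_polygon_consecutive[OF P, of "Suc k"] m by (auto intro!: arc_join)
  qed
  have e: "n - 1 = Suc m" using m by simp
  show "simple_path (polygon_path w (n - 1))"
    unfolding e polygon_path.simps
  proof (rule simple_path_join_loop)
    show "arc (polygon_path w m)" using arc by simp
    show "arc (linepath (w (Suc m)) (w (Suc (Suc m))))"
      using simple_polygon_consecutive[OF P, of "Suc m"] m by simp
    show "path_image (polygon_path w m) \<inter> path_image (linepath (w (Suc m)) (w (Suc (Suc m))))
       \<subseteq> {pathstart (polygon_path w m), pathstart (linepath (w (Suc m)) (w (Suc (Suc m))))}"
    proof
      fix x assume x: "x \<in> path_image (polygon_path w m) \<inter> path_image (linepath (w (Suc m)) (w (Suc (Suc m))))"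
      then obtain i where i: "i \<le> m" "x \<in> closed_segment (w i) (w (Suc i))"
        by (auto simp: path_image_polygon_path)
      then have "x \<in> {w (Suc m), w (Suc (Suc m))}"
        using D(5)[of i "Suc m" x] x m by auto
      then show "x \<in> {pathstart (polygon_path w m), pathstart (linepath (w (Suc m)) (w (Suc (Suc m))))}"
        using D(3) m by auto
    qed
  qed (use D(3) m in auto)
  show "pathfinish (polygon_path w (n - 1)) = pathstart (polygon_path w (n - 1))"
    using D(3) m by simp
  have "{..n - 1} = {..<n}" using m by auto
  then show "path_image (polygon_path w (n - 1)) = polygon_boundary n w"
    by (simp only: path_image_polygon_path polygon_boundary_def)
qed

text \<open>A sum over the sides rather than the winding number of a path: it can be split by sides,
  it does not depend on the starting vertex, and off the boundary it agrees with the winding number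
  of the closed path.\<close>

definition polygon_winding :: "nat \<Rightarrow> (nat \<Rightarrow> complex) \<Rightarrow> complex \<Rightarrow> complex" where
  "polygon_winding n w z = (\<Sum>i<n. winding_number (linepath (w i) (w (Suc i))) z)"

lemma polygon_winding_eq:
  assumes P: "simple_polygon n w" and z: "z \<notin> polygon_boundary n w"
  shows "polygon_winding n w z = winding_number (polygon_path w (n - 1)) z"
proof -
  have "{..n - 1} = {..<n}" using simple_polygonD(1)[OF P] by auto
  note e = this
  have zz: "z \<notin> path_image (polygon_path w (n - 1))" using z by (subst simple_polygon_path(3)[OF P])
  show ?thesis unfolding polygon_winding_def winding_polygon_path[OF zz] e ..
qed

lemma polygon_orientation:
  assumes P: "simple_polygon n w"
  obtains s :: real where "s = 1 \<or> s = - 1"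
    "\<And>z. z \<in> inside (polygon_boundary n w) \<Longrightarrow> polygon_winding n w z = of_real s"
    "\<And>z. z \<in> outside (polygon_boundary n w) \<Longrightarrow> polygon_winding n w z = 0"
proof -
  note S = simple_polygon_path[OF P]
  define \<gamma> where "\<gamma> = polygon_path w (n - 1)"
  have w: "polygon_winding n w z = winding_number \<gamma> z" if "z \<in> inside (polygon_boundary n w) \<or> z \<in> outside (polygon_boundary n w)" for z
    unfolding \<gamma>_def using polygon_winding_eq[OF P] that inside_no_overlap outside_no_overlap by blast
  have out: "polygon_winding n w z = 0" if "z \<in> outside (polygon_boundary n w)" for z
    using w that winding_number_zero_in_outside[of \<gamma> z] S by (simp add: \<gamma>_def)
  from S(1) show ?thesis
  proof (cases rule: simple_closed_path_winding_number_inside)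
    case 1
    then show ?thesis using that[of 1] out w S(3) by (simp add: \<gamma>_def)
  next
    case 2
    then show ?thesis using that[of "- 1"] out w S(3) by (simp add: \<gamma>_def)
  qed
qed

lemma polygon_winding_convex:
  assumes P: "simple_polygon n w" and C: "convex C" "C \<inter> polygon_boundary n w = {}" "x \<in> C" "y \<in> C"
  shows "polygon_winding n w x = polygon_winding n w y"
proof -
  note S = simple_polygon_path[OF P]
  have "winding_number (polygon_path w (n - 1)) constant_on C"
    using C S by (intro winding_number_constant) (auto simp: convex_connected)
  then have "winding_number (polygon_path w (n - 1)) x = winding_number (polygon_path w (n - 1)) y"
    using C by (auto simp: constant_on_def)
  moreover have "x \<notin> polygon_boundary n w" "y \<notin> polygon_boundary n w" using C by auto
  ultimately show ?thesis using polygon_winding_eq[OF P] by simp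
qed

text \<open>A segment lies in the frontier of the degenerate triangle
  \<open>convex hull {a, b, b}\<close>, and the frontier of a convex set is negligible.\<close>

lemma negligible_closed_segment: "negligible (closed_segment a (b :: complex))"
proof -
  have "closed_segment a b \<subseteq> frontier (convex hull {a, b, b})"
    unfolding frontier_of_triangle[OF DIM_complex] by blast
  then show ?thesis
    using negligible_convex_frontier[of "convex hull {a, b, b}"] by (meson convex_convex_hull negligible_subset)
qed

text \<open>Coning off from 0: each closed triangle 0, \<open>w i\<close>, \<open>w (Suc i)\<close>
  contributes its signed indicator, and the winding numbers of the radial segments telescope around
  the polygon.\<close>

lemma polygon_winding_triangles:
  assumes P: "simple_polygon n w" and z: "z \<notin> polygon_boundary n w" "\<And>i. z \<notin> closed_segment 0 (w i)"
  shows "polygon_winding n w z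
    = (\<Sum>i<n. if z \<in> interior (convex hull {0, w i, w (Suc i)}) then of_real (sgn (cross (w i) (w (Suc i)))) else 0)"
proof -
  have tri: "winding_number (linepath 0 a) z + winding_number (linepath a b) z - winding_number (linepath 0 b) z
     = (if z \<in> interior (convex hull {0, a, b}) then of_real (sgn (cross a b)) else 0)"
    if n: "z \<notin> closed_segment 0 a" "z \<notin> closed_segment a b" "z \<notin> closed_segment 0 b" for a b
  proof -
    define T where "T = linepath 0 a +++ linepath a b +++ linepath b 0"
    have n': "z \<notin> closed_segment b 0" using n(3) by (simp add: closed_segment_commute)
    have "winding_number (linepath b 0) z = - winding_number (linepath 0 b) z"
      using winding_number_reversepath[of "linepath 0 b" z] n(3) by simp
    then have T: "winding_number T z = winding_number (linepath 0 a) z + winding_number (linepath a b) z - winding_number (linepath 0 b) z"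
      unfolding T_def using n n' by (simp add: winding_number_join path_image_join)
    show ?thesis
    proof (cases "z \<in> interior (convex hull {0, a, b})")
      case True
      then have c: "cross a b \<noteq> 0" using interior_hull_degenerate by auto
      then obtain y x where yx: "0 < y" "0 < x" "z = of_real y * a + of_real x * b"
        using True interior_hull_triangle[OF c] by auto
      have "Im ((a - 0) * cnj (a - z)) = x * cross a b"
        unfolding yx(3) cross_def by (simp add: algebra_simps)
      then have "0 < Im ((a - 0) * cnj (a - z)) \<longleftrightarrow> 0 < cross a b" using yx by (simp add: zero_less_mult_iff)
      then have "winding_number T z = of_real (sgn (cross a b))"
        unfolding T_def winding_number_triangle[OF True] using c by (auto simp: sgn_if)
      then show ?thesis using T True by simp
    next
      case False
      then have "z \<notin> convex hull {0, a, b}"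
        using n n' by (simp add: interior_of_triangle)
      then have "winding_number T z = 0"
      proof (rule winding_number_zero_outside[rotated 3])
        show "path_image T \<subseteq> convex hull {0, a, b}"
          unfolding T_def by (simp add: path_image_join) (simp add: closed_segment_subset_convex_hull hull_inc)
      qed (simp_all add: T_def)
      then show ?thesis using T False by simp
    qed
  qed
  have "(\<Sum>i<n. if z \<in> interior (convex hull {0, w i, w (Suc i)}) then of_real (sgn (cross (w i) (w (Suc i)))) else (0::complex))
     = (\<Sum>i<n. winding_number (linepath 0 (w i)) z + winding_number (linepath (w i) (w (Suc i))) z - winding_number (linepath 0 (w (Suc i))) z)"
  proof (rule sum.cong)
    fix i assume "i \<in> {..<n}"
    then have "z \<notin> closed_segment (w i) (w (Suc i))" using z(1) by (auto simp: polygon_boundary_def)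
    then show "(if z \<in> interior (convex hull {0, w i, w (Suc i)}) then of_real (sgn (cross (w i) (w (Suc i)))) else (0::complex))
      = winding_number (linepath 0 (w i)) z + winding_number (linepath (w i) (w (Suc i))) z - winding_number (linepath 0 (w (Suc i))) z"
      using tri[OF z(2) _ z(2)] by simp
  qed simp
  also have "\<dots> = polygon_winding n w z - (\<Sum>i<n. winding_number (linepath 0 (w (Suc i))) z - winding_number (linepath 0 (w i)) z)"
    unfolding polygon_winding_def sum_subtractf[symmetric] by (intro sum.cong) auto
  also have "(\<Sum>i<n. winding_number (linepath 0 (w (Suc i))) z - winding_number (linepath 0 (w i)) z) = 0"
    using sum_lessThan_telescope[of "\<lambda>i. winding_number (linepath 0 (w i)) z" n] simple_polygonD(3)[OF P] by simp
  finally show ?thesis by simp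
qed

text \<open>Up to the sign \<open>s\<close>, the indicator of the inside is the winding number,
  which is almost everywhere the signed sum of the triangle indicators. Integrated against the
  density, each triangle gives its \<open>tval\<close>.\<close>

lemma polygon_klein_area:
  assumes P: "simple_polygon n w" and d: "\<And>i. cmod (w i) < 1"
    and s: "s = 1 \<or> s = - 1" "\<And>z. z \<in> inside (polygon_boundary n w) \<Longrightarrow> polygon_winding n w z = of_real s"
    "\<And>z. z \<in> outside (polygon_boundary n w) \<Longrightarrow> polygon_winding n w z = 0"
  shows "integral (polygon_boundary n w \<union> inside (polygon_boundary n w)) klein_density
    = s * (\<Sum>i<n. tval (w i) (w (Suc i)))"
proof -
  define B where "B = polygon_boundary n w"
  define T where "T i = interior (convex hull {0, w i, w (Suc i)})" for i
  define c where "c i = sgn (cross (w i) (w (Suc i)))" for i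
  define N where "N = B \<union> (\<Union>i<n. closed_segment 0 (w i))"
  have "negligible N"
    unfolding N_def B_def polygon_boundary_def
    by (intro negligible_Un negligible_Union) (auto simp: negligible_closed_segment)
  have wi: "w i = w (i mod n)" for i
  proof -
    have "w (r + n * k) = w r" for r k
    proof (induction k)
      case (Suc k)
      have "w (r + n * Suc k) = w ((r + n * k) + n)" by (simp add: algebra_simps)
      then show ?case using Suc simple_polygonD(2)[OF P] by simp
    qed simp
    from this[of "i mod n" "i div n"] show ?thesis by (simp add: mult.commute)
  qed
  have n0: "0 < n" using simple_polygonD(1)[OF P] by simp
  have "((\<lambda>z. if z \<in> T i then klein_density z else 0) has_integral c i * tval (w i) (w (Suc i))) UNIV" for i
    unfolding T_def c_def using triangle_has_integral[OF d d] has_integral_restrict_UNIV by blast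
  from has_integral_mult_right[OF this]
  have "((\<lambda>z. \<Sum>i<n. s * c i * (if z \<in> T i then klein_density z else 0)) has_integral
     (\<Sum>i<n. s * c i * (c i * tval (w i) (w (Suc i))))) UNIV"
    by (intro has_integral_sum) auto
  \<comment> \<open>The sign of the triangle occurs twice and cancels. When the triangle is
    degenerate the sign is 0, but so is \<open>tval\<close>.\<close>
  moreover have "s * c i * (c i * tval (w i) (w (Suc i))) = s * tval (w i) (w (Suc i))" for i
    by (cases "cross (w i) (w (Suc i)) = 0") (auto simp: c_def sgn_if tval_def)
  ultimately have I: "((\<lambda>z. \<Sum>i<n. s * c i * (if z \<in> T i then klein_density z else 0)) has_integral
     s * (\<Sum>i<n. tval (w i) (w (Suc i)))) UNIV"
    by (simp add: sum_distrib_left)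
  have "((\<lambda>z. if z \<in> B \<union> inside B then klein_density z else 0) has_integral s * (\<Sum>i<n. tval (w i) (w (Suc i)))) UNIV"
  proof (rule has_integral_spike[OF \<open>negligible N\<close> _ I])
    fix z assume "z \<in> UNIV - N"
    then have z: "z \<notin> B" "\<And>i. z \<notin> closed_segment 0 (w i)"
    proof -
      show "z \<notin> B" using \<open>z \<in> UNIV - N\<close> by (simp add: N_def)
      fix i
      have "i mod n < n" using n0 by simp
      then have "z \<notin> closed_segment 0 (w (i mod n))" using \<open>z \<in> UNIV - N\<close> by (auto simp: N_def)
      then show "z \<notin> closed_segment 0 (w i)" by (subst wi)
    qed
    have "polygon_winding n w z = of_real (\<Sum>i<n. if z \<in> T i then c i else 0)"
      using polygon_winding_triangles[OF P, of z] z unfolding B_def T_def c_def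
      by (simp add: if_distrib[of complex_of_real] cong: if_cong)
    moreover have "polygon_winding n w z = of_real (if z \<in> inside B then s else 0)"
    proof (cases "z \<in> inside B")
      case False
      then have "z \<in> outside B" using z(1) union_with_outside[of B] inside_Un_outside[of B] by blast
      then show ?thesis using s(3) False by (simp add: B_def)
    qed (use s(2) in \<open>simp add: B_def\<close>)
    ultimately have e: "(\<Sum>i<n. if z \<in> T i then c i else 0) = (if z \<in> inside B then s else 0)"
      by (simp only: of_real_eq_iff)
    have "(\<Sum>i<n. s * c i * (if z \<in> T i then klein_density z else 0)) = s * klein_density z * (\<Sum>i<n. if z \<in> T i then c i else 0)"
      unfolding sum_distrib_left by (intro sum.cong) auto
    then show "(if z \<in> B \<union> inside B then klein_density z else 0) = (\<Sum>i<n. s * c i * (if z \<in> T i then klein_density z else 0))"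
      using z(1) s(1) unfolding e by auto
  qed
  then show ?thesis
    unfolding has_integral_restrict_UNIV B_def by (rule integral_unique)
qed

text \<open>The inverse map takes the component of the image point into the bounded component of
  \<open>x\<close>; its closure is compact, so mapping back gives a bounded set.\<close>

lemma homeo_image_inside_subset:
  fixes f g :: "complex \<Rightarrow> complex"
  assumes f: "continuous_on UNIV f" and g: "continuous_on UNIV g"
    and fg: "\<And>x. f (g x) = x" and gf: "\<And>x. g (f x) = x"
  shows "f ` inside S \<subseteq> inside (f ` S)"
proof
  fix y assume "y \<in> f ` inside S"
  then obtain x where x: "x \<in> inside S" "y = f x" by auto
  then have x': "x \<notin> S" "bounded (connected_component_set (- S) x)" by (auto simp: inside_def)
  have y: "y \<notin> f ` S" using x' x gf by (metis imageE)
  define D where "D = connected_component_set (- (f ` S)) y"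
  have "connected (g ` D)" unfolding D_def
    by (rule connected_continuous_image[OF continuous_on_subset[OF g]]) auto
  moreover have "x \<in> g ` D" unfolding D_def using y x gf by (metis ComplI connected_component_refl image_eqI mem_Collect_eq)
  moreover have "g ` D \<subseteq> - S"
  proof
    fix v assume "v \<in> g ` D"
    then obtain u where u: "u \<in> D" "v = g u" by auto
    then have "u \<notin> f ` S" using connected_component_subset[of "- (f ` S)" y] by (auto simp: D_def)
    then show "v \<in> - S" using u fg by (metis ComplI image_eqI)
  qed
  ultimately have "g ` D \<subseteq> connected_component_set (- S) x"
    by (intro connected_component_maximal) auto
  then have "bounded (g ` D)" using x'(2) bounded_subset by blast
  then have "bounded (f ` closure (g ` D))"
    by (intro compact_imp_bounded compact_continuous_image continuous_on_subset[OF f]) (auto simp: compact_closure)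
  moreover have "D \<subseteq> f ` closure (g ` D)"
    using closure_subset fg by (metis (no_types, lifting) image_eqI subsetD subsetI)
  ultimately have "bounded D" using bounded_subset by blast
  then show "y \<in> inside (f ` S)" using y by (simp add: inside_def D_def)
qed

lemma homeo_image_inside:
  fixes f g :: "complex \<Rightarrow> complex"
  assumes f: "continuous_on UNIV f" and g: "continuous_on UNIV g"
    and fg: "\<And>x. f (g x) = x" and gf: "\<And>x. g (f x) = x"
  shows "f ` inside S = inside (f ` S)"
proof
  show "f ` inside S \<subseteq> inside (f ` S)" by (rule homeo_image_inside_subset[OF assms])
  have "g ` inside (f ` S) \<subseteq> inside (g ` f ` S)" by (rule homeo_image_inside_subset[OF g f gf fg])
  moreover have "g ` f ` S = S" using gf by (simp add: image_image)
  ultimately show "inside (f ` S) \<subseteq> f ` inside S" using fg by (metis image_eqI image_subset_iff subsetI)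
qed

text \<open>\<open>inside\<close> refers to the complement in the whole plane, whereas the Klein
  chart is a bijection only on the disc. It fixes the unit circle pointwise and hence extends by the
  identity to a homeomorphism of the plane.\<close>

lemma klein_image_inside:
  assumes S: "closed S" "S \<subseteq> ball 0 1"
  shows "klein ` inside S = inside (klein ` S)" "inside S \<subseteq> ball 0 1"
proof -
  define f where "f z = (if cmod z \<le> 1 then klein z else z)" for z
  define g where "g w = (if cmod w \<le> 1 then unklein w else w)" for w
  have on1: "klein z = z" "unklein z = z" if "cmod z = 1" for z
    using that by (simp_all add: klein_def unklein_def)
  have cl: "closed {z :: complex. cmod z \<le> 1}" "closed {z :: complex. 1 \<le> cmod z}"
    by (intro closed_Collect_le continuous_intros)+
  have un: "UNIV = {z :: complex. cmod z \<le> 1} \<union> {z. 1 \<le> cmod z}" by auto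
  have ck: "continuous_on {z. cmod z \<le> 1} klein"
    unfolding continuous_on_eq_continuous_within using klein_has_derivative has_derivative_continuous by blast
  have f: "continuous_on UNIV f"
    unfolding un f_def using cl ck on1 by (intro continuous_on_cases) auto
  have cu: "continuous_on {z. cmod z \<le> 1} unklein"
  proof -
    have "complex_of_real (1 + sqrt (1 - (cmod w)\<^sup>2)) \<noteq> 0" if "cmod w \<le> 1" for w
    proof -
      have "0 \<le> 1 - (cmod w)\<^sup>2" using that by (simp add: abs_square_le_1)
      then have "0 < 1 + sqrt (1 - (cmod w)\<^sup>2)" by (simp add: add_pos_nonneg)
      then show ?thesis by (metis less_irrefl of_real_eq_0_iff)
    qed
    then show ?thesis unfolding unklein_def by (intro continuous_intros) auto
  qed
  have g: "continuous_on UNIV g"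
    unfolding un g_def using cl cu on1 by (intro continuous_on_cases) auto
  have lt: "cmod (klein z) < 1" "unklein (klein z) = z" if "cmod z < 1" for z
  proof -
    show "cmod (klein z) < 1" using klein_in_disc that .
    from klein_unklein[OF this] show "unklein (klein z) = z" using klein_eq_iff[of z "unklein (klein z)"] that by simp
  qed
  have fg: "f (g x) = x" for x
    using klein_unklein[of x] on1[of x] by (cases "cmod x < 1"; cases "cmod x = 1") (auto simp: f_def g_def)
  have gf: "g (f x) = x" for x
    using lt[of x] on1[of x] by (cases "cmod x < 1"; cases "cmod x = 1") (auto simp: f_def g_def)
  show sub: "inside S \<subseteq> ball 0 1"
  proof (rule ccontr)
    assume "\<not> inside S \<subseteq> ball 0 1"
    then obtain z where z: "z \<in> inside S" "z \<notin> ball 0 1" by blast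
    have "z \<in> outside (ball 0 1)" by (rule convex_in_outside[OF convex_ball z(2)])
    then have "z \<in> outside S" using outside_mono[OF S(2)] by blast
    then show False using z(1) inside_Int_outside[of S] by blast
  qed
  have "f ` inside S = inside (f ` S)" by (rule homeo_image_inside[OF f g fg gf])
  moreover have "f ` S = klein ` S" "f ` inside S = klein ` inside S"
    using S sub by (auto simp: f_def intro!: image_cong)
  ultimately show "klein ` inside S = inside (klein ` S)" by simp
qed

text \<open>What \<open>hyp_ngon\<close> demands apart from positive area, so that a polygon can be
  treated as simple before its area has been computed.\<close>

definition hyp_simple :: "nat \<Rightarrow> complex list \<Rightarrow> bool" where
  "hyp_simple n P \<longleftrightarrow> length P = n \<and> 3 \<le> n \<and> set P \<subseteq> hyp_plane \<and> distinct P \<and>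
     (\<forall>i<n. \<forall>j<n. i \<noteq> j \<longrightarrow>
        side P i \<inter> side P j = {P ! i, next_vertex P i} \<inter> {P ! j, next_vertex P j})"

definition verts :: "complex list \<Rightarrow> nat \<Rightarrow> complex" where
  "verts P i = P ! (i mod length P)"

lemma hyp_simple_disc:
  assumes "hyp_simple n P"
  shows "cmod (verts P i) < 1"
proof -
  have "verts P i \<in> set P" using assms unfolding verts_def hyp_simple_def
    by (metis gr0I length_greater_0_conv mod_less_divisor not_numeral_le_zero nth_mem)
  then show ?thesis using assms by (auto simp: hyp_simple_def hyp_plane_def)
qed

lemma verts_nth: "hyp_simple n P \<Longrightarrow> i < n \<Longrightarrow> P ! i = verts P i \<and> next_vertex P i = verts P (Suc i)"
  by (simp add: verts_def next_vertex_def hyp_simple_def)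

lemma side_verts: "hyp_simple n P \<Longrightarrow> i < n \<Longrightarrow> side P i = hyp_segment (verts P i) (verts P (Suc i))"
  by (simp add: side_def verts_nth)

lemma hyp_segment_disc: "hyp_segment a b \<subseteq> ball 0 1"
  by (auto simp: hyp_segment_def hyp_plane_def)

lemma hyp_simple_klein:
  assumes P: "hyp_simple n P"
  shows "simple_polygon n (\<lambda>i. klein (verts P i))"
    "klein ` boundary P = polygon_boundary n (\<lambda>i. klein (verts P i))"
    "boundary P \<subseteq> ball 0 1"
proof -
  have n: "length P = n" "3 \<le> n" using P by (auto simp: hyp_simple_def)
  note d = hyp_simple_disc[OF P]
  have ks: "closed_segment (klein (verts P i)) (klein (verts P (Suc i))) = klein ` hyp_segment (verts P i) (verts P (Suc i))" for i
    using klein_image_hyp_segment[OF d d] by simp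
  show sub: "boundary P \<subseteq> ball 0 1"
    unfolding boundary_def side_def using hyp_segment_disc by auto
  show "klein ` boundary P = polygon_boundary n (\<lambda>i. klein (verts P i))"
    unfolding boundary_def polygon_boundary_def ks image_UN n(1) using side_verts[OF P] by simp
  show "simple_polygon n (\<lambda>i. klein (verts P i))"
    unfolding simple_polygon_def
  proof (intro conjI allI impI)
    show "3 \<le> n" by (rule n)
    show "klein (verts P (i + n)) = klein (verts P i)" for i using n by (simp add: verts_def)
    have "inj_on (verts P) {..<n}"
      using P by (auto simp: inj_on_def verts_def hyp_simple_def nth_eq_iff_index_eq)
    then show "inj_on (\<lambda>i. klein (verts P i)) {..<n}"
      using klein_eq_iff d by (auto simp: inj_on_def)
    fix i j assume ij: "i < n" "j < n" "i \<noteq> j"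
    have "hyp_segment (verts P i) (verts P (Suc i)) \<inter> hyp_segment (verts P j) (verts P (Suc j))
      = {verts P i, verts P (Suc i)} \<inter> {verts P j, verts P (Suc j)}"
      using P ij side_verts[OF P] verts_nth[OF P] unfolding hyp_simple_def by metis
    then have "klein ` (hyp_segment (verts P i) (verts P (Suc i)) \<inter> hyp_segment (verts P j) (verts P (Suc j)))
      = klein ` ({verts P i, verts P (Suc i)} \<inter> {verts P j, verts P (Suc j)})" by (rule arg_cong)
    moreover have "klein ` (A \<inter> B) = klein ` A \<inter> klein ` B" if "A \<subseteq> ball 0 1" "B \<subseteq> ball 0 1" for A B
      using inj_on_image_Int[OF klein_inj that] .
    ultimately show "closed_segment (klein (verts P i)) (klein (verts P (Suc i))) \<inter> closed_segment (klein (verts P j)) (klein (verts P (Suc j)))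
      = {klein (verts P i), klein (verts P (Suc i))} \<inter> {klein (verts P j), klein (verts P (Suc j))}"
      unfolding ks using hyp_segment_disc d by simp
  qed
qed

lemma compact_hyp_segment:
  assumes "cmod a < 1" "cmod b < 1"
  shows "compact (hyp_segment a b)"
proof -
  have "hyp_segment a b = unklein ` closed_segment (klein a) (klein b)"
  proof -
    have "unklein (klein z) = z" if "z \<in> hyp_segment a b" for z
    proof -
      have z: "cmod z < 1" using subsetD[OF hyp_segment_disc that] by simp
      from klein_unklein[OF klein_in_disc[OF z]] show ?thesis
        using klein_eq_iff[OF z, of "unklein (klein z)"] by simp
    qed
    then have "hyp_segment a b = unklein ` klein ` hyp_segment a b" by (simp add: image_image)
    then show ?thesis by (simp only: klein_image_hyp_segment[OF assms])
  qed
  moreover have "continuous_on (ball 0 1) unklein"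
  proof -
    have "complex_of_real (1 + sqrt (1 - (cmod w)\<^sup>2)) \<noteq> 0" if "cmod w < 1" for w
    proof -
      have "0 < 1 + sqrt (1 - (cmod w)\<^sup>2)" using one_minus_norm_pos[OF that] by (simp add: add_pos_pos)
      then show ?thesis by (metis less_irrefl of_real_eq_0_iff)
    qed
    then show ?thesis unfolding unklein_def by (intro continuous_intros) auto
  qed
  moreover have "closed_segment (klein a) (klein b) \<subseteq> ball 0 1"
    by (rule closed_segment_subset) (auto simp: assms klein_in_disc)
  ultimately show ?thesis
    by (metis compact_continuous_image compact_segment continuous_on_subset)
qed

lemma hyp_simple_region:
  assumes P: "hyp_simple n P"
  defines "B \<equiv> polygon_boundary n (\<lambda>i. klein (verts P i))"
  shows "klein ` region P = B \<union> inside B" "region P \<subseteq> ball 0 1" "compact (region P)"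
proof -
  note d = hyp_simple_disc[OF P]
  have n: "length P = n" using P by (simp add: hyp_simple_def)
  have c: "compact (boundary P)"
    unfolding boundary_def n using side_verts[OF P] compact_hyp_segment[OF d d] by (intro compact_UN) auto
  note k = hyp_simple_klein[OF P]
  note ki = klein_image_inside[OF compact_imp_closed[OF c] k(3)]
  show "klein ` region P = B \<union> inside B" unfolding region_def image_Un ki(1) k(2) B_def ..
  show sub: "region P \<subseteq> ball 0 1" unfolding region_def using ki(2) k(3) by auto
  have "closed (region P)" unfolding region_def union_with_inside
    using open_outside[OF compact_imp_closed[OF c]] by (simp add: closed_Compl)
  moreover have "bounded (region P)" using sub bounded_ball bounded_subset by blast
  ultimately show "compact (region P)" by (simp add: compact_eq_bounded_closed)
qed

text \<open>The sign is returned together with the winding numbers, since the analysis of interior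
  angles has to use the same orientation as the area formula.\<close>

theorem hyp_area_eq:
  assumes P: "hyp_simple n P"
  obtains s :: real where "s = 1 \<or> s = - 1" "hyp_area P = s * cyc_area n (\<lambda>i. verts P i)"
    "\<And>z. z \<in> inside (polygon_boundary n (\<lambda>i. klein (verts P i))) \<Longrightarrow> polygon_winding n (\<lambda>i. klein (verts P i)) z = of_real s"
    "\<And>z. z \<in> outside (polygon_boundary n (\<lambda>i. klein (verts P i))) \<Longrightarrow> polygon_winding n (\<lambda>i. klein (verts P i)) z = 0"
proof -
  note d = hyp_simple_disc[OF P]
  have n: "length P = n" using P by (simp add: hyp_simple_def)
  note k = hyp_simple_klein[OF P]
  obtain s where s: "s = 1 \<or> s = - 1" 
    "\<And>z. z \<in> inside (polygon_boundary n (\<lambda>i. klein (verts P i))) \<Longrightarrow> polygon_winding n (\<lambda>i. klein (verts P i)) z = of_real s"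
    "\<And>z. z \<in> outside (polygon_boundary n (\<lambda>i. klein (verts P i))) \<Longrightarrow> polygon_winding n (\<lambda>i. klein (verts P i)) z = 0"
    using polygon_orientation[OF k(1)] by blast
  note r = hyp_simple_region[OF P]
  have "hyp_area P = s * (\<Sum>i<n. tval (klein (verts P i)) (klein (verts P (Suc i))))"
    unfolding hyp_area_def integral_klein_compact[OF r(3,2)] r(1)
    by (rule polygon_klein_area[OF k(1) klein_in_disc[OF d] s])
  also have "(\<Sum>i<n. tval (klein (verts P i)) (klein (verts P (Suc i)))) = cyc_area n (\<lambda>i. verts P i)"
    unfolding cyc_sum_def tri_term_klein[OF d d] by (intro sum.cong) (auto simp: verts_def n)
  finally show ?thesis using that s by blast
qed

section \<open>Interior angles\<close>

lemma cross_inner: "cross e x = (\<i> * e) \<bullet> x"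
  by (simp add: cross_def inner_complex_def)

lemma cross_add_right: "cross e (x + y) = cross e x + cross e y"
  and cross_diff_right: "cross e (x - y) = cross e x - cross e y"
  and cross_scale_right: "cross e (of_real k * x) = k * cross e x"
  and cross_scale_left: "cross (of_real k * e) x = k * cross e x"
  and cross_swap: "cross e x = - cross x e"
  and cross_ii: "cross e (\<i> * e) = (cmod e)\<^sup>2"
  by (simp_all add: cross_def algebra_simps cmod_power2) (simp add: power2_eq_square)

lemma abs_cross_le: "\<bar>cross a b\<bar> \<le> cmod a * cmod b"
  unfolding cross_inner using Cauchy_Schwarz_ineq2[of "\<i> * a" b] by (simp add: norm_mult)

lemma convex_cross_pos: "convex {x. 0 < cross e (x - p)}"
proof -
  have "{x. 0 < cross e (x - p)} = {x. (\<i> * e) \<bullet> p < (\<i> * e) \<bullet> x}"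
    by (simp add: cross_inner inner_diff_right)
  then show ?thesis by (simp add: convex_halfspace_gt)
qed

lemma convex_cross_neg: "convex {x. cross e (x - p) < 0}"
proof -
  have "{x. cross e (x - p) < 0} = {x. (\<i> * e) \<bullet> x < (\<i> * e) \<bullet> p}"
    by (simp add: cross_inner inner_diff_right)
  then show ?thesis by (simp add: convex_halfspace_lt)
qed

lemma cross_closed_segment:
  assumes "x \<in> closed_segment a b" "p \<in> closed_segment a b"
  shows "cross (b - a) (x - p) = 0"
proof -
  obtain u v where xp: "x = (1 - u) *\<^sub>R a + u *\<^sub>R b" "p = (1 - v) *\<^sub>R a + v *\<^sub>R b"
    using assms unfolding closed_segment_def by auto
  have "x - p = of_real (u - v) * (b - a)" unfolding xp by (simp add: scaleR_conv_of_real algebra_simps)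
  then show ?thesis by (simp only: cross_scale_right cross_self mult_zero_right)
qed

text \<open>Allows local statements to be proved at the vertices with indices 0, 1, 2 only.\<close>

lemma simple_polygon_shift:
  assumes "simple_polygon n w"
  shows "simple_polygon n (\<lambda>i. w (i + k))" "polygon_boundary n (\<lambda>i. w (i + k)) = polygon_boundary n w"
    "polygon_winding n (\<lambda>i. w (i + k)) z = polygon_winding n w z"
proof -
  have step: "simple_polygon n (\<lambda>i. w (Suc i)) \<and> polygon_boundary n (\<lambda>i. w (Suc i)) = polygon_boundary n w \<and>
     polygon_winding n (\<lambda>i. w (Suc i)) z = polygon_winding n w z"
    if P: "simple_polygon n w" for w
  proof -
    note D = simple_polygonD[OF P]
    obtain m where m: "n = Suc m" using D(1) by (cases n) auto
    have w1: "w (Suc m) = w 0" "w (Suc (Suc m)) = w 1" using D(2)[of 0] D(2)[of 1] m by simp_all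
    have per: "w (Suc (i + n)) = w (Suc i)" for i using D(2)[of "Suc i"] by simp
    define \<sigma> where "\<sigma> i = (if Suc i < n then Suc i else 0)" for i
    have \<sigma>: "w (Suc i) = w (\<sigma> i)" "w (Suc (Suc i)) = w (Suc (\<sigma> i))" "\<sigma> i < n" if "i < n" for i
      using that m w1 by (auto simp: \<sigma>_def less_Suc_eq)
    have \<sigma>i: "\<sigma> i = \<sigma> j \<longleftrightarrow> i = j" if "i < n" "j < n" for i j
      using that m by (auto simp: \<sigma>_def)
    have 1: "simple_polygon n (\<lambda>i. w (Suc i))"
      unfolding simple_polygon_def
    proof (intro conjI allI impI)
      show "inj_on (\<lambda>i. w (Suc i)) {..<n}"
        using \<sigma> \<sigma>i D(4) by (auto simp: inj_on_def)
      fix i j assume "i < n" "j < n" "i \<noteq> j"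
      then show "closed_segment (w (Suc i)) (w (Suc (Suc i))) \<inter> closed_segment (w (Suc j)) (w (Suc (Suc j)))
         = {w (Suc i), w (Suc (Suc i))} \<inter> {w (Suc j), w (Suc (Suc j))}"
        using P \<sigma>[of i] \<sigma>[of j] \<sigma>i[of i j] unfolding simple_polygon_def by metis
    qed (use D(1) per in auto)
    have set_Suc: "(\<Union>i<n. G (Suc i)) = (\<Union>i<n. G i)" if "G (Suc m) = G 0" for G :: "nat \<Rightarrow> complex set"
    proof
      show "(\<Union>i<n. G (Suc i)) \<subseteq> (\<Union>i<n. G i)"
      proof
        fix x assume "x \<in> (\<Union>i<n. G (Suc i))"
        then obtain i where i: "i < n" "x \<in> G (Suc i)" by auto
        show "x \<in> (\<Union>i<n. G i)"
        proof (cases "Suc i < n")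
          case False
          then have "i = m" using i m by simp
          then show ?thesis using i that m by auto
        qed (use i in auto)
      qed
      show "(\<Union>i<n. G i) \<subseteq> (\<Union>i<n. G (Suc i))"
      proof
        fix x assume "x \<in> (\<Union>i<n. G i)"
        then obtain i where i: "i < n" "x \<in> G i" by auto
        show "x \<in> (\<Union>i<n. G (Suc i))"
        proof (cases i)
          case 0
          then show ?thesis using i that m by (auto intro!: bexI[of _ m])
        next
          case (Suc i')
          then show ?thesis using i by (auto intro!: bexI[of _ i'])
        qed
      qed
    qed
    have 2: "polygon_boundary n (\<lambda>i. w (Suc i)) = polygon_boundary n w"
      unfolding polygon_boundary_def by (rule set_Suc) (use w1 in simp)
    have 3: "polygon_winding n (\<lambda>i. w (Suc i)) z = polygon_winding n w z"
    proof -
      define f where "f i = winding_number (linepath (w i) (w (Suc i))) z" for i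
      have "f (Suc m) = f 0" using w1 by (simp add: f_def)
      then have "(\<Sum>i<Suc m. f (Suc i)) = (\<Sum>i<Suc m. f i)"
        using sum.lessThan_Suc_shift[of f "Suc m"] by simp
      then show ?thesis by (simp only: polygon_winding_def f_def m)
    qed
    show ?thesis using 1 2 3 by blast
  qed
  have "simple_polygon n (\<lambda>i. w (i + k)) \<and> polygon_boundary n (\<lambda>i. w (i + k)) = polygon_boundary n w \<and>
     polygon_winding n (\<lambda>i. w (i + k)) z = polygon_winding n w z"
  proof (induction k)
    case (Suc k)
    then show ?case using step[of "\<lambda>i. w (i + k)"] by simp
  qed (use assms in simp)
  then show "simple_polygon n (\<lambda>i. w (i + k))" "polygon_boundary n (\<lambda>i. w (i + k)) = polygon_boundary n w"
    "polygon_winding n (\<lambda>i. w (i + k)) z = polygon_winding n w z" by auto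
qed

text \<open>The winding number of a positively (negatively) oriented simple polygon is 1 on the left
  (0 on the left) of each side and drops by 1 across the side.\<close>

definition left_winding :: "real \<Rightarrow> complex" where "left_winding s = (if s = 1 then 1 else 0)"
definition right_winding :: "real \<Rightarrow> complex" where "right_winding s = (if s = 1 then 0 else - 1)"

definition oriented_polygon :: "nat \<Rightarrow> (nat \<Rightarrow> complex) \<Rightarrow> real \<Rightarrow> bool" where
  "oriented_polygon n w s \<longleftrightarrow> simple_polygon n w \<and> (s = 1 \<or> s = - 1) \<and>
    (\<forall>z \<in> inside (polygon_boundary n w). polygon_winding n w z = of_real s) \<and>
    (\<forall>z \<in> outside (polygon_boundary n w). polygon_winding n w z = 0)"

lemma oriented_polygon_shift:
  "oriented_polygon n w s \<Longrightarrow> oriented_polygon n (\<lambda>i. w (i + k)) s"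
  using simple_polygon_shift[of n w k] by (simp add: oriented_polygon_def)

text \<open>A small disc about \<open>p\<close> meets the boundary only in this side. By the Jordan
  curve theorem \<open>p\<close> is a limit of inside and of outside points, so the two half-discs
  carry the values \<open>s\<close> and 0 in some order. The jump across the side decides which
  order.\<close>

lemma winding_beside_side:
  assumes O: "oriented_polygon n w s" and p: "p \<in> open_segment (w 0) (w 1)"
  defines "e \<equiv> w 1 - w 0"
  shows "\<exists>h0>0. \<forall>h. 0 < h \<and> h < h0 \<longrightarrow>
    polygon_winding n w (p + of_real h * (\<i> * e)) = left_winding s \<and>
    polygon_winding n w (p - of_real h * (\<i> * e)) = right_winding s"
proof -
  have P: "simple_polygon n w" and s: "s = 1 \<or> s = - 1" using O by (auto simp: oriented_polygon_def)
  note D = simple_polygonD[OF P]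
  define B where "B = polygon_boundary n w"
  have n0: "0 < n" using D(1) by simp
  have e0: "e \<noteq> 0" using simple_polygon_consecutive[OF P n0] by (simp add: e_def)
  have pc: "p \<in> closed_segment (w 0) (w 1)" "p \<noteq> w 0" "p \<noteq> w 1" using p by (auto simp: open_segment_def)
  define K where "K = (\<Union>j\<in>{..<n} - {0}. closed_segment (w j) (w (Suc j)))"
  have "compact K" unfolding K_def by (intro compact_UN) auto
  then have "closed K" by (rule compact_imp_closed)
  moreover have "p \<notin> K"
  proof
    assume "p \<in> K"
    then obtain j where j: "j < n" "j \<noteq> 0" "p \<in> closed_segment (w j) (w (Suc j))" by (auto simp: K_def)
    then have "p \<in> {w 0, w (Suc 0)}" using D(5)[of 0 j p] n0 pc by auto
    then show False using pc by simp
  qed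
  ultimately obtain r where r: "0 < r" "ball p r \<subseteq> - K" using open_contains_ball[of "- K"] by auto
  have B: "B = closed_segment (w 0) (w 1) \<union> K"
    unfolding B_def polygon_boundary_def K_def using n0 by (auto intro: Suc_leI)
  have off: "x \<notin> B" if "x \<in> ball p r" "cross e (x - p) \<noteq> 0" for x
    using that r cross_closed_segment[of x "w 0" "w 1" p] pc(1) unfolding B e_def by auto
  define h where "h x = (\<Sum>j\<in>{..<n} - {0}. Re (winding_number (linepath (w j) (w (Suc j))) x))" for x
  have "isCont (winding_number (linepath (w j) (w (Suc j)))) p" if "j \<in> {..<n} - {0}" for j
  proof -
    have "p \<notin> path_image (linepath (w j) (w (Suc j)))" using \<open>p \<notin> K\<close> that by (auto simp: K_def)
    then show ?thesis by (intro continuous_at_winding_number) auto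
  qed
  then have "isCont h p"
    unfolding h_def by (intro continuous_sum isCont_Re)
  then have "(h \<longlongrightarrow> h p) (at p)" by (simp only: isCont_def)
  then have "eventually (\<lambda>x. dist (h x) (h p) < 1/4) (at p)" by (rule tendstoD) simp
  then obtain \<delta> where \<delta>': "0 < \<delta>" "\<forall>x\<in>UNIV. x \<noteq> p \<and> dist x p < \<delta> \<longrightarrow> dist (h x) (h p) < 1/4"
    unfolding eventually_at by blast
  have \<delta>: "0 < \<delta>" "\<bar>h x - h p\<bar> < 1/4" if "cmod (x - p) < \<delta>" for x
  proof -
    show "0 < \<delta>" by (rule \<delta>'(1))
    have "dist x p < \<delta>" using that by (simp only: dist_norm)
    then have "x \<noteq> p \<Longrightarrow> dist (h x) (h p) < 1/4" using \<delta>'(2) by blast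
    then show "\<bar>h x - h p\<bar> < 1/4" by (cases "x = p") (simp_all only: dist_real_def, simp)
  qed
  define L where "L = ball p r \<inter> {x. 0 < cross e (x - p)}"
  define R where "R = ball p r \<inter> {x. cross e (x - p) < 0}"
  have cL: "polygon_winding n w x = polygon_winding n w y" if "x \<in> L" "y \<in> L" for x y
    by (rule polygon_winding_convex[OF P _ _ that])
      (use off convex_cross_pos in \<open>auto simp: L_def B_def intro!: convex_Int\<close>)
  have cR: "polygon_winding n w x = polygon_winding n w y" if "x \<in> R" "y \<in> R" for x y
    by (rule polygon_winding_convex[OF P _ _ that])
      (use off convex_cross_neg in \<open>auto simp: R_def B_def intro!: convex_Int\<close>)
  \<comment> \<open>A nonempty open set is not contained in a line, so inside and outside points
    near \<open>p\<close> can be found off the line through the side, that is in one of the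
    half-discs.\<close>
  have near: "\<exists>x \<in> L \<union> R. x \<in> U" if "open U" "p \<in> closure U" for U
  proof -
    have "p \<in> ball p r \<inter> closure U" using that(2) r(1) by simp
    then have "ball p r \<inter> U \<noteq> {}" using open_Int_closure_eq_empty[OF open_ball, of p r U] by blast
    moreover have "\<not> ball p r \<inter> U \<subseteq> {x. (\<i> * e) \<bullet> x = (\<i> * e) \<bullet> p}" if "ball p r \<inter> U \<noteq> {}"
    proof
      assume "ball p r \<inter> U \<subseteq> {x. (\<i> * e) \<bullet> x = (\<i> * e) \<bullet> p}"
      then have "ball p r \<inter> U \<subseteq> interior {x. (\<i> * e) \<bullet> x = (\<i> * e) \<bullet> p}"
        using \<open>open U\<close> by (intro interior_maximal) auto
      moreover have "\<i> * e \<noteq> 0" using e0 by simp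
      ultimately show False using interior_hyperplane that by blast
    qed
    ultimately obtain x where "x \<in> ball p r" "x \<in> U" "(\<i> * e) \<bullet> x \<noteq> (\<i> * e) \<bullet> p" by auto
    then show ?thesis
      by (intro bexI[of _ x]) (auto simp: L_def R_def cross_inner inner_diff_right)
  qed
  have J: "open (inside B)" "open (outside B)" "frontier (inside B) = B" "frontier (outside B) = B"
    using Jordan_inside_outside[OF simple_polygon_path(1,2)[OF P]] simple_polygon_path(3)[OF P] by (auto simp: B_def)
  have pB: "p \<in> B" using pc B by auto
  obtain x1 where x1: "x1 \<in> L \<union> R" "polygon_winding n w x1 = of_real s"
    using near[OF J(1)] pB J(3) O unfolding frontier_def oriented_polygon_def B_def by blast
  obtain x2 where x2: "x2 \<in> L \<union> R" "polygon_winding n w x2 = 0"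
    using near[OF J(2)] pB J(4) O unfolding frontier_def oriented_polygon_def B_def by blast
  define h0 where "h0 = min r \<delta> / (cmod e)"
  have h0: "0 < h0" using r \<delta>'(1) e0 by (simp add: h0_def)
  have main: "polygon_winding n w (p + of_real t * (\<i> * e)) = left_winding s \<and>
    polygon_winding n w (p - of_real t * (\<i> * e)) = right_winding s" if t: "0 < t" "t < h0" for t
  proof -
    define x y where "x = p + of_real t * (\<i> * e)" and "y = p - of_real t * (\<i> * e)"
    have "t * cmod e < min r \<delta>" using t e0 by (simp add: h0_def field_simps)
    then have d: "cmod (x - p) < r" "cmod (x - p) < \<delta>" "cmod (y - p) < r" "cmod (y - p) < \<delta>"
      using t by (simp_all add: x_def y_def norm_mult)
    have cx: "cross e (x - p) = t * (cmod e)\<^sup>2" "cross e (y - p) = - (t * (cmod e)\<^sup>2)"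
      using cross_scale_right[of e t "\<i> * e"] cross_scale_right[of e "- t" "\<i> * e"] cross_ii[of e]
      by (simp_all add: x_def y_def)
    have pos: "0 < t * (cmod e)\<^sup>2" using t e0 by simp
    have xL: "x \<in> L" and yR: "y \<in> R" using d cx pos by (auto simp: L_def R_def dist_norm norm_minus_commute)
    have on: "x \<notin> closed_segment (w 0) (w 1)" "y \<notin> closed_segment (w 0) (w 1)"
    proof -
      have "cross e (x - p) \<noteq> 0" "cross e (y - p) \<noteq> 0" using cx pos by linarith+
      moreover have "x \<in> ball p r" "y \<in> ball p r" using d by (simp_all add: dist_norm norm_minus_commute)
      ultimately have "x \<notin> B" "y \<notin> B" using off by blast+
      then show "x \<notin> closed_segment (w 0) (w 1)" "y \<notin> closed_segment (w 0) (w 1)"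
        unfolding B by blast+
    qed
    have pw: "cross e (w 1 - p) = 0" "cross e (w 0 - p) = 0"
      using cross_closed_segment[of _ "w 0" "w 1" p] pc(1) by (auto simp: e_def)
    have "0 < Im ((w 1 - w 0) * cnj (w 1 - x))"
    proof -
      have "Im (e * cnj (w 1 - x)) = cross e (x - p) - cross e (w 1 - p)" by (simp add: cross_def algebra_simps)
      then show ?thesis using cx pos pw by (simp add: e_def)
    qed
    then have 1: "0 < Re (winding_number (linepath (w 0) (w 1)) x)" by (rule winding_number_linepath_pos_lt)
    have "0 < Im ((w 0 - w 1) * cnj (w 0 - y))"
    proof -
      have "Im (- e * cnj (w 0 - y)) = cross e (w 0 - p) - cross e (y - p)" by (simp add: cross_def algebra_simps)
      then show ?thesis using cx pos pw by (simp add: e_def)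
    qed
    then have 2: "Re (winding_number (linepath (w 0) (w 1)) y) < 0" by (rule winding_number_linepath_neg_lt)
    note 3 = winding_number_lt_half_linepath[OF on(1)] winding_number_lt_half_linepath[OF on(2)]
    have Rw: "Re (polygon_winding n w v) = Re (winding_number (linepath (w 0) (w 1)) v) + h v" for v
    proof -
      have "{..<n} = insert 0 ({..<n} - {0})" using n0 by auto
      then have "(\<Sum>j<n. winding_number (linepath (w j) (w (Suc j))) v)
         = winding_number (linepath (w 0) (w (Suc 0))) v + (\<Sum>j\<in>{..<n} - {0}. winding_number (linepath (w j) (w (Suc j))) v)"
        by (subst sum.remove[of _ 0]) (use n0 in auto)
      then show ?thesis unfolding polygon_winding_def h_def by simp
    qed
    \<comment> \<open>Left minus right: the side itself contributes a number in (0, 1), the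
      remaining sides one below 1/2 in modulus by continuity. Of the possible differences 1 and -1
      only 1 is left.\<close>
    have diff: "- 1/2 < Re (polygon_winding n w x) - Re (polygon_winding n w y)"
      "Re (polygon_winding n w x) - Re (polygon_winding n w y) < 3/2"
      using 1 2 3 \<delta>(2)[OF d(2)] \<delta>(2)[OF d(4)] unfolding Rw by linarith+
    have "(polygon_winding n w x = of_real s \<and> polygon_winding n w y = 0) \<or>
          (polygon_winding n w x = 0 \<and> polygon_winding n w y = of_real s)"
      using x1 x2 cL[OF xL] cR[OF yR] s by (metis UnE of_real_eq_0_iff zero_neq_neg_one zero_neq_one)
    then have "polygon_winding n w x = left_winding s \<and> polygon_winding n w y = right_winding s"
      using s diff by (auto simp: left_winding_def right_winding_def)
    then show ?thesis by (simp add: x_def y_def)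
  qed
  show ?thesis using h0 main by blast
qed

text \<open>The open sector swept counterclockwise from \<open>a\<close> to \<open>c\<close>:
  convex, reflex or, for opposite directions, a half-plane. For equal directions the formula also
  gives a half-plane, a case which \<open>left_sectors_meet\<close> later leads to a
  contradiction.\<close>

definition left_sector :: "complex \<Rightarrow> complex \<Rightarrow> complex set" where
  "left_sector a c = {x. if 0 < cross a c then 0 < cross a x \<and> 0 < cross x c
     else if cross a c < 0 then 0 < cross a x \<or> 0 < cross x c else 0 < cross a x}"

text \<open>\<open>f\<close> is constant on convex sets that avoid both rays. A convex sector is the
  intersection of the half-discs left of \<open>a\<close> and right of \<open>c\<close>; otherwise
  the sector is covered by such half-discs, each free of both rays. The value known beside a ray
  spreads over the set.\<close>

lemma left_sector_const:
  fixes f :: "complex \<Rightarrow> complex"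
  assumes r: "0 < r" and ac: "a \<noteq> 0" "c \<noteq> 0"
    and conv: "\<And>C x y. convex C \<Longrightarrow> C \<subseteq> ball 0 r \<Longrightarrow>
        (\<And>k. 0 \<le> k \<Longrightarrow> of_real k * a \<notin> C) \<Longrightarrow> (\<And>k. 0 \<le> k \<Longrightarrow> of_real k * c \<notin> C) \<Longrightarrow> x \<in> C \<Longrightarrow> y \<in> C \<Longrightarrow> f x = f y"
    and left: "\<And>t. 0 < t \<Longrightarrow> t < 1 \<Longrightarrow> \<exists>h0>0. \<forall>h. 0 < h \<and> h < h0 \<longrightarrow> f (of_real t * a + of_real h * (\<i> * a)) = W"
    and right: "\<And>t. 0 < t \<Longrightarrow> t < 1 \<Longrightarrow> \<exists>h0>0. \<forall>h. 0 < h \<and> h < h0 \<longrightarrow> f (of_real t * c - of_real h * (\<i> * c)) = W"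
    and x: "x \<in> left_sector a c" "cmod x < r"
  shows "f x = W"
proof -
  define Ha where "Ha = ball 0 r \<inter> {x. 0 < cross a (x - 0)}"
  define Hc where "Hc = ball 0 r \<inter> {x. cross c (x - 0) < 0}"
  have conv': "convex Ha" "convex Hc" "convex (Ha \<inter> Hc)"
    unfolding Ha_def Hc_def by (intro convex_Int convex_ball convex_cross_pos convex_cross_neg)+
  \<comment> \<open>A point just beside a ray: close enough for the prescribed value of
    \<open>f\<close>, inside the disc, and displaced by so little that it stays on the correct side
    of the other ray.\<close>
  have nearby: "\<exists>h. 0 < h \<and> h < h0 \<and> \<bar>k\<bar> * h < t * q \<and> cmod (of_real t * d + of_real h * e) < r"
    if "0 < h0" "0 < t" "0 < q" "t * cmod d < r / 2" for h0 t q k d e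
  proof -
    define h where "h = min (min (h0 / 2) (t * q / (2 * (\<bar>k\<bar> + 1)))) (r / (2 * (cmod e + 1)))"
    have e1: "0 < \<bar>k\<bar> + 1" "0 < cmod e + 1" by (simp_all add: add_nonneg_pos)
    have h: "0 < h" using that r e1 by (simp add: h_def)
    have "h * (\<bar>k\<bar> + 1) \<le> t * q / (2 * (\<bar>k\<bar> + 1)) * (\<bar>k\<bar> + 1)"
      using e1 by (intro mult_right_mono) (auto simp: h_def)
    also have "\<dots> = t * q / 2" using e1 by (simp add: field_simps)
    finally have "h * (\<bar>k\<bar> + 1) \<le> t * q / 2" .
    moreover have "h * (\<bar>k\<bar> + 1) = \<bar>k\<bar> * h + h" by (simp add: algebra_simps)
    moreover have "0 < t * q" using that by simp
    ultimately have k: "\<bar>k\<bar> * h < t * q" using h by linarith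
    have "h * (cmod e + 1) \<le> r / (2 * (cmod e + 1)) * (cmod e + 1)"
      using e1 by (intro mult_right_mono) (auto simp: h_def)
    also have "\<dots> = r / 2" using e1 by (simp add: field_simps)
    finally have "h * cmod e < r / 2" using h by (simp add: algebra_simps)
    moreover have "cmod (of_real t * d + of_real h * e) \<le> t * cmod d + h * cmod e"
      using norm_triangle_ineq[of "of_real t * d" "of_real h * e"] that h by (simp add: norm_mult)
    ultimately have "cmod (of_real t * d + of_real h * e) < r" using that by linarith
    moreover have "h < h0"
    proof -
      have "h \<le> h0 / 2" unfolding h_def by (meson min.cobounded1 order_trans)
      then show ?thesis using that by linarith
    qed
    ultimately show ?thesis using h k by blast
  qed
  define ta where "ta = min (1/2) (r / (4 * cmod a))"
  define tc where "tc = min (1/2) (r / (4 * cmod c))"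
  have ta: "0 < ta" "ta < 1" "ta * cmod a < r / 2" and tc: "0 < tc" "tc < 1" "tc * cmod c < r / 2"
    using r ac by (auto simp: ta_def tc_def min_def field_simps)
  obtain ha where ha: "0 < ha" "\<And>h. 0 < h \<Longrightarrow> h < ha \<Longrightarrow> f (of_real ta * a + of_real h * (\<i> * a)) = W"
    using left[OF ta(1,2)] by blast
  obtain hc where hc: "0 < hc" "\<And>h. 0 < h \<Longrightarrow> h < hc \<Longrightarrow> f (of_real tc * c - of_real h * (\<i> * c)) = W"
    using right[OF tc(1,2)] by blast
  have inHa: "of_real ta * a + of_real h * (\<i> * a) \<in> Ha" if "0 < h" "cmod (of_real ta * a + of_real h * (\<i> * a)) < r" for h
    using that ac by (simp add: Ha_def cross_add_right cross_scale_right cross_ii)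
  have rayA: "of_real k * a \<notin> Ha" for k by (simp add: Ha_def cross_scale_right)
  have rayC: "of_real k * c \<notin> Hc" for k by (simp add: Hc_def cross_scale_right)
  have caseA: "f y = W" if y: "y \<in> Ha" "cross a c \<le> 0" for y
  proof -
    obtain h where h: "0 < h" "h < ha" "cmod (of_real ta * a + of_real h * (\<i> * a)) < r"
      using nearby[OF ha(1) ta(1) zero_less_one ta(3), of 0 "\<i> * a"] by auto
    have "f y = f (of_real ta * a + of_real h * (\<i> * a))"
    proof (rule conv[OF conv'(1) _ _ _ y(1) inHa[OF h(1,3)]])
      show "of_real k * c \<notin> Ha" if "0 \<le> k" for k
        using that y(2) by (simp add: Ha_def cross_scale_right) (meson mult_nonneg_nonpos not_le)
    qed (use rayA in \<open>auto simp: Ha_def\<close>)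
    then show ?thesis using ha(2)[OF h(1,2)] by simp
  qed
  have caseC: "f y = W" if y: "y \<in> Hc" "cross a c \<le> 0" for y
  proof -
    obtain h where h: "0 < h" "h < hc" "cmod (of_real tc * c + of_real h * (- (\<i> * c))) < r"
      using nearby[OF hc(1) tc(1) zero_less_one tc(3), of 0 "- (\<i> * c)"] by auto
    have "cross c (of_real tc * c - of_real h * (\<i> * c)) = - (h * (cmod c)\<^sup>2)"
      by (simp add: cross_diff_right cross_scale_right cross_ii)
    then have inHc: "of_real tc * c - of_real h * (\<i> * c) \<in> Hc" using h ac by (simp add: Hc_def)
    have "f y = f (of_real tc * c - of_real h * (\<i> * c))"
    proof (rule conv[OF conv'(2) _ _ _ y(1) inHc])
      show "of_real k * a \<notin> Hc" if "0 \<le> k" for k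
        using that y(2) cross_swap[of a c] by (simp add: Hc_def cross_scale_right not_less)
    qed (use rayC in \<open>auto simp: Hc_def\<close>)
    then show ?thesis using hc(2)[OF h(1,2)] by simp
  qed
  have xb: "x \<in> ball 0 r" using x(2) by simp
  consider "0 < cross a c" | "cross a c < 0" | "cross a c = 0" by linarith
  then show ?thesis
  proof cases
    case 1
    then have xx: "x \<in> Ha \<inter> Hc"
      using x(1) xb cross_swap[of x c] by (simp add: left_sector_def Ha_def Hc_def)
    obtain h where h: "0 < h" "h < ha" "\<bar>cmod a * cmod c\<bar> * h < ta * cross a c" "cmod (of_real ta * a + of_real h * (\<i> * a)) < r"
      using nearby[OF ha(1) ta(1) 1 ta(3)] by metis
    have "cross c (of_real ta * a + of_real h * (\<i> * a)) = - (ta * cross a c) + h * cross c (\<i> * a)"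
      using cross_swap[of c a] by (simp add: cross_add_right cross_scale_right)
    moreover have "cross c (\<i> * a) \<le> cmod a * cmod c"
      using abs_cross_le[of c "\<i> * a"] by (simp add: norm_mult mult.commute)
    then have "h * cross c (\<i> * a) \<le> h * (cmod a * cmod c)" using h(1) by (intro mult_left_mono) auto
    then have "h * cross c (\<i> * a) < ta * cross a c" using h(3) by (simp add: mult.commute)
    ultimately have "of_real ta * a + of_real h * (\<i> * a) \<in> Hc" using h(4) by (simp add: Hc_def)
    then have "f x = f (of_real ta * a + of_real h * (\<i> * a))"
      using inHa[OF h(1,4)] by (intro conv[OF conv'(3) _ _ _ xx]) (use rayA rayC in \<open>auto simp: Ha_def\<close>)
    then show ?thesis using ha(2)[OF h(1,2)] by simp
  next
    case 2
    then have "x \<in> Ha \<or> x \<in> Hc"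
      using x(1) xb cross_swap[of x c] by (simp add: left_sector_def Ha_def Hc_def)
    then show ?thesis using caseA caseC 2 by auto
  next
    case 3
    then have "x \<in> Ha" using x(1) xb by (simp add: left_sector_def Ha_def)
    then show ?thesis using caseA 3 by simp
  qed
qed

lemma left_sector_not_ray:
  assumes "x \<in> left_sector a c" "0 \<le> k"
  shows "x \<noteq> of_real k * a" "x \<noteq> of_real k * c"
proof -
  show "x \<noteq> of_real k * a"
    using assms unfolding left_sector_def
    by (auto simp: cross_scale_right cross_scale_left split: if_splits) (meson mult_nonneg_nonpos not_less less_imp_le)
  show "x \<noteq> of_real k * c"
    using assms unfolding left_sector_def
    by (auto simp: cross_scale_right cross_scale_left split: if_splits) (meson mult_nonneg_nonpos not_less less_imp_le)
qed

text \<open>Near the vertex only the two adjacent sides are visible. With \<open>a\<close> pointing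
  to the next and \<open>c\<close> to the previous vertex, the sector from \<open>a\<close>
  counterclockwise to \<open>c\<close> is on the left of both sides, so the values beside the sides
  extend to it.\<close>

lemma winding_at_vertex:
  assumes O: "oriented_polygon n w s"
  defines "v \<equiv> w 1" and "a \<equiv> w 2 - w 1" and "c \<equiv> w 0 - w 1"
  shows "\<exists>r>0. \<forall>x. cmod x < r \<longrightarrow>
    (x \<in> left_sector a c \<longrightarrow> v + x \<notin> polygon_boundary n w \<and> polygon_winding n w (v + x) = left_winding s) \<and>
    (x \<in> left_sector c a \<longrightarrow> v + x \<notin> polygon_boundary n w \<and> polygon_winding n w (v + x) = right_winding s)"
proof -
  have P: "simple_polygon n w" using O by (simp add: oriented_polygon_def)
  note D = simple_polygonD[OF P]
  have n: "1 < n" "0 < n" using D(1) by auto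
  have nz: "a \<noteq> 0" "c \<noteq> 0"
    using simple_polygon_consecutive[OF P n(1)] simple_polygon_consecutive[OF P n(2)]
    by (auto simp: a_def c_def numeral_2_eq_2)
  define K where "K = (\<Union>j\<in>{..<n} - {0, 1}. closed_segment (w j) (w (Suc j)))"
  have "compact K" unfolding K_def by (intro compact_UN) auto
  then have "closed K" by (rule compact_imp_closed)
  moreover have "v \<notin> K"
  proof
    assume "v \<in> K"
    then obtain j where j: "j < n" "j \<noteq> 0" "j \<noteq> 1" "v \<in> closed_segment (w j) (w (Suc j))" by (auto simp: K_def)
    have "v = w j \<or> v = w (Suc j)" using D(5)[of j 1 v] j n by (auto simp: v_def)
    moreover have "w j \<noteq> w 1" using D(4)[of j 1] j n by simp
    moreover have "w (Suc j) \<noteq> w 1"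
    proof (cases "Suc j < n")
      case True
      then show ?thesis using D(4)[of "Suc j" 1] j n by simp
    next
      case False
      then have "Suc j = n" using j by simp
      then show ?thesis using D(3) D(4)[of 0 1] n by simp
    qed
    ultimately show False by (simp add: v_def)
  qed
  ultimately obtain r where r: "0 < r" "ball v r \<subseteq> - K" using open_contains_ball[of "- K"] by auto
  have ray: "\<exists>k\<ge>0. x = of_real k * a \<or> x = of_real k * c" if "v + x \<in> polygon_boundary n w" "cmod x < r" for x
  proof -
    have "v + x \<notin> K" using r(2) that(2) by (auto simp: subset_iff dist_norm)
    then have "v + x \<in> closed_segment (w 0) (w 1) \<or> v + x \<in> closed_segment (w 1) (w 2)"
      using that(1) by (auto simp: polygon_boundary_def K_def numeral_2_eq_2)
    then show ?thesis
    proof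
      assume "v + x \<in> closed_segment (w 0) (w 1)"
      then obtain u where "0 \<le> u" "u \<le> 1" "v + x = (1 - u) *\<^sub>R w 0 + u *\<^sub>R w 1" unfolding closed_segment_def by auto
      then show ?thesis
        by (intro exI[of _ "1 - u"]) (auto simp: v_def c_def scaleR_conv_of_real algebra_simps eq_diff_eq)
    next
      assume "v + x \<in> closed_segment (w 1) (w 2)"
      then obtain u where "0 \<le> u" "u \<le> 1" "v + x = (1 - u) *\<^sub>R w 1 + u *\<^sub>R w 2" unfolding closed_segment_def by auto
      then show ?thesis
        by (intro exI[of _ u]) (auto simp: v_def a_def scaleR_conv_of_real algebra_simps eq_diff_eq)
    qed
  qed
  define f where "f x = polygon_winding n w (v + x)" for x
  have conv: "f x = f y" if C: "convex C" "C \<subseteq> ball 0 r" "\<And>k. 0 \<le> k \<Longrightarrow> of_real k * a \<notin> C"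
    "\<And>k. 0 \<le> k \<Longrightarrow> of_real k * c \<notin> C" "x \<in> C" "y \<in> C" for C x y
  proof -
    have "convex ((+) v ` C)" using C(1) by (rule convex_translation)
    moreover have "(+) v ` C \<inter> polygon_boundary n w = {}"
    proof (rule equals0I, elim IntE imageE)
      fix y x assume y: "y \<in> polygon_boundary n w" "y = v + x" "x \<in> C"
      then have "cmod x < r" using subsetD[OF C(2) y(3)] by simp
      then show False using ray[of x] y C(3,4) by metis
    qed
    ultimately show ?thesis unfolding f_def by (rule polygon_winding_convex[OF P]) (use C in auto)
  qed
  have sideA: "\<exists>h0>0. \<forall>h. 0 < h \<and> h < h0 \<longrightarrow> f (of_real t * a + of_real h * (\<i> * a)) = left_winding s \<and>
      f (of_real t * a - of_real h * (\<i> * a)) = right_winding s" if t: "0 < t" "t < 1" for t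
  proof -
    have "v + of_real t * a \<in> open_segment (w (0 + 1)) (w (1 + 1))"
      using nz t unfolding in_segment(2)
      by (auto simp: v_def a_def scaleR_conv_of_real algebra_simps numeral_2_eq_2 intro!: exI[of _ t])
    from winding_beside_side[OF oriented_polygon_shift[OF O, of 1] this]
    show ?thesis unfolding simple_polygon_shift(3)[OF P]
      by (simp add: f_def v_def a_def numeral_2_eq_2 add.assoc diff_add_eq[symmetric] add_diff_eq)
  qed
  have sideC: "\<exists>h0>0. \<forall>h. 0 < h \<and> h < h0 \<longrightarrow> f (of_real t * c - of_real h * (\<i> * c)) = left_winding s \<and>
      f (of_real t * c + of_real h * (\<i> * c)) = right_winding s" if t: "0 < t" "t < 1" for t
  proof -
    have "v + of_real t * c \<in> open_segment (w 0) (w 1)"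
      using nz t unfolding in_segment(2)
      by (auto simp: v_def c_def scaleR_conv_of_real algebra_simps intro!: exI[of _ "1 - t"])
    from winding_beside_side[OF O this]
    obtain h0 where h0: "0 < h0" "\<And>h. 0 < h \<Longrightarrow> h < h0 \<Longrightarrow>
      polygon_winding n w (v + of_real t * c + of_real h * (\<i> * (w 1 - w 0))) = left_winding s \<and>
      polygon_winding n w (v + of_real t * c - of_real h * (\<i> * (w 1 - w 0))) = right_winding s" by blast
    have "w 1 - w 0 = - c" by (simp add: c_def)
    then show ?thesis using h0 by (intro exI[of _ h0]) (simp add: f_def add.assoc add_diff_eq)
  qed
  have L: "f x = left_winding s" if "x \<in> left_sector a c" "cmod x < r" for x
  proof (rule left_sector_const[where f = f and W = "left_winding s", OF r(1) nz _ _ _ that])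
    fix C x y
    assume "convex C" "C \<subseteq> ball 0 r" "\<And>k. 0 \<le> k \<Longrightarrow> of_real k * a \<notin> C"
      "\<And>k. 0 \<le> k \<Longrightarrow> of_real k * c \<notin> C" "x \<in> C" "y \<in> C"
    then show "f x = f y" by (rule conv)
  next
    fix t :: real assume t: "0 < t" "t < 1"
    show "\<exists>h0>0. \<forall>h. 0 < h \<and> h < h0 \<longrightarrow> f (of_real t * a + of_real h * (\<i> * a)) = left_winding s"
      using sideA[OF t] by blast
    show "\<exists>h0>0. \<forall>h. 0 < h \<and> h < h0 \<longrightarrow> f (of_real t * c - of_real h * (\<i> * c)) = left_winding s"
      using sideC[OF t] by blast
  qed
  have conv2: "f x = f y" if C: "convex C" "C \<subseteq> ball 0 r" "\<And>k. 0 \<le> k \<Longrightarrow> of_real k * c \<notin> C"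
    "\<And>k. 0 \<le> k \<Longrightarrow> of_real k * a \<notin> C" "x \<in> C" "y \<in> C" for C x y
    using conv[OF C(1,2,4,3,5,6)] .
  have R: "f x = right_winding s" if "x \<in> left_sector c a" "cmod x < r" for x
  proof (rule left_sector_const[where f = f and W = "right_winding s", OF r(1) nz(2,1) _ _ _ that])
    fix C x y
    assume "convex C" "C \<subseteq> ball 0 r" "\<And>k. 0 \<le> k \<Longrightarrow> of_real k * c \<notin> C"
      "\<And>k. 0 \<le> k \<Longrightarrow> of_real k * a \<notin> C" "x \<in> C" "y \<in> C"
    then show "f x = f y" by (rule conv2)
  next
    fix t :: real assume t: "0 < t" "t < 1"
    show "\<exists>h0>0. \<forall>h. 0 < h \<and> h < h0 \<longrightarrow> f (of_real t * c + of_real h * (\<i> * c)) = right_winding s"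
      using sideC[OF t] by blast
    show "\<exists>h0>0. \<forall>h. 0 < h \<and> h < h0 \<longrightarrow> f (of_real t * a - of_real h * (\<i> * a)) = right_winding s"
      using sideA[OF t] by blast
  qed
  show ?thesis
  proof (intro exI[of _ r] conjI allI impI)
    fix x assume x: "cmod x < r"
    {
      assume l: "x \<in> left_sector a c"
      then show "v + x \<notin> polygon_boundary n w" using ray[of x] left_sector_not_ray[OF l] x by blast
      show "polygon_winding n w (v + x) = left_winding s" using L[OF l x] by (simp add: f_def)
    }
    assume l: "x \<in> left_sector c a"
    then show "v + x \<notin> polygon_boundary n w" using ray[of x] left_sector_not_ray[OF l] x by blast
    show "polygon_winding n w (v + x) = right_winding s" using R[OF l x] by (simp add: f_def)
  qed (rule r)
qed

text \<open>The determinant of \<open>kdir v\<close> is 1 - |v|^4, positive in the disc: the Klein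
  chart preserves orientation and takes sectors of directions to sectors.\<close>

lemma cross_kdir: "cross (kdir v x) (kdir v y) = (1 - (cmod v) ^ 4) * cross x y"
proof -
  have "(cmod v) ^ 4 = ((cmod v)\<^sup>2)\<^sup>2" by simp
  then show ?thesis
    unfolding kdir_def cross_def cmod_power2 by (simp add: power2_eq_square algebra_simps)
qed

lemma left_sector_scale:
  assumes "0 < k" "0 < l" "0 < m"
  shows "of_real m * x \<in> left_sector (of_real k * a) (of_real l * c) \<longleftrightarrow> x \<in> left_sector a c"
  using assms by (simp add: left_sector_def cross_scale_left cross_scale_right zero_less_mult_iff mult_less_0_iff)

lemma left_sector_kdir:
  assumes "cmod v < 1"
  shows "kdir v x \<in> left_sector (kdir v a) (kdir v c) \<longleftrightarrow> x \<in> left_sector a c"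
proof -
  have "(cmod v) ^ 4 < 1" using assms by (simp add: power_less_one_iff)
  then show ?thesis by (simp add: left_sector_def cross_kdir zero_less_mult_iff mult_less_0_iff)
qed

section \<open>Measuring the directions that point into the polygon\<close>

lemma continuous_cross: "continuous_on S f \<Longrightarrow> continuous_on S g \<Longrightarrow> continuous_on S (\<lambda>x. cross (f x) (g x))"
  unfolding cross_def by (intro continuous_intros)

lemma open_left_sector: "open (left_sector a c)"
proof -
  have 1: "open {x. 0 < cross a x}" "open {x. 0 < cross x c}"
    by (intro open_Collect_less continuous_cross continuous_intros)+
  consider "0 < cross a c" | "cross a c < 0" | "cross a c = 0" by linarith
  then show ?thesis
  proof cases
    case 1
    then have "left_sector a c = {x. 0 < cross a x} \<inter> {x. 0 < cross x c}" by (auto simp: left_sector_def)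
    then show ?thesis using \<open>open {x. 0 < cross a x}\<close> \<open>open {x. 0 < cross x c}\<close> by (simp add: open_Int)
  next
    case 2
    then have "left_sector a c = {x. 0 < cross a x} \<union> {x. 0 < cross x c}" by (auto simp: left_sector_def)
    then show ?thesis using \<open>open {x. 0 < cross a x}\<close> \<open>open {x. 0 < cross x c}\<close> by (simp add: open_Un)
  next
    case 3
    then have "left_sector a c = {x. 0 < cross a x}" by (auto simp: left_sector_def)
    then show ?thesis using \<open>open {x. 0 < cross a x}\<close> by simp
  qed
qed

lemma left_sector_angles:
  assumes psi: "0 < \<psi>" "\<psi> < 2 * pi" and x: "0 < x" "x < \<psi>"
  shows "cis (\<mu> + x) \<in> left_sector (cis \<mu>) (cis (\<mu> + \<psi>))"
proof -
  have c: "cross (cis \<alpha>) (cis \<beta>) = sin (\<beta> - \<alpha>)" for \<alpha> \<beta> by (simp add: cross_def sin_diff algebra_simps)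
  have s: "cross (cis \<mu>) (cis (\<mu> + \<psi>)) = sin \<psi>" "cross (cis \<mu>) (cis (\<mu> + x)) = sin x"
    "cross (cis (\<mu> + x)) (cis (\<mu> + \<psi>)) = sin (\<psi> - x)" by (simp_all add: c)
  consider "\<psi> < pi" | "\<psi> = pi" | "pi < \<psi>" by linarith
  then show ?thesis
  proof cases
    case 1
    then show ?thesis using psi x by (simp add: left_sector_def s sin_gt_zero)
  next
    case 2
    then show ?thesis
      unfolding left_sector_def mem_Collect_eq s using psi x by (simp add: sin_gt_zero)
  next
    case 3
    then have "sin \<psi> < 0" using psi by (intro sin_lt_zero) auto
    moreover have "0 < sin x \<or> 0 < sin (\<psi> - x)"
      using 3 psi x by (cases "x < pi") (auto intro: sin_gt_zero)
    ultimately show ?thesis by (simp add: left_sector_def s)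
  qed
qed

text \<open>The hypotheses leave open only the two boundary directions, which account for at most
  three values of \<open>t\<close>, a null set. The cases in the proof reflect whether the sector
  runs across the angle 0.\<close>

lemma measure_directions:
  assumes mu: "0 \<le> \<mu>" "\<mu> < 2 * pi" and psi: "0 < \<psi>" "\<psi> < 2 * pi" and A: "A \<subseteq> {0..<2 * pi}"
    and ins: "\<And>t x. t \<in> {0..<2 * pi} \<Longrightarrow> cis t = cis (\<mu> + x) \<Longrightarrow> 0 < x \<Longrightarrow> x < \<psi> \<Longrightarrow> t \<in> A"
    and out: "\<And>t x. t \<in> {0..<2 * pi} \<Longrightarrow> cis t = cis (\<mu> + x) \<Longrightarrow> \<psi> < x \<Longrightarrow> x < 2 * pi \<Longrightarrow> t \<notin> A"
  shows "measure lborel A = \<psi>"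
proof -
  define f where "f t = (if \<mu> \<le> t then t - \<mu> else t - \<mu> + 2 * pi)" for t
  have f: "cis t = cis (\<mu> + f t)" "0 \<le> f t" "f t < 2 * pi" if "t \<in> {0..<2 * pi}" for t
    using that mu by (auto simp: f_def complex_eq_iff)
  define U where "U = {t \<in> {0..<2 * pi}. 0 < f t \<and> f t < \<psi>}"
  have UA: "U \<subseteq> A" using ins f by (auto simp: U_def)
  have fin: "A - U \<subseteq> {\<mu>, \<mu> + \<psi>, \<mu> + \<psi> - 2 * pi}"
  proof
    fix t assume t: "t \<in> A - U"
    then have t': "t \<in> {0..<2 * pi}" using A by auto
    then have "\<not> (\<psi> < f t)" using out[OF t' f(1)[OF t']] f(3)[OF t'] t by auto
    then have "f t = 0 \<or> f t = \<psi>" using t t' f(2)[OF t'] by (auto simp: U_def)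
    then show "t \<in> {\<mu>, \<mu> + \<psi>, \<mu> + \<psi> - 2 * pi}" using mu t' by (auto simp: f_def split: if_splits)
  qed
  have mU: "U \<in> sets lborel \<and> measure lborel U = \<psi>"
  proof (cases "\<mu> + \<psi> \<le> 2 * pi")
    case True
    have "U = {\<mu><..<\<mu> + \<psi>}" using True mu psi by (auto simp: U_def f_def split: if_splits)
    then show ?thesis using psi by simp
  next
    case False
    have "U = {\<mu><..<2 * pi} \<union> {0..<\<mu> + \<psi> - 2 * pi}"
      using False mu psi by (auto simp: U_def f_def split: if_splits)
    moreover have "measure lborel ({\<mu><..<2 * pi} \<union> {0..<\<mu> + \<psi> - 2 * pi})
       = measure lborel {\<mu><..<2 * pi} + measure lborel {0..<\<mu> + \<psi> - 2 * pi}"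
      using psi mu False by (intro measure_Union) auto
    ultimately show ?thesis using mu False by simp
  qed
  have "A - U \<in> null_sets lborel"
    using finite_subset[OF fin] by (intro finite_imp_null_set_lborel) simp
  then have "measure lborel (U \<union> (A - U)) = measure lborel U"
    using mU by (intro measure_Un_null_set) auto
  moreover have "U \<union> (A - U) = A" using UA by blast
  ultimately show ?thesis using mU by simp
qed

lemma complex_polar_2pi:
  assumes "z \<noteq> 0"
  obtains t where "0 \<le> t" "t < 2 * pi" "z = of_real (cmod z) * cis t"
proof -
  have "z = of_real (cmod z) * exp (\<i> * of_real (Arg2pi z))" using Arg2pi_eq by blast
  then show ?thesis
    using that[of "Arg2pi z"] Arg2pi_ge_0 Arg2pi_lt_2pi by (simp add: cis_conv_exp)
qed

text \<open>A Euclidean ray of the Poincare disc is in general curved in the Klein chart. Its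
  displacement from \<open>klein v\<close> is a positive multiple of \<open>kdir v (y s)\<close>,
  where \<open>y s\<close> tends to a positive multiple of \<open>cis t\<close>; since the sector is
  open, the ray stays in it for small \<open>s\<close>.\<close>

lemma ray_eventually_sector:
  assumes v: "cmod v < 1" and r: "0 < r" and t: "cis t \<in> left_sector (mob v p) (mob v q)"
    and p: "cmod p < 1" and q: "cmod q < 1"
  shows "\<exists>\<epsilon>>0. \<forall>s\<in>{0<..<\<epsilon>}. cmod (v + of_real s * cis t) < 1 \<and>
     klein (v + of_real s * cis t) - klein v \<in> left_sector (klein p - klein v) (klein q - klein v) \<and>
     cmod (klein (v + of_real s * cis t) - klein v) < r"
proof -
  define z where "z s = v + of_real s * cis t" for s :: real
  define y where "y s = cis t / (1 - cnj v * z s)" for s :: real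
  have z0: "z 0 = v" by (simp add: z_def)
  have nz: "1 - cnj v * v \<noteq> 0" using one_minus_mult_nz[of "cnj v" v] v by simp
  have cz: "isCont z 0" unfolding z_def by (intro continuous_intros)
  have cy: "isCont y 0" unfolding y_def using nz cz z0 by (intro continuous_intros) auto
  have "1 - cnj v * v = of_real (1 - (cmod v)\<^sup>2)"
    by (simp only: of_real_diff of_real_1 complex_norm_square mult.commute)
  then have "y 0 = of_real (1 / (1 - (cmod v)\<^sup>2)) * cis t" by (simp add: y_def z0)
  moreover have "0 < 1 / (1 - (cmod v)\<^sup>2)" using one_minus_norm_pos[OF v] by simp
  ultimately have y0: "y 0 \<in> left_sector (mob v p) (mob v q)"
    using left_sector_scale[of 1 1 "1 / (1 - (cmod v)\<^sup>2)" "cis t" "mob v p" "mob v q"] t by simp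
  have ev1: "eventually (\<lambda>s. y s \<in> left_sector (mob v p) (mob v q)) (at 0)"
    using cy y0 open_left_sector unfolding isCont_def by (intro topological_tendstoD) auto
  have ev2: "eventually (\<lambda>s. z s \<in> ball 0 1) (at 0)"
    using cz v z0 unfolding isCont_def by (intro topological_tendstoD) auto
  have "isCont klein v" using has_derivative_continuous[OF klein_has_derivative] .
  then have "isCont (\<lambda>s. klein (z s)) 0" using isCont_o2[OF cz, of klein] z0 by simp
  then have ev3: "eventually (\<lambda>s. klein (z s) \<in> ball (klein v) r) (at 0)"
    using r z0 unfolding isCont_def by (intro topological_tendstoD) auto
  have "eventually (\<lambda>s. y s \<in> left_sector (mob v p) (mob v q) \<and> z s \<in> ball 0 1 \<and> klein (z s) \<in> ball (klein v) r) (at 0)"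
    using ev1 ev2 ev3 by (intro eventually_conj)
  then obtain d where d: "0 < d" "\<And>s. s \<noteq> 0 \<Longrightarrow> dist s 0 < d \<Longrightarrow>
     y s \<in> left_sector (mob v p) (mob v q) \<and> z s \<in> ball 0 1 \<and> klein (z s) \<in> ball (klein v) r"
    unfolding eventually_at by blast
  show ?thesis
  proof (intro exI[of _ d] conjI ballI)
    fix s assume "s \<in> {0<..<d}"
    then have s: "0 < s" "s < d" by auto
    then have D: "y s \<in> left_sector (mob v p) (mob v q)" "cmod (z s) < 1" "klein (z s) \<in> ball (klein v) r"
      using d(2)[of s] by auto
    show "cmod (v + of_real s * cis t) < 1" using D(2) by (simp add: z_def)
    show "cmod (klein (v + of_real s * cis t) - klein v) < r"
      using D(3) by (simp add: z_def dist_norm norm_minus_commute)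
    have "mob v (z s) = of_real s * y s" by (simp add: mob_def y_def z_def)
    moreover obtain c where c: "0 < c" "klein (z s) - klein v = of_real c * kdir v (mob v (z s))"
      using klein_diff[OF v D(2)] .
    ultimately have e: "klein (z s) - klein v = of_real (c * s) * kdir v (y s)"
      by (simp add: kdir_scale)
    obtain c1 where c1: "0 < c1" "klein p - klein v = of_real c1 * kdir v (mob v p)" using klein_diff[OF v p] .
    obtain c2 where c2: "0 < c2" "klein q - klein v = of_real c2 * kdir v (mob v q)" using klein_diff[OF v q] .
    have "klein (z s) - klein v \<in> left_sector (klein p - klein v) (klein q - klein v)"
      unfolding e c1(2) c2(2) using left_sector_scale[OF c1(1) c2(1), of "c * s"] left_sector_kdir[OF v] D(1) c s by simp
    then show "klein (v + of_real s * cis t) - klein v \<in> left_sector (klein p - klein v) (klein q - klein v)"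
      by (simp add: z_def)
  qed (rule d)
qed

text \<open>If the two sides left the vertex in the same direction, one direction would lie in both
  sectors and would point both into and out of the polygon. This excludes the interior angle
  0.\<close>

lemma left_sectors_meet:
  assumes "a \<noteq> 0" "0 < k"
  shows "\<i> * a \<in> left_sector a (of_real k * a)" "\<i> * a \<in> left_sector (of_real k * a) a"
  using assms by (simp_all add: left_sector_def cross_scale_left cross_scale_right cross_ii)

text \<open>\<open>a\<close> and \<open>c\<close> are the initial directions of the sides towards the next and the previous vertex.\<close>

lemma interior_angle_oriented:
  assumes P: "hyp_simple n P" and O: "oriented_polygon n (\<lambda>i. klein (verts P i)) s" and i: "i < n"
  defines "v \<equiv> verts P i" and "p \<equiv> verts P (Suc i)" and "q \<equiv> verts P (i + n - 1)"
  defines "a \<equiv> mob v p" and "c \<equiv> mob v q"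
  shows "0 < interior_angle P i \<and> interior_angle P i < 2 * pi \<and>
    (if s = 1 then c * of_real (cmod a) = cis (interior_angle P i) * a * of_real (cmod c)
     else a * of_real (cmod c) = cis (interior_angle P i) * c * of_real (cmod a))"
proof -
  have n: "length P = n" "3 \<le> n" using P by (auto simp: hyp_simple_def)
  note d = hyp_simple_disc[OF P]
  define w where "w j = klein (verts P j)" for j
  have SP: "simple_polygon n w" unfolding w_def by (rule hyp_simple_klein(1)[OF P])
  note D = simple_polygonD[OF SP]
  define B where "B = polygon_boundary n w"
  have s: "s = 1 \<or> s = - 1" using O by (simp add: oriented_polygon_def)
  \<comment> \<open>The shift by \<open>i + n - 1\<close> places the previous vertex at index 0 and
    vertex \<open>i\<close> at index 1, as \<open>winding_at_vertex\<close> expects; the summand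
    \<open>n\<close> avoids truncated subtraction.\<close>
  have idx: "(\<lambda>j. w (j + (i + n - 1))) 0 = klein q" "(\<lambda>j. w (j + (i + n - 1))) 1 = klein v"
    "(\<lambda>j. w (j + (i + n - 1))) 2 = klein p"
  proof -
    have "1 + (i + n - 1) = i + n" "2 + (i + n - 1) = Suc i + n" using n by auto
    then show "(\<lambda>j. w (j + (i + n - 1))) 0 = klein q" "(\<lambda>j. w (j + (i + n - 1))) 1 = klein v"
      "(\<lambda>j. w (j + (i + n - 1))) 2 = klein p"
      using D(2)[of i] D(2)[of "Suc i"] by (simp_all only: w_def q_def v_def p_def add_0)
  qed
  have "oriented_polygon n w s" using O by (simp add: w_def[abs_def])
  from winding_at_vertex[OF oriented_polygon_shift[OF this, of "i + n - 1"]]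
  obtain r where r: "0 < r" and W: "\<And>x. cmod x < r \<Longrightarrow>
      (x \<in> left_sector (klein p - klein v) (klein q - klein v) \<longrightarrow> klein v + x \<notin> B \<and> polygon_winding n w (klein v + x) = left_winding s) \<and>
      (x \<in> left_sector (klein q - klein v) (klein p - klein v) \<longrightarrow> klein v + x \<notin> B \<and> polygon_winding n w (klein v + x) = right_winding s)"
    unfolding idx simple_polygon_shift(2,3)[OF SP] B_def by blast
  have reg: "z \<in> region P \<longleftrightarrow> polygon_winding n w (klein z) = of_real s" if z: "cmod z < 1" "klein z \<notin> B" for z
  proof -
    have "z \<in> region P \<longleftrightarrow> klein z \<in> klein ` region P"
      using inj_on_image_mem_iff[OF klein_inj, of z "region P"] hyp_simple_region(2)[OF P] z(1) by auto
    also have "\<dots> \<longleftrightarrow> klein z \<in> inside B"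
      using hyp_simple_region(1)[OF P] z(2) by (simp add: B_def w_def[abs_def])
    also have "\<dots> \<longleftrightarrow> polygon_winding n w (klein z) = of_real s"
    proof (cases "klein z \<in> inside B")
      case False
      then have "klein z \<in> outside B" using z(2) inside_Un_outside[of B] by blast
      then show ?thesis using False O s by (auto simp: oriented_polygon_def B_def w_def[abs_def])
    qed (use O in \<open>auto simp: oriented_polygon_def B_def w_def[abs_def]\<close>)
    finally show ?thesis .
  qed
  have cw: "v = verts P i" "cmod v < 1" "cmod p < 1" "cmod q < 1" using d by (simp_all add: v_def p_def q_def)
  define A where "A = {t \<in> {0..<2 * pi}. \<exists>\<epsilon>>0. \<forall>s\<in>{0<..<\<epsilon>}. v + of_real s * cis t \<in> region P}"
  have IA: "interior_angle P i = measure lborel A"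
    unfolding interior_angle_def A_def v_def using verts_nth[OF P i] by simp
  have inA: "t \<in> A" if t: "t \<in> {0..<2 * pi}"
    "cis t \<in> (if s = 1 then left_sector a c else left_sector c a)" for t
  proof -
    have "\<exists>\<epsilon>>0. \<forall>u\<in>{0<..<\<epsilon>}. v + of_real u * cis t \<in> region P"
    proof (cases "s = 1")
      case True
      then have "cis t \<in> left_sector (mob v p) (mob v q)" using t by (simp add: a_def c_def)
      from ray_eventually_sector[OF cw(2) r this cw(3,4)]
      show ?thesis using W reg True by (force simp: left_winding_def)
    next
      case False
      then have "cis t \<in> left_sector (mob v q) (mob v p)" using t by (simp add: a_def c_def)
      from ray_eventually_sector[OF cw(2) r this cw(4,3)]
      show ?thesis using W reg False s by (force simp: right_winding_def)
    qed
    then show ?thesis using t by (simp add: A_def)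
  qed
  have outA: "t \<notin> A" if t: "cis t \<in> (if s = 1 then left_sector c a else left_sector a c)" for t
  proof
    assume "t \<in> A"
    then obtain e1 where e1: "0 < e1" "\<And>u. u \<in> {0<..<e1} \<Longrightarrow> v + of_real u * cis t \<in> region P" by (auto simp: A_def)
    have "\<exists>e2>0. \<forall>u\<in>{0<..<e2}. v + of_real u * cis t \<notin> region P"
    proof (cases "s = 1")
      case True
      then have "cis t \<in> left_sector (mob v q) (mob v p)" using t by (simp add: a_def c_def)
      from ray_eventually_sector[OF cw(2) r this cw(4,3)]
      show ?thesis using W reg True by (force simp: right_winding_def)
    next
      case False
      then have "cis t \<in> left_sector (mob v p) (mob v q)" using t by (simp add: a_def c_def)
      from ray_eventually_sector[OF cw(2) r this cw(3,4)]
      show ?thesis using W reg False s by (force simp: left_winding_def)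
    qed
    then obtain e2 where e2: "0 < e2" "\<And>u. u \<in> {0<..<e2} \<Longrightarrow> v + of_real u * cis t \<notin> region P" by auto
    have "min e1 e2 / 2 \<in> {0<..<e1}" "min e1 e2 / 2 \<in> {0<..<e2}" using e1 e2 by auto
    then show False using e1(2) e2(2) by blast
  qed
  have main: "0 < measure lborel A \<and> measure lborel A < 2 * pi \<and> y * of_real (cmod x) = cis (measure lborel A) * x * of_real (cmod y)"
    if xy: "x \<noteq> 0" "y \<noteq> 0" and inA: "\<And>t. t \<in> {0..<2 * pi} \<Longrightarrow> cis t \<in> left_sector x y \<Longrightarrow> t \<in> A"
      and outA: "\<And>t. cis t \<in> left_sector y x \<Longrightarrow> t \<notin> A" for x y
  proof -
    obtain \<mu> where \<mu>: "0 \<le> \<mu>" "\<mu> < 2 * pi" "x = of_real (cmod x) * cis \<mu>" using complex_polar_2pi[OF xy(1)] .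
    have "y / cis \<mu> \<noteq> 0" using xy by simp
    then obtain \<psi> where \<psi>: "0 \<le> \<psi>" "\<psi> < 2 * pi" "y / cis \<mu> = of_real (cmod (y / cis \<mu>)) * cis \<psi>"
      using complex_polar_2pi by metis
    have y: "y = of_real (cmod y) * cis (\<mu> + \<psi>)"
      using \<psi>(3) by (simp add: norm_divide field_simps flip: cis_mult)
    have sx: "z \<in> left_sector x y \<longleftrightarrow> z \<in> left_sector (cis \<mu>) (cis (\<mu> + \<psi>))"
      "z \<in> left_sector y x \<longleftrightarrow> z \<in> left_sector (cis (\<mu> + \<psi>)) (cis \<mu>)" for z
      using left_sector_scale[of "cmod x" "cmod y" 1 z "cis \<mu>" "cis (\<mu> + \<psi>)"]
        left_sector_scale[of "cmod y" "cmod x" 1 z "cis (\<mu> + \<psi>)" "cis \<mu>"] xy \<mu>(3) y by simp_all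
    have "\<psi> \<noteq> 0"
    proof
      assume "\<psi> = 0"
      then have "\<i> * cis \<mu> \<in> left_sector x y" "\<i> * cis \<mu> \<in> left_sector y x"
        using left_sectors_meet[of "cis \<mu>" 1] unfolding sx by simp_all
      moreover obtain t where "0 \<le> t" "t < 2 * pi" "\<i> * cis \<mu> = of_real (cmod (\<i> * cis \<mu>)) * cis t"
        using complex_polar_2pi[of "\<i> * cis \<mu>"] by auto
      ultimately show False using inA[of t] outA[of t] by (simp add: norm_mult)
    qed
    then have \<psi>0: "0 < \<psi>" using \<psi> by simp
    have "measure lborel A = \<psi>"
    proof (rule measure_directions[OF \<mu>(1,2) \<psi>0 \<psi>(2)])
      show "A \<subseteq> {0..<2 * pi}" by (auto simp: A_def)
      fix t u assume t: "t \<in> {0..<2 * pi}" "cis t = cis (\<mu> + u)"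
      show "t \<in> A" if "0 < u" "u < \<psi>"
        using inA[OF t(1)] left_sector_angles[OF \<psi>0 \<psi>(2) that, of \<mu>] unfolding sx t(2) by simp
      show "t \<notin> A" if "\<psi> < u" "u < 2 * pi"
      proof -
        have "cis (\<mu> + \<psi> + (u - \<psi>)) \<in> left_sector (cis (\<mu> + \<psi>)) (cis (\<mu> + \<psi> + (2 * pi - \<psi>)))"
          using that \<psi>0 \<psi> by (intro left_sector_angles) auto
        moreover have "\<mu> + \<psi> + (u - \<psi>) = \<mu> + u" "cis (\<mu> + \<psi> + (2 * pi - \<psi>)) = cis \<mu>"
          by (simp_all add: complex_eq_iff)
        ultimately show ?thesis using outA[of t] unfolding sx t(2) by simp
      qed
    qed
    moreover have "y * of_real (cmod x) = cis \<psi> * x * of_real (cmod y)"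
    proof -
      have "y * of_real (cmod x) = of_real (cmod y) * cis (\<mu> + \<psi>) * of_real (cmod x)" using y by simp
      also have "\<dots> = cis \<psi> * (of_real (cmod x) * cis \<mu>) * of_real (cmod y)"
        by (simp flip: cis_mult)
      also have "of_real (cmod x) * cis \<mu> = x" using \<mu>(3) by simp
      finally show ?thesis .
    qed
    ultimately show ?thesis using \<psi>0 \<psi> by simp
  qed
  have n0: "0 < n" using n by simp
  have "v \<noteq> p" using simple_polygon_consecutive[OF SP i] by (auto simp: w_def v_def p_def)
  then have a0: "a \<noteq> 0" using mob_eq_0_iff[OF cw(2,3)] by (auto simp: a_def)
  have "q \<noteq> v"
  proof -
    have "(i + n - 1) mod n < n" using n0 by simp
    from simple_polygon_consecutive[OF SP this] have "verts P ((i + n - 1) mod n) \<noteq> verts P (Suc ((i + n - 1) mod n))"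
      by (auto simp: w_def)
    moreover have "verts P ((i + n - 1) mod n) = q" by (simp add: verts_def q_def n)
    moreover have "verts P (Suc ((i + n - 1) mod n)) = v"
      using n0 i by (simp add: verts_def v_def n mod_Suc_eq)
    ultimately show ?thesis by simp
  qed
  then have c0: "c \<noteq> 0" using mob_eq_0_iff[OF cw(2,4)] by (auto simp: c_def)
  show ?thesis
  proof (cases "s = 1")
    case True
    then show ?thesis using main[OF a0 c0] inA outA unfolding IA by simp
  next
    case False
    then show ?thesis using main[OF c0 a0] inA outA unfolding IA by simp
  qed
qed

section \<open>Regular polygons\<close>

lemma hyp_area_abs:
  assumes P: "hyp_simple n P"
  shows "hyp_area P = \<bar>cyc_area n (verts P)\<bar>"
proof -
  obtain s :: real where "s = 1 \<or> s = - 1" "hyp_area P = s * cyc_area n (\<lambda>i. verts P i)"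
    using hyp_area_eq[OF P] by metis
  moreover have "0 \<le> hyp_area P"
    unfolding hyp_area_def set_lebesgue_integral_def by (intro Bochner_Integration.integral_nonneg) simp
  ultimately show ?thesis by auto
qed

lemma perim_verts:
  assumes "hyp_simple n P"
  shows "perim P = cyc_len n (verts P)"
proof -
  have n: "length P = n" using assms by (simp add: hyp_simple_def)
  show ?thesis
    unfolding perim_def cyc_sum_def n side_length_def
    using verts_nth[OF assms] by (intro sum.cong) (auto simp: verts_def n)
qed

lemma verts_map: "P \<noteq> [] \<Longrightarrow> verts (map f P) i = f (verts P i)"
  by (simp add: verts_def)

lemma hyp_simple_mob:
  assumes P: "hyp_simple n P" and b: "cmod b < 1"
  shows "hyp_simple n (map (mob b) P)" "verts (map (mob b) P) i = mob b (verts P i)"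
proof -
  note d = hyp_simple_disc[OF P]
  have n: "length P = n" "3 \<le> n" "P \<noteq> []" using P by (auto simp: hyp_simple_def)
  show v: "verts (map (mob b) P) i = mob b (verts P i)" for i using n by (simp add: verts_map)
  have inj: "inj_on (mob b) (ball 0 1)" using b by (auto simp: inj_on_def mob_eq_iff)
  have dP: "set P \<subseteq> ball 0 1" using P by (auto simp: hyp_simple_def hyp_plane_def)
  have sd: "side (map (mob b) P) i = mob b ` side P i" if "i < n" for i
  proof -
    have "side (map (mob b) P) i = hyp_segment (mob b (P ! i)) (mob b (next_vertex P i))"
      using that n by (simp add: side_def next_vertex_def)
    also have "\<dots> = mob b ` side P i"
      using verts_nth[OF P that] mob_image_hyp_segment[OF b d d] by (simp add: side_def)
    finally show ?thesis .
  qed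
  show "hyp_simple n (map (mob b) P)"
    unfolding hyp_simple_def
  proof (intro conjI allI impI)
    show "set (map (mob b) P) \<subseteq> hyp_plane" using dP b by (auto simp: hyp_plane_def)
    show "distinct (map (mob b) P)"
      using P inj_on_subset[OF inj dP] by (simp add: distinct_map hyp_simple_def)
    fix i j assume ij: "i < n" "j < n" "i \<noteq> j"
    have "mob b ` (side P i \<inter> side P j) = mob b ` side P i \<inter> mob b ` side P j"
      by (rule inj_on_image_Int[OF inj]) (auto simp: side_def hyp_segment_def hyp_plane_def)
    moreover have "side P i \<inter> side P j = {P ! i, next_vertex P i} \<inter> {P ! j, next_vertex P j}"
      using P ij by (simp add: hyp_simple_def)
    moreover have "mob b ` ({P ! i, next_vertex P i} \<inter> {P ! j, next_vertex P j})
       = mob b ` {P ! i, next_vertex P i} \<inter> mob b ` {P ! j, next_vertex P j}"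
      using verts_nth[OF P] ij d by (intro inj_on_image_Int[OF inj]) auto
    ultimately show "side (map (mob b) P) i \<inter> side (map (mob b) P) j
      = {map (mob b) P ! i, next_vertex (map (mob b) P) i} \<inter> {map (mob b) P ! j, next_vertex (map (mob b) P) j}"
      using ij n by (simp add: sd next_vertex_def)
  qed (use n in auto)
qed

lemma hyp_ngon_iff: "hyp_ngon n P \<longleftrightarrow> hyp_simple n P \<and> 0 < hyp_area P"
  by (auto simp: hyp_ngon_def hyp_simple_def)

lemma cis_power: "cis a ^ i = cis (real i * a)"
  by (rule Complex.DeMoivre)

text \<open>In a star polygon with density \<open>k\<close> the sides starting at the adjacent points \<open>1\<close> and
  \<open>cis (2 \<pi> / n)\<close> of the circle cross each other.\<close>

lemma star_polygon_not_simple: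
  assumes P: "simple_polygon n (\<lambda>i. u ^ i * x)" and x: "x \<noteq> 0"
    and u: "u = cis (2 * pi * real k / real n)" and k: "2 \<le> k" "k + 2 \<le> n"
  shows False
proof -
  note D = simple_polygonD[OF P]
  have n: "0 < n" "1 < n" using k by auto
  define h \<epsilon> where "h = pi * real k / real n" and "\<epsilon> = pi / real n"
  have eps: "0 < \<epsilon>" using n by (simp add: \<epsilon>_def)
  have hk: "h = real k * \<epsilon>" by (simp add: h_def \<epsilon>_def)
  have npi: "real n * \<epsilon> = pi" using n by (simp add: \<epsilon>_def)
  have "2 * \<epsilon> \<le> h" unfolding hk using k eps by (intro mult_right_mono) auto
  moreover have "h \<le> pi - 2 * \<epsilon>"
  proof -
    have "(real k + 2) * \<epsilon> \<le> real n * \<epsilon>" using k eps by (intro mult_right_mono) auto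
    then show ?thesis using npi by (simp add: hk algebra_simps)
  qed
  ultimately have h: "2 * \<epsilon> \<le> h" "h \<le> pi - 2 * \<epsilon>" by auto
  have e2: "\<epsilon> < pi / 2" using h eps by linarith
  have uc: "u = cis (2 * h)" unfolding u h_def by (simp add: mult.assoc)
  have "inj_on (\<lambda>i. u ^ i) {..<n}"
    using D(4) x by (intro inj_onI) simp
  moreover have un: "u ^ n = 1" using D(3) x by simp
  then have "(\<lambda>i. u ^ i) ` {..<n} \<subseteq> {z. z ^ n = 1}"
    using power_mult[of u n] power_mult[of u _ n] by (auto simp: mult.commute)
  moreover have "card {z :: complex. z ^ n = 1} = n" using card_roots_unity_eq[OF n(1)] .
  moreover have "finite {z :: complex. z ^ n = 1}" using n(1) by (intro finite_roots_unity) simp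
  \<comment> \<open>The \<open>n\<close> powers of \<open>u\<close> are distinct, so they exhaust
    the n-th roots of unity; in particular some side starts at the neighbour \<zeta> of 1.\<close>
  ultimately have img: "(\<lambda>i. u ^ i) ` {..<n} = {z. z ^ n = 1}"
    by (intro card_subset_eq) (simp_all add: card_image)
  define \<zeta> where "\<zeta> = cis (2 * \<epsilon>)"
  have "\<zeta> ^ n = cis (2 * (real n * \<epsilon>))" by (simp add: \<zeta>_def cis_power mult.left_commute)
  then have "\<zeta> ^ n = 1" by (simp add: npi)
  then obtain j where j: "j < n" "u ^ j = \<zeta>" using img by (metis (mono_tags, lifting) imageE lessThan_iff mem_Collect_eq)
  have "\<zeta> \<noteq> 1" using cis_eq_1_imp_0[of "2 * \<epsilon>"] eps e2 by (auto simp: \<zeta>_def)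
  then have j0: "j \<noteq> 0" using j(2) by (metis power_0)
  define \<rho> where "\<rho> = cos h / cos \<epsilon>"
  have ce: "0 < cos \<epsilon>" using eps e2 by (intro cos_gt_zero) auto
  have sh: "0 < sin h" using h eps by (intro sin_gt_zero) auto
  define y where "y = cos h * sin \<epsilon> / cos \<epsilon>"
  have y: "\<bar>y\<bar> \<le> sin h"
  proof -
    have "0 \<le> sin (h - \<epsilon>)" "0 \<le> sin (h + \<epsilon>)" using h eps by (auto intro!: sin_ge_zero)
    then have "\<bar>cos h * sin \<epsilon>\<bar> \<le> sin h * cos \<epsilon>" by (simp add: sin_diff sin_add abs_le_iff)
    then show ?thesis using ce by (simp add: y_def abs_divide divide_le_eq)
  qed
  \<comment> \<open>The crossing point of the chord from angle 0 to \<open>2 * h\<close> and its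
    copy rotated by \<open>2 * \<epsilon>\<close>. Both lines have distance |cos h| from 0; by
    symmetry they cross on the line of angle h + \<epsilon>, at signed radius cos h / cos
    \<epsilon>.\<close>
  define X where "X = of_real \<rho> * cis (h + \<epsilon>)"
  have Xh: "X = cis h * Complex (cos h) y"
  proof -
    have "X = cis h * (of_real \<rho> * cis \<epsilon>)" unfolding X_def cis_mult[symmetric] by (simp only: mult.left_commute)
    also have "of_real \<rho> * cis \<epsilon> = Complex (cos h) y"
      using ce by (simp add: complex_eq_iff \<rho>_def y_def)
    finally show ?thesis .
  qed
  have Xe: "X = cis (h + 2 * \<epsilon>) * Complex (cos h) (- y)"
  proof -
    have "X = cis (h + 2 * \<epsilon>) * (of_real \<rho> * cis (- \<epsilon>))"
      unfolding X_def mult.left_commute[of "cis (h + 2 * \<epsilon>)"] cis_mult by (simp add: algebra_simps)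
    also have "of_real \<rho> * cis (- \<epsilon>) = Complex (cos h) (- y)"
      using ce by (simp add: complex_eq_iff \<rho>_def y_def)
    finally show ?thesis .
  qed
  have seg: "cis m * Complex (cos h) t * x \<in> closed_segment (cis (m - h) * x) (cis (m + h) * x)" if "\<bar>t\<bar> \<le> sin h" for t m
  proof -
    define l where "l = (1 + t / sin h) / 2"
    have l: "0 \<le> l" "l \<le> 1" using that sh by (auto simp: l_def abs_le_iff field_simps)
    have "of_real (1 - l) * cis (- h) + of_real l * cis h = Complex (cos h) ((2 * l - 1) * sin h)"
      by (simp add: complex_eq_iff algebra_simps)
    also have "(2 * l - 1) * sin h = t" using sh by (simp add: l_def field_simps)
    finally have "Complex (cos h) t = of_real (1 - l) * cis (- h) + of_real l * cis h" ..
    then have "cis m * Complex (cos h) t * x = of_real (1 - l) * (cis m * cis (- h) * x) + of_real l * (cis m * cis h * x)"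
      by (simp only: distrib_left distrib_right mult_ac)
    then have "cis m * Complex (cos h) t * x = (1 - l) *\<^sub>R (cis (m - h) * x) + l *\<^sub>R (cis (m + h) * x)"
      by (simp add: cis_mult scaleR_conv_of_real)
    then show ?thesis unfolding closed_segment_def using l by blast
  qed
  have "X * x \<in> closed_segment (u ^ 0 * x) (u ^ Suc 0 * x)"
  proof -
    have "cis (h - h) = u ^ 0" "cis (h + h) = u ^ Suc 0" by (simp_all add: uc)
    then show ?thesis using seg[OF y, of h] unfolding Xh by (simp only:)
  qed
  moreover have "X * x \<in> closed_segment (u ^ j * x) (u ^ Suc j * x)"
  proof -
    have "cis (h + 2 * \<epsilon> - h) = u ^ j" "cis (h + 2 * \<epsilon> + h) = u ^ Suc j"
      unfolding power_Suc j(2) by (simp_all add: \<zeta>_def uc cis_mult algebra_simps)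
    then show ?thesis using seg[of "- y" "h + 2 * \<epsilon>"] y unfolding Xe by (simp only: abs_minus_cancel)
  qed
  ultimately have "X * x \<in> {u ^ 0 * x, u ^ Suc 0 * x}"
    using D(5)[of 0 j "X * x"] j j0 n by blast
  \<comment> \<open>Sides of a simple polygon meet only in vertices, which for \<open>x = 1\<close>
    have modulus 1. But |cos h| < cos \<epsilon>, since \<open>h\<close> keeps the distance 2
    \<epsilon> from 0 and from \<pi>.\<close>
  then have "cmod X = 1" using x by (auto simp: uc)
  then have "\<bar>\<rho>\<bar> = 1" by (simp add: X_def norm_mult)
  then have "\<bar>cos h\<bar> = cos \<epsilon>" using ce by (simp add: \<rho>_def abs_divide)
  moreover have "cos h < cos \<epsilon>" using h eps by (intro cos_monotone_0_pi) auto
  moreover have "cos (pi - h) < cos \<epsilon>" using h eps by (intro cos_monotone_0_pi) auto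
  ultimately show False by (auto simp: abs_if cos_diff split: if_splits)
qed

lemma klein_mult_unit: "cmod c = 1 \<Longrightarrow> klein (c * z) = c * klein z"
  by (simp add: klein_def norm_mult)

text \<open>Equal angles mean equal turning, so the centred polygon is an orbit of a root of unity,
  and simplicity leaves only the two rotations by 2 \<pi> / n in either sense.
  \<open>circle_chord_cos\<close> gives the perimeter relation with equality, and the turning factor
  gives the angle.\<close>

lemma regular_ngon_values:
  assumes R: "regular_ngon n \<theta> P"
  shows "0 < hyp_area P" "\<theta> = pi - 2 * pi / real n - hyp_area P / real n"
    "hyp_area P / (2 * real n) + pi / real n < pi / 2"
    "cosh (perim P / (2 * real n)) * cos (hyp_area P / (2 * real n) + pi / real n) = cos (pi / real n)"
proof -
  have ng: "hyp_ngon n P" and sides: "\<And>i j. i < n \<Longrightarrow> j < n \<Longrightarrow> side_length P i = side_length P j"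
    and ang: "\<And>i. i < n \<Longrightarrow> interior_angle P i = \<theta>"
    using R unfolding regular_ngon_def by blast+
  have P: "hyp_simple n P" and A0: "0 < hyp_area P" using ng by (auto simp: hyp_ngon_iff)
  have n: "3 \<le> n" "length P = n" "0 < n" using P by (auto simp: hyp_simple_def)
  note d = hyp_simple_disc[OF P]
  define V where "V = verts P"
  have Vm: "V (i mod n) = V i" for i by (simp add: V_def verts_def n)
  have SP: "simple_polygon n (\<lambda>i. klein (V i))" unfolding V_def by (rule hyp_simple_klein(1)[OF P])
  obtain s where s: "s = 1 \<or> s = - 1" "hyp_area P = s * cyc_area n V"
    "\<And>z. z \<in> inside (polygon_boundary n (\<lambda>i. klein (V i))) \<Longrightarrow> polygon_winding n (\<lambda>i. klein (V i)) z = of_real s"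
    "\<And>z. z \<in> outside (polygon_boundary n (\<lambda>i. klein (V i))) \<Longrightarrow> polygon_winding n (\<lambda>i. klein (V i)) z = 0"
    using hyp_area_eq[OF P] unfolding V_def by metis
  have O: "oriented_polygon n (\<lambda>i. klein (verts P i)) s"
    using s SP by (simp add: oriented_polygon_def V_def)
  define l where "l = side_length P 0"
  have mS: "V (Suc (i mod n)) = V (Suc i)" for i
    using Vm[of "Suc (i mod n)"] Vm[of "Suc i"] by (simp add: mod_Suc_eq)
  have Vl: "hyp_dist (V i) (V (Suc i)) = l" for i
  proof -
    have "i mod n < n" using n by simp
    then have "side_length P (i mod n) = l" using sides[of "i mod n" 0] n by (simp add: l_def)
    then show ?thesis
      using verts_nth[OF P \<open>i mod n < n\<close>] unfolding side_length_def V_def[symmetric] Vm mS by simp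
  qed
  have l0: "0 < l"
  proof -
    have "V 0 \<noteq> V (Suc 0)" using simple_polygon_consecutive[OF SP n(3)] by auto
    then show ?thesis using hyp_dist_nonneg[OF d d, of 0 1] hyp_dist_eq_0_iff[OF d d, of 0 1] Vl[of 0]
      by (simp add: V_def)
  qed
  define t where "t = tanh (l / 2)"
  have t: "0 < t" using l0 by (simp add: t_def)
  have Vd: "cmod (V i) < 1" for i using d by (simp add: V_def)
  have side: "cmod (mob (V i) (V (Suc i))) = t" for i
    using norm_mob_eq_tanh[OF Vd Vd] Vl by (simp add: t_def)
  \<comment> \<open>The interior sector runs from the next to the previous vertex if
    \<open>s = 1\<close> and the other way round if \<open>s = -1\<close>; in both cases the
    direction to the next vertex is the direction to the previous one turned by - s
    \<theta>.\<close>
  define \<kappa> where "\<kappa> = cis (- (s * \<theta>))"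
  have th: "0 < \<theta>" "\<theta> < 2 * pi"
    using interior_angle_oriented[OF P O n(3)] ang[OF n(3)] by auto
  have turn: "mob (V (Suc i)) (V (Suc (Suc i))) = \<kappa> * mob (V (Suc i)) (V i)" for i
  proof -
    define j where "j = Suc i mod n"
    have j: "j < n" using n by (simp add: j_def)
    have "(j + n - 1) mod n = i mod n" using pred_Suc_mod[of "i mod n" n] n by (simp add: j_def mod_Suc_eq)
    then have e: "verts P j = V (Suc i)" "verts P (Suc j) = V (Suc (Suc i))" "verts P (j + n - 1) = V i"
      using Vm[of "Suc i"] Vm[of "j + n - 1"] Vm[of i] mS[of "Suc i"] by (simp_all add: V_def j_def)
    define a c where "a = mob (V (Suc i)) (V (Suc (Suc i)))" and "c = mob (V (Suc i)) (V i)"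
    have ac: "cmod a = t" "cmod c = t"
      using side[of "Suc i"] side[of i] norm_mob_commute[OF Vd Vd, of "Suc i" i] by (simp_all add: a_def c_def)
    have "if s = 1 then c * of_real (cmod a) = cis \<theta> * a * of_real (cmod c)
        else a * of_real (cmod c) = cis \<theta> * c * of_real (cmod a)"
      using interior_angle_oriented[OF P O j] unfolding e ang[OF j] a_def c_def by simp
    then have "if s = 1 then c = cis \<theta> * a else a = cis \<theta> * c" using t unfolding ac by (auto split: if_splits)
    then have "a = \<kappa> * c"
    proof (cases "s = 1")
      case True
      assume "if s = 1 then c = cis \<theta> * a else a = cis \<theta> * c"
      then have "c = cis \<theta> * a" using True by simp
      then have "\<kappa> * c = cis (- \<theta>) * cis \<theta> * a" using True by (simp add: \<kappa>_def)
      then show ?thesis by (simp add: cis_mult)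
    next
      case False
      assume "if s = 1 then c = cis \<theta> * a else a = cis \<theta> * c"
      then show ?thesis using False s(1) by (simp add: \<kappa>_def)
    qed
    then show ?thesis by (simp add: a_def c_def)
  qed
  obtain b where b: "cmod b < 1" "(\<Sum>i<n. mob b (V i) / of_real (1 - (cmod (mob b (V i)))\<^sup>2)) = 0"
    using exists_center[of n V] Vd n by blast
  define Z where "Z i = mob b (V i)" for i
  have Zd: "cmod (Z i) < 1" for i using b(1) Vd by (simp add: Z_def)
  have per: "Z (i + n) = Z i" for i using Vm[of "i + n"] Vm[of i] by (simp add: Z_def)
  have Zl: "hyp_dist (Z i) (Z (Suc i)) = l" for i using Vl by (simp add: Z_def hyp_dist_mob b Vd)
  have Zside: "cmod (mob (Z i) (Z (Suc i))) = t" for i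
    using norm_mob_eq_tanh[OF Zd Zd] Zl by (simp add: t_def)
  have Zturn: "mob (Z (Suc i)) (Z (Suc (Suc i))) = \<kappa> * mob (Z (Suc i)) (Z i)" for i
  proof -
    obtain w where w: "\<And>y. cmod y < 1 \<Longrightarrow> mob (mob b (V (Suc i))) (mob b y) = w * mob (V (Suc i)) y"
      using mob_mob_factor[OF b(1) Vd] by metis
    show ?thesis unfolding Z_def using w[OF Vd] turn by simp
  qed
  have cent: "(\<Sum>i<n. Z i / of_real (1 - (cmod (Z i))\<^sup>2)) = 0" using b(2) by (simp only: Z_def)
  obtain u where u: "u ^ n = 1" "\<And>i. Z i = u ^ i * Z 0" "Z 0 \<noteq> 0"
    using equilateral_equiangular_orbit[where Z = Z, OF Zd n(3) per Zside t Zturn cent] by metis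
  obtain k where k: "k < n" "u = cis (2 * pi * real k / real n)" using roots_unity_cis[OF u(1) n(3)] .
  have cu: "cmod u = 1" using k(2) by simp
  have Q: "hyp_simple n (map (mob b) P)" "verts (map (mob b) P) i = Z i" for i
    using hyp_simple_mob[OF P b(1)] by (simp_all add: Z_def V_def)
  have "klein (Z i) = u ^ i * klein (Z 0)" for i
    using klein_mult_unit[of "u ^ i" "Z 0"] u(2)[of i] cu by (simp add: norm_power)
  then have "(\<lambda>i. klein (Z i)) = (\<lambda>i. u ^ i * klein (Z 0))" by (rule ext)
  then have "simple_polygon n (\<lambda>i. u ^ i * klein (Z 0))"
    using hyp_simple_klein(1)[OF Q(1)] unfolding Q(2) by (simp only:)
  moreover have "klein (Z 0) \<noteq> 0" using klein_eq_iff[of 0 "Z 0"] Zd u(3) by simp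
  ultimately have "\<not> (2 \<le> k \<and> k + 2 \<le> n)" using star_polygon_not_simple k(2) by blast
  moreover have "k \<noteq> 0"
  proof
    assume "k = 0"
    then have "Z (Suc 0) = Z 0" using u(2)[of "Suc 0"] k(2) by simp
    then show False using Zside[of 0] t by simp
  qed
  ultimately have k1: "k = 1 \<or> k = n - 1" using k(1) n by linarith
  define \<sigma> :: real where "\<sigma> = (if k = 1 then 1 else - 1)"
  have \<sigma>: "\<sigma> = 1 \<or> \<sigma> = - 1" by (simp add: \<sigma>_def)
  define \<phi> where "\<phi> = \<sigma> * (2 * pi / real n)"
  have uphi: "u = cis \<phi>"
  proof (cases "k = 1")
    case False
    then have "k = n - 1" using k1 by simp
    then have "2 * pi * real k / real n = 2 * pi - 2 * pi / real n" using n by (simp add: of_nat_diff field_simps)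
    then have "u = cis (2 * pi - 2 * pi / real n)" using k(2) by simp
    then show ?thesis using False by (simp add: \<phi>_def \<sigma>_def complex_eq_iff)
  qed (simp add: k(2) \<phi>_def \<sigma>_def)
  define r where "r = (cmod (Z 0))\<^sup>2"
  have nZ: "cmod (Z i) = cmod (Z 0)" for i using u(2)[of i] cu by (simp add: norm_mult norm_power)
  have r: "0 < r" "r < 1" using u(3) Zd[of 0] by (simp_all add: r_def abs_square_less_1)
  define \<alpha> where "\<alpha> = Arg (1 - of_real r * cis (- \<phi>))"
  have Zs: "Z (Suc i) = cis \<phi> * Z i" for i using u(2)[of "Suc i"] u(2)[of i] uphi by (simp add: mult.assoc)
  have tt: "tri_term (Z i) (Z (Suc i)) = 2 * \<alpha>" for i
    unfolding Zs[of i] using circle_chord(1)[OF Zd[of i], of \<phi>] by (simp add: nZ[of i] \<alpha>_def r_def)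
  have "cyc_area n V = cyc_area n Z" using cyc_area_mob[OF b(1) Vd, of n] by (simp add: Z_def[abs_def])
  also have "\<dots> = (\<Sum>i<n. tri_term (Z i) (Z (Suc i)))"
    unfolding cyc_sum_def using Vm by (intro sum.cong) (auto simp: Z_def)
  finally have area: "hyp_area P = s * (2 * real n * \<alpha>)" using s(2) by (simp add: tt)
  define K where "K = cosh (l / 2) * (1 - r)"
  have K0: "0 < K" using r by (simp add: K_def cosh_real_pos)
  have chord: "of_real K * cis \<alpha> = 1 - of_real r * cis (- \<phi>)"
    using circle_chord(3)[OF Zd[of 0], of \<phi>] Zl[of 0] Zs[of 0] by (simp add: K_def \<alpha>_def r_def)
  have ab: "\<bar>\<alpha>\<bar> < pi / 2" using circle_chord(2)[OF Zd[of 0], of \<phi>] by (simp add: \<alpha>_def r_def)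
  have sn: "0 < sin (2 * pi / real n)" using n by (intro sin_gt_zero) (auto simp: field_simps)
  have "K * sin \<alpha> = r * sin \<phi>" using arg_cong[OF chord, of Im] by simp
  also have "sin \<phi> = \<sigma> * sin (2 * pi / real n)" using \<sigma> by (auto simp: \<phi>_def)
  finally have "K * (\<sigma> * sin \<alpha>) = r * sin (2 * pi / real n)" using \<sigma> by auto
  then have "0 < K * (\<sigma> * sin \<alpha>)" using r sn by simp
  then have "0 < \<sigma> * sin \<alpha>" using K0 by (simp add: zero_less_mult_iff)
  moreover have "\<sigma> * sin \<alpha> = sin (\<sigma> * \<alpha>)" using \<sigma> by auto
  ultimately have "0 < sin (\<sigma> * \<alpha>)" by simp
  moreover have "\<bar>\<sigma> * \<alpha>\<bar> < pi / 2" using ab \<sigma> by auto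
  ultimately have beta: "0 < \<sigma> * \<alpha>"
    using sin_ge_zero[of "- (\<sigma> * \<alpha>)"] by (cases "\<sigma> * \<alpha> \<le> 0") (auto simp: abs_less_iff)
  have "0 < s * \<alpha>" using A0 n unfolding area by (auto simp: zero_less_mult_iff mult_less_0_iff)
  \<comment> \<open>The sense of rotation \<sigma> determines the sign of \<alpha>, while the area
    \<open>s * (2 * real n * \<alpha>)\<close> is positive; hence the orientation obtained from
    winding numbers is the sense of rotation.\<close>
  then have ss: "s = \<sigma>" using beta s(1) \<sigma> by auto
  define \<beta> where "\<beta> = \<sigma> * \<alpha>"
  have \<alpha>: "\<alpha> = \<sigma> * \<beta>" using \<sigma> by (auto simp: \<beta>_def)
  have A: "hyp_area P / (2 * real n) = \<beta>" using area n ss by (simp add: \<beta>_def)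
  have "K * cos (\<alpha> + \<sigma> * (pi / real n)) = cos (\<sigma> * (pi / real n)) - r * cos (\<phi> - \<sigma> * (pi / real n))"
    using circle_chord_cos[OF Zd[of 0], of \<phi> "\<sigma> * (pi / real n)"] Zl[of 0] Zs[of 0] by (simp add: K_def \<alpha>_def r_def)
  moreover have "cos (\<alpha> + \<sigma> * (pi / real n)) = cos (\<beta> + pi / real n)"
  proof -
    have "\<alpha> + \<sigma> * (pi / real n) = \<sigma> * (\<beta> + pi / real n)" unfolding \<alpha> by (rule distrib_left[symmetric])
    then have "cos (\<alpha> + \<sigma> * (pi / real n)) = cos (\<sigma> * (\<beta> + pi / real n))" by (rule arg_cong)
    then show ?thesis using \<sigma> cos_minus[of "\<beta> + pi / real n"] by (elim disjE) simp_all
  qed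
  moreover have "cos (\<sigma> * (pi / real n)) = cos (pi / real n)" "cos (\<phi> - \<sigma> * (pi / real n)) = cos (pi / real n)"
  proof -
    have "\<phi> - \<sigma> * (pi / real n) = \<sigma> * (pi / real n)" by (simp add: \<phi>_def field_simps)
    then show "cos (\<sigma> * (pi / real n)) = cos (pi / real n)" "cos (\<phi> - \<sigma> * (pi / real n)) = cos (pi / real n)"
      using \<sigma> by auto
  qed
  ultimately have "(1 - r) * (cosh (l / 2) * cos (\<beta> + pi / real n)) = (1 - r) * cos (pi / real n)"
    by (simp add: K_def algebra_simps)
  then have main: "cosh (l / 2) * cos (\<beta> + pi / real n) = cos (pi / real n)" using r by simp
  have "perim P = real n * l"
  proof -
    have "perim P = (\<Sum>i<n. l)"
      unfolding perim_def n(2) l_def by (rule sum.cong) (auto intro: sides[OF _ n(3)])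
    then show ?thesis by simp
  qed
  then have pl: "perim P / (2 * real n) = l / 2" using n by simp
  show "cosh (perim P / (2 * real n)) * cos (hyp_area P / (2 * real n) + pi / real n) = cos (pi / real n)"
    unfolding pl A by (rule main)
  have pn: "0 < pi / real n" "pi / real n < pi / 2" using n by (simp_all add: field_simps)
  have "0 < cos (pi / real n)" using pn by (intro cos_gt_zero) auto
  then have "0 < cos (\<beta> + pi / real n)"
    using main cosh_real_pos[of "l/2"] by (metis zero_less_mult_pos)
  moreover have "\<beta> < pi / 2" "0 < \<beta>" using \<open>\<bar>\<sigma> * \<alpha>\<bar> < pi / 2\<close> beta by (simp_all add: \<beta>_def)
  ultimately have bpn: "\<beta> + pi / real n < pi / 2" using pn by (intro abs_less_cos_pos) linarith+
  then show "hyp_area P / (2 * real n) + pi / real n < pi / 2" unfolding A .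
  show "0 < hyp_area P" by (rule A0)
  \<comment> \<open>The turning factor computed a second time, as the quotient of the two chord
    directions at a vertex on the circle. Comparison with - s \<theta> determines \<theta> modulo 2
    \<pi>, and the bounds on \<theta>, \<beta> and \<pi> / n leave a single value.\<close>
  have "\<kappa> = - cis (\<phi> + 2 * \<alpha>)"
  proof -
    define x where "x = Z 1"
    have x: "Z 2 = u * x" "u * Z 0 = x" using Zs[of 1] Zs[of 0] uphi by (simp_all add: x_def numeral_2_eq_2)
    have uu: "u * cnj u = 1" using cu complex_norm_square[of u] by simp
    have xr: "cnj x * x = of_real r" using complex_norm_square[of x] nZ[of 1] by (simp add: x_def r_def mult.commute)
    have Z0: "Z 0 = cnj u * x" using x(2) uu by (metis mult.assoc mult.commute mult_1)
    define W where "W = 1 - of_real r * cnj u"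
    have W: "W = of_real K * cis \<alpha>" using chord by (simp add: W_def uphi cis_cnj)
    have W0: "W \<noteq> 0" using W K0 by simp
    have cW: "1 - of_real r * u = cnj W" by (simp add: W_def)
    have 1: "mob x (u * x) = (u - 1) * x / cnj W"
    proof -
      have "1 - cnj x * (u * x) = cnj W" unfolding cW[symmetric] xr[symmetric] by (simp add: mult_ac)
      then show ?thesis by (simp add: mob_def left_diff_distrib)
    qed
    have 2: "mob x (cnj u * x) = (cnj u - 1) * x / W"
    proof -
      have "1 - cnj x * (cnj u * x) = W" unfolding W_def xr[symmetric] by (simp add: mult_ac)
      then show ?thesis by (simp add: mob_def left_diff_distrib)
    qed
    have x0: "x \<noteq> 0" using nZ[of 1] u(3) by (auto simp: x_def)
    have u1: "cnj u - 1 \<noteq> 0"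
    proof
      assume "cnj u - 1 = 0"
      then have "Z (Suc 0) = Z 0" using Zs[of 0] uphi by (metis complex_cnj_cnj complex_cnj_one eq_iff_diff_eq_0 mult_1)
      then show False using Zside[of 0] t by simp
    qed
    have "(u - 1) * x / cnj W = \<kappa> * ((cnj u - 1) * x / W)"
      using Zturn[of 0] 1 2 Z0 x by (simp add: x_def numeral_2_eq_2)
    moreover have "u - 1 = - u * (cnj u - 1)" using uu by (simp add: algebra_simps)
    ultimately have "(cnj u - 1) * x * (- u / cnj W) = (cnj u - 1) * x * (\<kappa> / W)" by (simp add: mult_ac)
    then have "- u / cnj W = \<kappa> / W" using u1 x0 by (simp only: mult_left_cancel mult_eq_0_iff simp_thms)
    then have "\<kappa> = - u * (W / cnj W)" using W0 by (simp add: field_simps)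
    also have "W / cnj W = cis (2 * \<alpha>)" using K0 unfolding W by (simp add: cis_cnj cis_divide)
    finally show ?thesis by (simp add: uphi cis_mult)
  qed
  then have "cis (- (\<sigma> * \<theta>)) = - cis (\<sigma> * (2 * pi / real n + 2 * \<beta>))"
    unfolding \<kappa>_def ss \<phi>_def \<alpha> by (simp add: algebra_simps)
  then have "1 = - cis (\<sigma> * (2 * pi / real n + 2 * \<beta>)) * cis (\<sigma> * \<theta>)"
    by (metis cis_mult cis_zero add.left_inverse)
  then have "cis (\<sigma> * (2 * pi / real n + 2 * \<beta>)) * cis (\<sigma> * \<theta>) * cis (- (\<sigma> * pi)) = - cis (- (\<sigma> * pi))"
    by (metis minus_minus mult_minus1 mult_minus_left)
  also have "\<dots> = 1" using \<sigma> by (elim disjE) (simp_all add: complex_eq_iff)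
  finally have "cis (\<sigma> * (2 * pi / real n + 2 * \<beta> + \<theta> - pi)) = 1" by (simp add: cis_mult algebra_simps)
  moreover have "\<bar>\<sigma> * (2 * pi / real n + 2 * \<beta> + \<theta> - pi)\<bar> < 2 * pi"
  proof -
    have "0 < 2 * pi / real n + 2 * \<beta>" "2 * pi / real n + 2 * \<beta> < pi"
      using bpn pn \<open>0 < \<beta>\<close> times_divide_eq_right[of 2 pi "real n"] by linarith+
    then have "\<bar>2 * pi / real n + 2 * \<beta> + \<theta> - pi\<bar> < 2 * pi" using th by (simp add: abs_less_iff)
    then show ?thesis using \<sigma> by (auto simp: abs_mult)
  qed
  ultimately have "\<sigma> * (2 * pi / real n + 2 * \<beta> + \<theta> - pi) = 0" by (rule cis_eq_1_imp_0)
  then have "\<theta> = pi - 2 * pi / real n - 2 * \<beta>" using \<sigma> by auto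
  then show "\<theta> = pi - 2 * pi / real n - hyp_area P / real n" unfolding A[symmetric] using n by (simp add: field_simps)
qed

lemma hyp_simple_mob_measures:
  assumes P: "hyp_simple n P" and b: "cmod b < 1"
  shows "hyp_area (map (mob b) P) = hyp_area P" "perim (map (mob b) P) = perim P"
proof -
  note d = hyp_simple_disc[OF P]
  have v: "verts (map (mob b) P) = (\<lambda>i. mob b (verts P i))" using hyp_simple_mob(2)[OF P b] by (rule ext)
  show "hyp_area (map (mob b) P) = hyp_area P"
    unfolding hyp_area_abs[OF P] hyp_area_abs[OF hyp_simple_mob(1)[OF P b]] v cyc_area_mob[of b "verts P", OF b d] ..
  show "perim (map (mob b) P) = perim P"
    unfolding perim_verts[OF P] perim_verts[OF hyp_simple_mob(1)[OF P b]] v cyc_sum_def hyp_dist_mob[OF b d d] ..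
qed

text \<open>\<open>klein\<close> moves points along their rays only, so it respects both half-planes
  bounded by the imaginary axis. These are convex, hence contain the boundary in the Klein chart and
  everything inside it.\<close>

lemma hyp_region_half_plane:
  assumes P: "hyp_simple n P" and v: "\<And>i. 0 < \<sigma> * Re (verts P i)" and z: "z \<in> region P"
  shows "0 < \<sigma> * Re z"
proof -
  define H :: "complex set" where "H = {w. 0 < inner (of_real \<sigma>) w}"
  define B where "B = polygon_boundary n (\<lambda>i. klein (verts P i))"
  have H: "w \<in> H \<longleftrightarrow> 0 < \<sigma> * Re w" for w by (simp add: H_def inner_complex_def)
  have cH: "convex H" unfolding H_def using convex_halfspace_gt[of 0 "complex_of_real \<sigma>"] by simp
  have k: "0 < \<sigma> * Re (klein w) \<longleftrightarrow> 0 < \<sigma> * Re w" for w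
  proof -
    define q where "q = 1 + (cmod w)\<^sup>2"
    have q: "0 < q" unfolding q_def by (rule add_pos_nonneg) simp_all
    have "Re (klein w) = 2 / q * Re w" unfolding klein_def q_def[symmetric] by simp
    then have "\<sigma> * Re (klein w) = 2 / q * (\<sigma> * Re w)" by simp
    then show ?thesis using q by (simp only: zero_less_mult_iff) auto
  qed
  have B: "B \<subseteq> H" unfolding B_def polygon_boundary_def
    using v k by (intro UN_least closed_segment_subset cH) (simp_all add: H)
  have "inside B \<subseteq> H"
  proof
    fix w assume w: "w \<in> inside B"
    show "w \<in> H"
    proof (rule ccontr)
      assume "w \<notin> H"
      then have "w \<in> outside B" using convex_in_outside[OF cH] outside_mono[OF B] by blast
      then show False using w inside_Int_outside[of B] by blast
    qed
  qed
  moreover have "klein z \<in> B \<union> inside B"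
    using hyp_simple_region(1)[OF P] z unfolding B_def by blast
  ultimately show ?thesis using B H k by blast
qed

text \<open>The left-hand side is the value at \<open>u ^ k\<close> of the linear functional normal
  to the side from 1 to \<open>u\<close>. Its maximum over the n-th roots of unity is attained only
  at the two ends of that side.\<close>

lemma cos_chord_functional:
  assumes n: "3 \<le> n" and k: "k < n"
  shows "cos ((2 * real k - 1) * (pi / real n)) \<le> cos (pi / real n)"
    "cos ((2 * real k - 1) * (pi / real n)) = cos (pi / real n) \<Longrightarrow> k = 0 \<or> k = 1"
proof -
  define h where "h = pi / real n"
  have h: "0 < h" "h < pi" "real n * h = pi" using n by (simp_all add: h_def field_simps)
  have less: "cos ((2 * real k - 1) * h) < cos h" if "2 \<le> k"
  proof -
    define x where "x = (2 * real k - 1) * h"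
    have "3 * h \<le> x" unfolding x_def using that h by (intro mult_right_mono) auto
    moreover have "x \<le> 2 * pi - 3 * h"
    proof -
      have "(2 * real k - 1) * h \<le> (2 * real n - 3) * h" using k h by (intro mult_right_mono) auto
      then show ?thesis using h(3) by (simp add: x_def algebra_simps)
    qed
    ultimately have x: "h < x" "h < 2 * pi - x" using h by linarith+
    show ?thesis
    proof (cases "x \<le> pi")
      case True
      then show ?thesis unfolding x_def[symmetric] using x h by (intro cos_monotone_0_pi) auto
    next
      case False
      then have "cos (2 * pi - x) < cos h" using x h by (intro cos_monotone_0_pi) auto
      then show ?thesis unfolding x_def[symmetric] by (simp add: cos_diff)
    qed
  qed
  have small: "cos ((2 * real k - 1) * h) = cos h" if "k = 0 \<or> k = 1" using that by auto
  show "cos ((2 * real k - 1) * (pi / real n)) \<le> cos (pi / real n)"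
    using less small not_less_eq_eq[of 1 k] unfolding h_def[symmetric] by (cases "2 \<le> k") (auto simp: le_Suc_eq numeral_2_eq_2)
  show "cos ((2 * real k - 1) * (pi / real n)) = cos (pi / real n) \<Longrightarrow> k = 0 \<or> k = 1"
    using less unfolding h_def[symmetric] by (cases "2 \<le> k") auto
qed

lemma convex_comb_max:
  fixes a b c t :: real
  assumes "0 < t" "t < 1" "a \<le> c" "b \<le> c" "(1 - t) * a + t * b = c"
  shows "a = c" "b = c"
proof -
  have "(1 - t) * (c - a) + t * (c - b) = 0" using assms(5) by (simp add: algebra_simps)
  moreover have "0 \<le> (1 - t) * (c - a)" "0 \<le> t * (c - b)" using assms by simp_all
  ultimately have "(1 - t) * (c - a) = 0" "t * (c - b) = 0" by linarith+
  then show "a = c" "b = c" using assms by auto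
qed

text \<open>The side from \<open>1\<close> to \<open>u\<close> is where a linear functional attains its maximum over the
  polygon with vertices \<open>u ^ k\<close>.\<close>

lemma chord_meets_chord:
  assumes n: "3 \<le> n" and k: "0 < k" "k < n" and u: "u = cis (2 * pi / real n)"
    and t: "0 \<le> t" "t \<le> 1"
    and e: "(1 - of_real s) + of_real s * u = (1 - of_real t) * u ^ k + of_real t * u ^ Suc k"
  shows "t = 0 \<or> t = 1"
proof (rule ccontr)
  assume "\<not> (t = 0 \<or> t = 1)"
  then have t: "0 < t" "t < 1" using t by auto
  define h where "h = pi / real n"
  define D where "D j = cos ((2 * real j - 1) * h)" for j
  have un: "u ^ n = 1" using n unfolding u cis_power by simp
  have D: "Re (u ^ j * cis (- h)) = D j" for j
  proof -
    have "u ^ j * cis (- h) = cis (real j * (2 * pi / real n) - h)" unfolding u cis_power cis_mult by simp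
    also have "real j * (2 * pi / real n) - h = (2 * real j - 1) * h" by (simp add: h_def algebra_simps)
    finally show ?thesis by (simp add: D_def)
  qed
  have "D n = D 0" using D[of n] D[of 0] un by simp
  then have Dmod: "D (Suc k) = D (Suc k mod n)" using k by (cases "Suc k = n") auto
  have le: "D j \<le> cos h" if "j < n" for j
    using cos_chord_functional(1)[OF n that] by (simp add: D_def h_def)
  have eq: "j = 0 \<or> j = 1" if "j < n" "D j = cos h" for j
    using cos_chord_functional(2)[OF n that(1)] that(2) by (simp add: D_def h_def)
  have Rm: "Re (of_real c * w) = c * Re w" for c w by simp
  have "((1 - of_real s) + of_real s * u) * cis (- h)
    = of_real (1 - s) * (u ^ 0 * cis (- h)) + of_real s * (u ^ 1 * cis (- h))" by (simp add: algebra_simps)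
  then have "Re (((1 - of_real s) + of_real s * u) * cis (- h)) = (1 - s) * D 0 + s * D 1"
    by (simp only: plus_complex.sel Rm D)
  also have "\<dots> = cos h" by (simp add: D_def algebra_simps)
  finally have "cos h = Re (((1 - of_real t) * u ^ k + of_real t * u ^ Suc k) * cis (- h))" unfolding e ..
  also have "((1 - of_real t) * u ^ k + of_real t * u ^ Suc k) * cis (- h)
    = of_real (1 - t) * (u ^ k * cis (- h)) + of_real t * (u ^ Suc k * cis (- h))" by (simp add: algebra_simps)
  also have "Re \<dots> = (1 - t) * D k + t * D (Suc k)"
    by (simp only: plus_complex.sel Rm D)
  finally have c: "(1 - t) * D k + t * D (Suc k mod n) = cos h" using Dmod by simp
  have m: "Suc k mod n < n" using n by simp
  have "D k = cos h" "D (Suc k mod n) = cos h"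
    using convex_comb_max[OF t le[OF k(2)] le[OF m] c] by blast+
  then have "k = 1" "Suc k mod n = 0 \<or> Suc k mod n = 1" using eq[OF k(2)] eq[OF m] k by auto
  then show False using n by auto
qed

text \<open>Division by \<open>u ^ i\<close> turns the first side into the one from 1 to
  \<open>u\<close>, where \<open>chord_meets_chord\<close> applies; \<open>k\<close> is the offset
  from \<open>i\<close> to \<open>j\<close> around the polygon.\<close>

lemma regular_chords_meet:
  assumes n: "3 \<le> n" and u: "u = cis (2 * pi / real n)" and x: "x \<noteq> 0"
    and ij: "i < n" "j < n" "i \<noteq> j"
    and z: "z \<in> closed_segment (u ^ i * x) (u ^ Suc i * x)" "z \<in> closed_segment (u ^ j * x) (u ^ Suc j * x)"
  shows "z \<in> {u ^ j * x, u ^ Suc j * x}"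
proof -
  obtain s where s: "z = (1 - s) *\<^sub>R (u ^ i * x) + s *\<^sub>R (u ^ Suc i * x)" using z(1) unfolding closed_segment_def by blast
  obtain t where t: "0 \<le> t" "t \<le> 1" "z = (1 - t) *\<^sub>R (u ^ j * x) + t *\<^sub>R (u ^ Suc j * x)" using z(2) unfolding closed_segment_def by blast
  have un: "u ^ n = 1" using n unfolding u cis_power by simp
  define k where "k = (if i < j then j - i else j + n - i)"
  have k: "0 < k" "k < n" using ij by (auto simp: k_def)
  have "i + k = (if i < j then j else j + n)" using ij by (auto simp: k_def)
  then have "u ^ (i + k) = u ^ j" using un by (simp add: power_add)
  then have uk: "u ^ j = u ^ i * u ^ k" by (simp add: power_add)
  have ui: "u ^ i \<noteq> 0" unfolding u by simp
  have "(u ^ i * x) * ((1 - of_real s) + of_real s * u) = z"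
    unfolding s scaleR_conv_of_real power_Suc by (simp add: algebra_simps)
  also have "z = (u ^ i * x) * ((1 - of_real t) * u ^ k + of_real t * u ^ Suc k)"
    unfolding t scaleR_conv_of_real power_Suc uk by (simp add: algebra_simps)
  finally have "(1 - of_real s) + of_real s * u = (1 - of_real t) * u ^ k + of_real t * u ^ Suc k"
    using ui x by (simp only: mult_left_cancel mult_eq_0_iff simp_thms)
  then have "t = 0 \<or> t = 1" by (rule chord_meets_chord[OF n k u t(1,2)])
  then show ?thesis unfolding t(3) by (elim disjE) simp_all
qed

text \<open>The function \<open>f\<close> of the overview, obtained by solving its defining relation
  for the perimeter.\<close>

definition regular_perim :: "nat \<Rightarrow> real \<Rightarrow> real" where
  "regular_perim n A = 2 * real n * arcosh (cos (pi / real n) / cos (A / (2 * real n) + pi / real n))"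

lemma hyp_segment_ends: "cmod a < 1 \<Longrightarrow> cmod b < 1 \<Longrightarrow> {a, b} \<subseteq> hyp_segment a b"
  using mem_hyp_segment_iff[of a b] by auto

text \<open>The vertices are placed on a circle about 0 whose radius is read off from the wanted
  area. The radius is returned as well, since it bounds the translation needed to separate two
  polygons.\<close>

theorem regular_ngon_exists:
  assumes n: "3 \<le> n" and A: "0 < A" "A / (2 * real n) + pi / real n < pi / 2"
  obtains Q r where "hyp_simple n Q" "hyp_area Q = A" "perim Q = regular_perim n A"
    "0 \<le> r" "r < 1" "\<And>i. cmod (verts Q i) = r"
proof -
  define h \<beta> where "h = pi / real n" and "\<beta> = A / (2 * real n)"
  have h: "0 < h" using n by (simp add: h_def)
  have b: "0 < \<beta>" "\<beta> + h < pi / 2" using A n by (simp_all add: \<beta>_def h_def)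
  have eps: "2 * pi / real n = 2 * h" by (simp add: h_def)
  have s0: "0 < sin (2 * h + \<beta>)" "0 < sin \<beta>" "0 < sin (2 * h)" using h b by (auto intro!: sin_gt_zero)
  \<comment> \<open>The squared circumradius. For \<open>1 - \<rho> * cis (- (2 * h))\<close> to
    have argument \<beta>, the triangle with vertices 0, 1 and
    \<open>\<rho> * cis (- (2 * h))\<close> must have the angles 2 h at 0 and \<beta> at 1; the law
    of sines gives \<rho>.\<close>
  define \<rho> where "\<rho> = sin \<beta> / sin (2 * h + \<beta>)"
  have "0 < sin h" "0 < cos (\<beta> + h)" using h b by (auto intro!: sin_gt_zero cos_gt_zero)
  then have "0 < 2 * sin h * cos (\<beta> + h)" by simp
  also have "2 * sin h * cos (\<beta> + h) = sin (2 * h + \<beta>) - sin \<beta>"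
  proof -
    have "2 * sin h * cos (\<beta> + h) = sin ((\<beta> + h) + h) - sin ((\<beta> + h) - h)"
      unfolding sin_add[of "\<beta> + h" h] sin_diff[of "\<beta> + h" h] by (simp add: algebra_simps)
    also have "(\<beta> + h) + h = 2 * h + \<beta>" by simp
    finally show ?thesis by simp
  qed
  finally have rho: "0 < \<rho>" "\<rho> < 1" using s0 by (simp_all add: \<rho>_def)
  define r where "r = sqrt \<rho>"
  have r: "0 < r" "r < 1" "r\<^sup>2 = \<rho>" using rho by (simp_all add: r_def)
  define u where "u = cis (2 * h)"
  have u: "u = cis (2 * pi / real n)" by (simp only: u_def eps)
  have un: "u ^ n = 1" using n unfolding u cis_power by simp
  have cu: "cmod (u ^ i) = 1" for i by (simp add: u_def norm_power)
  define x where "x = complex_of_real r"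
  define p where "p i = u ^ i * x" for i
  have cx: "cmod x = r" using r by (simp add: x_def)
  have cp: "cmod (p i) = r" for i by (simp add: p_def norm_mult cu cx)
  then have pd: "cmod (p i) < 1" for i using r by simp
  have pm: "p (i mod n) = p i" for i
  proof -
    have "u ^ (i mod n + n * (i div n)) = u ^ (i mod n)" unfolding power_add power_mult un by simp
    then show ?thesis by (simp add: p_def)
  qed
  have kp: "klein (p i) = u ^ i * klein x" for i unfolding p_def by (rule klein_mult_unit[OF cu])
  have kx: "klein x \<noteq> 0" using klein_eq_iff[of 0 x] cx r by (simp add: klein_def x_def)
  define Q where "Q = map p [0..<n]"
  have lQ: "length Q = n" by (simp add: Q_def)
  have Qi: "Q ! i = p i" if "i < n" for i using that by (simp add: Q_def)
  have nQ: "next_vertex Q i = p (Suc i)" for i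
    using Qi[of "Suc i mod n"] pm[of "Suc i"] n by (simp add: next_vertex_def lQ)
  have vQ: "verts Q i = p i" for i using Qi[of "i mod n"] pm[of i] n by (simp add: verts_def lQ)
  have sQ: "side Q i = hyp_segment (p i) (p (Suc i))" if "i < n" for i by (simp add: side_def nQ Qi[OF that])
  have meet: "z \<in> {p j, p (Suc j)}" if "i < n" "j < n" "i \<noteq> j" "z \<in> side Q i" "z \<in> side Q j" for i j z
  proof -
    have zd: "cmod z < 1" using that(4) hyp_segment_disc[of "p i" "p (Suc i)"] unfolding sQ[OF that(1)] by auto
    have "klein z \<in> closed_segment (klein (p k)) (klein (p (Suc k)))" if "k < n" "z \<in> side Q k" for k
      using klein_image_hyp_segment[OF pd pd, of k "Suc k"] that sQ by blast
    then have "klein z \<in> {u ^ j * klein x, u ^ Suc j * klein x}"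
      using that unfolding kp by (intro regular_chords_meet[OF n u kx that(1-3)]) blast+
    then have "klein z = klein (p j) \<or> klein z = klein (p (Suc j))" unfolding kp by blast
    then show ?thesis using klein_eq_iff[OF pd zd] by blast
  qed
  have inj: "inj_on p {..<n}"
  proof -
    have "p i \<noteq> p j" if "i < j" "j < n" for i j
    proof
      assume "p i = p j"
      then have "u ^ i = u ^ j" using r by (simp add: p_def x_def)
      also have "\<dots> = u ^ i * u ^ (j - i)" unfolding power_add[symmetric] using that by simp
      finally have "u ^ i * 1 = u ^ i * u ^ (j - i)" by simp
      then have "1 = u ^ (j - i)" using cu[of i] by (metis mult_left_cancel norm_zero zero_neq_one)
      then have c1: "cis (real (j - i) * (2 * h)) = 1" by (simp add: u_def cis_power)
      have nh: "real n * h = pi" using n by (simp add: h_def)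
      have lt: "real (j - i) * (2 * h) < real n * (2 * h)" using that h by (intro mult_strict_right_mono) auto
      have "real n * (2 * h) = 2 * pi" unfolding nh[symmetric] by (rule mult.left_commute)
      moreover have "0 < real (j - i) * (2 * h)" using that h by simp
      ultimately have "\<bar>real (j - i) * (2 * h)\<bar> < 2 * pi" using lt by (simp only: abs_of_pos)
      then have "real (j - i) * (2 * h) = 0" using c1 by (intro cis_eq_1_imp_0)
      then show False using that h by simp
    qed
    then show ?thesis by (metis (no_types, lifting) inj_onI lessThan_iff linorder_neqE_nat)
  qed
  have hs: "hyp_simple n Q"
    unfolding hyp_simple_def
  proof (intro conjI allI impI)
    show "set Q \<subseteq> hyp_plane" using pd by (auto simp: Q_def hyp_plane_def)
    show "distinct Q" using inj by (simp add: Q_def distinct_map atLeast0LessThan)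
    fix i j assume ij: "i < n" "j < n" "i \<noteq> j"
    have "{p i, p (Suc i)} \<subseteq> side Q i" "{p j, p (Suc j)} \<subseteq> side Q j"
      unfolding sQ[OF ij(1)] sQ[OF ij(2)] by (intro hyp_segment_ends pd)+
    then show "side Q i \<inter> side Q j = {Q ! i, next_vertex Q i} \<inter> {Q ! j, next_vertex Q j}"
      unfolding nQ Qi[OF ij(1)] Qi[OF ij(2)] using meet[OF ij] meet[OF ij(2,1)] ij(3) by blast
  qed (use n lQ in auto)
  define K where "K = sin (2 * h) / sin (2 * h + \<beta>)"
  have K: "0 < K" using s0 by (simp add: K_def)
  define S where "S = sin (2 * h + \<beta>)"
  have S0: "S \<noteq> 0" using s0 by (simp add: S_def)
  have "of_real K * cis \<beta> = 1 - of_real \<rho> * cis (- (2 * h))"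
  proof (rule complex_eqI)
    have "sin (2 * h) * cos \<beta> = S - sin \<beta> * cos (2 * h)" by (simp add: S_def sin_add)
    then have "sin (2 * h) / S * cos \<beta> = 1 - sin \<beta> / S * cos (2 * h)" using S0 by (simp add: field_simps)
    then show "Re (of_real K * cis \<beta>) = Re (1 - of_real \<rho> * cis (- (2 * h)))"
      by (simp add: K_def \<rho>_def S_def)
    show "Im (of_real K * cis \<beta>) = Im (1 - of_real \<rho> * cis (- (2 * h)))"
      by (simp add: K_def \<rho>_def)
  qed
  then have arg: "Arg (1 - of_real (r\<^sup>2) * cis (- (2 * h))) = \<beta>"
    unfolding r(3) using K b h by (intro Arg_unique[of K]) (auto simp: cis_conv_exp)
  have pS: "p (Suc i) = cis (2 * h) * p i" for i by (simp add: p_def u_def)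
  have tt: "tri_term (p i) (p (Suc i)) = 2 * \<beta>" for i
    unfolding pS circle_chord(1)[OF pd] cp arg ..
  have "cyc_area n (verts Q) = (\<Sum>i<n. tri_term (p i) (p (Suc i)))"
    unfolding cyc_sum_def vQ pm ..
  also have "\<dots> = A" unfolding tt using n by (simp add: \<beta>_def)
  finally have "cyc_area n (verts Q) = A" .
  then have area: "hyp_area Q = A" using hyp_area_abs[OF hs] A by simp
  have dist: "hyp_dist (p i) (p (Suc i)) = 2 * arcosh (cos h / cos (\<beta> + h))" for i
  proof -
    define d where "d = hyp_dist (p i) (p (Suc i))"
    have "cosh (d / 2) * (1 - r\<^sup>2) * cos (\<beta> + h) = cos h - r\<^sup>2 * cos (2 * h - h)"
      using circle_chord_cos[OF pd[of i], of "2 * h" h] unfolding cp arg by (simp only: pS d_def)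
    then have "(1 - \<rho>) * (cosh (d / 2) * cos (\<beta> + h)) = (1 - \<rho>) * cos h" by (simp add: r(3) algebra_simps)
    then have "cosh (d / 2) * cos (\<beta> + h) = cos h" using rho by simp
    then have "cosh (d / 2) = cos h / cos (\<beta> + h)" using \<open>0 < cos (\<beta> + h)\<close> by (simp add: eq_divide_eq)
    moreover have "0 \<le> d / 2" using hyp_dist_nonneg[OF pd pd] by (simp add: d_def)
    ultimately show ?thesis using arcosh_cosh_real[of "d / 2"] unfolding d_def[symmetric] by simp
  qed
  have "perim Q = (\<Sum>i<n. hyp_dist (p i) (p (Suc i)))"
    unfolding perim_verts[OF hs] cyc_sum_def vQ pm ..
  also have "\<dots> = regular_perim n A" unfolding dist by (simp add: regular_perim_def h_def \<beta>_def)
  finally have "perim Q = regular_perim n A" .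
  then show ?thesis using that[of Q r] hs area r vQ cp by simp
qed

text \<open>A translation by more than the radius moves a centred circle off the imaginary axis: the
  largest real part of the numerator is - (b - r) (1 - b r).\<close>

lemma Re_mob_neg:
  assumes b: "r < b" "b < 1" and z: "cmod z = r"
  shows "Re (mob (of_real b) z) < 0" "0 < Re (mob (of_real (- b)) z)"
proof -
  have neg: "Re (mob (of_real b) w) < 0" if w: "cmod w = r" for w
  proof -
    have r: "0 \<le> r" using w by auto
    define q where "q = 1 - of_real b * w"
    have "cmod w < 1" "0 < b" using b r w by auto
    then have q: "q \<noteq> 0" unfolding q_def using one_minus_mult_nz[of "of_real b" w] b by simp
    have "mob (of_real b) w = (w - of_real b) * cnj q / of_real ((cmod q)\<^sup>2)"
      
    proof -
      have "mob (of_real b) w = (w - of_real b) / q" by (simp add: mob_def q_def)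
      then show ?thesis using q unfolding complex_norm_square by simp
    qed
    then have M: "Re (mob (of_real b) w) = Re ((w - of_real b) * cnj q) / (cmod q)\<^sup>2" by simp
    have "Re ((w - of_real b) * cnj q) = (1 + b\<^sup>2) * Re w - b * (1 + (cmod w)\<^sup>2)"
      unfolding cmod_power2 by (simp add: q_def algebra_simps power2_eq_square)
    also have "\<dots> < 0"
    proof -
      have "(1 + b\<^sup>2) * Re w \<le> (1 + b\<^sup>2) * r" using complex_Re_le_cmod[of w] w by (intro mult_left_mono) auto
      moreover have "0 < (b - r) * (1 - b * r)"
      proof -
        have "b * r < 1" using mult_left_le[of r b] b \<open>0 < b\<close> by linarith
        then show ?thesis using b by simp
      qed
      moreover have "b * (1 + r\<^sup>2) - (1 + b\<^sup>2) * r = (b - r) * (1 - b * r)" by (simp add: power2_eq_square algebra_simps)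
      ultimately show ?thesis unfolding w by linarith
    qed
    finally show ?thesis using q unfolding M by (intro divide_neg_pos) simp_all
  qed
  show "Re (mob (of_real b) z) < 0" by (rule neg[OF z])
  have "mob (of_real (- b)) z = - mob (of_real b) (- z)" by (simp add: mob_def minus_divide_left)
  then show "0 < Re (mob (of_real (- b)) z)" using neg[of "- z"] z by simp
qed

text \<open>Two centred regular polygons are translated into opposite half-planes. Isometries leave
  areas and perimeters unchanged, and the half-planes make the regions disjoint.\<close>

theorem two_ngon_configuration:
  assumes n: "3 \<le> n" and x: "0 < x" "x / (2 * real n) + pi / real n < pi / 2"
    and y: "0 < y" "y / (2 * real n) + pi / real n < pi / 2"
  obtains C where "ngon_configuration n C" "card C = 2" "total_area C = x + y"
    "total_perim C = regular_perim n x + regular_perim n y"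
proof -
  obtain P r where P: "hyp_simple n P" "hyp_area P = x" "perim P = regular_perim n x"
    "0 \<le> r" "r < 1" "\<And>i. cmod (verts P i) = r"
    by (rule regular_ngon_exists[OF n x]) blast
  obtain Q s where Q: "hyp_simple n Q" "hyp_area Q = y" "perim Q = regular_perim n y"
    "0 \<le> s" "s < 1" "\<And>i. cmod (verts Q i) = s"
    by (rule regular_ngon_exists[OF n y]) blast
  define b where "b = (1 + max r s) / 2"
  have b: "r < b" "s < b" "b < 1" "0 < b" using P(4,5) Q(4,5) by (auto simp: b_def)
  have cb: "cmod (of_real b) < 1" "cmod (of_real (- b)) < 1" using b by simp_all
  define P' Q' where "P' = map (mob (of_real b)) P" and "Q' = map (mob (of_real (- b))) Q"
  have P': "hyp_simple n P'" "hyp_area P' = x" "perim P' = regular_perim n x"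
    unfolding P'_def using hyp_simple_mob(1)[OF P(1) cb(1)] hyp_simple_mob_measures[OF P(1) cb(1)] P by simp_all
  have Q': "hyp_simple n Q'" "hyp_area Q' = y" "perim Q' = regular_perim n y"
    unfolding Q'_def using hyp_simple_mob(1)[OF Q(1) cb(2)] hyp_simple_mob_measures[OF Q(1) cb(2)] Q by simp_all
  have vP: "0 < - 1 * Re (verts P' i)" for i
    unfolding P'_def hyp_simple_mob(2)[OF P(1) cb(1)] using Re_mob_neg(1)[OF b(1,3) P(6)] by simp
  have vQ: "0 < 1 * Re (verts Q' i)" for i
    unfolding Q'_def hyp_simple_mob(2)[OF Q(1) cb(2)] using Re_mob_neg(2)[OF b(2,3) Q(6)] by simp
  have ne: "P' \<noteq> Q'" using vP[of 0] vQ[of 0] by auto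
  have disj: "region P' \<inter> region Q' = {}"
    using hyp_region_half_plane[OF P'(1) vP] hyp_region_half_plane[OF Q'(1) vQ] by fastforce
  define C where "C = {P', Q'}"
  have "ngon_configuration n C"
    unfolding ngon_configuration_def disjoint_family_on_def
    using P' Q' x y disj by (auto simp: C_def hyp_ngon_iff)
  moreover have "card C = 2" "total_area C = x + y" "total_perim C = regular_perim n x + regular_perim n y"
    using ne P' Q' by (simp_all add: C_def total_area_def total_perim_def)
  ultimately show ?thesis by (rule that)
qed

section \<open>Perimeter of regular polygons as a function of area\<close>

text \<open>The area of the ideal n-gon, which \<open>ngon_isoperimetric\<close> shows to be a
  strict upper bound.\<close>

definition area_bound :: "nat \<Rightarrow> real" where
  "area_bound n = (real n - 2) * pi"

lemma area_bound_iff: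
  assumes "3 \<le> n"
  shows "A / (2 * real n) + pi / real n < pi / 2 \<longleftrightarrow> A < area_bound n"
proof -
  have "A / (2 * real n) + pi / real n = (A + 2 * pi) / (2 * real n)" by (simp add: add_divide_distrib)
  also have "\<dots> < pi / 2 \<longleftrightarrow> A + 2 * pi < pi / 2 * (2 * real n)"
    using assms by (intro pos_divide_less_eq) simp
  finally show ?thesis by (auto simp: area_bound_def algebra_simps)
qed

text \<open>For the regular polygon with interior angle \<theta> this is (\<pi> - \<theta>) / 2,
  half the exterior angle.\<close>

definition vertex_arg :: "nat \<Rightarrow> real \<Rightarrow> real" where
  "vertex_arg n A = A / (2 * real n) + pi / real n"

context
  fixes n :: nat
  assumes n: "3 \<le> n"
begin

lemma pi_over_n: "0 < pi / real n" "pi / real n < pi / 2"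
  using n by (simp_all add: field_simps)

lemma vertex_arg_less: "A < B \<Longrightarrow> vertex_arg n A < vertex_arg n B"
  using n by (simp add: vertex_arg_def divide_strict_right_mono)

lemma vertex_arg_range:
  assumes "0 \<le> A" "A < area_bound n"
  shows "pi / real n \<le> vertex_arg n A" "vertex_arg n A < pi / 2"
  using assms area_bound_iff[OF n, of A] by (simp_all add: vertex_arg_def)

lemma cos_vertex_arg:
  assumes "0 \<le> A" "A < area_bound n"
  shows "0 < cos (vertex_arg n A)" "cos (vertex_arg n A) \<le> cos (pi / real n)"
    "0 < A \<Longrightarrow> cos (vertex_arg n A) < cos (pi / real n)"
proof -
  note v = vertex_arg_range[OF assms] pi_over_n
  show "0 < cos (vertex_arg n A)" using v by (intro cos_gt_zero) linarith+
  show "cos (vertex_arg n A) \<le> cos (pi / real n)" using v by (intro cos_monotone_0_pi_le) linarith+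
  assume "0 < A"
  then have "pi / real n < vertex_arg n A" using n by (simp add: vertex_arg_def)
  then show "cos (vertex_arg n A) < cos (pi / real n)" using v by (intro cos_monotone_0_pi) linarith+
qed

lemma regular_perim_alt: "regular_perim n A = 2 * real n * arcosh (cos (pi / real n) / cos (vertex_arg n A))"
  by (simp add: regular_perim_def vertex_arg_def)

lemma regular_perim_0: "regular_perim n 0 = 0"
proof -
  have "cos (pi / real n) \<noteq> 0" using pi_over_n cos_gt_zero[of "pi / real n"] by simp
  then show ?thesis by (simp add: regular_perim_def)
qed

lemma regular_perim_le:
  assumes A: "0 \<le> A" "A < area_bound n" and L: "0 \<le> L"
    and le: "cos (pi / real n) \<le> cosh (L / (2 * real n)) * cos (vertex_arg n A)"
  shows "regular_perim n A \<le> L"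
proof -
  note c = cos_vertex_arg[OF A]
  have "cos (pi / real n) / cos (vertex_arg n A) \<le> cosh (L / (2 * real n))"
    using le c(1) by (simp add: divide_le_eq)
  moreover have "1 \<le> cos (pi / real n) / cos (vertex_arg n A)" using c(1,2) by (simp add: le_divide_eq)
  ultimately have "arcosh (cos (pi / real n) / cos (vertex_arg n A)) \<le> arcosh (cosh (L / (2 * real n)))"
    by (metis arcosh_real_strict_mono order_le_less)
  also have "\<dots> = L / (2 * real n)" using L n by (intro arcosh_cosh_real) simp
  finally show ?thesis using n unfolding regular_perim_alt by (simp add: field_simps)
qed

lemma regular_perim_eq:
  assumes A: "0 \<le> A" "A < area_bound n" and L: "0 \<le> L"
    and eq: "cosh (L / (2 * real n)) * cos (vertex_arg n A) = cos (pi / real n)"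
  shows "L = regular_perim n A"
proof -
  have "cos (pi / real n) / cos (vertex_arg n A) = cosh (L / (2 * real n))"
    using eq cos_vertex_arg(1)[OF A] by (simp add: divide_eq_eq)
  then have "regular_perim n A = 2 * real n * arcosh (cosh (L / (2 * real n)))" by (simp add: regular_perim_alt)
  also have "arcosh (cosh (L / (2 * real n))) = L / (2 * real n)" using L n by (intro arcosh_cosh_real) simp
  finally show ?thesis using n by simp
qed

lemma continuous_on_regular_perim: "continuous_on {0..<area_bound n} (regular_perim n)"
proof -
  have v: "continuous_on {0..<area_bound n} (vertex_arg n)"
    unfolding vertex_arg_def using n by (intro continuous_intros) auto
  have "cos (vertex_arg n A) \<noteq> 0" "1 \<le> cos (pi / real n) / cos (vertex_arg n A)" if "A \<in> {0..<area_bound n}" for A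
    using cos_vertex_arg[of A] that by (auto simp: le_divide_eq)
  then show ?thesis unfolding regular_perim_alt by (intro continuous_intros v) auto
qed

text \<open>The derivative of \<open>regular_perim n\<close> at \<open>A\<close> is \<open>cos (\<pi> / n) / sqrt (recip_slope_sq (sin_sq_arg A))\<close>.\<close>

definition recip_slope_sq :: "real \<Rightarrow> real" where
  "recip_slope_sq u = 1 + (sin (pi / real n))\<^sup>2 - u - (sin (pi / real n))\<^sup>2 / u"

definition sin_sq_arg :: "real \<Rightarrow> real" where
  "sin_sq_arg A = (sin (vertex_arg n A))\<^sup>2"

lemma sin_sq_arg_less:
  assumes "0 \<le> A" "A < B" "B < area_bound n"
  shows "sin_sq_arg A < sin_sq_arg B" "0 < sin_sq_arg A"
proof -
  have r: "0 \<le> B" "A < area_bound n" using assms by auto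
  note v = vertex_arg_range[OF assms(1) r(2)] vertex_arg_range[OF r(1) assms(3)] pi_over_n vertex_arg_less[OF assms(2)]
  have s: "0 < sin (vertex_arg n A)" using v by (intro sin_gt_zero) linarith+
  have "sin (vertex_arg n A) < sin (vertex_arg n B)" using v by (intro sin_monotone_2pi) linarith+
  then show "sin_sq_arg A < sin_sq_arg B" unfolding sin_sq_arg_def using s by (intro power_strict_mono) auto
  show "0 < sin_sq_arg A" using s by (simp add: sin_sq_arg_def)
qed

text \<open>The factorised form shows positivity, as the cosine of \<open>vertex_arg\<close> lies
  strictly between 0 and cos (\<pi> / n) for positive area.\<close>

lemma recip_slope_sq_sin_sq_arg:
  assumes A: "0 < A" "A < area_bound n"
  shows "recip_slope_sq (sin_sq_arg A) = (cos (vertex_arg n A))\<^sup>2 * ((cos (pi / real n))\<^sup>2 - (cos (vertex_arg n A))\<^sup>2) / sin_sq_arg A"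
    "0 < recip_slope_sq (sin_sq_arg A)"
proof -
  define S C c d where "S = sin_sq_arg A" and "C = (cos (vertex_arg n A))\<^sup>2" and "c = (cos (pi / real n))\<^sup>2"
    and "d = (sin (pi / real n))\<^sup>2"
  have S: "0 < S" using sin_sq_arg_less(2)[of A "(A + area_bound n) / 2"] A by (simp add: S_def)
  have SC: "S = 1 - C" "d = 1 - c" by (simp_all add: S_def C_def c_def d_def sin_sq_arg_def sin_squared_eq)
  have "(1 + d - S - d / S) * S = (1 + d) * S - S * S - d" using S by (simp add: left_diff_distrib)
  also have "\<dots> = C * (c - C)" unfolding SC by (simp add: algebra_simps)
  finally have "(1 + d - S - d / S) * S = C * (c - C)" .
  then have e: "recip_slope_sq S = C * (c - C) / S" using S by (simp add: recip_slope_sq_def d_def eq_divide_eq)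
  then show "recip_slope_sq (sin_sq_arg A) = (cos (vertex_arg n A))\<^sup>2 * ((cos (pi / real n))\<^sup>2 - (cos (vertex_arg n A))\<^sup>2) / sin_sq_arg A"
    by (simp only: S_def C_def c_def)
  note cv = cos_vertex_arg[OF less_imp_le[OF A(1)] A(2)]
  have "C < c" unfolding C_def c_def using cv(1) cv(3)[OF A(1)] by (intro power_strict_mono) auto
  moreover have "0 < C" using cv by (simp add: C_def)
  ultimately show "0 < recip_slope_sq (sin_sq_arg A)" using S unfolding S_def[symmetric] e by simp
qed

lemma regular_perim_deriv:
  assumes A: "0 < A" "A < area_bound n"
  shows "(regular_perim n has_real_derivative cos (pi / real n) / sqrt (recip_slope_sq (sin_sq_arg A))) (at A)"
proof -
  define c where "c = cos (pi / real n)"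
  define C S where "C = cos (vertex_arg n A)" and "S = sin (vertex_arg n A)"
  note cv = cos_vertex_arg[OF less_imp_le[OF A(1)] A(2)]
  have C: "0 < C" "C < c" using cv A by (simp_all add: C_def c_def)
  define q where "q = recip_slope_sq (sin_sq_arg A)"
  have v: "0 < vertex_arg n A" "vertex_arg n A < pi / 2"
    using vertex_arg_range[OF less_imp_le[OF A(1)] A(2)] pi_over_n by linarith+
  then have S: "0 < S" unfolding S_def by (intro sin_gt_zero) linarith+
  have q: "q = C\<^sup>2 * (c\<^sup>2 - C\<^sup>2) / S\<^sup>2" "0 < q"
    using recip_slope_sq_sin_sq_arg[OF A] by (simp_all add: q_def C_def c_def S_def sin_sq_arg_def)
  \<comment> \<open>The root in the derivative of \<open>arcosh\<close>, expressed through
    \<open>q\<close> so that \<open>S\<close> and \<open>C\<close> cancel against the inner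
    derivative.\<close>
  have sq: "sqrt ((c / C)\<^sup>2 - 1) = sqrt q * S / C\<^sup>2"
  proof (rule real_sqrt_unique)
    have "(sqrt q * S / C\<^sup>2)\<^sup>2 = q * S\<^sup>2 / (C\<^sup>2)\<^sup>2" using q(2) by (simp add: power_mult_distrib power_divide)
    also have "\<dots> = (c\<^sup>2 - C\<^sup>2) / C\<^sup>2" using S C unfolding q(1) by (simp add: power2_eq_square)
    also have "\<dots> = (c / C)\<^sup>2 - 1" using C by (simp add: power_divide diff_divide_distrib)
    finally show "(sqrt q * S / C\<^sup>2)\<^sup>2 = (c / C)\<^sup>2 - 1" .
    show "0 \<le> sqrt q * S / C\<^sup>2" using q S by simp
  qed
  define N where "N = 2 * real n"
  have N: "0 < N" using n by (simp add: N_def)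
  have "((\<lambda>A. A / N + pi / real n) has_real_derivative 1 / N) (at A)" using N by (auto intro!: derivative_eq_intros)
  then have va: "(vertex_arg n has_real_derivative 1 / N) (at A)" by (simp add: vertex_arg_def[abs_def] N_def)
  have cosd: "((\<lambda>A. cos (vertex_arg n A)) has_real_derivative - S * (1 / N)) (at A)"
    using DERIV_chain2[OF DERIV_cos va] by (simp add: S_def)
  have "((\<lambda>A. c / cos (vertex_arg n A)) has_real_derivative (0 * C - c * (- S * (1 / N))) / (C * C)) (at A)"
    using C unfolding C_def by (intro DERIV_divide DERIV_const cosd[unfolded C_def]) simp
  then have quot: "((\<lambda>A. c / cos (vertex_arg n A)) has_real_derivative c * S / (N * C\<^sup>2)) (at A)"
    using N C by (simp add: power2_eq_square)
  have "(arcosh has_real_derivative 1 / sqrt ((c / C)\<^sup>2 - 1)) (at (c / cos (vertex_arg n A)))"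
    using C unfolding C_def by (intro arcosh_real_has_field_derivative) (simp add: less_divide_eq)
  from DERIV_chain2[OF this quot]
  have "((\<lambda>A. N * arcosh (c / cos (vertex_arg n A))) has_real_derivative
      N * (1 / (sqrt q * S / C\<^sup>2) * (c * S / (N * C\<^sup>2)))) (at A)"
    unfolding sq by (intro DERIV_cmult)
  moreover have "N * (1 / (sqrt q * S / C\<^sup>2) * (c * S / (N * C\<^sup>2))) = c / sqrt q"
  proof -
    have "N * (1 / (Q * S / D) * (c * S / (N * D))) = c / Q" if "Q \<noteq> 0" "D \<noteq> 0" for Q D
      using that N S by (simp add: field_simps)
    then show ?thesis using q(2) C(1) by (metis less_irrefl real_sqrt_eq_0_iff zero_eq_power2)
  qed
  moreover have "regular_perim n = (\<lambda>A. N * arcosh (c / cos (vertex_arg n A)))"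
    by (rule ext) (simp add: regular_perim_alt N_def c_def)
  ultimately show ?thesis by (simp add: q_def c_def)
qed

text \<open>The derivative of \<open>\<lambda>t. regular_perim n (t + y) - regular_perim n t\<close> has the sign of
  \<open>sin (vertex_arg n t) * sin (vertex_arg n (t + y)) - sin (pi / n)\<close>, and this increases with \<open>t\<close>.\<close>

lemma perim_deriv_compare:
  assumes t: "0 < t" "t < s" "s < area_bound n"
  defines "D \<equiv> \<lambda>a. cos (pi / real n) / sqrt (recip_slope_sq (sin_sq_arg a))"
  shows "sin_sq_arg t * sin_sq_arg s < (sin (pi / real n))\<^sup>2 \<Longrightarrow> D s < D t"
    "(sin (pi / real n))\<^sup>2 < sin_sq_arg t * sin_sq_arg s \<Longrightarrow> D t < D s"
proof -
  define d where "d = (sin (pi / real n))\<^sup>2"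
  define a b where "a = sin_sq_arg t" and "b = sin_sq_arg s"
  have ab: "0 < a" "a < b" using sin_sq_arg_less[OF less_imp_le[OF t(1)] t(2,3)] by (simp_all add: a_def b_def)
  have pos: "0 < recip_slope_sq a" "0 < recip_slope_sq b" using recip_slope_sq_sin_sq_arg(2)[of t] recip_slope_sq_sin_sq_arg(2)[of s] t by (simp_all add: a_def b_def)
  have c: "0 < cos (pi / real n)" using pi_over_n by (intro cos_gt_zero) auto
  have less: "cos (pi / real n) / sqrt x < cos (pi / real n) / sqrt y" if "0 < y" "y < x" for x y
    using c that by (intro divide_strict_left_mono) auto
  \<comment> \<open>The factor \<open>b - a\<close> is positive, so the sign of the difference
    depends only on whether \<open>a * b\<close> exceeds \<open>d\<close>.\<close>
  have diff: "recip_slope_sq a - recip_slope_sq b = (b - a) * (1 - d / (a * b))"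
    using ab by (simp add: recip_slope_sq_def d_def[symmetric] field_simps)
  show "sin_sq_arg t * sin_sq_arg s < (sin (pi / real n))\<^sup>2 \<Longrightarrow> D s < D t"
  proof -
    assume "sin_sq_arg t * sin_sq_arg s < (sin (pi / real n))\<^sup>2"
    then have "a * b < d" by (simp add: a_def b_def d_def)
    then have "1 < d / (a * b)" using ab by (simp add: less_divide_eq)
    then have "(b - a) * (1 - d / (a * b)) < 0" using ab by (intro mult_pos_neg) auto
    then have "recip_slope_sq a < recip_slope_sq b" using diff by simp
    then show ?thesis unfolding D_def using less pos by (simp add: a_def b_def)
  qed
  assume "(sin (pi / real n))\<^sup>2 < sin_sq_arg t * sin_sq_arg s"
  then have "d < a * b" by (simp add: a_def b_def d_def)
  then have "d / (a * b) < 1" using ab by (simp add: divide_less_eq)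
  then have "0 < (b - a) * (1 - d / (a * b))" using ab by (intro mult_pos_pos) auto
  then have "recip_slope_sq b < recip_slope_sq a" using diff by simp
  then show "D t < D s" unfolding D_def using less pos by (simp add: a_def b_def)
qed

lemma regular_perim_split_persists:
  assumes x: "0 < x" and y: "0 < y" and le: "regular_perim n x + regular_perim n y \<le> regular_perim n (x + y)"
    and z: "x < z" "z + y < area_bound n"
  shows "regular_perim n z + regular_perim n y < regular_perim n (z + y)"
proof -
  define H where "H t = regular_perim n (t + y) - regular_perim n t" for t
  define D where "D a = cos (pi / real n) / sqrt (recip_slope_sq (sin_sq_arg a))" for a
  define w where "w t = sin_sq_arg t * sin_sq_arg (t + y)" for t
  define d where "d = (sin (pi / real n))\<^sup>2"
  have contH: "continuous_on {0..z} H"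
  proof -
    have "continuous_on {0..z} (\<lambda>t. regular_perim n (t + y))"
      by (rule continuous_on_compose2[OF continuous_on_regular_perim]) (use y z x in \<open>auto intro!: continuous_intros\<close>)
    moreover have "continuous_on {0..z} (regular_perim n)"
      by (rule continuous_on_subset[OF continuous_on_regular_perim]) (use y z x in auto)
    ultimately show ?thesis unfolding H_def by (intro continuous_intros)
  qed
  have dH: "(H has_real_derivative D (t + y) - D t) (at t)" if "0 < t" "t \<le> z" for t
  proof -
    have "((\<lambda>t. regular_perim n (t + y)) has_real_derivative D (t + y)) (at t)"
      using regular_perim_deriv[of "t + y"] that y z DERIV_shift[of "regular_perim n" "D (t + y)" t y] by (simp add: D_def)
    moreover have "(regular_perim n has_real_derivative D t) (at t)"
      using regular_perim_deriv[of t] that y z by (simp add: D_def)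
    ultimately show ?thesis unfolding H_def by (intro DERIV_diff)
  qed
  have wmono: "w s < w t" if "0 < s" "s < t" "t \<le> z" for s t
  proof -
    have "sin_sq_arg s < sin_sq_arg t" "0 < sin_sq_arg s" "sin_sq_arg (s + y) < sin_sq_arg (t + y)" "0 < sin_sq_arg (s + y)"
      using sin_sq_arg_less[of s t] sin_sq_arg_less[of "s + y" "t + y"] that y z by simp_all
    then show ?thesis unfolding w_def by (intro mult_strict_mono) auto
  qed
  \<comment> \<open>Otherwise \<open>w\<close> would stay below \<open>d\<close> on the whole open
    interval from 0 to \<open>x\<close>, so \<open>H\<close> would decrease there. As H 0 is the
    perimeter for the area \<open>y\<close>, this contradicts H 0 \<le> H x.\<close>
  have "d < w x"
  proof (rule ccontr)
    assume "\<not> d < w x"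
    then have "w t < d" if "0 < t" "t < x" for t using wmono[of t x] that z by simp
    then have neg: "D (t + y) - D t < 0" if "0 < t" "t < x" for t
      using perim_deriv_compare(1)[of t "t + y"] that y z by (simp add: w_def d_def D_def)
    have "H x < H 0"
    proof (rule DERIV_neg_imp_decreasing_open[OF x])
      fix t assume "0 < t" "t < x"
      then show "\<exists>m. (H has_real_derivative m) (at t) \<and> m < 0" using dH[of t] neg[of t] z by auto
    qed (use contH z x in \<open>auto intro: continuous_on_subset\<close>)
    then show False using le by (simp add: H_def regular_perim_0)
  qed
  then have "d < w t" if "x \<le> t" "t \<le> z" for t using wmono[of x t] that x by (cases "t = x") auto
  then have pos: "0 < D (t + y) - D t" if "x \<le> t" "t \<le> z" for t
    using perim_deriv_compare(2)[of t "t + y"] that x y z by (simp add: w_def d_def D_def)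
  have "H x < H z"
    using dH pos x by (intro DERIV_pos_imp_increasing[OF z(1)]) (meson less_le_trans)
  then show ?thesis using le by (simp add: H_def)
qed

text \<open>Only splits into two pieces are recorded; more pieces are handled by induction in
  \<open>regular_perim_sum\<close>.\<close>

definition splittable :: "real set" where
  "splittable = {A. A < area_bound n \<and>
     (\<exists>x y. 0 < x \<and> 0 < y \<and> A = x + y \<and> regular_perim n x + regular_perim n y < regular_perim n A)}"

text \<open>All additional area is given to the first piece;
  \<open>regular_perim_split_persists\<close> makes the weak inequality strict at every larger
  admissible area.\<close>

lemma splittableI:
  assumes "0 < x" "0 < y" "regular_perim n x + regular_perim n y \<le> regular_perim n (x + y)"
    "x + y < A" "A < area_bound n"
  shows "A \<in> splittable"
proof -
  have "regular_perim n (A - y) + regular_perim n y < regular_perim n ((A - y) + y)"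
    using assms by (intro regular_perim_split_persists[of x]) auto
  moreover have "0 < A - y" "A = (A - y) + y" using assms by auto
  ultimately show ?thesis unfolding splittable_def using assms(2,5) by (metis (mono_tags, lifting) mem_Collect_eq)
qed

text \<open>By continuity a strictly profitable split remains so when the first piece shrinks a
  little. Hence the infimum of the profitable areas is not attained.\<close>

lemma splittable_less:
  assumes "A \<in> splittable"
  obtains B where "B \<in> splittable" "B < A"
proof -
  obtain x y where xy: "0 < x" "0 < y" "A = x + y" "x + y < area_bound n"
    "regular_perim n x + regular_perim n y < regular_perim n (x + y)"
    using assms unfolding splittable_def by blast
  define g where "g t = regular_perim n (t + y) - regular_perim n t - regular_perim n y" for t
  have "(regular_perim n has_real_derivative cos (pi / real n) / sqrt (recip_slope_sq (sin_sq_arg a))) (at a)"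
    if "a = x \<or> a = x + y" for a
    using that xy by (intro regular_perim_deriv) auto
  then have c: "isCont (regular_perim n) x" "isCont (regular_perim n) (x + y)"
    using DERIV_isCont by blast+
  have "isCont (\<lambda>t. regular_perim n (t + y)) x"
    by (rule isCont_o2[where g = "regular_perim n"]) (use c in \<open>auto intro!: continuous_intros\<close>)
  then have "isCont g x" unfolding g_def using c(1) by (intro continuous_intros)
  moreover have "0 < g x" using xy by (simp add: g_def)
  ultimately have "\<forall>\<^sub>F t in at x. 0 < g t" unfolding isCont_def by (rule order_tendstoD(1))
  then obtain e where e: "0 < e" "\<And>t. t \<noteq> x \<Longrightarrow> dist t x < e \<Longrightarrow> 0 < g t"
    unfolding eventually_at by blast
  define t where "t = x - min e x / 2"
  have t: "0 < t" "t < x" "dist t x < e" using e(1) xy(1) by (auto simp: t_def dist_real_def min_def)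
  have "t + y \<in> splittable"
    unfolding splittable_def using t xy e(2)[OF _ t(3)] by (auto simp: g_def)
  then show ?thesis using that[of "t + y"] t xy by simp
qed

text \<open>If no split is ever strictly profitable, the value \<open>area_bound n\<close>
  corresponds to the threshold angle 0, so that every regular polygon falls under the first
  alternative.\<close>

definition critical_area :: real where
  "critical_area = (if splittable = {} then area_bound n else Inf splittable)"

lemma critical_area_lower:
  assumes "A \<in> splittable"
  shows "critical_area < A"
proof -
  obtain B where B: "B \<in> splittable" "B < A" using splittable_less[OF assms] .
  have "bdd_below splittable" by (rule bdd_belowI[of _ 0]) (auto simp: splittable_def)
  then have "Inf splittable \<le> B" using B(1) by (intro cInf_lower)
  then show ?thesis using B assms by (auto simp: critical_area_def)
qed

lemma critical_area_le: "critical_area \<le> area_bound n"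
proof (cases "splittable = {}")
  case False
  then obtain A where "A \<in> splittable" by blast
  then show ?thesis using critical_area_lower[of A] by (simp add: splittable_def)
qed (simp add: critical_area_def)

lemma splittable_above:
  assumes A: "critical_area < A" "A < area_bound n"
  shows "A \<in> splittable"
proof -
  have ne: "splittable \<noteq> {}" using A by (auto simp: critical_area_def)
  then have "Inf splittable < A" using A by (simp add: critical_area_def)
  then obtain B where B: "B \<in> splittable" "B < A" using cInf_lessD[OF ne] by blast
  then obtain x y where "0 < x" "0 < y" "B = x + y" "regular_perim n x + regular_perim n y < regular_perim n (x + y)"
    unfolding splittable_def by blast
  then show ?thesis using B(2) A(2) by (intro splittableI[of x y]) auto
qed

lemma regular_perim_subadditive:
  assumes "0 < x" "0 < y" "x + y < area_bound n"
  shows "x + y \<le> critical_area \<Longrightarrow> regular_perim n (x + y) \<le> regular_perim n x + regular_perim n y"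
    "x + y < critical_area \<Longrightarrow> regular_perim n (x + y) < regular_perim n x + regular_perim n y"
proof -
  show "regular_perim n (x + y) \<le> regular_perim n x + regular_perim n y" if "x + y \<le> critical_area"
  proof (rule ccontr)
    assume "\<not> ?thesis"
    then have "x + y \<in> splittable" unfolding splittable_def using assms by auto
    then show False using critical_area_lower that by fastforce
  qed
  show "regular_perim n (x + y) < regular_perim n x + regular_perim n y" if "x + y < critical_area"
  proof (rule ccontr)
    assume "\<not> ?thesis"
    \<comment> \<open>Equality at \<open>x + y\<close> would already make every larger admissible
      area splittable; the midpoint is such an area, and it still lies below the critical
      one.\<close>
    then have "(x + y + critical_area) / 2 \<in> splittable"
      using assms that critical_area_le by (intro splittableI[of x y]) auto
    then show False using critical_area_lower that by fastforce
  qed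
qed

text \<open>Strictness is required only once: one piece is separated strictly from the rest, and the
  weak inequality, proved by induction, treats the rest.\<close>

lemma regular_perim_sum:
  assumes "finite C" "C \<noteq> {}" "\<And>P. P \<in> C \<Longrightarrow> 0 < g P" "sum g C < area_bound n"
  shows "sum g C \<le> critical_area \<Longrightarrow> regular_perim n (sum g C) \<le> (\<Sum>P\<in>C. regular_perim n (g P))"
    "sum g C < critical_area \<Longrightarrow> card C \<noteq> 1 \<Longrightarrow> regular_perim n (sum g C) < (\<Sum>P\<in>C. regular_perim n (g P))"
proof -
  have weak: "sum g C \<le> critical_area \<longrightarrow> regular_perim n (sum g C) \<le> (\<Sum>P\<in>C. regular_perim n (g P))"
    if "finite C" "C \<noteq> {}" "\<forall>P\<in>C. 0 < g P" "sum g C < area_bound n" for C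
    using that
  proof (induction C rule: finite_ne_induct)
    case (insert a C)
    have "0 < sum g C" using insert by (intro sum_pos) auto
    then show ?case using insert regular_perim_subadditive(1)[of "g a" "sum g C"] by fastforce
  qed simp
  show "sum g C \<le> critical_area \<Longrightarrow> regular_perim n (sum g C) \<le> (\<Sum>P\<in>C. regular_perim n (g P))"
    using weak assms by blast
  assume s: "sum g C < critical_area" and c: "card C \<noteq> 1"
  obtain a where a: "a \<in> C" using assms(2) by blast
  define E where "E = C - {a}"
  have C: "C = insert a E" "a \<notin> E" "finite E" using a assms(1) by (auto simp: E_def)
  have E: "E \<noteq> {}" using c C by auto
  have e: "sum g C = g a + sum g E" using C by simp
  have "0 < sum g E" using assms(3) C E by (intro sum_pos) auto
  moreover have "0 < g a" using assms(3) a by blast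
  ultimately have "regular_perim n (sum g C) < regular_perim n (g a) + regular_perim n (sum g E)"
    using regular_perim_subadditive(2)[of "g a" "sum g E"] s assms(4) unfolding e by blast
  also have "regular_perim n (sum g E) \<le> (\<Sum>P\<in>E. regular_perim n (g P))"
    using weak[of E] C E assms(3,4) s \<open>0 < g a\<close> unfolding e by auto
  finally show "regular_perim n (sum g C) < (\<Sum>P\<in>C. regular_perim n (g P))" using C by simp
qed

section \<open>Comparison of polygons and configurations with regular polygons\<close>

lemma cyc_sum_cnj:
  assumes "\<And>i. cmod (z i) < 1"
  shows "cyc_area n (\<lambda>i. cnj (z i)) = - cyc_area n z" "cyc_len n (\<lambda>i. cnj (z i)) = cyc_len n z"
proof -
  have "tri_term (cnj (z i)) (cnj (z j)) = tri_term (z j) (z i)" for i j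
    unfolding tri_term_def complex_cnj_cnj by (subst mult.commute) (rule refl)
  then have e: "tri_term (cnj (z i)) (cnj (z j)) = - tri_term (z i) (z j)" for i j
    using tri_term_swap[OF assms assms] by (rule trans)
  show "cyc_area n (\<lambda>i. cnj (z i)) = - cyc_area n z" unfolding cyc_sum_def e sum_negf ..
  show "cyc_len n (\<lambda>i. cnj (z i)) = cyc_len n z"
    unfolding cyc_sum_def hyp_dist_def by (simp flip: complex_cnj_diff)
qed

lemma ngon_isoperimetric:
  assumes P: "hyp_ngon n P"
  shows "hyp_area P < area_bound n" "regular_perim n (hyp_area P) \<le> perim P"
proof -
  have S: "hyp_simple n P" "0 < hyp_area P" using P by (auto simp: hyp_ngon_iff)
  note d = hyp_simple_disc[OF S(1)]
  \<comment> \<open>\<open>polygon_isoperimetric\<close> asks for nonnegative signed area, so a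
    negatively oriented polygon is replaced by its mirror image.\<close>
  define z where "z i = (if 0 \<le> cyc_area n (verts P) then verts P i else cnj (verts P i))" for i
  have z: "cmod (z i) < 1" for i using d by (simp add: z_def)
  have zz: "cyc_area n z = hyp_area P \<and> cyc_len n z = perim P"
  proof (cases "0 \<le> cyc_area n (verts P)")
    case True
    then have "z = verts P" by (simp add: z_def fun_eq_iff)
    then show ?thesis using True hyp_area_abs[OF S(1)] perim_verts[OF S(1)] by simp
  next
    case False
    then have "z = (\<lambda>i. cnj (verts P i))" by (simp add: z_def fun_eq_iff)
    then show ?thesis
      using False cyc_sum_cnj[of "verts P", OF d] hyp_area_abs[OF S(1)] perim_verts[OF S(1)] by simp
  qed
  note zz = conjunct1[OF zz] conjunct2[OF zz]
  note I = polygon_isoperimetric[OF n, of z, OF z, unfolded zz, OF less_imp_le[OF S(2)]]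
  show A: "hyp_area P < area_bound n" using I(1) area_bound_iff[OF n] by simp
  have "0 \<le> perim P" unfolding perim_verts[OF S(1)] cyc_sum_def using d hyp_dist_nonneg by (intro sum_nonneg) auto
  then show "regular_perim n (hyp_area P) \<le> perim P"
    using I(2) A S(2) by (intro regular_perim_le) (simp_all add: vertex_arg_def)
qed

lemma regular_ngon_perim:
  assumes R: "regular_ngon n \<theta> P"
  shows "0 < hyp_area P" "hyp_area P < area_bound n" "\<theta> = (area_bound n - hyp_area P) / real n"
    "perim P = regular_perim n (hyp_area P)"
proof -
  note v = regular_ngon_values[OF R]
  have S: "hyp_simple n P" using R by (simp add: regular_ngon_def hyp_ngon_iff)
  show "0 < hyp_area P" by (rule v(1))
  show A: "hyp_area P < area_bound n" using v(3) area_bound_iff[OF n] by simp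
  show "\<theta> = (area_bound n - hyp_area P) / real n" using v(2) n by (simp add: area_bound_def left_diff_distrib diff_divide_distrib)
  have "0 \<le> perim P"
    unfolding perim_verts[OF S] cyc_sum_def using hyp_simple_disc[OF S] hyp_dist_nonneg by (intro sum_nonneg) auto
  then show "perim P = regular_perim n (hyp_area P)"
    using v(1,4) A by (intro regular_perim_eq) (simp_all add: vertex_arg_def)
qed

lemma configuration_perim:
  assumes C: "ngon_configuration n C" "0 < total_area C" "total_area C < area_bound n"
  shows "total_area C \<le> critical_area \<Longrightarrow> regular_perim n (total_area C) \<le> total_perim C"
    "total_area C < critical_area \<Longrightarrow> card C \<noteq> 1 \<Longrightarrow> regular_perim n (total_area C) < total_perim C"
proof -
  have fin: "finite C" and ng: "\<And>P. P \<in> C \<Longrightarrow> hyp_ngon n P" using C(1) by (auto simp: ngon_configuration_def)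
  have ne: "C \<noteq> {}" using C(2) by (auto simp: total_area_def)
  have pos: "\<And>P. P \<in> C \<Longrightarrow> 0 < hyp_area P" using ng by (simp add: hyp_ngon_iff)
  have le: "(\<Sum>P\<in>C. regular_perim n (hyp_area P)) \<le> total_perim C"
    unfolding total_perim_def using ng ngon_isoperimetric(2) by (intro sum_mono) auto
  note s = regular_perim_sum[OF fin ne pos C(3)[unfolded total_area_def]]
  show "total_area C \<le> critical_area \<Longrightarrow> regular_perim n (total_area C) \<le> total_perim C"
    using s(1) le unfolding total_area_def by linarith
  show "total_area C < critical_area \<Longrightarrow> card C \<noteq> 1 \<Longrightarrow> regular_perim n (total_area C) < total_perim C"
    using s(2) le unfolding total_area_def by linarith
qed

lemma splitting_configuration:
  assumes "A \<in> splittable"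
  obtains C where "ngon_configuration n C" "1 \<le> card C" "total_area C = A" "total_perim C < regular_perim n A"
proof -
  obtain x y where xy: "0 < x" "0 < y" "A = x + y" "A < area_bound n"
    "regular_perim n x + regular_perim n y < regular_perim n A"
    using assms unfolding splittable_def by blast
  have "x / (2 * real n) + pi / real n < pi / 2" "y / (2 * real n) + pi / real n < pi / 2"
    using area_bound_iff[OF n] xy by simp_all
  then obtain C where "ngon_configuration n C" "card C = 2" "total_area C = x + y"
    "total_perim C = regular_perim n x + regular_perim n y"
    using two_ngon_configuration[OF n xy(1) _ xy(2)] by blast
  then show ?thesis using that[of C] xy by simp
qed

end

theorem theorem1p2:
  fixes n :: nat
  assumes "3 \<le> n"
  shows "\<exists>\<Theta>::real. \<forall>\<theta> P. regular_ngon n \<theta> P \<longrightarrow>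
    (\<Theta> \<le> \<theta> \<longrightarrow>
       (\<forall>C. ngon_configuration n C \<and> total_area C = hyp_area P \<longrightarrow>
          perim P \<le> total_perim C \<and>
          (\<Theta> < \<theta> \<and> perim P = total_perim C \<longrightarrow> card C = 1))) \<and>
    (\<theta> < \<Theta> \<longrightarrow>
       (\<exists>C. ngon_configuration n C \<and> 1 \<le> card C \<and> total_area C = hyp_area P \<and>
          total_perim C < perim P))"
proof -
  \<comment> \<open>The angle belonging to the critical area under \<theta> = ((n - 2) \<pi> - A) /
    n. As the angle decreases with the area, \<Theta> \<le> \<theta> means at most critical
    area.\<close>
  define \<Theta> where "\<Theta> = (area_bound n - critical_area n) / real n"
  have "(\<Theta> \<le> \<theta> \<longrightarrow>
       (\<forall>C. ngon_configuration n C \<and> total_area C = hyp_area P \<longrightarrow>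
          perim P \<le> total_perim C \<and>
          (\<Theta> < \<theta> \<and> perim P = total_perim C \<longrightarrow> card C = 1))) \<and>
    (\<theta> < \<Theta> \<longrightarrow>
       (\<exists>C. ngon_configuration n C \<and> 1 \<le> card C \<and> total_area C = hyp_area P \<and>
          total_perim C < perim P))" if R: "regular_ngon n \<theta> P" for \<theta> P
  proof -
    note r = regular_ngon_perim[OF assms R]
    have iff: "\<Theta> \<le> \<theta> \<longleftrightarrow> hyp_area P \<le> critical_area n" "\<Theta> < \<theta> \<longleftrightarrow> hyp_area P < critical_area n"
      "\<theta> < \<Theta> \<longleftrightarrow> critical_area n < hyp_area P"
      using assms unfolding \<Theta>_def r(3) by (simp_all add: divide_le_cancel divide_less_cancel)
    have "perim P \<le> total_perim C \<and> (\<Theta> < \<theta> \<and> perim P = total_perim C \<longrightarrow> card C = 1)"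
      if "\<Theta> \<le> \<theta>" "ngon_configuration n C" "total_area C = hyp_area P" for C
      using configuration_perim[OF assms that(2)] that(1) r(1,2) unfolding that(3) r(4) iff by fastforce
    moreover have "\<exists>C. ngon_configuration n C \<and> 1 \<le> card C \<and> total_area C = hyp_area P \<and> total_perim C < perim P"
      if "\<theta> < \<Theta>"
    proof -
      have "hyp_area P \<in> splittable n" using that r(2) unfolding iff by (intro splittable_above[OF assms])
      then show ?thesis unfolding r(4) using splitting_configuration[OF assms] by metis
    qed
    ultimately show ?thesis by blast
  qed
  then show ?thesis by (intro exI[of _ \<Theta>] allI impI)
qed

end
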